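(* Let $N\ge2$, $V=(\mathbf C^N)^*$ with basis $\phi_1,\dots,\phi_N$, $\mathrm{ad}_{E_{ij}}(\phi_k)=-\delta_{ik}\phi_j$, and $\lambda_i=E_{ii}+\hbar(N-i)$. The generalized gauge transformation given by the isomorphism between the Kostant–Whittaker reduction and the parabolic restriction of $V\otimes\mathrm U_\hbar(\mathfrak{gl}_N)$ is $$S(\lambda)=D(\lambda)\cdot\bigl(\lambda_i^{\,j-1}\bigr)_{i,j=1}^N,\qquad D(\lambda)=\mathrm{diag}\Bigl(\prod_{j<i}(\lambda_i-\lambda_j)^{-1}\Bigr)_{i=1}^N,$$ that is, $\phi^\psi_k=\sum_{i=1}^N\bar\phi_i\cdot S(\lambda)_{ik}$ in $\mathfrak n_-^\psi\backslash (V\otimes\mathrm U_\hbar(\mathfrak{gl}_N)^{\mathrm{gen}})/\mathfrak n$ for $1\le k\le N$. It is a vertex-IRF transformation between the standard solution $R^{\mathrm{dyn}}(\lambda)$ of the quantum dynamical Yang–Baxter equation and the rational Cremmer–Gervais solution $R^{\mathrm{CG}}$ on $V\otimes V$: $$R^{\mathrm{CG}}=\bigl(S(\lambda)^{-1}\otimes S(\lambda+\hbar h_{(1)})^{-1}\bigr)\,R^{\mathrm{dyn}}(\lambda)\,\bigl(S(\lambda+\hbar h_{(2)})\otimes S(\lambda)\bigr).$$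
   Context: $\mathbf C$ is an algebraically closed field of characteristic zero. $\mathrm U_\hbar(\mathfrak g)$ is the $\mathbf C[\hbar]$-algebra generated by $\mathfrak g$ with $xy-yx=\hbar[x,y]$. $E_{ij}$ are the matrix units of $\mathfrak{gl}_N=\mathfrak n_-\oplus\mathfrak h\oplus\mathfrak n$ (strictly lower, diagonal, strictly upper). $\psi:\mathfrak n_-\to\mathbf C$: $\psi(E_{i+1,i})=1$, $\psi(E_{ij})=0$ for $i>j+1$; $x^\psi=x-\psi(x)$, $\mathfrak n_-^\psi=\{x^\psi\}$. $\mathrm U_\hbar(\mathfrak h)^{\mathrm{gen}}$ is the localization of $\mathrm U_\hbar(\mathfrak h)$ at all $E_{ii}-E_{jj}+n\hbar$ ($i\ne j$, $n\in\mathbb Z$), and $\mathrm U_\hbar(\mathfrak{gl}_N)^{\mathrm{gen}}=\mathrm U_\hbar(\mathfrak h)^{\mathrm{gen}}\otimes_{\mathrm U_\hbar(\mathfrak h)}\mathrm U_\hbar(\mathfrak{gl}_N)$. $V\otimes\mathrm U_\hbar(\mathfrak{gl}_N)$ is a bimodule with right multiplication and left action $\xi(v\otimes z)=\hbar\,\mathrm{ad}_\xi(v)\otimes z+v\otimes\xi z$; we write $\phi z$ for $\phi\otimes z$. $X/\mathfrak n=X/X\mathfrak n$, $\mathfrak n_-^\psi\backslash X=X/\mathfrak n_-^\psi X$. The double quotient is a right $\mathrm U_\hbar(\mathfrak h)^{\mathrm{gen}}$-module, free on the classes of $\phi_1,\dots,\phi_N$. *Parabolic restriction*: $\mathrm{res}(V\otimes\mathrm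 U_\hbar(\mathfrak{gl}_N))=(V\otimes\mathrm U_\hbar(\mathfrak{gl}_N)^{\mathrm{gen}}/\mathfrak n)^N$ ($N$-invariants, i.e. vectors killed by the left $\mathfrak n$-action), free over $\mathrm U_\hbar(\mathfrak h)^{\mathrm{gen}}$ with basis $$\bar\phi_i=\sum_{i<i_1<\dots<i_s\le N,\ s\ge0}E_{i_1i}E_{i_2i_1}\cdots E_{i_si_{s-1}}\,\phi_{i_s}\,(\lambda_i-\lambda_{i_1})^{-1}\cdots(\lambda_i-\lambda_{i_s})^{-1}$$ (the $s=0$ term is $\phi_i$). The induced standard dynamical twist on $V\otimes V$ is $J(\lambda)(\phi_i\otimes\phi_j)=\phi_i\otimes\phi_j+\hbar\,\delta_{i>j}\,(\lambda_j-\lambda_i)^{-1}\phi_j\otimes\phi_i$, and $R^{\mathrm{dyn}}(\lambda)=\sigma J(\lambda)^{-1}\sigma J(\lambda)$, $\sigma$ being the flip. *Kostant–Whittaker reduction*: $\mathrm{res}^\psi(V\otimes\mathrm U_\hbar(\mathfrak{gl}_N))=(\mathfrak n_-^\psi\backslash V\otimes\mathrm U_\hbar(\mathfrak{gl}_N))^{N_-}$, with elements $\phi^\psi_k=[\phi_k\otimes1]\cdot P_{\mathfrak m_N}((N-1)\hbar,(N-2)\hbar,\dots,\hbar)$. Here $L_{ij}(u)=\delta_{ij}u+E_{ij}$, $L^{a_1\dots a_m}_{b_1\dots b_m}(u)=\sum_{\sigma\in S_m}\mathrm{sgn}(\sigma)L_{a_{\sigma(1)}b_1}(u)L_{a_{\sigma(2)}b_2}(u-\hbar)\cdots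 L_{a_{\sigma(m)}b_m}(u-(m-1)\hbar)$; for $i>j$, $P^\psi_{ij}(u)=\sum_{k\ge0}(-1)^{(i+j)k}\hbar^{-k}(-E^\psi_{ij})^k\frac1{k!}L_{j\dots i-1}^{j\dots i-1}(u)\cdots L_{j\dots i-1}^{j\dots i-1}(u-(k-1)\hbar)$; $P_{\mathfrak m_N}(\vec u)=\bigl(P^\psi_{N,N-1}(u_{N-1})\bigr)\bigl(P^\psi_{N-1,N-2}(u_{N-2})P^\psi_{N,N-2}(u_{N-2})\bigr)\cdots\bigl(P^\psi_{21}(u_1)\cdots P^\psi_{N1}(u_1)\bigr)$, acting on the right, where on $\mathfrak n_-^\psi\backslash V\otimes\mathrm U_\hbar(\mathfrak{gl}_N)$ the right action of $\hbar^{-1}\xi^\psi$, $\xi\in\mathfrak n_-$, is $-\mathrm{ad}_\xi$ (differential of the diagonal $\mathrm{GL}_N$-action). *$R^{\mathrm{CG}}$*: identifying $\phi_i\otimes\phi_j$ with $X_1^{i-1}X_2^{j-1}$, $R^{\mathrm{CG}}$ acts on polynomials of degree $<N$ in each of $X_1,X_2$ by $f(X_1,X_2)\mapsto f(X_1,X_2)-\hbar\frac{f(X_1,X_2)-f(X_2,X_1)}{X_1-X_2}$. *Conventions*: matrices act by $A\phi_k=\sum_iA_{ik}\phi_i$. $\phi_j$ has weight $-\varepsilon_j$, and $f(\lambda+\hbar h_{(a)})$ on a vector whose $a$-th tensor component is $\phi_j$ means $f$ with $\lambda_j$ replaced by $\lambda_j-\hbar$. In $S(\lambda+\hbar h_{(2)})\otimes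 S(\lambda)$ the operator $S(\lambda)$ on the second factor is applied first; in $S(\lambda)^{-1}\otimes S(\lambda+\hbar h_{(1)})^{-1}$ the operator on the second factor is applied first. *)

theory Defs
  imports
    "HOL-Analysis.Analysis"
    "HOL-Library.Poly_Mapping"
    "HOL-Computational_Algebra.Fraction_Field"
    "HOL-Combinatorics.Permutations"
begin

text \<open>
  \<open>N = CARD('n)\<close>, where \<open>'n\<close> is a finite linearly ordered index type playing the role of
  \<open>{1, \<dots>, N}\<close>; \<open>idx\<close> is the order isomorphism onto \<open>{1, \<dots>, N}\<close>. The ground field is the type
  \<open>'a\<close>, and \<open>\<C>[\<hbar>]\<close> is \<open>'a poly\<close>, with \<open>\<hbar>\<close> the polynomial variable.
\<close>

definition idx :: "'n::{finite,linorder} \<Rightarrow> nat"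
  where "idx i = card {..i}"

definition hb_poly :: "'a::comm_ring_1 poly"
  where "hb_poly = [:0, 1:]"


section \<open>The algebra \<open>U\<^sub>\<hbar>(gl\<^sub>N)\<close>\<close>

text \<open>
  The unital associative \<open>'a poly\<close>-algebra presented by the generators \<open>E\<^sub>i\<^sub>j\<close> and the relations
  \<open>E\<^sub>i\<^sub>j E\<^sub>k\<^sub>l - E\<^sub>k\<^sub>l E\<^sub>i\<^sub>j = \<hbar> [E\<^sub>i\<^sub>j, E\<^sub>k\<^sub>l]\<close>: algebra terms modulo the congruence generated by the
  axioms of a unital \<open>'a poly\<close>-algebra and these relations.
\<close>

datatype ('r, 'n) uterm =
    Scalar 'r
  | Gen 'n 'n
  | Plus "('r, 'n) uterm" "('r, 'n) uterm"
  | Times "('r, 'n) uterm" "('r, 'n) uterm"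

inductive ueq :: "('a::field poly, 'n) uterm \<Rightarrow> ('a poly, 'n) uterm \<Rightarrow> bool"
  where
    ueq_refl: "ueq x x"
  | ueq_sym: "ueq x y \<Longrightarrow> ueq y x"
  | ueq_trans: "ueq x y \<Longrightarrow> ueq y z \<Longrightarrow> ueq x z"
  | ueq_Plus: "ueq x x' \<Longrightarrow> ueq y y' \<Longrightarrow> ueq (Plus x y) (Plus x' y')"
  | ueq_Times: "ueq x x' \<Longrightarrow> ueq y y' \<Longrightarrow> ueq (Times x y) (Times x' y')"
  | ueq_add_assoc: "ueq (Plus (Plus x y) z) (Plus x (Plus y z))"
  | ueq_add_comm: "ueq (Plus x y) (Plus y x)"
  | ueq_add_zero: "ueq (Plus (Scalar 0) x) x"
  | ueq_add_neg: "ueq (Plus (Times (Scalar (- 1)) x) x) (Scalar 0)"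
  | ueq_mult_assoc: "ueq (Times (Times x y) z) (Times x (Times y z))"
  | ueq_mult_one: "ueq (Times (Scalar 1) x) x"
  | ueq_distrib_left: "ueq (Times x (Plus y z)) (Plus (Times x y) (Times x z))"
  | ueq_distrib_right: "ueq (Times (Plus x y) z) (Plus (Times x z) (Times y z))"
  | ueq_scalar_add: "ueq (Scalar (a + b)) (Plus (Scalar a) (Scalar b))"
  | ueq_scalar_mult: "ueq (Scalar (a * b)) (Times (Scalar a) (Scalar b))"
  | ueq_scalar_central: "ueq (Times (Scalar a) x) (Times x (Scalar a))"
  | ueq_lie: "ueq (Times (Gen i j) (Gen k l))
      (Plus (Times (Gen k l) (Gen i j))
        (Times (Scalar hb_poly)
          (Plus (if j = k then Gen i l else Scalar 0)
            (Times (Scalar (- 1)) (if l = i then Gen k j else Scalar 0)))))"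

quotient_type (overloaded) ('a, 'n) U = "('a::field poly, 'n) uterm" / ueq
  by (rule equivpI)
    (auto intro!: reflpI sympI transpI intro: ueq_refl ueq_sym ueq_trans)

text \<open>Non-triviality, by the augmentation.\<close>

primrec uterm_aug :: "('a::field poly, 'n) uterm \<Rightarrow> 'a poly"
  where
    "uterm_aug (Scalar c) = c"
  | "uterm_aug (Gen i j) = 0"
  | "uterm_aug (Plus x y) = uterm_aug x + uterm_aug y"
  | "uterm_aug (Times x y) = uterm_aug x * uterm_aug y"

lemma uterm_aug_cong: "ueq x y \<Longrightarrow> uterm_aug x = uterm_aug y"
  by (induction rule: ueq.induct) (auto simp: algebra_simps)

instantiation U :: (field, type) ring_1
begin

lift_definition zero_U :: "('a, 'b) U" is "Scalar 0" .
lift_definition one_U :: "('a, 'b) U" is "Scalar 1" .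
lift_definition plus_U :: "('a, 'b) U \<Rightarrow> ('a, 'b) U \<Rightarrow> ('a, 'b) U" is Plus
  by (rule ueq_Plus)
lift_definition times_U :: "('a, 'b) U \<Rightarrow> ('a, 'b) U \<Rightarrow> ('a, 'b) U" is Times
  by (rule ueq_Times)
lift_definition uminus_U :: "('a, 'b) U \<Rightarrow> ('a, 'b) U" is "\<lambda>x. Times (Scalar (- 1)) x"
  by (intro ueq_Times ueq_refl)
definition minus_U :: "('a, 'b) U \<Rightarrow> ('a, 'b) U \<Rightarrow> ('a, 'b) U"
  where "minus_U x y = x + - y"

instance
proof
  fix a b c :: "('a, 'b) U"
  show "a + b + c = a + (b + c)" by transfer (rule ueq_add_assoc)
  show "a + b = b + a" by transfer (rule ueq_add_comm)
  show "0 + a = a" by transfer (rule ueq_add_zero)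
  show "- a + a = 0" by transfer (rule ueq_add_neg)
  show "a - b = a + - b" by (simp add: minus_U_def)
  show "a * b * c = a * (b * c)" by transfer (rule ueq_mult_assoc)
  show "1 * a = a" by transfer (rule ueq_mult_one)
  show "a * 1 = a"
    by transfer (blast intro: ueq_trans ueq_sym ueq_mult_one ueq_scalar_central)
  show "(a + b) * c = a * c + b * c" by transfer (rule ueq_distrib_right)
  show "a * (b + c) = a * b + a * c" by transfer (rule ueq_distrib_left)
  show "(0 :: ('a, 'b) U) \<noteq> 1"
    by transfer (auto dest: uterm_aug_cong)
qed

end

lift_definition scalU :: "'a::field poly \<Rightarrow> ('a, 'n) U" is "Scalar :: 'a poly \<Rightarrow> _" .
lift_definition E :: "'n \<Rightarrow> 'n \<Rightarrow> ('a::field, 'n) U" is Gen .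

lemma scalU_0 [simp]: "scalU 0 = 0" and scalU_1 [simp]: "scalU 1 = 1"
  by (simp_all add: zero_U_def one_U_def scalU.abs_eq)

lemma scalU_add: "scalU (a + b) = scalU a + scalU b"
  by transfer (rule ueq_scalar_add)

lemma scalU_mult: "scalU (a * b) = scalU a * scalU b"
  by transfer (rule ueq_scalar_mult)

lemma scalU_central: "scalU a * x = x * scalU a"
  by transfer (rule ueq_scalar_central)

lemma abs_U_simps:
  "abs_U (Scalar c) = scalU c" "abs_U (Gen i j) = E i j"
  "abs_U (Plus x y) = abs_U x + abs_U y" "abs_U (Times x y) = abs_U x * abs_U y"
  by (simp_all add: scalU.abs_eq E.abs_eq plus_U.abs_eq times_U.abs_eq)

lemma scalU_minus_1: "scalU (- 1) = (- 1 :: ('a::field, 'n) U)"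
proof -
  have "scalU (- 1 + 1) = (scalU (- 1) + scalU 1 :: ('a, 'n) U)" by (rule scalU_add)
  then show ?thesis by (simp add: eq_neg_iff_add_eq_0)
qed

definition lieU :: "'n \<Rightarrow> 'n \<Rightarrow> 'n \<Rightarrow> 'n \<Rightarrow> ('a::field, 'n) U"
  \<comment> \<open>the Lie bracket \<open>[E\<^sub>i\<^sub>j, E\<^sub>k\<^sub>l]\<close> of \<open>gl\<^sub>N\<close>, as an element of the algebra\<close>
  where "lieU i j k l = (if j = k then E i l else 0) - (if l = i then E k j else 0)"

lemma E_E: "E i j * E k l = E k l * E i j + scalU hb_poly * (lieU i j k l :: ('a::field, 'n) U)"
proof -
  have "abs_U (Times (Gen i j) (Gen k l)) = (abs_U
      (Plus (Times (Gen k l) (Gen i j))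
        (Times (Scalar hb_poly)
          (Plus (if j = k then Gen i l else Scalar 0)
            (Times (Scalar (- 1)) (if l = i then Gen k j else Scalar 0))))) :: ('a, 'n) U)"
    by (simp only: U.abs_eq_iff ueq_lie)
  then show ?thesis
    by (simp add: abs_U_simps lieU_def scalU_minus_1 split: if_splits)
qed

text \<open>
  The adjoint action of \<open>E\<^sub>i\<^sub>j\<close> on \<open>U\<^sub>\<hbar>(gl\<^sub>N)\<close> is the \<open>\<C>[\<hbar>]\<close>-linear derivation extending the Lie
  bracket (the differential of the adjoint action of the group).
\<close>

primrec ad_uterm :: "'n \<Rightarrow> 'n \<Rightarrow> ('a::field poly, 'n) uterm \<Rightarrow> ('a, 'n) U"
  where
    "ad_uterm i j (Scalar c) = 0"
  | "ad_uterm i j (Gen k l) = lieU i j k l"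
  | "ad_uterm i j (Plus x y) = ad_uterm i j x + ad_uterm i j y"
  | "ad_uterm i j (Times x y) = ad_uterm i j x * abs_U y + abs_U x * ad_uterm i j y"

lemma ad_uterm_lie:
  "lieU i j k l * E m n + E k l * lieU i j m n =
   lieU i j m n * E k l + E m n * lieU i j k l
     + scalU hb_poly * ((if l = m then lieU i j k n else 0) - (if n = k then lieU i j m l else 0)
       :: ('a::field, 'n) U)"
proof -
  let ?h = "scalU hb_poly :: ('a, 'n) U"
  have 1: "lieU i j k l * E m n = E m n * lieU i j k l
      + ?h * ((if j = k then lieU i l m n else 0) - (if l = i then lieU k j m n else 0))"
    using E_E[of i l m n, where 'a = 'a] E_E[of k j m n, where 'a = 'a]
    unfolding lieU_def[of i j k l] by (auto simp: algebra_simps)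
  have 2: "E k l * lieU i j m n = lieU i j m n * E k l
      + ?h * ((if j = m then lieU k l i n else 0) - (if n = i then lieU k l m j else 0))"
    using E_E[of k l i n, where 'a = 'a] E_E[of k l m j, where 'a = 'a]
    unfolding lieU_def[of i j m n] by (auto simp: algebra_simps)
  have 3: "((if j = k then lieU i l m n else 0) - (if l = i then lieU k j m n else 0))
      + ((if j = m then lieU k l i n else 0) - (if n = i then lieU k l m j else 0))
      = ((if l = m then lieU i j k n else 0) - (if n = k then lieU i j m l else 0)
         :: ('a, 'n) U)"
    by (auto simp: lieU_def)
  show ?thesis
    unfolding 1 2 3[symmetric] by (simp add: algebra_simps)
qed

lemma ad_uterm_cong:
  assumes "ueq x y"
  shows "ad_uterm i j x = ad_uterm i j y"
  using assms
proof (induction rule: ueq.induct)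
  case (ueq_Times x x' y y')
  then have "abs_U x = abs_U x'" "abs_U y = abs_U y'" by (simp_all add: U.abs_eq_iff)
  with ueq_Times show ?case by simp
next
  case (ueq_lie k l m n)
  show ?case
    using ad_uterm_lie[of i j k l m n, where 'a = 'a]
    by (auto simp: abs_U_simps scalU_minus_1 split: if_splits)
qed (simp_all add: abs_U_simps scalU_minus_1 scalU_add scalU_mult scalU_central algebra_simps)

lift_definition adU :: "'n \<Rightarrow> 'n \<Rightarrow> ('a::field, 'n) U \<Rightarrow> ('a, 'n) U" is ad_uterm
  by (rule ad_uterm_cong)


section \<open>The algebra \<open>U\<^sub>\<hbar>(h)\<close> and its localization\<close>

text \<open>
  As \<open>h\<close> is abelian, \<open>U\<^sub>\<hbar>(h)\<close> is the polynomial ring over \<open>\<C>[\<hbar>]\<close> in the variables \<open>E\<^sub>i\<^sub>i\<close>. It is a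
  domain, and its localization is realised inside its field of fractions.
\<close>

type_synonym ('a, 'n) Uh = "('n \<Rightarrow>\<^sub>0 nat) \<Rightarrow>\<^sub>0 'a poly"

definition Uh_var :: "'n \<Rightarrow> ('a::field, 'n::{finite,linorder}) Uh"
  where "Uh_var i = Poly_Mapping.single (Poly_Mapping.single i 1) 1"

definition Uh_scal :: "'a::field poly \<Rightarrow> ('a, 'n::{finite,linorder}) Uh"
  where "Uh_scal c = Poly_Mapping.single 0 c"

inductive_set Uh_den :: "('a::field, 'n::{finite,linorder}) Uh set"
  \<comment> \<open>the multiplicative set generated by all \<open>E\<^sub>i\<^sub>i - E\<^sub>j\<^sub>j + n \<hbar>\<close>\<close>
  where
    one: "1 \<in> Uh_den"
  | mult: "s \<in> Uh_den \<Longrightarrow> i \<noteq> j \<Longrightarrow>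
      s * (Uh_var i - Uh_var j + Uh_scal (of_int n * hb_poly)) \<in> Uh_den"

lemma Uh_scal_0 [simp]: "Uh_scal 0 = 0" and Uh_scal_1 [simp]: "Uh_scal 1 = 1"
  by (simp_all add: Uh_scal_def)

lemma Uh_scal_add: "Uh_scal (a + b) = Uh_scal a + Uh_scal b"
  by (simp add: Uh_scal_def single_add)

lemma Uh_scal_diff: "Uh_scal (a - b) = Uh_scal a - Uh_scal b"
  by (simp add: Uh_scal_def single_diff)

lemma Uh_scal_mult: "Uh_scal (a * b) = Uh_scal a * Uh_scal b"
  by (simp add: Uh_scal_def mult_single)

lemma Uh_den_factor_nonzero:
  assumes "i \<noteq> j"
  shows "Uh_var i - Uh_var j + Uh_scal c \<noteq> (0 :: ('a::field, 'n::{finite,linorder}) Uh)"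
proof
  assume eq: "Uh_var i - Uh_var j + Uh_scal c = (0 :: ('a, 'n) Uh)"
  have ne: "Poly_Mapping.single j 1 \<noteq> (Poly_Mapping.single i 1 :: 'n \<Rightarrow>\<^sub>0 nat)"
    using assms by (metis lookup_single_eq lookup_single_not_eq zero_neq_one)
  have ne0: "(0 :: 'n \<Rightarrow>\<^sub>0 nat) \<noteq> Poly_Mapping.single i 1"
    by (metis lookup_single_eq lookup_zero zero_neq_one)
  have "Poly_Mapping.lookup (Uh_var i - Uh_var j + Uh_scal c :: ('a, 'n) Uh) (Poly_Mapping.single i 1) = 1"
    using ne ne0
    by (simp add: Uh_var_def Uh_scal_def lookup_add lookup_minus lookup_single_not_eq del: One_nat_def)
  with eq show False by simp
qed

lemma Uh_den_nonzero: "s \<in> Uh_den \<Longrightarrow> s \<noteq> 0"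
  by (induction rule: Uh_den.induct) (auto simp: Uh_den_factor_nonzero)

lemma Uh_den_mult:
  assumes "s \<in> Uh_den" "t \<in> Uh_den"
  shows "s * t \<in> Uh_den"
  using assms(2,1)
  by (induction rule: Uh_den.induct)
    (auto simp: mult.assoc[symmetric] intro!: Uh_den.intros)

typedef (overloaded) ('a, 'n) Uhgen =
    "{x :: ('a::field, 'n::{finite,linorder}) Uh fract. \<exists>p s. s \<in> Uh_den \<and> x = Fract p s}"
  morphisms of_Uhgen to_Uhgen
  by (auto intro: Uh_den.one)

setup_lifting type_definition_Uhgen

instantiation Uhgen :: (field, "{finite,linorder}") comm_ring_1
begin

lift_definition zero_Uhgen :: "('a, 'b) Uhgen" is 0
  by (auto simp: Zero_fract_def intro: Uh_den.one)
lift_definition one_Uhgen :: "('a, 'b) Uhgen" is 1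
  by (auto simp: One_fract_def intro: Uh_den.one)
lift_definition plus_Uhgen :: "('a, 'b) Uhgen \<Rightarrow> ('a, 'b) Uhgen \<Rightarrow> ('a, 'b) Uhgen" is "(+)"
  using Uh_den_mult Uh_den_nonzero by (fastforce simp: add_fract)
lift_definition times_Uhgen :: "('a, 'b) Uhgen \<Rightarrow> ('a, 'b) Uhgen \<Rightarrow> ('a, 'b) Uhgen" is "(*)"
  using Uh_den_mult Uh_den_nonzero by fastforce
lift_definition uminus_Uhgen :: "('a, 'b) Uhgen \<Rightarrow> ('a, 'b) Uhgen" is uminus
  by (metis minus_fract)
lift_definition minus_Uhgen :: "('a, 'b) Uhgen \<Rightarrow> ('a, 'b) Uhgen \<Rightarrow> ('a, 'b) Uhgen" is "(-)"
  using Uh_den_mult Uh_den_nonzero by (fastforce simp: diff_fract)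

instance
  by standard (transfer; simp add: algebra_simps)+

end

lift_definition Uhgen_E :: "'n \<Rightarrow> ('a::field, 'n::{finite,linorder}) Uhgen" is "\<lambda>i. Fract (Uh_var i) 1"
  using Uh_den.one by blast

lift_definition Uhgen_scal :: "'a::field poly \<Rightarrow> ('a, 'n::{finite,linorder}) Uhgen"
  is "\<lambda>c :: 'a poly. Fract (Uh_scal c) 1"
  using Uh_den.one by blast

lemma Uhgen_scal_0 [simp]: "Uhgen_scal 0 = 0"
  by transfer (simp add: Zero_fract_def)

lemma Uhgen_scal_1 [simp]: "Uhgen_scal 1 = 1"
  by transfer (simp add: One_fract_def)

lemma Uhgen_scal_add: "Uhgen_scal (a + b) = Uhgen_scal a + Uhgen_scal b"
  by transfer (simp add: Uh_scal_add)

lemma Uhgen_scal_minus: "Uhgen_scal (- a) = - Uhgen_scal a"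
  using Uhgen_scal_add[of "- a" a] by (simp add: eq_neg_iff_add_eq_0)

lemma Uhgen_scal_mult: "Uhgen_scal (a * b) = Uhgen_scal a * Uhgen_scal b"
  by transfer (simp add: Uh_scal_mult)

text \<open>The automorphism of \<open>U\<^sub>\<hbar>(h)\<close>, and of its localization, given by \<open>E\<^sub>k\<^sub>k \<mapsto> E\<^sub>k\<^sub>k + c\<^sub>k \<hbar>\<close>.\<close>

definition shift_mono :: "('n \<Rightarrow> int) \<Rightarrow> ('n \<Rightarrow>\<^sub>0 nat) \<Rightarrow> ('a::field, 'n::{finite,linorder}) Uh"
  where "shift_mono c m = (\<Prod>k\<in>UNIV. (Uh_var k + Uh_scal (of_int (c k) * hb_poly)) ^ Poly_Mapping.lookup m k)"

definition shift_Uh ::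
    "('n \<Rightarrow> int) \<Rightarrow> ('a, 'n) Uh \<Rightarrow> ('a::field, 'n::{finite,linorder}) Uh"
  where "shift_Uh c p = (\<Sum>m\<in>Poly_Mapping.keys p. Uh_scal (Poly_Mapping.lookup p m) * shift_mono c m)"

lemma shift_Uh_superset:
  assumes "finite A" "Poly_Mapping.keys p \<subseteq> A"
  shows "shift_Uh c p = (\<Sum>m\<in>A. Uh_scal (Poly_Mapping.lookup p m) * shift_mono c m)"
  unfolding shift_Uh_def
  by (rule sum.mono_neutral_left) (use assms in \<open>auto simp: in_keys_iff\<close>)

lemma shift_Uh_add: "shift_Uh c (p + q) = shift_Uh c p + shift_Uh c q"
proof -
  let ?A = "Poly_Mapping.keys p \<union> Poly_Mapping.keys q"
  have "Poly_Mapping.keys (p + q) \<subseteq> ?A" by (rule keys_add)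
  then show ?thesis
    by (simp add: shift_Uh_superset[of ?A] lookup_add Uh_scal_add distrib_right sum.distrib)
qed

lemma shift_Uh_single: "shift_Uh c (Poly_Mapping.single m a) = Uh_scal a * shift_mono c m"
  by (cases "a = 0") (simp_all add: shift_Uh_def)

lemma shift_mono_add: "shift_mono c (m + m') = shift_mono c m * shift_mono c m'"
  by (simp add: shift_mono_def lookup_add power_add prod.distrib)

lemma shift_mono_0 [simp]: "shift_mono c 0 = 1"
  by (simp add: shift_mono_def)

lemma sum_monomials:
  "(\<Sum>m\<in>Poly_Mapping.keys p. Poly_Mapping.single m (Poly_Mapping.lookup p m)) = p"
  by (rule poly_mapping_eqI) (simp add: lookup_sum lookup_single when_def in_keys_iff)

lemma Uh_additive_induct:
  fixes p :: "('a::field, 'n::{finite,linorder}) Uh"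
  assumes "\<And>m a. P (Poly_Mapping.single m a)" "\<And>p q. P p \<Longrightarrow> P q \<Longrightarrow> P (p + q)"
  shows "P p"
proof -
  have "P (\<Sum>m\<in>A. Poly_Mapping.single m (Poly_Mapping.lookup p m))" if "finite A" for A
    using that
  proof induction
    case empty
    show ?case using assms(1)[of 0 0] by simp
  qed (simp add: assms)
  from this[of "Poly_Mapping.keys p"] show ?thesis by (simp add: sum_monomials)
qed

lemma shift_Uh_mult: "shift_Uh c (p * q) = shift_Uh c p * shift_Uh c q"
proof (induction p rule: Uh_additive_induct)
  case (1 m a)
  show ?case
    by (induction q rule: Uh_additive_induct)
      (simp_all add: mult_single shift_Uh_single shift_mono_add Uh_scal_mult shift_Uh_add
        algebra_simps)
qed (simp add: shift_Uh_add distrib_right)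

lemma shift_Uh_scal: "shift_Uh c (Uh_scal a) = Uh_scal a"
  by (subst Uh_scal_def) (simp add: shift_Uh_single)

lemma shift_Uh_1: "shift_Uh c 1 = 1"
  using shift_Uh_scal[of c 1] by simp

lemma shift_Uh_var: "shift_Uh c (Uh_var i) = Uh_var i + Uh_scal (of_int (c i) * hb_poly)"
proof -
  have "shift_mono c (Poly_Mapping.single i 1) =
      (\<Prod>k\<in>UNIV. if k = i then Uh_var i + Uh_scal (of_int (c i) * hb_poly) else 1)"
    unfolding shift_mono_def
    by (rule prod.cong) (auto simp: lookup_single_not_eq)
  then show ?thesis by (subst Uh_var_def) (simp add: shift_Uh_single)
qed

lemma Uh_induct [case_names scal var add mult]:
  fixes p :: "('a::field, 'n::{finite,linorder}) Uh"
  assumes "\<And>c. P (Uh_scal c)" "\<And>i. P (Uh_var i)"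
    and "\<And>p q. P p \<Longrightarrow> P q \<Longrightarrow> P (p + q)" "\<And>p q. P p \<Longrightarrow> P q \<Longrightarrow> P (p * q)"
  shows "P p"
proof (induction p rule: Uh_additive_induct)
  case (1 m a)
  have pow: "P (Poly_Mapping.single (Poly_Mapping.single i n) 1)" for i n
  proof (induction n)
    case 0
    show ?case using assms(1)[of 1] by simp
  next
    case (Suc n)
    have "Poly_Mapping.single (Poly_Mapping.single i (Suc n)) 1 =
        Uh_var i * (Poly_Mapping.single (Poly_Mapping.single i n) 1 :: ('a, 'n) Uh)"
      by (simp add: Uh_var_def mult_single single_add[symmetric])
    with Suc assms show ?case by simp
  qed
  have "P (Poly_Mapping.single (\<Sum>i\<in>A. Poly_Mapping.single i (Poly_Mapping.lookup m i)) 1)" if "finite A" for A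
    using that
  proof induction
    case empty
    show ?case using assms(1)[of 1] by simp
  next
    case (insert i A)
    then have "Poly_Mapping.single (\<Sum>i\<in>insert i A. Poly_Mapping.single i (Poly_Mapping.lookup m i)) 1 =
        Poly_Mapping.single (Poly_Mapping.single i (Poly_Mapping.lookup m i)) 1 *
        (Poly_Mapping.single (\<Sum>i\<in>A. Poly_Mapping.single i (Poly_Mapping.lookup m i)) 1 :: ('a, 'n) Uh)"
      by (simp add: mult_single)
    with insert pow assms show ?case by simp
  qed
  from this[of "Poly_Mapping.keys m"] have "P (Poly_Mapping.single m 1)"
    by (simp add: sum_monomials)
  then have "P (Uh_scal a * Poly_Mapping.single m 1)" using assms by blast
  then show ?case by (simp add: Uh_scal_def mult_single)
qed (use assms in blast)

lemma shift_Uh_shift_Uh: "shift_Uh c (shift_Uh d p) = shift_Uh (\<lambda>k. c k + d k) p"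
  by (induction p rule: Uh_induct)
    (simp_all add: shift_Uh_scal shift_Uh_var shift_Uh_add shift_Uh_mult
      Uh_scal_add distrib_right algebra_simps)

lemma shift_Uh_zero: "shift_Uh (\<lambda>k. 0) p = p"
  by (induction p rule: Uh_induct)
    (simp_all add: shift_Uh_scal shift_Uh_var shift_Uh_add shift_Uh_mult)

lemma shift_Uh_eq_0_iff: "shift_Uh c p = 0 \<longleftrightarrow> p = 0"
proof
  assume "shift_Uh c p = 0"
  then have "shift_Uh (\<lambda>k. - c k) (shift_Uh c p) = 0" by (simp add: shift_Uh_def)
  then show "p = 0" by (simp add: shift_Uh_shift_Uh shift_Uh_zero)
qed (simp add: shift_Uh_def)

lemma shift_Uh_minus: "shift_Uh c (p - q) = shift_Uh c p - shift_Uh c q"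
  using shift_Uh_add[of c "p - q" q] by (simp add: algebra_simps)

lemma shift_Uh_den:
  fixes s :: "('a::field, 'n::{finite,linorder}) Uh"
  assumes "s \<in> Uh_den"
  shows "shift_Uh c s \<in> Uh_den"
  using assms
proof (induction rule: Uh_den.induct)
  case one
  show ?case by (simp add: shift_Uh_1 Uh_den.one)
next
  case (mult s i j n)
  have "Uh_scal (of_int (n + c i - c j) * hb_poly) = Uh_scal (of_int n * hb_poly)
      + Uh_scal (of_int (c i) * hb_poly) - (Uh_scal (of_int (c j) * hb_poly) :: ('a, 'n) Uh)"
    by (simp add: ring_distribs Uh_scal_add Uh_scal_diff)
  then have "shift_Uh c (Uh_var i - Uh_var j + Uh_scal (of_int n * hb_poly)) =
      (Uh_var i - Uh_var j + Uh_scal (of_int (n + c i - c j) * hb_poly) :: ('a, 'n) Uh)"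
    by (simp add: shift_Uh_add shift_Uh_minus shift_Uh_var shift_Uh_scal)
  with mult show ?case by (simp add: shift_Uh_mult Uh_den.mult del: of_int_add of_int_diff)
qed

lift_definition shift_frac ::
    "('n \<Rightarrow> int) \<Rightarrow> ('a::field, 'n::{finite,linorder}) Uh fract \<Rightarrow> ('a, 'n) Uh fract"
  is "\<lambda>c x. (shift_Uh c (fst x), shift_Uh c (snd x))"
  by (auto simp: shift_Uh_eq_0_iff simp flip: shift_Uh_mult)

lemma shift_frac_Fract: "q \<noteq> 0 \<Longrightarrow> shift_frac c (Fract p q) = Fract (shift_Uh c p) (shift_Uh c q)"
  by transfer (simp add: shift_Uh_eq_0_iff)

lemma shift_frac_add: "shift_frac c (x + y) = shift_frac c x + shift_frac c y"
  by (cases x; cases y) (simp add: shift_frac_Fract shift_Uh_eq_0_iff shift_Uh_add shift_Uh_mult)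

lemma shift_frac_mult: "shift_frac c (x * y) = shift_frac c x * shift_frac c y"
  by (cases x; cases y) (simp add: shift_frac_Fract shift_Uh_mult)

lift_definition shift ::
    "('n \<Rightarrow> int) \<Rightarrow> ('a::field, 'n::{finite,linorder}) Uhgen \<Rightarrow> ('a, 'n) Uhgen"
  is shift_frac
  using shift_Uh_den Uh_den_nonzero by (fastforce simp: shift_frac_Fract)

lemma shift_add: "shift c (x + y) = shift c x + shift c y"
  by transfer (simp add: shift_frac_add)

lemma shift_mult: "shift c (x * y) = shift c x * shift c y"
  by transfer (simp add: shift_frac_mult)

lemma shift_scal: "shift c (Uhgen_scal a) = Uhgen_scal a"
  by transfer (simp add: shift_frac_Fract shift_Uh_scal shift_Uh_1)

lemma shift_0: "shift c 0 = 0" and shift_1: "shift c 1 = 1"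
  using shift_scal[of c 0] shift_scal[of c 1] by simp_all

lemma shift_E: "shift c (Uhgen_E i) = Uhgen_E i + Uhgen_scal (of_int (c i) * hb_poly)"
  by transfer (simp add: shift_frac_Fract shift_Uh_var shift_Uh_1)

lemma shift_frac_shift_frac: "shift_frac c (shift_frac d x) = shift_frac (\<lambda>k. c k + d k) x"
  by (cases x) (simp add: shift_frac_Fract shift_Uh_eq_0_iff shift_Uh_shift_Uh)

lemma shift_shift: "shift c (shift d x) = shift (\<lambda>k. c k + d k) x"
  by transfer (rule shift_frac_shift_frac)

lemma shift_frac_zero: "shift_frac (\<lambda>k. 0) x = x"
  by (cases x) (simp add: shift_frac_Fract shift_Uh_zero)

lemma shift_zero: "shift (\<lambda>k. 0) x = x"
  by transfer (rule shift_frac_zero)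


section \<open>The algebra \<open>U\<^sub>\<hbar>(gl\<^sub>N)\<^sup>g\<^sup>e\<^sup>n\<close>\<close>

text \<open>
  The tensor product of \<open>U\<^sub>\<hbar>(h)\<^sup>g\<^sup>e\<^sup>n\<close> and \<open>U\<^sub>\<hbar>(gl\<^sub>N)\<close> over \<open>U\<^sub>\<hbar>(h)\<close>. It suffices to impose the
  balancing relation for the scalars and the \<open>E\<^sub>i\<^sub>i\<close>, as these generate the ring \<open>U\<^sub>\<hbar>(h)\<close>.
\<close>

datatype ('f, 'u) tterm =
    TZero
  | Tens 'f 'u
  | TPlus "('f, 'u) tterm" "('f, 'u) tterm"
  | TNeg "('f, 'u) tterm"

inductive teq :: "(('a::field, 'n::{finite,linorder}) Uhgen, ('a, 'n) U) tterm \<Rightarrow>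
    (('a, 'n) Uhgen, ('a, 'n) U) tterm \<Rightarrow> bool"
  where
    teq_refl: "teq x x"
  | teq_sym: "teq x y \<Longrightarrow> teq y x"
  | teq_trans: "teq x y \<Longrightarrow> teq y z \<Longrightarrow> teq x z"
  | teq_TPlus: "teq x x' \<Longrightarrow> teq y y' \<Longrightarrow> teq (TPlus x y) (TPlus x' y')"
  | teq_TNeg: "teq x x' \<Longrightarrow> teq (TNeg x) (TNeg x')"
  | teq_add_assoc: "teq (TPlus (TPlus x y) z) (TPlus x (TPlus y z))"
  | teq_add_comm: "teq (TPlus x y) (TPlus y x)"
  | teq_add_zero: "teq (TPlus TZero x) x"
  | teq_add_neg: "teq (TPlus (TNeg x) x) TZero"
  | teq_tens_left: "teq (Tens (f + g) z) (TPlus (Tens f z) (Tens g z))"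
  | teq_tens_right: "teq (Tens f (z + w)) (TPlus (Tens f z) (Tens f w))"
  | teq_balanced_E: "teq (Tens (f * Uhgen_E i) z) (Tens f (E i i * z))"
  | teq_balanced_scal: "teq (Tens (f * Uhgen_scal c) z) (Tens f (scalU c * z))"

quotient_type (overloaded) ('a, 'n) Ugen =
    "(('a::field, 'n::{finite,linorder}) Uhgen, ('a, 'n) U) tterm" / teq
  by (rule equivpI)
    (auto intro!: reflpI sympI transpI intro: teq_refl teq_sym teq_trans)

instantiation Ugen :: (field, "{finite,linorder}") ab_group_add
begin

lift_definition zero_Ugen :: "('a, 'b) Ugen" is TZero .
lift_definition plus_Ugen :: "('a, 'b) Ugen \<Rightarrow> ('a, 'b) Ugen \<Rightarrow> ('a, 'b) Ugen" is TPlus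
  by (rule teq_TPlus)
lift_definition uminus_Ugen :: "('a, 'b) Ugen \<Rightarrow> ('a, 'b) Ugen" is TNeg
  by (rule teq_TNeg)
definition minus_Ugen :: "('a, 'b) Ugen \<Rightarrow> ('a, 'b) Ugen \<Rightarrow> ('a, 'b) Ugen"
  where "minus_Ugen x y = x + - y"

instance
proof
  fix a b c :: "('a, 'b) Ugen"
  show "a + b + c = a + (b + c)" by transfer (rule teq_add_assoc)
  show "a + b = b + a" by transfer (rule teq_add_comm)
  show "0 + a = a" by transfer (rule teq_add_zero)
  show "- a + a = 0" by transfer (rule teq_add_neg)
  show "a - b = a + - b" by (simp add: minus_Ugen_def)
qed

end

definition tens :: "('a::field, 'n::{finite,linorder}) Uhgen \<Rightarrow> ('a, 'n) U \<Rightarrow> ('a, 'n) Ugen"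
  where "tens f z = abs_Ugen (Tens f z)"

lemma abs_Ugen_simps:
  "abs_Ugen TZero = 0" "abs_Ugen (Tens f z) = tens f z"
  "abs_Ugen (TPlus x y) = abs_Ugen x + abs_Ugen y" "abs_Ugen (TNeg x) = - abs_Ugen x"
  by (simp_all add: tens_def zero_Ugen_def plus_Ugen.abs_eq uminus_Ugen.abs_eq)

lemma tens_add_left: "tens (f + g) z = tens f z + tens g z"
  unfolding abs_Ugen_simps[symmetric] U.abs_eq_iff Ugen.abs_eq_iff by (rule teq_tens_left)

lemma tens_add_right: "tens f (z + w) = tens f z + tens f w"
  unfolding abs_Ugen_simps[symmetric] Ugen.abs_eq_iff by (rule teq_tens_right)

lemma tens_balanced_E: "tens (f * Uhgen_E i) z = tens f (E i i * z)"
  unfolding abs_Ugen_simps[symmetric] Ugen.abs_eq_iff by (rule teq_balanced_E)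

lemma tens_balanced_scal: "tens (f * Uhgen_scal c) z = tens f (scalU c * z)"
  unfolding abs_Ugen_simps[symmetric] Ugen.abs_eq_iff by (rule teq_balanced_scal)

lemma tens_0_left: "tens 0 z = 0"
  using tens_add_left[of 0 0 z] by simp

lemma tens_0_right: "tens f 0 = 0"
  using tens_add_right[of f 0 0] by simp

lemma tens_minus_right: "tens f (- z) = - tens f z"
  using tens_add_right[of f "- z" z] by (simp add: tens_0_right eq_neg_iff_add_eq_0)

lemma Ugen_induct [case_names zero tens add neg]:
  assumes "P 0" "\<And>f z. P (tens f z)" "\<And>x y. P x \<Longrightarrow> P y \<Longrightarrow> P (x + y)" "\<And>x. P x \<Longrightarrow> P (- x)"
  shows "P x"
proof (induction x rule: Ugen.abs_induct)
  case (1 t)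
  show ?case by (induction t) (simp_all add: abs_Ugen_simps assms)
qed

primrec tterm_lift :: "('f \<Rightarrow> 'u \<Rightarrow> 'm::ab_group_add) \<Rightarrow> ('f, 'u) tterm \<Rightarrow> 'm"
  where
    "tterm_lift b TZero = 0"
  | "tterm_lift b (Tens f z) = b f z"
  | "tterm_lift b (TPlus x y) = tterm_lift b x + tterm_lift b y"
  | "tterm_lift b (TNeg x) = - tterm_lift b x"

text \<open>The additive map out of the tensor product induced by a balanced biadditive map.\<close>

definition tens_lift :: "(('a::field, 'n::{finite,linorder}) Uhgen \<Rightarrow> ('a, 'n) U \<Rightarrow> 'm::ab_group_add)
    \<Rightarrow> ('a, 'n) Ugen \<Rightarrow> 'm"
  where "tens_lift b x = tterm_lift b (rep_Ugen x)"

locale balanced =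
  fixes b :: "('a::field, 'n::{finite,linorder}) Uhgen \<Rightarrow> ('a, 'n) U \<Rightarrow> 'm::ab_group_add"
  assumes add_left: "b (f + g) z = b f z + b g z"
    and add_right: "b f (z + w) = b f z + b f w"
    and bal_E: "b (f * Uhgen_E i) z = b f (E i i * z)"
    and bal_scal: "b (f * Uhgen_scal c) z = b f (scalU c * z)"
begin

lemma tterm_lift_cong: "teq x y \<Longrightarrow> tterm_lift b x = tterm_lift b y"
  by (induction rule: teq.induct) (simp_all add: add_left add_right bal_E bal_scal algebra_simps)

lemma tens_lift_abs: "tens_lift b (abs_Ugen t) = tterm_lift b t"
  unfolding tens_lift_def
  by (rule tterm_lift_cong) (metis Quotient_Ugen Quotient_rep_abs teq_refl)

lemma tens_lift_simps:
  "tens_lift b 0 = 0" "tens_lift b (tens f z) = b f z"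
  "tens_lift b (- x) = - tens_lift b x"
  by (simp_all add: abs_Ugen_simps(1,2)[symmetric] tens_lift_abs)
    (induction x rule: Ugen.abs_induct, simp add: abs_Ugen_simps(4)[symmetric] tens_lift_abs)

lemma tens_lift_add: "tens_lift b (x + y) = tens_lift b x + tens_lift b y"
  by (induction x rule: Ugen.abs_induct, induction y rule: Ugen.abs_induct)
    (simp add: abs_Ugen_simps(3)[symmetric] tens_lift_abs)

end


text \<open>
  The algebra structure on the tensor product is determined by the requirement that both tensor
  factors be subalgebras. In it \<open>E\<^sub>i\<^sub>j f = \<tau>(f) E\<^sub>i\<^sub>j\<close> for \<open>f\<close> in \<open>U\<^sub>\<hbar>(h)\<^sup>g\<^sup>e\<^sup>n\<close>, where \<open>\<tau>\<close> is the
  automorphism \<open>E\<^sub>k\<^sub>k \<mapsto> E\<^sub>k\<^sub>k + \<hbar> (\<delta>\<^sub>j\<^sub>k - \<delta>\<^sub>i\<^sub>k)\<close>, because \<open>E\<^sub>i\<^sub>j E\<^sub>k\<^sub>k = E\<^sub>k\<^sub>k E\<^sub>i\<^sub>j + \<hbar> [E\<^sub>i\<^sub>j, E\<^sub>k\<^sub>k]\<close>. Hence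
  \<open>f \<otimes> z\<close> multiplies from the left as \<open>f\<close> composed with the action of \<open>z\<close>, where \<open>E\<^sub>i\<^sub>j\<close> acts by
  \<open>g \<otimes> w \<mapsto> \<tau>(g) \<otimes> E\<^sub>i\<^sub>j w\<close>.
\<close>

definition wt :: "'n \<Rightarrow> 'n \<Rightarrow> 'n \<Rightarrow> int"
  where "wt i j k = (if j = k then 1 else 0) - (if i = k then 1 else 0)"

definition Ugen_hmult ::
    "('a, 'n) Uhgen \<Rightarrow> ('a::field, 'n::{finite,linorder}) Ugen \<Rightarrow> ('a, 'n) Ugen"
  where "Ugen_hmult g = tens_lift (\<lambda>f z. tens (g * f) z)"

definition Ugen_Emult :: "'n \<Rightarrow> 'n \<Rightarrow> ('a::field, 'n::{finite,linorder}) Ugen \<Rightarrow> ('a, 'n) Ugen"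
  where "Ugen_Emult i j = tens_lift (\<lambda>f z. tens (shift (wt i j) f) (E i j * z))"

text \<open>The action of \<open>U\<^sub>\<hbar>(gl\<^sub>N)\<close> extending given actions of scalars and of the \<open>E\<^sub>i\<^sub>j\<close>.\<close>

primrec uterm_act :: "('r \<Rightarrow> 'm \<Rightarrow> 'm) \<Rightarrow> ('n \<Rightarrow> 'n \<Rightarrow> 'm \<Rightarrow> 'm) \<Rightarrow> ('r, 'n) uterm \<Rightarrow>
    'm::ab_group_add \<Rightarrow> 'm"
  where
    "uterm_act s e (Scalar c) t = s c t"
  | "uterm_act s e (Gen i j) t = e i j t"
  | "uterm_act s e (Plus x y) t = uterm_act s e x t + uterm_act s e y t"
  | "uterm_act s e (Times x y) t = uterm_act s e x (uterm_act s e y t)"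

definition U_act :: "('a::field poly \<Rightarrow> 'm \<Rightarrow> 'm) \<Rightarrow> ('n \<Rightarrow> 'n \<Rightarrow> 'm \<Rightarrow> 'm) \<Rightarrow> ('a, 'n) U \<Rightarrow>
    'm::ab_group_add \<Rightarrow> 'm"
  where "U_act s e z = uterm_act s e (rep_U z)"

locale lie_action =
  fixes s :: "'a::field poly \<Rightarrow> 'm::ab_group_add \<Rightarrow> 'm" and e :: "'n \<Rightarrow> 'n \<Rightarrow> 'm \<Rightarrow> 'm"
  assumes s_add_right: "s c (x + y) = s c x + s c y"
    and s_add_left: "s (c + d) x = s c x + s d x"
    and s_mult: "s (c * d) x = s c (s d x)"
    and s_1: "s 1 x = x"
    and e_add: "e i j (x + y) = e i j x + e i j y"
    and e_s: "e i j (s c x) = s c (e i j x)"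
    and e_e: "e i j (e k l x) = e k l (e i j x) +
      s hb_poly ((if j = k then e i l x else 0) - (if l = i then e k j x else 0))"
begin

lemma s_0_right: "s c 0 = 0"
  using s_add_right[of c 0 0] by simp

lemma s_0_left: "s 0 x = 0"
  using s_add_left[of 0 0 x] by simp

lemma s_minus_1: "s (- 1) x = - x"
  using s_add_left[of "- 1" 1 x] by (simp add: s_0_left s_1 eq_neg_iff_add_eq_0)

lemma e_0: "e i j 0 = 0"
  using e_add[of i j 0 0] by simp

lemma uterm_act_add: "uterm_act s e x (t + t') = uterm_act s e x t + uterm_act s e x t'"
  by (induction x arbitrary: t t') (simp_all add: s_add_right e_add algebra_simps)

lemma uterm_act_s: "uterm_act s e x (s c t) = s c (uterm_act s e x t)"
  by (induction x arbitrary: t) (simp_all add: s_add_right e_s mult.commute flip: s_mult)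

lemma uterm_act_cong: "ueq x y \<Longrightarrow> uterm_act s e x t = uterm_act s e y t"
proof (induction arbitrary: t rule: ueq.induct)
  case (ueq_lie i j k l)
  show ?case by (simp add: e_e[of i j k l] s_minus_1 s_0_left)
qed (simp_all add: s_add_left s_mult s_1 s_0_left s_minus_1 uterm_act_add uterm_act_s algebra_simps)

lemma U_act_abs: "U_act s e (abs_U x) t = uterm_act s e x t"
  unfolding U_act_def by (rule uterm_act_cong) (metis Quotient_U Quotient_rep_abs ueq_refl)

lemma U_act_scal: "U_act s e (scalU c) t = s c t"
  and U_act_E: "U_act s e (E i j) t = e i j t"
  by (simp_all add: abs_U_simps[symmetric] U_act_abs)

lemma U_act_plus: "U_act s e (z + w) t = U_act s e z t + U_act s e w t"
  and U_act_times: "U_act s e (z * w) t = U_act s e z (U_act s e w t)"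
  by (induction z rule: U.abs_induct; induction w rule: U.abs_induct;
      simp add: abs_U_simps(3,4)[symmetric] U_act_abs)+

lemma U_act_add: "U_act s e z (t + t') = U_act s e z t + U_act s e z t'"
  by (simp add: U_act_def uterm_act_add)

lemma U_act_1: "U_act s e 1 t = t"
  using U_act_scal[of 1 t] by (simp add: s_1)

lemma U_act_0: "U_act s e z 0 = 0"
  using U_act_add[of z 0 0] by simp

lemma U_act_minus: "U_act s e z (- t) = - U_act s e z t"
  using U_act_add[of z "- t" t] by (simp add: U_act_0 eq_neg_iff_add_eq_0)

end

lemma U_induct [case_names scal E plus times]:
  assumes "\<And>c. P (scalU c)" "\<And>i j. P (E i j)"
    "\<And>z w. P z \<Longrightarrow> P w \<Longrightarrow> P (z + w)" "\<And>z w. P z \<Longrightarrow> P w \<Longrightarrow> P (z * w)"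
  shows "P z"
proof (induction z rule: U.abs_induct)
  case (1 t)
  show ?case by (induction t) (simp_all add: abs_U_simps assms)
qed

lemma wt_diag: "wt i i = (\<lambda>k. 0)"
  by (auto simp: wt_def)

lemma E_diag_commute:
  "E i j * E k k = (E k k * E i j + scalU (of_int (wt i j k) * hb_poly) * E i j :: ('a::field, 'n) U)"
proof -
  have "lieU i j k k = (of_int (wt i j k) * E i j :: ('a, 'n) U)"
    by (auto simp: lieU_def wt_def)
  moreover have "scalU (of_int n) = (of_int n :: ('a, 'n) U)" for n
  proof -
    have "scalU (- c) = - (scalU c :: ('a, 'n) U)" for c
    proof -
      have "scalU (- c + c) = (scalU (- c) + scalU c :: ('a, 'n) U)" by (rule scalU_add)
      then show ?thesis by (simp add: eq_neg_iff_add_eq_0)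
    qed
    moreover have "scalU (of_nat m) = (of_nat m :: ('a, 'n) U)" for m
      by (induction m) (simp_all add: scalU_add)
    ultimately show ?thesis by (cases n rule: int_cases2) simp_all
  qed
  ultimately show ?thesis
    by (simp add: E_E[of i j k k] scalU_mult mult.assoc[symmetric]
        flip: scalU_central[of hb_poly])
qed

interpretation Ugen_hmult: balanced "\<lambda>f z. tens (g * f) (z :: ('a::field, 'n::{finite,linorder}) U)"
  by standard
    (simp_all add: distrib_left tens_add_left tens_add_right mult.assoc[symmetric]
      tens_balanced_E tens_balanced_scal)

interpretation Ugen_Emult: balanced "\<lambda>f z. tens (shift (wt i j) f)
    (E i j * z :: ('a::field, 'n::{finite,linorder}) U)"
proof
  fix f :: "('a, 'n) Uhgen" and z :: "('a, 'n) U" and k :: 'n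
  have "tens (shift (wt i j) (f * Uhgen_E k)) (E i j * z) =
      tens (shift (wt i j) f) ((E k k + scalU (of_int (wt i j k) * hb_poly)) * E i j * z)"
    by (simp add: shift_mult shift_E distrib_left distrib_right tens_add_left tens_add_right
        tens_balanced_E tens_balanced_scal mult.assoc)
  also have "\<dots> = tens (shift (wt i j) f) (E i j * (E k k * z))"
    by (simp add: distrib_right E_diag_commute mult.assoc[symmetric])
  finally show "tens (shift (wt i j) (f * Uhgen_E k)) (E i j * z) =
      tens (shift (wt i j) f) (E i j * (E k k * z))" .
next
  fix f :: "('a, 'n) Uhgen" and z :: "('a, 'n) U" and c
  have "E i j * (scalU c * z) = scalU c * (E i j * z)"
    by (metis scalU_central mult.assoc)
  then show "tens (shift (wt i j) (f * Uhgen_scal c)) (E i j * z) =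
      tens (shift (wt i j) f) (E i j * (scalU c * z))"
    by (simp add: shift_mult shift_scal tens_balanced_scal)
qed (simp_all add: shift_add distrib_left tens_add_left tens_add_right)

lemmas hmult_simps = Ugen_hmult.tens_lift_simps[folded Ugen_hmult_def]
  Ugen_hmult.tens_lift_add[folded Ugen_hmult_def]

lemmas Emult_simps = Ugen_Emult.tens_lift_simps[folded Ugen_Emult_def]
  Ugen_Emult.tens_lift_add[folded Ugen_Emult_def]

lemma hmult_add_left: "Ugen_hmult (f + g) x = Ugen_hmult f x + Ugen_hmult g x"
  by (induction x rule: Ugen_induct)
    (simp_all add: hmult_simps distrib_right tens_add_left algebra_simps)

lemma hmult_diff: "Ugen_hmult f (x - y) = Ugen_hmult f x - Ugen_hmult f y"
  unfolding diff_conv_add_uminus hmult_simps ..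

lemma hmult_mult: "Ugen_hmult (f * g) x = Ugen_hmult f (Ugen_hmult g x)"
  by (induction x rule: Ugen_induct) (simp_all add: hmult_simps mult.assoc)

lemma hmult_1: "Ugen_hmult 1 x = x"
  by (induction x rule: Ugen_induct) (simp_all add: hmult_simps)

lemma Emult_hmult: "Ugen_Emult i j (Ugen_hmult f x) = Ugen_hmult (shift (wt i j) f) (Ugen_Emult i j x)"
  by (induction x rule: Ugen_induct) (simp_all add: hmult_simps Emult_simps shift_mult)

lemma Emult_diag: "Ugen_Emult i i x = Ugen_hmult (Uhgen_E i) x"
proof (induction x rule: Ugen_induct)
  case (tens f z)
  have "tens (Uhgen_E i * f) z = tens f (E i i * z)"
    by (metis mult.commute tens_balanced_E)
  then show ?case by (simp add: hmult_simps Emult_simps wt_diag shift_zero)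
qed (simp_all add: hmult_simps Emult_simps)

lemma shift_wt_wt:
  "shift (wt i j) (shift (wt k l) f) = shift (wt k l) (shift (wt i j) f)"
  "shift (wt i k) (shift (wt k j) f) = shift (wt i j) f"
  "shift (wt k j) (shift (wt i k) f) = shift (wt i j) f"
  by (auto simp: shift_shift wt_def intro!: arg_cong[of _ _ "\<lambda>c. shift c f"])

lemma hmult_scal_tens: "tens (Uhgen_scal c * f) z = tens f (scalU c * z)"
  by (metis mult.commute tens_balanced_scal)

interpretation Ugen_act: lie_action
  "\<lambda>c. Ugen_hmult (Uhgen_scal c :: ('a::field, 'n::{finite,linorder}) Uhgen)" Ugen_Emult
proof
  fix i j k l :: 'n and x :: "('a, 'n) Ugen"
  show "Ugen_Emult i j (Ugen_Emult k l x) = Ugen_Emult k l (Ugen_Emult i j x) +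
      Ugen_hmult (Uhgen_scal hb_poly)
        ((if j = k then Ugen_Emult i l x else 0) - (if l = i then Ugen_Emult k j x else 0))"
  proof (induction x rule: Ugen_induct)
    case (tens f z)
    have "E i j * (E k l * z) = E k l * (E i j * z) + scalU hb_poly * (lieU i j k l * z)"
      by (simp add: E_E[of i j k l] distrib_right mult.assoc flip: mult.assoc[of "E i j"])
    moreover have "lieU i j k l * z = (if j = k then E i l * z else 0)
        + (- (if l = i then E k j * z else 0))"
      by (simp add: lieU_def left_diff_distrib)
    ultimately have "tens f' (E i j * (E k l * z)) = tens f' (E k l * (E i j * z))
      + Ugen_hmult (Uhgen_scal hb_poly) ((if j = k then tens f' (E i l * z) else 0)
        - (if l = i then tens f' (E k j * z) else 0))" for f'
      by (simp add: tens_add_right tens_minus_right hmult_simps hmult_scal_tens distrib_left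
          tens_0_right diff_conv_add_uminus del: add_uminus_conv_diff)
    note key = this
    define g where "g = shift (wt i j) (shift (wt k l) f)"
    have 1: "Ugen_Emult i j (Ugen_Emult k l (tens f z)) = tens g (E i j * (E k l * z))"
      by (simp add: Emult_simps g_def)
    have 2: "Ugen_Emult k l (Ugen_Emult i j (tens f z)) = tens g (E k l * (E i j * z))"
      by (simp add: Emult_simps g_def shift_wt_wt(1)[of k l i j])
    have 3: "(if j = k then Ugen_Emult i l (tens f z) else 0) =
        (if j = k then tens g (E i l * z) else 0)"
      by (simp add: Emult_simps g_def shift_wt_wt(2))
    have 4: "(if l = i then Ugen_Emult k j (tens f z) else 0) =
        (if l = i then tens g (E k j * z) else 0)"
      by (simp add: Emult_simps g_def shift_wt_wt(3))
    show ?case unfolding 1 2 3 4 by (rule key)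
  next
    case (add x y)
    have "Ugen_Emult i j (Ugen_Emult k l (x + y)) =
        Ugen_Emult i j (Ugen_Emult k l x) + Ugen_Emult i j (Ugen_Emult k l y)"
      by (simp add: Emult_simps)
    also note add(1)
    also note add(2)
    finally show ?case by (simp add: Emult_simps hmult_simps hmult_diff)
  next
    case (neg x)
    have "Ugen_Emult i j (Ugen_Emult k l (- x)) = - Ugen_Emult i j (Ugen_Emult k l x)"
      by (simp add: Emult_simps)
    also note neg
    finally show ?case by (simp add: Emult_simps hmult_simps hmult_diff)
  qed (simp add: Emult_simps hmult_simps)
qed (simp_all add: hmult_simps Emult_simps Uhgen_scal_add Uhgen_scal_mult hmult_add_left hmult_mult
    hmult_1 Emult_hmult shift_scal)

definition U_mult_Ugen :: "('a, 'n) U \<Rightarrow> ('a::field, 'n::{finite,linorder}) Ugen \<Rightarrow> ('a, 'n) Ugen"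
  where "U_mult_Ugen = U_act (\<lambda>c. Ugen_hmult (Uhgen_scal c)) Ugen_Emult"

lemmas U_mult_Ugen_simps = Ugen_act.U_act_scal[folded U_mult_Ugen_def]
  Ugen_act.U_act_E[folded U_mult_Ugen_def] Ugen_act.U_act_plus[folded U_mult_Ugen_def]
  Ugen_act.U_act_times[folded U_mult_Ugen_def] Ugen_act.U_act_add[folded U_mult_Ugen_def]
  Ugen_act.U_act_1[folded U_mult_Ugen_def] Ugen_act.U_act_0[folded U_mult_Ugen_def]
  Ugen_act.U_act_minus[folded U_mult_Ugen_def]

lemma U_mult_Ugen_tens_1: "U_mult_Ugen z (tens 1 w) = tens 1 (z * w)"
proof (induction z arbitrary: w rule: U_induct)
  case (scal c)
  show ?case using hmult_scal_tens[of c 1 w] by (simp add: U_mult_Ugen_simps hmult_simps)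
qed (simp_all add: U_mult_Ugen_simps Emult_simps shift_1 distrib_right tens_add_right mult.assoc)

interpretation Ugen_mult: balanced "\<lambda>f z. Ugen_hmult f (U_mult_Ugen z t)"
  by standard
    (simp_all add: hmult_add_left hmult_mult hmult_simps U_mult_Ugen_simps Emult_diag)

text \<open>Non-triviality, by the action of \<open>U\<^sub>\<hbar>(gl\<^sub>N)\<close> on \<open>U\<^sub>\<hbar>(h)\<^sup>g\<^sup>e\<^sup>n\<close> in which \<open>E\<^sub>i\<^sub>j\<close> acts as \<open>E\<^sub>j\<^sub>j \<tau>\<close>.\<close>

interpretation Uhgen_act: lie_action
  "\<lambda>c x. (Uhgen_scal c :: ('a::field, 'n::{finite,linorder}) Uhgen) * x"
  "\<lambda>i j x. Uhgen_E j * shift (wt i j) x"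
proof
  fix i j k l :: 'n and x :: "('a, 'n) Uhgen"
  have *: "shift (wt k l) (shift (wt i j) x) = shift (wt i j) (shift (wt k l) x)"
    by (rule shift_wt_wt)
  show "Uhgen_E j * shift (wt i j) (Uhgen_E l * shift (wt k l) x) =
      Uhgen_E l * shift (wt k l) (Uhgen_E j * shift (wt i j) x) +
      Uhgen_scal hb_poly * ((if j = k then Uhgen_E l * shift (wt i l) x else 0) -
        (if l = i then Uhgen_E j * shift (wt k j) x else 0))"
    unfolding shift_mult shift_E *
    by (auto simp: shift_wt_wt wt_diag shift_zero wt_def[of _ _ j] wt_def[of _ _ l] algebra_simps
      Uhgen_scal_add Uhgen_scal_minus)
qed (simp_all add: shift_add shift_mult shift_scal Uhgen_scal_add Uhgen_scal_mult algebra_simps)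

definition Ugen_aug :: "('a::field, 'n::{finite,linorder}) Ugen \<Rightarrow> ('a, 'n) Uhgen"
  where "Ugen_aug = tens_lift (\<lambda>f z. f *
    U_act (\<lambda>c x. Uhgen_scal c * x) (\<lambda>i j x. Uhgen_E j * shift (wt i j) x) z 1)"

interpretation Ugen_aug: balanced "\<lambda>f z. f *
    U_act (\<lambda>c x. Uhgen_scal c * x) (\<lambda>i j x. Uhgen_E j * shift (wt i j) x)
    (z :: ('a::field, 'n::{finite,linorder}) U) 1"
  by standard (simp_all add: Uhgen_act.U_act_plus Uhgen_act.U_act_times Uhgen_act.U_act_scal
      Uhgen_act.U_act_E wt_diag shift_zero distrib_left distrib_right mult.assoc)

instantiation Ugen :: (field, "{finite,linorder}") ring_1
begin

definition one_Ugen :: "('a, 'b) Ugen"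
  where "1 = tens 1 1"

definition times_Ugen :: "('a, 'b) Ugen \<Rightarrow> ('a, 'b) Ugen \<Rightarrow> ('a, 'b) Ugen"
  where "x * y = tens_lift (\<lambda>f z. Ugen_hmult f (U_mult_Ugen z y)) x"

lemma Ugen_mult_simps:
  fixes y :: "('a, 'b) Ugen"
  shows "0 * y = 0" "tens f z * y = Ugen_hmult f (U_mult_Ugen z y)"
    "- x * y = - (x * y)" "(x + x') * y = x * y + x' * y"
  by (simp_all add: times_Ugen_def Ugen_mult.tens_lift_simps Ugen_mult.tens_lift_add)

lemma hmult_times: "Ugen_hmult f x * y = Ugen_hmult f (x * y)"
  by (induction x rule: Ugen_induct)
    (simp_all add: hmult_simps Ugen_mult_simps hmult_mult)

lemma U_mult_times: "U_mult_Ugen z x * y = U_mult_Ugen z (x * y)"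
proof (induction z arbitrary: x rule: U_induct)
  case (E i j)
  show ?case
    by (induction x rule: Ugen_induct)
      (simp_all add: U_mult_Ugen_simps Emult_simps Ugen_mult_simps Emult_hmult)
qed (simp_all add: U_mult_Ugen_simps hmult_times Ugen_mult_simps)

instance
proof
  fix a b c :: "('a, 'b) Ugen"
  show "a * b * c = a * (b * c)"
    by (induction a rule: Ugen_induct)
      (simp_all add: Ugen_mult_simps hmult_times U_mult_times)
  show "1 * a = a"
    by (simp add: one_Ugen_def Ugen_mult_simps hmult_1 U_mult_Ugen_simps)
  show "a * 1 = a"
    by (induction a rule: Ugen_induct)
      (simp_all add: one_Ugen_def Ugen_mult_simps U_mult_Ugen_tens_1 hmult_simps)
  show "(a + b) * c = a * c + b * c"
    by (simp add: Ugen_mult_simps)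
  show "a * (b + c) = a * b + a * c"
    by (induction a rule: Ugen_induct)
      (simp_all add: Ugen_mult_simps hmult_simps U_mult_Ugen_simps algebra_simps)
  have "Ugen_aug (0 :: ('a, 'b) Ugen) = 0" "Ugen_aug (1 :: ('a, 'b) Ugen) = 1"
    by (simp_all add: Ugen_aug_def one_Ugen_def Ugen_aug.tens_lift_simps Uhgen_act.U_act_1)
  then show "(0 :: ('a, 'b) Ugen) \<noteq> 1"
    by (metis zero_neq_one)
qed

end

lemma tens_1_times: "tens 1 z * tens 1 w = tens 1 (z * w :: ('a::field, 'n::{finite,linorder}) U)"
  by (simp add: Ugen_mult_simps hmult_1 U_mult_Ugen_tens_1)

lemma tens_times_right: "tens f z * tens 1 w = tens f (z * w :: ('a::field, 'n::{finite,linorder}) U)"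
  by (simp add: Ugen_mult_simps hmult_simps U_mult_Ugen_tens_1)

lemma tens_times_left: "tens f 1 * tens g w = tens (f * g) (w :: ('a::field, 'n::{finite,linorder}) U)"
  by (simp add: Ugen_mult_simps hmult_simps U_mult_Ugen_simps)


section \<open>Kostant--Whittaker reduction\<close>

text \<open>
  With \<open>V\<close> free on \<open>\<phi>\<^sub>1, \<dots>, \<phi>\<^sub>N\<close>, an element \<open>\<Sum>\<^sub>k \<phi>\<^sub>k \<otimes> z\<^sub>k\<close> of \<open>V \<otimes> A\<close> is the vector
  \<open>(z\<^sub>k)\<^sub>k\<close> in \<open>A ^ 'n\<close>. Thus \<open>axis k 1\<close> is \<open>\<phi>\<^sub>k \<otimes> 1\<close>, and since \<open>ad(E\<^sub>i\<^sub>j) \<phi>\<^sub>k = - \<delta>\<^sub>i\<^sub>k \<phi>\<^sub>j\<close>, the map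
  \<open>ad(E\<^sub>i\<^sub>j) \<otimes> id\<close> is \<open>x \<mapsto> axis j (- x $ i)\<close>.
\<close>

type_synonym ('a, 'n) V_U = "(('a, 'n) U, 'n) vec"
type_synonym ('a, 'n) V_Ugen = "(('a, 'n) Ugen, 'n) vec"

definition hb_U :: "('a::field, 'n) U"
  where "hb_U = scalU hb_poly"

definition ad_diag :: "'n \<Rightarrow> 'n \<Rightarrow> ('a::field, 'n::finite) V_U \<Rightarrow> ('a, 'n) V_U"
  \<comment> \<open>the diagonal action of \<open>E\<^sub>i\<^sub>j\<close> on \<open>V \<otimes> U\<^sub>\<hbar>(gl\<^sub>N)\<close>\<close>
  where "ad_diag i j x = axis j (- x $ i) + (\<chi> k. adU i j (x $ k))"

definition L :: "'n \<Rightarrow> 'n \<Rightarrow> ('a::field, 'n) U \<Rightarrow> ('a, 'n) U"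
  where "L i j u = (if i = j then u else 0) + E i j"

definition quantum_minor :: "'n list \<Rightarrow> 'n list \<Rightarrow> ('a::field, 'n) U \<Rightarrow> ('a, 'n) U"
  where "quantum_minor as bs u =
    (\<Sum>\<sigma> | \<sigma> permutes {..<length bs}. of_int (sign \<sigma>) *
      prod_list (map (\<lambda>r. L (as ! \<sigma> r) (bs ! r) (u - of_nat r * hb_U)) [0..<length bs]))"

text \<open>
  \<open>P_psi i j u\<close> is the right action of \<open>P\<^sup>\<psi>\<^sub>i\<^sub>j(u)\<close>, on representatives in \<open>V \<otimes> U\<^sub>\<hbar>(gl\<^sub>N)\<close>: the
  factor \<open>\<hbar>\<^sup>-\<^sup>k (- E\<^sup>\<psi>\<^sub>i\<^sub>j)\<^sup>k\<close> acts first, as \<open>ad(E\<^sub>i\<^sub>j)\<^sup>k\<close>. For \<open>i > j\<close> the diagonal action of \<open>E\<^sub>i\<^sub>j\<close> and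
  right multiplication both preserve \<open>n\<^sub>-\<^sup>\<psi> (V \<otimes> U\<^sub>\<hbar>(gl\<^sub>N))\<close> (the former because \<open>\<psi>\<close> vanishes on
  \<open>[n\<^sub>-, n\<^sub>-]\<close>), so the operator descends to the quotient. The sum over all \<open>k\<close> is finite because
  \<open>ad(E\<^sub>i\<^sub>j)\<close> is locally nilpotent.
\<close>

definition P_psi ::
    "'n \<Rightarrow> 'n \<Rightarrow> ('a::field_char_0, 'n) U \<Rightarrow> ('a, 'n::{finite,linorder}) V_U \<Rightarrow> ('a, 'n) V_U"
  where "P_psi i j u x = (let js = sorted_list_of_set {j..<i} in
    Sum_any (\<lambda>k. \<chi> m. scalU [:(- 1) ^ ((idx i + idx j) * k) / fact k:] *
      ((ad_diag i j ^^ k) x $ m) *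
      prod_list (map (\<lambda>r. quantum_minor js js (u - of_nat r * hb_U)) [0..<k])))"

text \<open>
  In \<open>P\<close> the leftmost factor acts first: \<open>j\<close> runs down from \<open>N - 1\<close> to \<open>1\<close> and, for each \<open>j\<close>, \<open>i\<close>
  runs up from \<open>j + 1\<close> to \<open>N\<close>.
\<close>

definition P_m :: "('n \<Rightarrow> ('a::field_char_0, 'n) U) \<Rightarrow> ('a, 'n::{finite,linorder}) V_U \<Rightarrow> ('a, 'n) V_U"
  where "P_m u = fold (\<lambda>j. fold (\<lambda>i. P_psi i j (u j)) (sorted_list_of_set {j<..}))
    (rev (sorted_list_of_set UNIV))"

definition phi_psi :: "'n \<Rightarrow> ('a::field_char_0, 'n::{finite,linorder}) V_U"
  \<comment> \<open>a representative of \<open>\<phi>\<^sup>\<psi>\<^sub>k\<close>\<close>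
  where "phi_psi k = P_m (\<lambda>j. of_nat (CARD('n) - idx j) * hb_U) (axis k 1)"


section \<open>The double quotient and parabolic restriction\<close>

definition U_Ugen :: "('a, 'n) U \<Rightarrow> ('a::field, 'n::{finite,linorder}) Ugen"
  where "U_Ugen z = tens 1 z"

definition Uhgen_Ugen :: "('a, 'n) Uhgen \<Rightarrow> ('a::field, 'n::{finite,linorder}) Ugen"
  where "Uhgen_Ugen f = tens f 1"

definition left_E :: "'n \<Rightarrow> 'n \<Rightarrow> ('a::field, 'n::{finite,linorder}) V_Ugen \<Rightarrow> ('a, 'n) V_Ugen"
  \<comment> \<open>the left action \<open>\<xi> (v \<otimes> z) = \<hbar> ad(\<xi>) v \<otimes> z + v \<otimes> \<xi> z\<close> for \<open>\<xi> = E\<^sub>i\<^sub>j\<close>\<close>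
  where "left_E i j x = axis j (- (U_Ugen hb_U * x $ i)) + (\<chi> k. U_Ugen (E i j) * x $ k)"

definition right_mult :: "('r::times) ^ 'n \<Rightarrow> 'r \<Rightarrow> 'r ^ 'n"
  where "right_mult x z = (\<chi> k. x $ k * z)"

definition psi :: "'n \<Rightarrow> 'n::{finite,linorder} \<Rightarrow> 'a::field"
  \<comment> \<open>the value of \<open>\<psi>\<close> at \<open>E\<^sub>i\<^sub>j\<close>, for \<open>i > j\<close>\<close>
  where "psi i j = (if idx i = idx j + 1 then 1 else 0)"

inductive_set dq_null :: "(('a::field, 'n::{finite,linorder}) V_Ugen) set"
  \<comment> \<open>\<open>n\<^sub>-\<^sup>\<psi> X + X n\<close> for \<open>X = V \<otimes> U\<^sub>\<hbar>(gl\<^sub>N)\<^sup>g\<^sup>e\<^sup>n\<close>\<close>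
  where
    zero: "0 \<in> dq_null"
  | add: "x \<in> dq_null \<Longrightarrow> y \<in> dq_null \<Longrightarrow> x + y \<in> dq_null"
  | left: "j < i \<Longrightarrow> left_E i j x - (\<chi> k. U_Ugen (scalU [:psi i j:]) * x $ k) \<in> dq_null"
  | right: "i < j \<Longrightarrow> right_mult x (U_Ugen (E i j)) \<in> dq_null"

definition dq_class :: "('a::field, 'n::{finite,linorder}) V_Ugen \<Rightarrow> (('a, 'n) V_Ugen) set"
  \<comment> \<open>the class of \<open>x\<close> in the double quotient \<open>X / (n\<^sub>-\<^sup>\<psi> X + X n)\<close>\<close>
  where "dq_class x = {y. y - x \<in> dq_null}"

definition hb_frac :: "('a::field, 'n::{finite,linorder}) Uh fract"
  where "hb_frac = Fract (Uh_scal hb_poly) 1"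

text \<open>\<open>\<lambda>\<^sub>i\<close>, in the field of fractions of \<open>U\<^sub>\<hbar>(h)\<close>.\<close>

definition lam :: "'n \<Rightarrow> ('a::field, 'n::{finite,linorder}) Uh fract"
  where "lam i = Fract (Uh_var i) 1 + of_nat (CARD('n) - idx i) * hb_frac"

lemma range_of_Uhgen: "range of_Uhgen = {x. \<exists>p s. s \<in> Uh_den \<and> x = Fract p s}"
  by (rule type_definition.Rep_range[OF type_definition_Uhgen])

lemma lam_Fract:
  "lam i = Fract (Uh_var i + Uh_scal (of_int (int (CARD('n) - idx i)) * hb_poly))
    (1 :: ('a::field, 'n::{finite,linorder}) Uh)"
proof -
  have "of_nat m * hb_frac = Fract (Uh_scal (of_int (int m) * hb_poly)) (1 :: ('a, 'n) Uh)" for m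
  proof (induction m)
    case 0
    show ?case by (simp add: Zero_fract_def)
  next
    case (Suc m)
    then show ?case
      by (simp add: distrib_right Uh_scal_add hb_frac_def algebra_simps)
  qed
  then show ?thesis by (simp add: lam_def)
qed

lemma inverse_lam_diff_mem:
  fixes i j :: "'n::{finite,linorder}"
  assumes "i \<noteq> j"
  shows "inverse (lam i - lam j) \<in> range (of_Uhgen :: ('a::field, 'n) Uhgen \<Rightarrow> _)"
proof -
  let ?n = "int (CARD('n) - idx i) - int (CARD('n) - idx j)"
  let ?s = "Uh_var i - Uh_var j + Uh_scal (of_int ?n * hb_poly) :: ('a, 'n) Uh"
  have "lam i - lam j = Fract ?s 1"
    by (simp add: lam_Fract left_diff_distrib Uh_scal_diff algebra_simps)
  then have "inverse (lam i - lam j) = Fract 1 ?s" by simp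
  moreover have "?s \<in> Uh_den"
    using Uh_den.mult[OF Uh_den.one assms, of ?n, where 'a = 'a] by simp
  ultimately show ?thesis unfolding range_of_Uhgen by blast
qed

lemma range_of_Uhgen_mult:
  fixes x y :: "('a::field, 'n::{finite,linorder}) Uh fract"
  assumes "x \<in> range of_Uhgen" "y \<in> range of_Uhgen"
  shows "x * y \<in> range of_Uhgen"
proof -
  obtain f g where "x = of_Uhgen f" "y = of_Uhgen g" using assms by blast
  then have "x * y = of_Uhgen (f * g)" by (simp add: times_Uhgen.rep_eq)
  then show ?thesis by blast
qed

lemma range_of_Uhgen_prod:
  fixes f :: "'b \<Rightarrow> ('a::field, 'n::{finite,linorder}) Uh fract"
  assumes "\<And>a. a \<in> A \<Longrightarrow> f a \<in> range of_Uhgen"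
  shows "prod f A \<in> range of_Uhgen"
proof -
  have "1 = of_Uhgen (1 :: ('a, 'n) Uhgen)" by (simp add: one_Uhgen.rep_eq)
  then have "1 \<in> range (of_Uhgen :: ('a, 'n) Uhgen \<Rightarrow> _)" by blast
  with assms show ?thesis
    by (induction A rule: infinite_finite_induct) (simp_all add: range_of_Uhgen_mult)
qed

lemma lam_mem: "lam i \<in> range of_Uhgen"
  unfolding range_of_Uhgen lam_Fract using Uh_den.one by blast

text \<open>For \<open>i = i\<^sub>0\<close> and a list \<open>[i\<^sub>1, \<dots>, i\<^sub>s]\<close>: the vector \<open>E\<^bsub>i\<^sub>1i\<^sub>0\<^esub> E\<^bsub>i\<^sub>2i\<^sub>1\<^esub> \<cdots> \<phi>\<^bsub>i\<^sub>s\<^esub>\<close>.\<close>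

fun chain_vec :: "'n \<Rightarrow> 'n list \<Rightarrow> ('a::field, 'n::{finite,linorder}) V_Ugen"
  where
    "chain_vec i [] = axis i 1"
  | "chain_vec i (j # js) = left_E j i (chain_vec j js)"

definition phi_bar :: "'n \<Rightarrow> ('a::field, 'n::{finite,linorder}) V_Ugen"
  \<comment> \<open>a representative of the basis element of the parabolic restriction; the chains
    \<open>i < i\<^sub>1 < \<dots> < i\<^sub>s \<le> N\<close> are the subsets of \<open>{i<..}\<close>\<close>
  where "phi_bar i = (\<Sum>A\<in>Pow {i<..}. right_mult (chain_vec i (sorted_list_of_set A))
    (Uhgen_Ugen (to_Uhgen (\<Prod>a\<in>A. inverse (lam i - lam a)))))"


section \<open>The matrices of the vertex-IRF transformation\<close>

text \<open>Column \<open>k\<close> of a matrix \<open>A\<close> holds the image of the \<open>k\<close>-th basis vector.\<close>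

definition D_mat :: "('n \<Rightarrow> 'k::field) \<Rightarrow> (('k, 'n) vec, 'n::{finite,linorder}) vec"
  where "D_mat l = (\<chi> i k. if i = k then \<Prod>j\<in>{..<i}. inverse (l i - l j) else 0)"

definition S_mat :: "('n \<Rightarrow> 'k::field) \<Rightarrow> (('k, 'n) vec, 'n::{finite,linorder}) vec"
  where "S_mat l = D_mat l ** (\<chi> i j. l i ^ (idx j - 1))"

lemma S_mat_nth: "S_mat l $ i $ k = (\<Prod>j\<in>{..<i}. inverse (l i - l j)) * l i ^ (idx k - 1)"
proof -
  have "S_mat l $ i $ k = (\<Sum>m\<in>UNIV. if i = m
      then (\<Prod>j\<in>{..<i}. inverse (l i - l j)) * l m ^ (idx k - 1) else 0)"
    unfolding S_mat_def D_mat_def matrix_matrix_mult_def vec_lambda_beta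
    by (rule sum.cong) simp_all
  then show ?thesis by simp
qed

text \<open>At the generic point, the entries of \<open>S(\<lambda>)\<close> lie in \<open>U\<^sub>\<hbar>(h)\<^sup>g\<^sup>e\<^sup>n\<close>.\<close>

lemma S_mat_mem: "S_mat lam $ i $ k \<in> range of_Uhgen"
proof -
  have "lam i ^ m \<in> range of_Uhgen" for m
    using range_of_Uhgen_prod[of "{..<m}" "\<lambda>_. lam i"] by (simp add: lam_mem)
  moreover have "(\<Prod>j\<in>{..<i}. inverse (lam i - lam j)) \<in> range of_Uhgen"
    by (rule range_of_Uhgen_prod) (auto intro!: inverse_lam_diff_mem)
  ultimately show ?thesis
    unfolding S_mat_nth by (blast intro: range_of_Uhgen_mult)
qed

definition flip_mat :: "'k::field ^ ('n \<times> 'n) ^ ('n \<times> 'n::finite)"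
  where "flip_mat = (\<chi> p q. if p = (snd q, fst q) then 1 else 0)"

definition J_mat :: "'k \<Rightarrow> ('n \<Rightarrow> 'k) \<Rightarrow> 'k::field ^ ('n \<times> 'n) ^ ('n::{finite,linorder} \<times> 'n)"
  where "J_mat hb l = (\<chi> p q. case q of (i, j) \<Rightarrow>
    (if p = (i, j) then 1 else 0) + (if j < i \<and> p = (j, i) then hb * inverse (l j - l i) else 0))"

definition R_dyn :: "'k \<Rightarrow> ('n \<Rightarrow> 'k) \<Rightarrow> 'k::field ^ ('n \<times> 'n) ^ ('n::{finite,linorder} \<times> 'n)"
  where "R_dyn hb l = flip_mat ** matrix_inv (J_mat hb l) ** flip_mat ** J_mat hb l"

text \<open>
  Operators on one tensor factor which depend on the basis vector in the other one. With
  \<open>dyn_shift hb l m\<close>, which is \<open>\<lambda> + \<hbar> h\<^bsub>(a)\<^esub>\<close> on vectors with \<open>a\<close>-th component \<open>\<phi>\<^sub>m\<close>, these give the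
  factors of the dynamical tensor products, each of which is a product of two such operators.
\<close>

definition on_fst :: "('n \<Rightarrow> 'k ^ 'n ^ 'n) \<Rightarrow> 'k::field ^ ('n \<times> 'n) ^ ('n \<times> 'n::finite)"
  where "on_fst A = (\<chi> p q. if snd p = snd q then A (snd q) $ fst p $ fst q else 0)"

definition on_snd :: "('n \<Rightarrow> 'k ^ 'n ^ 'n) \<Rightarrow> 'k::field ^ ('n \<times> 'n) ^ ('n \<times> 'n::finite)"
  where "on_snd A = (\<chi> p q. if fst p = fst q then A (fst q) $ snd p $ snd q else 0)"

definition dyn_shift :: "'k::field \<Rightarrow> ('n \<Rightarrow> 'k) \<Rightarrow> 'n \<Rightarrow> 'n \<Rightarrow> 'k"
  where "dyn_shift hb l m = l(m := l m - hb)"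

text \<open>Polynomials in \<open>X\<^sub>1\<close> and \<open>X\<^sub>2\<close> are polynomials in \<open>X\<^sub>2\<close> with coefficients polynomials in \<open>X\<^sub>1\<close>.\<close>

definition X1 :: "'k::field poly poly"
  where "X1 = [:[:0, 1:]:]"

definition X2 :: "'k::field poly poly"
  where "X2 = [:0, 1:]"

definition subst2 :: "'k::field poly poly \<Rightarrow> 'k poly poly \<Rightarrow> 'k poly poly \<Rightarrow> 'k poly poly"
  \<comment> \<open>\<open>f(P, Q)\<close>\<close>
  where "subst2 f P Q = poly (map_poly (\<lambda>c. poly (map_poly (\<lambda>a. [:[:a:]:]) c) P) f) Q"

definition CG_op :: "'k \<Rightarrow> 'k::field poly poly \<Rightarrow> 'k poly poly"
  \<comment> \<open>the polynomial division is exact\<close>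
  where "CG_op hb f = f - [:[:hb:]:] * ((f - subst2 f X2 X1) div (X1 - X2))"

definition R_CG :: "'k \<Rightarrow> 'k::field ^ ('n \<times> 'n) ^ ('n::{finite,linorder} \<times> 'n)"
  where "R_CG hb = (\<chi> p q. case (p, q) of ((i, j), (k, l)) \<Rightarrow>
    coeff (coeff (CG_op hb (X1 ^ (idx k - 1) * X2 ^ (idx l - 1))) (idx j - 1)) (idx i - 1))"

end

theory Submission
  imports Defs
begin

text \<open>
  Let \<open>T\<close> be the endomorphism \<open>\<phi>\<^sub>k \<otimes> z \<mapsto> \<Sum>\<^sub>b \<phi>\<^sub>b \<otimes> E\<^sub>b\<^sub>k z\<close> of \<open>V \<otimes> U\<^sub>\<hbar>(gl\<^sub>N)\<close>. It commutes with the left and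
  right actions, hence acts on every reduction. Modulo \<open>n\<^sub>-\<^sup>\<psi>\<close>, the difference \<open>T \<phi>\<^sub>k - \<phi>\<^sub>k\<^sub>+\<^sub>1\<close> lies in the
  span of the right multiples by the \<open>L\<^sub>i\<^sub>j(u\<^sub>j)\<close> with \<open>i \<le> j < N\<close>. The operator \<open>P\<close> changes vectors only
  by elements of this span and takes values in the \<open>N\<^sub>-\<close>-invariants, and the only invariant in the span
  is zero; since \<open>T\<^sup>k\<^sup>-\<^sup>1 \<phi>\<^sub>1\<close> is invariant, it equals \<open>\<phi>\<^sup>\<psi>\<^sub>k\<close>. In the double quotient the basis vector of the
  parabolic restriction with index \<open>i\<close> is an eigenvector of \<open>T\<close> with eigenvalue \<open>\<lambda>\<^sub>i\<close>, and \<open>\<phi>\<^sub>1\<close> is expanded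
  in these vectors by partial fractions.

  For the vertex-IRF identity, the rows of the dynamical tensor square of \<open>S\<close> are multiples of
  evaluations of polynomials \<open>f(X\<^sub>1, X\<^sub>2)\<close> at \<open>(\<lambda>\<^sub>i, \<lambda>\<^sub>j)\<close> for \<open>i \<noteq> j\<close> and at \<open>(\<lambda>\<^sub>i - \<hbar>, \<lambda>\<^sub>i)\<close>, so it reduces to
  identities between the values at \<open>(x, y)\<close> and \<open>(y, x)\<close>.
\<close>


section \<open>Column determinants\<close>

text \<open>The constants \<open>(N - k) \<hbar>\<close> have a single origin. In
  \<open>T \<phi>\<^sub>k\<close> the generators \<open>E\<^sub>b\<^sub>k\<close> with
  \<open>b > k\<close> stand on the right, where
  \<open>E\<^sub>b\<^sub>k - \<psi>(E\<^sub>b\<^sub>k)\<close> is \<open>- \<hbar>\<close> times the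
  diagonal action. Each of these \<open>N - k\<close> rows yields one
  \<open>\<hbar> \<phi>\<^sub>k\<close>, and together they complete \<open>E\<^sub>k\<^sub>k\<close>
  to \<open>\<lambda>\<^sub>k = L\<^sub>k\<^sub>k((N - k) \<hbar>)\<close>. Hence the arguments of
  \<open>P\<close> match the eigenvalues of \<open>T\<close>. The obstacle is the invariance of the
  values of \<open>P\<close>, since a row below a block does not commute with the minors in
  \<open>P\<close>. The proof follows vectors that are not yet invariant but lie in the class
  \<open>cls\<close>: invariant for a block of consecutive indices, with every lower row acting
  through signed principal minors. Each factor of \<open>P\<close> enlarges the block by one. That
  zero is the only invariant in the span is proved column by column, with series that act like the
  evaluation of a Taylor expansion at zero: they fix the invariants and annihilate the multiples of
  one entry.\<close>

definition cdet :: "nat \<Rightarrow> (nat \<Rightarrow> nat \<Rightarrow> 'u::ring_1) \<Rightarrow> 'u"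
  where "cdet n A = (\<Sum>\<sigma> | \<sigma> permutes {..<n}. of_int (sign \<sigma>) * prod_list (map (\<lambda>r. A (\<sigma> r) r) [0..<n]))"

lemma cdet_cong:
  assumes "\<And>r c. r < n \<Longrightarrow> c < n \<Longrightarrow> A r c = B r c"
  shows "cdet n A = cdet n B"
  unfolding cdet_def
proof (rule sum.cong[OF refl])
  fix \<sigma> assume "\<sigma> \<in> {\<sigma>. \<sigma> permutes {..<n}}"
  then have "\<sigma> r < n" if "r < n" for r
    using that permutes_in_image[of \<sigma> "{..<n}" r] by auto
  then have "map (\<lambda>r. A (\<sigma> r) r) [0..<n] = map (\<lambda>r. B (\<sigma> r) r) [0..<n]"
    using assms by auto
  then show "of_int (sign \<sigma>) * prod_list (map (\<lambda>r. A (\<sigma> r) r) [0..<n])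
    = of_int (sign \<sigma>) * prod_list (map (\<lambda>r. B (\<sigma> r) r) [0..<n])" by (simp only:)
qed

lemma sum_permutes_left:
  assumes "\<tau> permutes S"
  shows "(\<Sum>\<sigma> | \<sigma> permutes S. f (\<tau> \<circ> \<sigma>)) = (\<Sum>\<sigma> | \<sigma> permutes S. f \<sigma>)"
  using setum_permutations_compose_left[OF assms, of f] by (simp add: o_def)

lemma sum_permutes_right:
  assumes "\<tau> permutes S"
  shows "(\<Sum>\<sigma> | \<sigma> permutes S. f (\<sigma> \<circ> \<tau>)) = (\<Sum>\<sigma> | \<sigma> permutes S. f \<sigma>)"
  using sum_permutations_compose_right[OF assms, of f] by (simp add: o_def)

lemma sign_transpose_left:
  assumes "\<sigma> permutes {..<n::nat}" "i \<noteq> j"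
  shows "sign (Transposition.transpose i j \<circ> \<sigma>) = - sign \<sigma>" "sign (\<sigma> \<circ> Transposition.transpose i j) = - sign \<sigma>"
  using assms permutes_imp_permutation[OF _ assms(1)]
  by (simp_all add: sign_compose sign_swap_id permutation_swap_id)

text \<open>The factors are ordered by columns, so an exchange of rows leaves their order alone and
  only composes each permutation with a transposition on the left.\<close>

lemma cdet_row_swap:
  fixes A :: "nat \<Rightarrow> nat \<Rightarrow> 'u::ring_1"
  assumes "i < n" "j < n" "i \<noteq> j"
  shows "cdet n (\<lambda>r. A (Transposition.transpose i j r)) = - cdet n A"
proof -
  define f :: "(nat \<Rightarrow> nat) \<Rightarrow> 'u"
    where "f = (\<lambda>\<sigma>. of_int (sign \<sigma>) * prod_list (map (\<lambda>r. A (\<sigma> r) r) [0..<n]))"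
  have t: "Transposition.transpose i j permutes {..<n}" using assms by (simp add: permutes_swap_id)
  have "cdet n (\<lambda>r. A (Transposition.transpose i j r)) = (\<Sum>\<sigma> | \<sigma> permutes {..<n}. - f (Transposition.transpose i j \<circ> \<sigma>))"
    unfolding cdet_def f_def using assms by (intro sum.cong) (auto simp: sign_transpose_left)
  also have "\<dots> = - (\<Sum>\<sigma> | \<sigma> permutes {..<n}. f \<sigma>)"
    by (simp add: sum_negf sum_permutes_left[OF t, of f])
  finally show ?thesis by (simp add: cdet_def f_def)
qed

lemma cdet_row_eq:
  fixes A :: "nat \<Rightarrow> nat \<Rightarrow> 'u::ring_1"
  assumes "\<And>x::'u. x + x = 0 \<Longrightarrow> x = 0" "i < n" "j < n" "i \<noteq> j" "A i = A j"
  shows "cdet n A = 0"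
proof -
  have "(\<lambda>r. A (Transposition.transpose i j r)) = A" using assms(5) by (auto simp: Transposition.transpose_def)
  then have "cdet n A = - cdet n A" using cdet_row_swap[of i n j A] assms by simp
  then have "cdet n A + cdet n A = 0" using add.right_inverse[of "cdet n A"] by simp
  then show ?thesis using assms(1) by blast
qed

text \<open>A permutation of \<open>{..<Suc n}\<close> is a transposition of \<open>n\<close> and
  \<open>b\<close> after a permutation of \<open>{..<n}\<close>. The last column is split off
  because its entry is the rightmost factor. In the minor, row \<open>n\<close> takes the place of
  row \<open>b\<close>, so the sign is \<open>- 1\<close> for every \<open>b < n\<close>.\<close>

lemma cdet_Suc:
  fixes A :: "nat \<Rightarrow> nat \<Rightarrow> 'u::ring_1"
  shows "cdet (Suc n) A = (\<Sum>b\<le>n. (if b = n then 1 else - 1) * cdet n (\<lambda>r. A (if r = b then n else r)) * A b n)"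
proof -
  have ins: "{..<Suc n} = insert n {..<n}" by auto
  have sgn: "sign (Transposition.transpose n b \<circ> p) = (if b = n then 1 else - 1) * sign p"
    if "p permutes {..<n}" for b and p :: "nat \<Rightarrow> nat"
    using permutes_imp_permutation[OF _ that]
    by (simp add: sign_compose sign_swap_id permutation_swap_id)
  have pr: "prod_list (map (\<lambda>r. A ((Transposition.transpose n b \<circ> p) r) r) [0..<Suc n])
    = prod_list (map (\<lambda>r. A (if p r = b then n else p r) r) [0..<n]) * A b n"
    if "p permutes {..<n}" for b and p :: "nat \<Rightarrow> nat"
  proof -
    have pn: "p n = n" using that by (simp add: permutes_not_in)
    have "(Transposition.transpose n b \<circ> p) r = (if p r = b then n else p r)" if "r < n" for r
      using that permutes_in_image[OF \<open>p permutes _\<close>, of r] by (auto simp: Transposition.transpose_def)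
    then have "map (\<lambda>r. A ((Transposition.transpose n b \<circ> p) r) r) [0..<n] = map (\<lambda>r. A (if p r = b then n else p r) r) [0..<n]"
      by (intro map_cong) auto
    then show ?thesis using pn
      by (simp only: upt_Suc_append[OF le0] map_append prod_list.append) simp
  qed
  have "cdet (Suc n) A = (\<Sum>b\<in>insert n {..<n}. \<Sum>p | p permutes {..<n}.
      of_int (sign (Transposition.transpose n b \<circ> p)) * prod_list (map (\<lambda>r. A ((Transposition.transpose n b \<circ> p) r) r) [0..<Suc n]))"
    unfolding cdet_def ins by (subst sum_over_permutations_insert) auto
  also have "\<dots> = (\<Sum>b\<in>insert n {..<n}. \<Sum>p | p permutes {..<n}.
      (if b = n then 1 else - 1) * (of_int (sign p) * prod_list (map (\<lambda>r. A (if p r = b then n else p r) r) [0..<n])) * A b n)"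
  proof (intro sum.cong refl)
    fix b and p :: "nat \<Rightarrow> nat"
    assume "p \<in> {p. p permutes {..<n}}"
    then have p: "p permutes {..<n}" by simp
    show "of_int (sign (Transposition.transpose n b \<circ> p)) *
        prod_list (map (\<lambda>r. A ((Transposition.transpose n b \<circ> p) r) r) [0..<Suc n]) =
      (if b = n then 1 else - 1) * (of_int (sign p) * prod_list (map (\<lambda>r. A (if p r = b then n else p r) r) [0..<n])) * A b n"
      unfolding sgn[OF p] pr[OF p] by (cases "b = n") (simp_all add: mult.assoc)
  qed
  also have "\<dots> = (\<Sum>b\<in>insert n {..<n}. (if b = n then 1 else - 1) * cdet n (\<lambda>r. A (if r = b then n else r)) * A b n)"
    by (simp add: cdet_def sum_distrib_left sum_distrib_right mult.assoc)
  also have "insert n {..<n} = {..n}" by auto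
  finally show ?thesis .
qed

lemma upt_split: "i \<le> j \<Longrightarrow> j \<le> k \<Longrightarrow> [i..<k] = [i..<j] @ [j..<k]"
  using upt_add_eq_append[of i j "k - j"] by simp

lemma prod_list_upt_split:
  assumes "Suc p < n"
  shows "prod_list (map f [0..<n]) = prod_list (map f [0..<p]) * (f p * f (Suc p)) * (prod_list (map f [Suc (Suc p)..<n]) :: 'u::monoid_mult)"
proof -
  have "[0..<n] = [0..<p] @ [p, Suc p] @ [Suc (Suc p)..<n]"
    using assms upt_split[of 0 p n] by (simp add: upt_conv_Cons)
  then show ?thesis by (simp add: mult.assoc)
qed

text \<open>For entries which do not commute, exchanging two columns requires a relation between the
  entries; consecutive columns suffice.\<close>

lemma cdet_col_swap:
  fixes A :: "nat \<Rightarrow> nat \<Rightarrow> 'u::ring_1"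
  assumes tor: "\<And>x::'u. x + x = 0 \<Longrightarrow> x = 0" and p: "Suc p < n"
    and rest: "\<And>r c. c \<noteq> p \<Longrightarrow> c \<noteq> Suc p \<Longrightarrow> A r c = B r c"
    and rel: "\<And>r s. r < n \<Longrightarrow> s < n \<Longrightarrow> A r p * A s (Suc p) + B r p * B s (Suc p) = A s p * A r (Suc p) + B s p * B r (Suc p)"
  shows "cdet n A = - cdet n B"
proof -
  define g where "g = (\<lambda>\<sigma>. prod_list (map (\<lambda>r. A (\<sigma> r) r) [0..<n]) + prod_list (map (\<lambda>r. B (\<sigma> r) r) [0..<n]))"
  define f where "f = (\<lambda>\<sigma>. of_int (sign \<sigma>) * g \<sigma>)"
  let ?t = "Transposition.transpose p (Suc p)"
  have t: "?t permutes {..<n}" using p by (simp add: permutes_swap_id)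
  have g: "g \<sigma> = prod_list (map (\<lambda>r. A (\<sigma> r) r) [0..<p]) *
      (A (\<sigma> p) p * A (\<sigma> (Suc p)) (Suc p) + B (\<sigma> p) p * B (\<sigma> (Suc p)) (Suc p)) *
      prod_list (map (\<lambda>r. A (\<sigma> r) r) [Suc (Suc p)..<n])" for \<sigma>
  proof -
    have "map (\<lambda>r. B (\<sigma> r) r) [0..<p] = map (\<lambda>r. A (\<sigma> r) r) [0..<p]"
      "map (\<lambda>r. B (\<sigma> r) r) [Suc (Suc p)..<n] = map (\<lambda>r. A (\<sigma> r) r) [Suc (Suc p)..<n]"
      by (auto simp: rest)
    then show ?thesis unfolding g_def prod_list_upt_split[OF p]
      by (simp only: distrib_left distrib_right mult.assoc)
  qed
  \<comment> \<open>The hypothesis \<open>rel\<close> is symmetric in the two rows, so the sum of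
    the products of \<open>A\<close> and \<open>B\<close> does not change when they are exchanged,
    whereas the sign of the permutation does.\<close>
  have gt: "g (\<sigma> \<circ> ?t) = g \<sigma>" if "\<sigma> permutes {..<n}" for \<sigma>
  proof -
    have "map (\<lambda>r. A ((\<sigma> \<circ> ?t) r) r) [0..<p] = map (\<lambda>r. A (\<sigma> r) r) [0..<p]"
      "map (\<lambda>r. A ((\<sigma> \<circ> ?t) r) r) [Suc (Suc p)..<n] = map (\<lambda>r. A (\<sigma> r) r) [Suc (Suc p)..<n]"
      by (auto simp: Transposition.transpose_def)
    moreover have "\<sigma> p < n" "\<sigma> (Suc p) < n"
      using p permutes_in_image[OF that, of p] permutes_in_image[OF that, of "Suc p"] by auto
    ultimately show ?thesis unfolding g using rel[of "\<sigma> p" "\<sigma> (Suc p)"]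
      by (simp only: o_apply transpose_apply_first transpose_apply_second)
  qed
  have ft: "f (\<sigma> \<circ> ?t) = - f \<sigma>" if "\<sigma> permutes {..<n}" for \<sigma>
    using gt[OF that] sign_transpose_left(2)[OF that, of p "Suc p"] by (simp add: f_def)
  have "(\<Sum>\<sigma> | \<sigma> permutes {..<n}. f \<sigma>) = (\<Sum>\<sigma> | \<sigma> permutes {..<n}. f (\<sigma> \<circ> ?t))"
    by (rule sum_permutes_right[OF t, symmetric])
  also have "\<dots> = - (\<Sum>\<sigma> | \<sigma> permutes {..<n}. f \<sigma>)"
    by (simp add: ft flip: sum_negf)
  finally have "(\<Sum>\<sigma> | \<sigma> permutes {..<n}. f \<sigma>) = 0"
    using tor by (metis add.right_inverse)
  moreover have "(\<Sum>\<sigma> | \<sigma> permutes {..<n}. f \<sigma>) = cdet n A + cdet n B"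
    unfolding f_def g_def cdet_def by (simp add: distrib_left sum.distrib)
  ultimately show ?thesis by (simp add: eq_neg_iff_add_eq_0)
qed

lemma derivation_prod_list:
  fixes d :: "'u::ring_1 \<Rightarrow> 'u"
  assumes "\<And>x y. d (x * y) = d x * y + x * d y" "\<And>x y. d (x + y) = d x + d y"
  shows "d (prod_list (map f [0..<n])) = (\<Sum>p<n. prod_list (map (\<lambda>r. if r = p then d (f r) else f r) [0..<n]))"
proof (induction n)
  case 0
  have "d 1 = d 1 + d 1" using assms(1)[of 1 1] by simp
  then show ?case by simp
next
  case (Suc n)
  have "d (prod_list (map f [0..<Suc n])) = d (prod_list (map f [0..<n])) * f n + prod_list (map f [0..<n]) * d (f n)"
    by (simp add: assms(1))
  also have "\<dots> = (\<Sum>p<n. prod_list (map (\<lambda>r. if r = p then d (f r) else f r) [0..<Suc n])) +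
      prod_list (map (\<lambda>r. if r = n then d (f r) else f r) [0..<Suc n])"
  proof -
    have "map (\<lambda>r. if r = n then d (f r) else f r) [0..<n] = map f [0..<n]" by simp
    then show ?thesis unfolding Suc
      by (simp only: upt_Suc_append[OF le0] map_append prod_list.append) (simp add: sum_distrib_right)
  qed
  finally show ?case by simp
qed

lemma derivation_cdet:
  fixes d :: "'u::ring_1 \<Rightarrow> 'u"
  assumes "\<And>x y. d (x * y) = d x * y + x * d y" "\<And>x y. d (x + y) = d x + d y"
  shows "d (cdet n A) = (\<Sum>\<sigma> | \<sigma> permutes {..<n}. of_int (sign \<sigma>) *
    (\<Sum>p<n. prod_list (map (\<lambda>r. if r = p then d (A (\<sigma> r) r) else A (\<sigma> r) r) [0..<n])))"
proof -
  interpret add: additive d by standard (rule assms(2))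
  have d1: "d 1 = 0" using assms(1)[of 1 1] by simp
  have "d (of_int (sign \<sigma>) * x) = of_int (sign \<sigma>) * d x" for \<sigma> :: "nat \<Rightarrow> nat" and x
    by (simp add: sign_def add.minus)
  then show ?thesis
    unfolding cdet_def add.sum by (simp add: derivation_prod_list[OF assms])
qed

text \<open>Differentiating in column \<open>p\<close> the term of \<open>\<sigma>\<close> touches
  the entry in row \<open>\<sigma> p\<close>, so the sum over columns of the \<open>R\<close>-parts
  can be regrouped as a sum over rows. The shape \<open>R - C\<close> is that of the adjoint action
  on \<open>L\<close>, which changes either a row index or a column index.\<close>

lemma cdet_derivation_rows:
  assumes d: "\<And>x y. d (x * y) = d x * y + x * d y" "\<And>x y. d (x + y) = d x + d (y::'u::ring_1)"
    and A: "\<And>r c. r < n \<Longrightarrow> c < n \<Longrightarrow> d (A r c) = R r c - C r c"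
  shows "d (cdet n A) = (\<Sum>i<n. cdet n (\<lambda>r. if r = i then R r else A r))
    - (\<Sum>p<n. cdet n (\<lambda>r c. if c = p then C r c else A r c))"
proof -
  have split: "prod_list (map (\<lambda>r. if r = p then X r - Y r else Z r) [0..<n]) =
    prod_list (map (\<lambda>r. if r = p then X r else Z r) [0..<n]) - (prod_list (map (\<lambda>r. if r = p then Y r else Z r) [0..<n]) :: 'u)"
    if "p < n" for p X Y Z
  proof -
    have l: "[0..<n] = [0..<p] @ [p] @ [Suc p..<n]"
      using that upt_split[of 0 p n] by (simp add: upt_conv_Cons)
    have m: "map (\<lambda>r. if r = p then W r else Z r) [0..<p] = map Z [0..<p]"
      "map (\<lambda>r. if r = p then W r else Z r) [Suc p..<n] = map Z [Suc p..<n]" for W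
      by auto
    show ?thesis unfolding l map_append m prod_list.append by (simp add: algebra_simps)
  qed
  have perm: "(\<Sum>p<n. prod_list (map (\<lambda>r. if r = p then R (\<sigma> r) r else A (\<sigma> r) r) [0..<n]))
      = (\<Sum>i<n. prod_list (map (\<lambda>r. (if \<sigma> r = i then R (\<sigma> r) else A (\<sigma> r)) r) [0..<n]))"
    if "\<sigma> permutes {..<n}" for \<sigma>
  proof -
    have inj: "\<sigma> r = \<sigma> p \<longleftrightarrow> r = p" for r p using permutes_inj[OF that] by (auto dest: injD)
    have "bij_betw \<sigma> {..<n} {..<n}" using that by (rule permutes_imp_bij)
    then have "(\<Sum>i<n. prod_list (map (\<lambda>r. (if \<sigma> r = i then R (\<sigma> r) else A (\<sigma> r)) r) [0..<n]))
      = (\<Sum>p<n. prod_list (map (\<lambda>r. (if \<sigma> r = \<sigma> p then R (\<sigma> r) else A (\<sigma> r)) r) [0..<n]))"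
      by (rule sum.reindex_bij_betw[symmetric])
    also have "\<dots> = (\<Sum>p<n. prod_list (map (\<lambda>r. if r = p then R (\<sigma> r) r else A (\<sigma> r) r) [0..<n]))"
      unfolding inj by (intro sum.cong refl arg_cong[of _ _ prod_list] map_cong) auto
    finally show ?thesis ..
  qed
  have "d (cdet n A) = (\<Sum>\<sigma> | \<sigma> permutes {..<n}. of_int (sign \<sigma>) *
    (\<Sum>p<n. prod_list (map (\<lambda>r. if r = p then R (\<sigma> r) r - C (\<sigma> r) r else A (\<sigma> r) r) [0..<n])))"
    unfolding derivation_cdet[OF d]
  proof (intro sum.cong refl arg_cong[of _ _ "(*) _"] arg_cong[of _ _ prod_list] map_cong)
    fix \<sigma> p r assume "\<sigma> \<in> {\<sigma>. \<sigma> permutes {..<n}}" "r \<in> set [0..<n]"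
    then have "\<sigma> r < n" "r < n" using permutes_in_image[of \<sigma> "{..<n}" r] by auto
    then show "(if r = p then d (A (\<sigma> r) r) else A (\<sigma> r) r) = (if r = p then R (\<sigma> r) r - C (\<sigma> r) r else A (\<sigma> r) r)"
      by (cases "r = p") (auto simp: A)
  qed
  also have "\<dots> = (\<Sum>\<sigma> | \<sigma> permutes {..<n}. of_int (sign \<sigma>) *
      (\<Sum>i<n. prod_list (map (\<lambda>r. (if \<sigma> r = i then R (\<sigma> r) else A (\<sigma> r)) r) [0..<n])))
    - (\<Sum>\<sigma> | \<sigma> permutes {..<n}. of_int (sign \<sigma>) *
      (\<Sum>p<n. prod_list (map (\<lambda>r. if r = p then C (\<sigma> r) r else A (\<sigma> r) r) [0..<n])))"
    by (simp add: split perm sum_subtractf right_diff_distrib)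
  also have "\<dots> = (\<Sum>i<n. cdet n (\<lambda>r. if r = i then R r else A r))
    - (\<Sum>p<n. cdet n (\<lambda>r c. if c = p then C r c else A r c))"
    unfolding cdet_def sum_distrib_left
    by (subst (1 2) sum.swap) (simp add: if_distrib[of "\<lambda>f. f _"])
  finally show ?thesis .
qed


section \<open>Quantum minors\<close>

lemma prod_list_zero: "0 \<in> set xs \<Longrightarrow> prod_list xs = (0::'u::semiring_1)"
  by (induction xs) auto

lemma cdet_zero_row:
  assumes "i < n" "\<And>c. c < n \<Longrightarrow> A i c = 0"
  shows "cdet n A = 0"
  unfolding cdet_def
proof (rule sum.neutral, rule ballI)
  fix \<sigma> assume "\<sigma> \<in> {\<sigma>. \<sigma> permutes {..<n}}"
  then have b: "bij_betw \<sigma> {..<n} {..<n}" by (auto intro: permutes_imp_bij)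
  then obtain r where "r < n" "\<sigma> r = i"
    using assms(1) unfolding bij_betw_def by (metis imageE lessThan_iff)
  then have "0 \<in> set (map (\<lambda>r. A (\<sigma> r) r) [0..<n])" using assms(2) by force
  then show "of_int (sign \<sigma>) * prod_list (map (\<lambda>r. A (\<sigma> r) r) [0..<n]) = 0"
    by (simp only: prod_list_zero mult_zero_right)
qed

lemma cdet_zero_col:
  assumes "p < n" "\<And>r. r < n \<Longrightarrow> A r p = 0"
  shows "cdet n A = 0"
  unfolding cdet_def
proof (rule sum.neutral, rule ballI)
  fix \<sigma> assume "\<sigma> \<in> {\<sigma>. \<sigma> permutes {..<n}}"
  then have "\<sigma> p < n" using assms(1) permutes_in_image[of \<sigma> "{..<n}" p] by auto
  then have "0 \<in> set (map (\<lambda>r. A (\<sigma> r) r) [0..<n])" using assms by force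
  then show "of_int (sign \<sigma>) * prod_list (map (\<lambda>r. A (\<sigma> r) r) [0..<n]) = 0"
    by (simp only: prod_list_zero mult_zero_right)
qed

lemma commutes_mult:
  assumes "z * a = a * z" "z * b = b * (z :: 'u::semigroup_mult)"
  shows "z * (a * b) = a * b * z"
proof -
  have "z * (a * b) = a * (z * b)" using assms(1) by (simp flip: mult.assoc)
  then show ?thesis using assms(2) by (simp add: mult.assoc)
qed

lemma prod_list_commutes:
  assumes "\<And>y. y \<in> set ys \<Longrightarrow> z * y = y * (z :: 'u::monoid_mult)"
  shows "z * prod_list ys = prod_list ys * z"
  using assms
proof (induction ys)
  case (Cons y ys)
  then show ?case by (simp add: commutes_mult)
qed simp

lemma cdet_commutes:
  assumes "\<And>r c. r < n \<Longrightarrow> c < n \<Longrightarrow> z * A r c = A r c * (z :: 'u::ring_1)"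
  shows "z * cdet n A = cdet n A * z"
proof -
  have "z * (of_int (sign \<sigma>) * prod_list (map (\<lambda>r. A (\<sigma> r) r) [0..<n])) =
      of_int (sign \<sigma>) * prod_list (map (\<lambda>r. A (\<sigma> r) r) [0..<n]) * z" if s: "\<sigma> permutes {..<n}" for \<sigma>
  proof -
    have "\<sigma> r < n" if "r < n" for r
      using that permutes_in_image[OF s, of r] by auto
    then have "z * prod_list (map (\<lambda>r. A (\<sigma> r) r) [0..<n]) = prod_list (map (\<lambda>r. A (\<sigma> r) r) [0..<n]) * z"
      using assms by (intro prod_list_commutes) auto
    moreover have "z * of_int (sign \<sigma>) = of_int (sign \<sigma>) * z"
      by (rule mult_of_int_commute[symmetric])
    ultimately show ?thesis by (intro commutes_mult)
  qed
  then show ?thesis unfolding cdet_def by (simp add: sum_distrib_left sum_distrib_right)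
qed

text \<open>The properties of \<open>U\<^sub>\<hbar>(gl\<^sub>N)\<close> behind the computations,
  with indices from 0 to \<open>N - 1\<close>, so that blocks of indices are intervals of natural
  numbers. The derivation \<open>ad\<close> is a separate parameter because commutators only give
  \<open>h\<close> times it.\<close>

locale gl_alg =
  fixes N :: nat and E :: "nat \<Rightarrow> nat \<Rightarrow> 'u::ring_1" and h :: 'u and ad :: "nat \<Rightarrow> nat \<Rightarrow> 'u \<Rightarrow> 'u"
  assumes ad_add: "ad i j (x + y) = ad i j x + ad i j y"
    and ad_mult: "ad i j (x * y) = ad i j x * y + x * ad i j y"
    and ad_E: "i < N \<Longrightarrow> j < N \<Longrightarrow> k < N \<Longrightarrow> l < N \<Longrightarrow>
      ad i j (E k l) = (if j = k then E i l else 0) - (if l = i then E k j else 0)"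
    and E_ad: "i < N \<Longrightarrow> j < N \<Longrightarrow> E i j * x = x * E i j + h * ad i j x"
    and h_central: "h * x = x * h"
    and ad_h: "ad i j h = 0"
    and no_2_torsion: "x + x = 0 \<Longrightarrow> x = (0::'u)"
begin

definition scal :: "'u \<Rightarrow> bool"
  where "scal u \<longleftrightarrow> (\<forall>x. u * x = x * u) \<and> (\<forall>i j. ad i j u = 0)"

lemma ad_0: "ad i j 0 = 0"
  using ad_add[of i j 0 0] by simp

lemma ad_minus: "ad i j (- x) = - ad i j x"
  using ad_add[of i j "- x" x] by (simp add: ad_0 eq_neg_iff_add_eq_0)

lemma ad_1: "ad i j 1 = 0"
  using ad_mult[of i j 1 1] by simp

lemma ad_of_nat: "ad i j (of_nat n) = 0"
  by (induction n) (simp_all add: ad_0 ad_add ad_1)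

lemma scalD: "scal u \<Longrightarrow> u * x = x * u" "scal u \<Longrightarrow> ad i j u = 0"
  unfolding scal_def by blast+

lemma scal_h: "scal h"
  unfolding scal_def using h_central ad_h by blast

lemma scal_add: "scal u \<Longrightarrow> scal v \<Longrightarrow> scal (u + v)"
  unfolding scal_def distrib_left distrib_right ad_add by (metis add_0)

lemma scal_mult:
  assumes "scal u" "scal v"
  shows "scal (u * v)"
  unfolding scal_def
proof (intro conjI allI)
  show "u * v * x = x * (u * v)" for x
    by (rule commutes_mult[symmetric]) (rule scalD(1)[symmetric], rule assms)+
  show "ad i j (u * v) = 0" for i j
    by (simp add: ad_mult scalD(2)[OF assms(1)] scalD(2)[OF assms(2)])
qed

lemma scal_minus: "scal u \<Longrightarrow> scal (- u)"
  unfolding scal_def mult_minus_left mult_minus_right ad_minus by (metis neg_0_equal_iff_equal)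

lemma scal_diff: "scal u \<Longrightarrow> scal v \<Longrightarrow> scal (u - v)"
  using scal_add[OF _ scal_minus, of u v] by simp

lemma scal_of_nat: "scal (of_nat n)"
  unfolding scal_def using ad_of_nat mult_of_nat_commute by blast

lemma scal_1: "scal 1" and scal_0: "scal 0"
  unfolding scal_def by (simp_all add: ad_1 ad_0)

lemmas scal_intros = scal_h scal_add scal_mult scal_diff scal_of_nat scal_1 scal_0 scal_minus

lemma scal_power: "scal u \<Longrightarrow> scal (u ^ n)"
  by (induction n) (simp_all add: scal_1 scal_mult)

definition lf :: "nat \<Rightarrow> nat \<Rightarrow> 'u \<Rightarrow> 'u"
  where "lf i j u = (if i = j then u else 0) + E i j"

text \<open>The quantum minor of the matrix \<open>L\<close>. Its index lists may be unsorted and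
  may repeat, as happens after \<open>ad\<close> has changed an index.\<close>

definition qm :: "nat list \<Rightarrow> nat list \<Rightarrow> 'u \<Rightarrow> 'u"
  where "qm rws cls u = cdet (length cls) (\<lambda>r c. lf (rws ! r) (cls ! c) (u - of_nat c * h))"

lemma ad_lf:
  assumes "i < N" "j < N" "k < N" "l < N" "scal u"
  shows "ad i j (lf k l u) = (if k = j then lf i l u else 0) - (if l = i then lf k j u else 0)"
  using assms by (auto simp: lf_def ad_add ad_E ad_0 scalD(2))

lemma qm_Nil: "qm [] [] u = 1"
  by (simp add: qm_def cdet_def)

section \<open>Expansion and exchange of rows and columns of quantum minors\<close>

lemma qm_snoc_update:
  assumes "length xs = length cls"
  shows "qm (xs @ [z]) (cls @ [c]) u = (\<Sum>b\<le>length cls. (if b = length cls then 1 else - 1) *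
    qm (xs[b := z]) cls u * lf ((xs @ [z]) ! b) c (u - of_nat (length cls) * h))"
proof -
  let ?n = "length cls"
  have eq: "cdet ?n (\<lambda>r ca. lf ((xs @ [z]) ! (if r = b then ?n else r)) ((cls @ [c]) ! ca) (u - of_nat ca * h))
      = qm (xs[b := z]) cls u" if "b \<le> ?n" for b
    unfolding qm_def
    by (rule cdet_cong) (use assms in \<open>auto simp: nth_append nth_list_update\<close>)
  show ?thesis
    unfolding qm_def length_append_singleton cdet_Suc
    by (intro sum.cong refl) (simp add: eq[unfolded qm_def])
qed

lemma qm_row_swap:
  assumes "length (xs @ a # b # ys) = length cls"
  shows "qm (xs @ a # b # ys) cls u = - qm (xs @ b # a # ys) cls u"
proof -
  let ?p = "length xs"
  have "qm (xs @ a # b # ys) cls u = cdet (length cls)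
    (\<lambda>r. (\<lambda>c. lf ((xs @ b # a # ys) ! Transposition.transpose ?p (Suc ?p) r) (cls ! c) (u - of_nat c * h)))"
    unfolding qm_def
  proof (rule cdet_cong)
    fix r c
    have "(xs @ a # b # ys) ! r = (xs @ b # a # ys) ! Transposition.transpose ?p (Suc ?p) r"
      by (cases "r = ?p"; cases "r = Suc ?p"; cases "r < ?p")
        (auto simp: nth_append Transposition.transpose_def nth_Cons split: nat.splits)
    then show "lf ((xs @ a # b # ys) ! r) (cls ! c) (u - of_nat c * h)
      = lf ((xs @ b # a # ys) ! Transposition.transpose ?p (Suc ?p) r) (cls ! c) (u - of_nat c * h)" by simp
  qed
  also have "\<dots> = - qm (xs @ b # a # ys) cls u"
    unfolding qm_def
    by (subst cdet_row_swap[where A = "\<lambda>r c. lf ((xs @ b # a # ys) ! r) (cls ! c) (u - of_nat c * h)"])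
      (use assms in auto)
  finally show ?thesis .
qed

lemma qm_row_move:
  assumes "length (xs @ a # ys) = length cls"
  shows "qm (xs @ a # ys) cls u = (- 1) ^ length ys * qm (xs @ ys @ [a]) cls u"
  using assms
proof (induction ys arbitrary: xs)
  case (Cons b ys)
  have "qm (xs @ a # b # ys) cls u = - qm ((xs @ [b]) @ a # ys) cls u"
    using qm_row_swap[of xs a b ys cls u] Cons.prems by simp
  also have "\<dots> = (- 1) ^ length (b # ys) * qm (xs @ (b # ys) @ [a]) cls u"
    using Cons.IH[of "xs @ [b]"] Cons.prems by simp
  finally show ?case .
qed simp

text \<open>In \<open>qm_snoc_update\<close> the last row sits in place \<open>b\<close>; carrying
  it back to the end passes \<open>length cls - Suc b\<close> rows, which accounts for the
  sign.\<close>

lemma qm_snoc: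
  assumes "length rws = Suc (length cls)"
  shows "qm rws (cls @ [c]) u = (\<Sum>b\<le>length cls. (- 1) ^ (length cls + b) *
    qm (take b rws @ drop (Suc b) rws) cls u * lf (rws ! b) c (u - of_nat (length cls) * h))"
proof -
  let ?n = "length cls"
  obtain xs z where rws: "rws = xs @ [z]" using assms by (metis Zero_not_Suc list.size(3) rev_exhaust)
  have len: "length xs = ?n" using assms rws by simp
  have *: "(if b = ?n then 1 else - 1) * qm (xs[b := z]) cls u
      = (- 1) ^ (?n + b) * qm (take b rws @ drop (Suc b) rws) cls u" if "b \<le> ?n" for b
  proof (cases "b = ?n")
    case True
    then show ?thesis using len rws by (simp add: list_update_beyond flip: power2_eq_square mult_2)
  next
    case False
    then have b: "b < length xs" using that len by simp
    have "qm (xs[b := z]) cls u = (- 1) ^ (?n - Suc b) * qm (take b rws @ drop (Suc b) rws) cls u"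
      using qm_row_move[of "take b xs" z "drop (Suc b) xs" cls u] b len rws
      by (simp add: upd_conv_take_nth_drop)
    moreover have "(- 1) ^ (?n + b) = (- 1 :: 'u) * (- 1) ^ (?n - Suc b)"
      using b len by (auto simp: minus_one_power_iff simp flip: power_Suc)
    ultimately show ?thesis using False by simp
  qed
  have "qm rws (cls @ [c]) u = (\<Sum>b\<le>?n. (if b = ?n then 1 else - 1) *
    qm (xs[b := z]) cls u * lf (rws ! b) c (u - of_nat ?n * h))"
    unfolding rws by (rule qm_snoc_update[OF len])
  also have "\<dots> = (\<Sum>b\<le>?n. (- 1) ^ (?n + b) *
    qm (take b rws @ drop (Suc b) rws) cls u * lf (rws ! b) c (u - of_nat ?n * h))"
    by (intro sum.cong refl) (simp only: * atMost_iff)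
  finally show ?thesis .
qed

lemma qm_row_dup:
  assumes "length rws = length cls" "\<not> distinct rws"
  shows "qm rws cls u = 0"
proof -
  obtain i k where "i < length rws" "k < length rws" "i \<noteq> k" "rws ! i = rws ! k"
    using assms(2) by (auto simp: distinct_conv_nth)
  then show ?thesis
    unfolding qm_def using assms(1) by (intro cdet_row_eq[OF no_2_torsion, of i _ k]) auto
qed

lemma E_comm:
  assumes "i < N" "j < N" "k < N" "l < N"
  shows "E i j * E k l = E k l * E i j + h * ((if j = k then E i l else 0) - (if l = i then E k j else 0))"
  using E_ad[of i j "E k l"] ad_E[of i j k l] assms by simp

text \<open>The commutation relation of the matrix \<open>L\<close> at two parameters that differ by
  \<open>h\<close>. Two of the four terms come from the bracket, the other two from the difference
  of the parameters.\<close>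

lemma lf_lf:
  assumes "r < N" "s < N" "a < N" "b < N" "scal v"
  shows "lf r a v * lf s b (v - h) - lf s b v * lf r a (v - h) =
    h * ((if a = s then E r b else 0) - (if b = r then E s a else 0)
      + (if r = a then E s b else 0) - (if s = b then E r a else 0))"
proof -
  have eq: "(x + A) * (y' + B) - (y + B) * (x' + A) = h * (c + p - q)"
    if "A * B = B * A + h * c" "x * y' = y * x'" "x * B = B * x' + h * p" "A * y' + h * q = y * A"
    for x y x' y' A B c p q :: 'u
  proof -
    have "(x + A) * (y' + B) - (y + B) * (x' + A) =
      (x * y' - y * x') + (x * B - B * x') + (A * B - B * A) - (y * A - A * y')"
      by (simp add: algebra_simps)
    also have "\<dots> = h * p + h * c - h * q" using that by (simp flip: that(4))
    finally show ?thesis by (simp add: algebra_simps)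
  qed
  have v: "v * x = x * v" for x using scalD(1)[OF assms(5)] by simp
  have "h * v = v * h" by (rule h_central)
  then have vv: "v * (v - h) = (v - h) * v" by (simp add: algebra_simps)
  show ?thesis
    unfolding lf_def
  proof (rule eq)
    show "E r a * E s b = E s b * E r a + h * ((if a = s then E r b else 0) - (if b = r then E s a else 0))"
      using assms by (intro E_comm)
    show "(if r = a then v else 0) * (if s = b then v - h else 0) = (if s = b then v else 0) * (if r = a then v - h else 0)"
      by simp
    show "(if r = a then v else 0) * E s b = E s b * (if r = a then v - h else 0) + h * (if r = a then E s b else 0)"
      using v[of "E s b"] h_central[of "E s b"] by (simp add: algebra_simps)
    show "E r a * (if s = b then v - h else 0) + h * (if s = b then E r a else 0) = (if s = b then v else 0) * E r a"
      using v[of "E r a"] h_central[of "E r a"] by (simp add: algebra_simps)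
  qed
qed

text \<open>The right-hand side of \<open>lf_lf\<close> changes sign when \<open>a\<close> and
  \<open>b\<close> are exchanged. This is the relation that \<open>cdet_col_swap\<close> requires,
  and the reason why the parameter drops by \<open>h\<close> from column to column of a quantum
  minor.\<close>

lemma lf_antisym:
  assumes "r < N" "s < N" "a < N" "b < N" "scal v"
  shows "lf r a v * lf s b (v - h) + lf r b v * lf s a (v - h) = lf s a v * lf r b (v - h) + lf s b v * lf r a (v - h)"
proof -
  have "lf r a v * lf s b (v - h) - lf s b v * lf r a (v - h) = - (lf r b v * lf s a (v - h) - lf s a v * lf r b (v - h))"
    unfolding lf_lf[OF assms] lf_lf[OF assms(1,2,4,3,5)] by (auto simp: algebra_simps)
  then show ?thesis by (simp add: algebra_simps)
qed

lemma qm_col_swap: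
  assumes "length rws = length (xs @ a # b # ys)" "set rws \<subseteq> {..<N}" "a < N" "b < N" "scal u"
  shows "qm rws (xs @ a # b # ys) u = - qm rws (xs @ b # a # ys) u"
  unfolding qm_def
proof -
  let ?p = "length xs" and ?n = "length (xs @ a # b # ys)"
  let ?A = "\<lambda>cls r c. lf (rws ! r) (cls ! c) (u - of_nat c * h)"
  have "cdet ?n (?A (xs @ a # b # ys)) = - cdet ?n (?A (xs @ b # a # ys))"
  proof (rule cdet_col_swap[OF no_2_torsion, of ?p])
    show "?A (xs @ a # b # ys) r c = ?A (xs @ b # a # ys) r c" if "c \<noteq> ?p" "c \<noteq> Suc ?p" for r c
      using that by (cases "c < ?p") (auto simp: nth_append nth_Cons split: nat.splits)
  next
    fix r s assume "r < ?n" "s < ?n"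
    then have rs: "rws ! r < N" "rws ! s < N"
      using assms(1,2) nth_mem by (metis lessThan_iff subsetD)+
    have v: "scal (u - of_nat ?p * h)" using assms(5) by (intro scal_intros)
    have e: "u - of_nat (Suc ?p) * h = (u - of_nat ?p * h) - h" by (simp add: algebra_simps)
    show "?A (xs @ a # b # ys) r ?p * ?A (xs @ a # b # ys) s (Suc ?p) + ?A (xs @ b # a # ys) r ?p * ?A (xs @ b # a # ys) s (Suc ?p)
      = ?A (xs @ a # b # ys) s ?p * ?A (xs @ a # b # ys) r (Suc ?p) + ?A (xs @ b # a # ys) s ?p * ?A (xs @ b # a # ys) r (Suc ?p)"
      unfolding e using lf_antisym[OF rs assms(3,4) v] by (simp add: nth_append)
  next
    show "Suc ?p < ?n" by simp
  qed
  then show "cdet ?n (?A (xs @ a # b # ys)) = - cdet (length (xs @ b # a # ys)) (?A (xs @ b # a # ys))" by simp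
qed

lemma qm_col_dup_adjacent:
  assumes "length rws = length (xs @ a # ys @ a # zs)" "set rws \<subseteq> {..<N}" "a < N" "set ys \<subseteq> {..<N}" "scal u"
  shows "qm rws (xs @ a # ys @ a # zs) u = 0"
  using assms
proof (induction ys arbitrary: xs)
  case Nil
  then have "qm rws (xs @ a # a # zs) u = - qm rws (xs @ a # a # zs) u"
    by (intro qm_col_swap) auto
  then have "qm rws (xs @ a # a # zs) u + qm rws (xs @ a # a # zs) u = 0"
    by (metis add.right_inverse)
  then show ?case using no_2_torsion[of "qm rws (xs @ a # a # zs) u"] by simp
next
  case (Cons b ys)
  then have "qm rws (xs @ a # b # (ys @ a # zs)) u = - qm rws (xs @ b # a # (ys @ a # zs)) u"
    by (intro qm_col_swap) auto
  moreover have "qm rws ((xs @ [b]) @ a # ys @ a # zs) u = 0"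
    using Cons.prems by (intro Cons.IH) auto
  ultimately show ?case by simp
qed

lemma qm_col_dup:
  assumes "length rws = length cls" "set rws \<subseteq> {..<N}" "set cls \<subseteq> {..<N}" "\<not> distinct cls" "scal u"
  shows "qm rws cls u = 0"
proof -
  obtain xs ys zs a where "cls = xs @ [a] @ ys @ [a] @ zs" using not_distinct_decomp[OF assms(4)] by blast
  then show ?thesis using assms qm_col_dup_adjacent[of rws xs a ys zs u] by auto
qed

section \<open>The adjoint action on quantum minors\<close>

lemma ad_qm:
  assumes "length rws = length cls" "set rws \<subseteq> {..<N}" "set cls \<subseteq> {..<N}" "k < N" "l < N" "scal u"
  shows "ad k l (qm rws cls u) =
    (\<Sum>i<length cls. if rws ! i = l then qm (rws[i := k]) cls u else 0)
    - (\<Sum>p<length cls. if cls ! p = k then qm rws (cls[p := l]) u else 0)"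
proof -
  let ?n = "length cls"
  let ?R = "\<lambda>r c. if rws ! r = l then lf k (cls ! c) (u - of_nat c * h) else 0"
  let ?C = "\<lambda>r c. if cls ! c = k then lf (rws ! r) l (u - of_nat c * h) else 0"
  let ?A = "\<lambda>r c. lf (rws ! r) (cls ! c) (u - of_nat c * h)"
  have "ad k l (qm rws cls u) = (\<Sum>i<?n. cdet ?n (\<lambda>r. if r = i then ?R r else ?A r))
    - (\<Sum>p<?n. cdet ?n (\<lambda>r c. if c = p then ?C r c else ?A r c))"
    unfolding qm_def
  proof (rule cdet_derivation_rows)
    fix r c assume rc: "r < ?n" "c < ?n"
    then have "rws ! r < N" "cls ! c < N"
      using assms(1,2,3) nth_mem by (metis lessThan_iff subsetD)+
    then show "ad k l (?A r c) = ?R r c - ?C r c"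
      using assms by (intro ad_lf scal_intros)
  qed (rule ad_mult ad_add)+
  moreover have "cdet ?n (\<lambda>r. if r = i then ?R r else ?A r) = (if rws ! i = l then qm (rws[i := k]) cls u else 0)"
    if "i < ?n" for i
  proof (cases "rws ! i = l")
    case True
    then show ?thesis unfolding qm_def using that assms(1) by (auto intro!: cdet_cong simp: nth_list_update)
  next
    case False
    then show ?thesis using that by (auto intro!: cdet_zero_row[of i])
  qed
  moreover have "cdet ?n (\<lambda>r c. if c = p then ?C r c else ?A r c) = (if cls ! p = k then qm rws (cls[p := l]) u else 0)"
    if "p < ?n" for p
  proof (cases "cls ! p = k")
    case True
    then show ?thesis unfolding qm_def using that by (auto intro!: cdet_cong simp: nth_list_update)
  next
    case False
    then show ?thesis using that by (auto intro!: cdet_zero_col[of p])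
  qed
  ultimately show ?thesis by simp
qed

lemma ad_qm_none:
  assumes "length rws = length cls" "set rws \<subseteq> {..<N}" "set cls \<subseteq> {..<N}" "k < N" "l < N" "scal u"
    and "l \<notin> set rws" "k \<notin> set cls"
  shows "ad k l (qm rws cls u) = 0"
proof -
  have "rws ! i \<noteq> l" "cls ! i \<noteq> k" if "i < length cls" for i using that assms(1,7,8) by (metis nth_mem)+
  then show ?thesis by (simp add: ad_qm[OF assms(1-6)])
qed

lemma ad_qm_row:
  assumes "length rws = length cls" "set rws \<subseteq> {..<N}" "set cls \<subseteq> {..<N}" "k < N" "scal u"
    and "distinct rws" "i < length rws" "k \<notin> set cls"
  shows "ad k (rws ! i) (qm rws cls u) = qm (rws[i := k]) cls u"
proof -
  have l: "rws ! i < N" using assms(2,7) nth_mem by (metis lessThan_iff subsetD)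
  have "rws ! i' = rws ! i \<longleftrightarrow> i' = i" if "i' < length cls" for i'
    using that assms(1,6,7) nth_eq_iff_index_eq by metis
  moreover have "cls ! i' \<noteq> k" if "i' < length cls" for i' using that assms(8) by (metis nth_mem)
  ultimately show ?thesis using assms(1,7) by (simp add: ad_qm[OF assms(1-4) l assms(5)] if_distrib cong: if_cong)
qed

text \<open>For \<open>k \<noteq> l\<close>, changing the row \<open>l\<close> to \<open>k\<close>
  repeats the row \<open>k\<close>, and changing the column \<open>k\<close> to \<open>l\<close>
  repeats the column \<open>l\<close>. For \<open>k = l\<close> the row term and the column term are
  both the minor itself and cancel.\<close>

lemma ad_qm_central:
  assumes "set B \<subseteq> {..<N}" "distinct B" "k \<in> set B" "l \<in> set B" "scal u"
  shows "ad k l (qm B B u) = 0"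
proof -
  obtain i p where i: "i < length B" "B ! i = l" and p: "p < length B" "B ! p = k"
    using assms(3,4) by (auto simp: in_set_conv_nth)
  have kl: "k < N" "l < N" using assms by auto
  have ii: "B ! i' = l \<longleftrightarrow> i' = i" if "i' < length B" for i' using that assms(2) i nth_eq_iff_index_eq by metis
  have pp: "B ! p' = k \<longleftrightarrow> p' = p" if "p' < length B" for p' using that assms(2) p nth_eq_iff_index_eq by metis
  have "ad k l (qm B B u) = qm (B[i := k]) B u - qm B (B[p := l]) u"
    using i p by (simp add: ad_qm[OF refl assms(1,1) kl assms(5)] ii pp)
  also have "\<dots> = 0"
  proof (cases "k = l")
    case True
    then have "i = p" using i p assms(2) nth_eq_iff_index_eq by metis
    then show ?thesis using True i p by (metis cancel_comm_monoid_add_class.diff_cancel list_update_id)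
  next
    case False
    then have ne: "i \<noteq> p" using i p by auto
    have "B[i := k] ! i = B[i := k] ! p" "B[p := l] ! i = B[p := l] ! p"
      using i p ne by (auto simp: nth_list_update)
    then have "\<not> distinct (B[i := k])" "\<not> distinct (B[p := l])"
      using i p ne nth_eq_iff_index_eq[of "B[i := k]" i p] nth_eq_iff_index_eq[of "B[p := l]" i p] by auto
    moreover have "set (B[p := l]) \<subseteq> {..<N}" using assms(1) kl set_update_subset_insert[of B p l] by auto
    ultimately have "qm (B[i := k]) B u = 0" "qm B (B[p := l]) u = 0"
      using assms(1,5) qm_row_dup[of "B[i := k]" B u] qm_col_dup[of B "B[p := l]" u] by simp_all
    then show ?thesis by simp
  qed
  finally show ?thesis .
qed

lemma lf_commutes: "scal u \<Longrightarrow> z * E i j = E i j * z \<Longrightarrow> z * lf i j u = lf i j u * z"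
  using scalD(1)[of u z] by (simp add: lf_def distrib_left distrib_right)

lemma qm_commutes:
  assumes "length rws = length cls" "scal u" "\<And>x y. x \<in> set rws \<Longrightarrow> y \<in> set cls \<Longrightarrow> z * E x y = E x y * z"
  shows "z * qm rws cls u = qm rws cls u * z"
  unfolding qm_def using assms by (intro cdet_commutes lf_commutes scal_intros) auto

lemma E_commutes: "i < N \<Longrightarrow> j < N \<Longrightarrow> ad i j x = 0 \<Longrightarrow> E i j * x = x * E i j"
  by (simp add: E_ad)

end


section \<open>Whittaker modules\<close>

text \<open>A model of the quotient by \<open>n\<^sub>-\<^sup>\<psi>\<close>: \<open>D i j\<close>
  is the diagonal action of \<open>E\<^sub>i\<^sub>j\<close>, and \<open>act_E\<close> is the rule
  that \<open>E\<^sub>i\<^sub>j - \<psi>(E\<^sub>i\<^sub>j)\<close> acts from the right as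
  \<open>- D i j\<close> followed by \<open>h\<close>. Apart from additivity, the laws of
  \<open>D i j\<close> concern \<open>j < i\<close>, where the diagonal action descends to the
  quotient.\<close>

locale whittaker = gl_alg N E h ad for N and E :: "nat \<Rightarrow> nat \<Rightarrow> 'u::ring_1" and h ad +
  fixes act :: "'y::ab_group_add \<Rightarrow> 'u \<Rightarrow> 'y" (infixl "\<cdot>" 75) and D :: "nat \<Rightarrow> nat \<Rightarrow> 'y \<Rightarrow> 'y"
  assumes act_add_left: "(x + y) \<cdot> a = x \<cdot> a + y \<cdot> a"
    and act_add_right: "x \<cdot> (a + b) = x \<cdot> a + x \<cdot> b"
    and act_mult: "x \<cdot> (a * b) = x \<cdot> a \<cdot> b"
    and act_1 [simp]: "x \<cdot> 1 = x"
    and D_add: "D i j (x + y) = D i j x + D i j y"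
    and D_act: "j < i \<Longrightarrow> i < N \<Longrightarrow> D i j (x \<cdot> a) = D i j x \<cdot> a + x \<cdot> ad i j a"
    and D_D: "j < i \<Longrightarrow> i < N \<Longrightarrow> l < k \<Longrightarrow> k < N \<Longrightarrow> D i j (D k l x) =
      D k l (D i j x) + ((if j = k then D i l x else 0) - (if l = i then D k j x else 0))"
    and act_E: "j < i \<Longrightarrow> i < N \<Longrightarrow> x \<cdot> E i j = (if i = Suc j then x else 0) - D i j x \<cdot> h"
begin

lemma act_0_left [simp]: "0 \<cdot> a = 0"
  using act_add_left[of 0 0 a] by simp

lemma act_0_right [simp]: "x \<cdot> 0 = 0"
  using act_add_right[of x 0 0] by simp

lemma act_minus_left: "(- x) \<cdot> a = - (x \<cdot> a)"
  using act_add_left[of "- x" x a] by (simp add: eq_neg_iff_add_eq_0)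

lemma act_minus_right: "x \<cdot> (- a) = - (x \<cdot> a)"
  using act_add_right[of x "- a" a] by (simp add: eq_neg_iff_add_eq_0)

lemma act_diff_left: "(x - y) \<cdot> a = x \<cdot> a - y \<cdot> a"
  using act_add_left[of x "- y" a] by (simp add: act_minus_left)

lemma act_diff_right: "x \<cdot> (a - b) = x \<cdot> a - x \<cdot> b"
  using act_add_right[of x a "- b"] by (simp add: act_minus_right)

lemma act_sum_left: "sum f A \<cdot> a = (\<Sum>i\<in>A. f i \<cdot> a)"
  by (induction A rule: infinite_finite_induct) (simp_all add: act_add_left)

lemma act_sum_right: "x \<cdot> sum f A = (\<Sum>i\<in>A. x \<cdot> f i)"
  by (induction A rule: infinite_finite_induct) (simp_all add: act_add_right)

lemma D_0 [simp]: "D i j 0 = 0"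
  using D_add[of i j 0 0] by simp

lemma D_minus: "D i j (- x) = - D i j x"
  using D_add[of i j "- x" x] by (simp add: eq_neg_iff_add_eq_0)

lemma D_diff: "D i j (x - y) = D i j x - D i j y"
  using D_add[of i j x "- y"] by (simp add: D_minus)

lemma D_sum: "D i j (sum f A) = (\<Sum>a\<in>A. D i j (f a))"
  by (induction A rule: infinite_finite_induct) (simp_all add: D_add)

lemma act_scal: "scal u \<Longrightarrow> x \<cdot> u \<cdot> a = x \<cdot> a \<cdot> u"
  by (metis act_mult scalD(1))

lemma D_act_scal: "j < i \<Longrightarrow> i < N \<Longrightarrow> scal u \<Longrightarrow> D i j (x \<cdot> u) = D i j x \<cdot> u"
  by (simp add: D_act scalD(2))

text \<open>By \<open>act_E\<close>, a vector with this invariance is a Whittaker vector for the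
  block of indices from \<open>j\<close> to \<open>j + n - 1\<close>.\<close>

definition wh :: "nat \<Rightarrow> nat \<Rightarrow> 'y \<Rightarrow> bool"
  where "wh j n x \<longleftrightarrow> (\<forall>p q. j \<le> q \<longrightarrow> q < p \<longrightarrow> p < j + n \<longrightarrow> D p q x = 0)"

lemma wh_E: "wh j n x \<Longrightarrow> j \<le> q \<Longrightarrow> q < p \<Longrightarrow> p < j + n \<Longrightarrow> j + n \<le> N \<Longrightarrow> x \<cdot> E p q = (if p = Suc q then x else 0)"
  by (simp add: wh_def act_E)

lemma scal_sub: "scal u \<Longrightarrow> scal (u - of_nat n * h)"
  by (intro scal_intros)

lemma act_mult_zero: "x \<cdot> a = 0 \<Longrightarrow> x \<cdot> (a * b) = 0"
  by (simp add: act_mult)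

text \<open>A Whittaker vector sees ones directly below the diagonal and zeros further down, and row
  \<open>k\<close> lies at least two places below the last column. In the expansion along that
  column, either row \<open>k\<close> remains in the smaller minor, or the last factor is
  \<open>E k (j + m)\<close>. Moved to the front, this entry annihilates \<open>x\<close>, and the
  commutator consists of minors that again contain row \<open>k\<close>.\<close>

lemma wh_qm_zero:
  assumes "wh j n x" "j + n \<le> N" "scal v"
  shows "length rws = m \<Longrightarrow> set rws \<subseteq> {..<N} \<Longrightarrow> k \<in> set rws \<Longrightarrow> j + m < k \<Longrightarrow> k < j + n \<Longrightarrow>
    x \<cdot> qm rws [j..<j + m] v = 0"
proof (induction m arbitrary: rws)
  case (Suc m)
  let ?c = "j + m"
  have IH: "x \<cdot> qm rws' [j..<j + m] v = 0"
    if "length rws' = m" "set rws' \<subseteq> {..<N}" "k \<in> set rws'" for rws'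
    using that Suc.prems by (intro Suc.IH) auto
  have "x \<cdot> (qm (take b rws @ drop (Suc b) rws) [j..<j + m] v * lf (rws ! b) ?c (v - of_nat m * h)) = 0"
    if b: "b \<le> m" for b
  proof -
    let ?r = "take b rws @ drop (Suc b) rws"
    have len: "length ?r = m" using b Suc.prems(1) by auto
    have sub: "set ?r \<subseteq> {..<N}" using Suc.prems(2) set_take_subset[of b rws] set_drop_subset[of "Suc b" rws] by auto
    have split: "rws = take b rws @ rws ! b # drop (Suc b) rws" using b Suc.prems(1) by (simp add: id_take_nth_drop)
    show ?thesis
    proof (cases "k \<in> set ?r")
      case True
      then show ?thesis using IH[OF len sub] by (simp add: act_mult)
    next
      case False
      have "set rws = insert (rws ! b) (set ?r)" by (subst split) simp
      with False Suc.prems(3) have k: "rws ! b = k" by auto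
      have "ad k ?c (qm ?r [j..<j + m] v) = (\<Sum>i<m. if ?r ! i = ?c then qm (?r[i := k]) [j..<j + m] v else 0)"
      proof -
        have col: "(\<Sum>p<length [j..<j + m]. if [j..<j + m] ! p = k then qm ?r ([j..<j + m][p := ?c]) v else 0) = 0"
          using Suc.prems(4) by (intro sum.neutral) auto
        have "ad k ?c (qm ?r [j..<j + m] v) =
            (\<Sum>i<length [j..<j + m]. if ?r ! i = ?c then qm (?r[i := k]) [j..<j + m] v else 0)
            - (\<Sum>p<length [j..<j + m]. if [j..<j + m] ! p = k then qm ?r ([j..<j + m][p := ?c]) v else 0)"
          using len sub Suc.prems(4,5) assms(2,3) by (intro ad_qm) auto
        then show ?thesis unfolding col by simp
      qed
      moreover have "x \<cdot> (if ?r ! i = ?c then qm (?r[i := k]) [j..<j + m] v else 0) = 0" if "i < m" for i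
      proof -
        have "set (?r[i := k]) \<subseteq> {..<N}"
          using subset_trans[OF set_update_subset_insert[of ?r i k], of "{..<N}"] sub Suc.prems(5) assms(2) by simp
        then show ?thesis using IH[of "?r[i := k]"] that len by (simp add: set_update_memI)
      qed
      ultimately have ad0: "x \<cdot> ad k ?c (qm ?r [j..<j + m] v) = 0"
        by (simp add: act_sum_right)
      have lf: "lf (rws ! b) ?c (v - of_nat m * h) = E k ?c" using k Suc.prems(4) by (simp add: lf_def)
      have "qm ?r [j..<j + m] v * E k ?c = E k ?c * qm ?r [j..<j + m] v - ad k ?c (qm ?r [j..<j + m] v) * h"
        using E_ad[of k ?c "qm ?r [j..<j + m] v"] h_central[of "ad k ?c (qm ?r [j..<j + m] v)"] Suc.prems(4,5) assms(2) by simp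
      moreover have "x \<cdot> E k ?c = 0"
        using wh_E[OF assms(1), of ?c k] Suc.prems(4,5) assms(2) by simp
      ultimately show ?thesis unfolding lf by (simp add: act_diff_right act_mult ad0)
    qed
  qed
  then have "x \<cdot> ((- 1) ^ (m + b) * qm (take b rws @ drop (Suc b) rws) [j..<j + m] v * lf (rws ! b) ?c (v - of_nat m * h)) = 0"
    if "b \<le> m" for b
    using that by (cases "even (m + b)") (simp_all add: act_minus_right)
  then show ?case
    using qm_snoc[of rws "[j..<j + m]" ?c v] Suc.prems(1) by (simp add: act_sum_right)
qed simp

text \<open>The list of rows \<open>\<rho>, j + 1, \<dots>, j + m\<close> with entry number
  \<open>b\<close> removed, where \<open>\<rho>\<close> counts as number 0. Such lists arise from
  the expansion of a minor along its last column.\<close>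

definition del_row :: "nat \<Rightarrow> nat \<Rightarrow> nat \<Rightarrow> nat \<Rightarrow> nat list"
  where "del_row j \<rho> b m = (if b = 0 then [Suc j..<Suc (j + m)] else \<rho> # [Suc j..<j + b] @ [Suc (j + b)..<Suc (j + m)])"

text \<open>The leading minor of size \<open>b\<close> of the block with its first row replaced by
  the row \<open>\<rho>\<close>. Size zero gives 1, which makes the recursions below
  uniform.\<close>

definition NN :: "nat \<Rightarrow> nat \<Rightarrow> nat \<Rightarrow> 'u \<Rightarrow> 'u"
  where "NN j \<rho> b v = qm (del_row j \<rho> b b) [j..<j + b] v"

definition MM :: "nat \<Rightarrow> nat \<Rightarrow> 'u \<Rightarrow> 'u"
  where "MM j b v = qm [j..<j + b] [j..<j + b] v"

lemma NN_0: "NN j \<rho> 0 v = 1" and MM_0: "MM j 0 v = 1"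
  by (simp_all add: NN_def MM_def del_row_def qm_Nil)

lemma NN_pos: "b > 0 \<Longrightarrow> NN j \<rho> b v = qm (\<rho> # [Suc j..<j + b]) [j..<j + b] v"
  by (simp add: NN_def del_row_def)

lemma NN_self: "NN j j b v = MM j b v"
  by (cases "b = 0") (simp_all add: qm_Nil NN_0 MM_0 NN_pos MM_def upt_conv_Cons)

lemma del_row_Suc: "b \<le> m \<Longrightarrow> del_row j \<rho> b (Suc m) = del_row j \<rho> b m @ [Suc (j + m)]"
  by (simp add: del_row_def)

lemma length_del_row: "b \<le> m \<Longrightarrow> length (del_row j \<rho> b m) = m"
  by (auto simp: del_row_def)

text \<open>After place \<open>b\<close> every row index exceeds its column index by one, so the
  vector sees a triangular tail with ones on its diagonal. The tail is peeled off from the end: all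
  terms of the expansion that keep the last row vanish by \<open>wh_qm_zero\<close>, and the
  remaining entry commutes with \<open>NN\<close> and acts as the identity.\<close>

lemma wh_del_row:
  assumes "wh j n x" "j + n \<le> N" "scal v" "\<rho> = j \<or> j + n \<le> \<rho> \<and> \<rho> < N" "b \<le> m" "m < n"
  shows "x \<cdot> qm (del_row j \<rho> b m) [j..<j + m] v = x \<cdot> NN j \<rho> b v"
  using assms(5,6)
proof (induction m rule: dec_induct)
  case base
  show ?case by (simp add: NN_def)
next
  case (step m)
  let ?R = "del_row j \<rho> b m" and ?k = "Suc (j + m)"
  let ?rws = "?R @ [?k]"
  have len: "length ?R = m" using step by (simp add: length_del_row)
  have sub: "set ?rws \<subseteq> {..<N}" using step assms by (auto simp: del_row_def)
  have zero: "x \<cdot> (qm (take b' ?rws @ drop (Suc b') ?rws) [j..<j + m] v * y) = 0" if "b' < m" for b' y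
  proof (rule act_mult_zero, rule wh_qm_zero[OF assms(1-3), where k = ?k])
    show "set (take b' ?rws @ drop (Suc b') ?rws) \<subseteq> {..<N}"
      using sub set_take_subset[of b' ?rws] set_drop_subset[of "Suc b'" ?rws] by auto
  qed (use that len step in auto)
  have last: "x \<cdot> (qm ?R [j..<j + m] v * lf ?k (j + m) (v - of_nat m * h)) = x \<cdot> NN j \<rho> b v"
  proof -
    have lf: "lf ?k (j + m) (v - of_nat m * h) = E ?k (j + m)" by (simp add: lf_def)
    have ad0: "ad ?k (j + m) (NN j \<rho> b v) = 0"
    proof (cases "b = 0")
      case True
      then show ?thesis by (simp add: NN_0 ad_1)
    next
      case False
      then show ?thesis unfolding NN_pos[of b, OF neq0_conv[THEN iffD1, OF False]]
        using step assms by (intro ad_qm_none) auto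
    qed
    have "x \<cdot> (qm ?R [j..<j + m] v * E ?k (j + m)) = x \<cdot> (NN j \<rho> b v * E ?k (j + m))"
      using step by (simp add: act_mult)
    also have "\<dots> = x \<cdot> (E ?k (j + m) * NN j \<rho> b v)"
      using E_commutes[OF _ _ ad0] step assms(2) by simp
    also have "\<dots> = x \<cdot> NN j \<rho> b v"
      using wh_E[OF assms(1), of "j + m" ?k] step assms(2) by (simp add: act_mult)
    finally show ?thesis unfolding lf .
  qed
  have "x \<cdot> qm ?rws ([j..<j + m] @ [j + m]) v = (\<Sum>b'\<le>m. x \<cdot> ((- 1) ^ (m + b') *
    qm (take b' ?rws @ drop (Suc b') ?rws) [j..<j + m] v * lf (?rws ! b') (j + m) (v - of_nat m * h)))"
    using qm_snoc[of ?rws "[j..<j + m]" "j + m" v] len by (simp add: act_sum_right)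
  also have "\<dots> = (\<Sum>b'\<in>{m}. x \<cdot> ((- 1) ^ (m + b') *
    qm (take b' ?rws @ drop (Suc b') ?rws) [j..<j + m] v * lf (?rws ! b') (j + m) (v - of_nat m * h)))"
  proof (rule sum.mono_neutral_right)
    show "\<forall>i\<in>{..m} - {m}. x \<cdot> ((- 1) ^ (m + i) * qm (take i ?rws @ drop (Suc i) ?rws) [j..<j + m] v *
          lf (?rws ! i) (j + m) (v - of_nat m * h)) = 0"
    proof
      fix i assume "i \<in> {..m} - {m}"
      then have "i < m" by auto
      then show "x \<cdot> ((- 1) ^ (m + i) * qm (take i ?rws @ drop (Suc i) ?rws) [j..<j + m] v *
          lf (?rws ! i) (j + m) (v - of_nat m * h)) = 0"
        using zero[of i] by (cases "even (m + i)") (simp_all add: act_minus_right)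
    qed
  qed auto
  also have "\<dots> = x \<cdot> NN j \<rho> b v"
    using last len by (simp add: nth_append flip: mult_2)
  finally show ?case using step by (simp add: del_row_Suc)
qed

lemma del_row_take: "b \<le> m \<Longrightarrow> take b (\<rho> # [Suc j..<Suc (j + m)]) @ drop (Suc b) (\<rho> # [Suc j..<Suc (j + m)]) = del_row j \<rho> b m"
  by (cases b) (auto simp: del_row_def take_upt drop_upt simp del: upt_Suc)

text \<open>Whittaker vectors see the matrix \<open>L(v)\<close> as a Hessenberg matrix, with ones below the diagonal; its
  leading minors satisfy the corresponding recursion.\<close>

lemma NN_Suc:
  assumes "wh j n x" "j + n \<le> N" "scal v" "\<rho> = j \<or> j + n \<le> \<rho> \<and> \<rho> < N" "m < n"
  shows "x \<cdot> NN j \<rho> (Suc m) v = (\<Sum>b\<le>m. x \<cdot> ((- 1) ^ (m + b) * NN j \<rho> b v *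
    lf (if b = 0 then \<rho> else j + b) (j + m) (v - of_nat m * h)))"
proof -
  let ?rws = "\<rho> # [Suc j..<Suc (j + m)]"
  have "x \<cdot> NN j \<rho> (Suc m) v = x \<cdot> qm ?rws ([j..<j + m] @ [j + m]) v"
    by (simp add: NN_pos)
  also have "\<dots> = (\<Sum>b\<le>m. x \<cdot> ((- 1) ^ (m + b) *
    qm (take b ?rws @ drop (Suc b) ?rws) [j..<j + m] v * lf (?rws ! b) (j + m) (v - of_nat m * h)))"
    by (subst qm_snoc) (auto simp: act_sum_right)
  also have "\<dots> = (\<Sum>b\<le>m. x \<cdot> ((- 1) ^ (m + b) * NN j \<rho> b v *
    lf (if b = 0 then \<rho> else j + b) (j + m) (v - of_nat m * h)))"
  proof (rule sum.cong[OF refl])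
    fix b assume "b \<in> {..m}"
    then have b: "b \<le> m" by simp
    have "?rws ! b = (if b = 0 then \<rho> else j + b)" using b by (cases b) (simp_all del: upt_Suc)
    moreover have "x \<cdot> qm (take b ?rws @ drop (Suc b) ?rws) [j..<j + m] v = x \<cdot> NN j \<rho> b v"
      unfolding del_row_take[OF b] using assms b by (intro wh_del_row)
    ultimately show "x \<cdot> ((- 1) ^ (m + b) * qm (take b ?rws @ drop (Suc b) ?rws) [j..<j + m] v * lf (?rws ! b) (j + m) (v - of_nat m * h))
      = x \<cdot> ((- 1) ^ (m + b) * NN j \<rho> b v * lf (if b = 0 then \<rho> else j + b) (j + m) (v - of_nat m * h))"
      by (cases "even (m + b)") (simp_all add: act_minus_right act_mult del: upt_Suc)
  qed
  finally show ?thesis .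
qed

lemma MM_Suc:
  assumes "wh j n x" "j + n \<le> N" "scal v" "m < n"
  shows "x \<cdot> MM j (Suc m) v = (\<Sum>b\<le>m. x \<cdot> ((- 1) ^ (m + b) * MM j b v * lf (j + b) (j + m) (v - of_nat m * h)))"
proof -
  have "(if b = 0 then j else j + b) = j + b" for b by simp
  then show ?thesis
    using NN_Suc[OF assms(1-3) disjI1[OF refl] assms(4)] by (simp only: NN_self)
qed

lemma lf_shift: "lf i k (u + y) = lf i k u + (if i = k then y else 0)"
  by (simp add: lf_def)

lemma act_sign: "x \<cdot> ((- 1) ^ k * a) = (if even k then x \<cdot> a else - (x \<cdot> a))"
  by (simp add: act_minus_right)

text \<open>Both kinds of minors are expanded by the Hessenberg recursion, and the terms with
  \<open>b > 0\<close> match by induction. By \<open>act_E\<close> the entry in row \<open>c\<close>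
  contributes \<open>- x \<cdot> MM j m u \<cdot> h\<close>, which makes up for the difference
  between the last diagonal entries at the parameters \<open>u + h\<close> and
  \<open>u\<close>.\<close>

lemma wh_NN:
  assumes "wh j n w" "wh j n x" "j + n \<le> N" "scal u" "j + n \<le> c" "c < N"
    and rel: "\<And>b. b < n \<Longrightarrow> D c (j + b) w = x \<cdot> ((- 1) ^ b * MM j b u)"
  shows "m < n \<Longrightarrow> w \<cdot> NN j c (Suc m) (u + h) = x \<cdot> MM j (Suc m) u - x \<cdot> MM j (Suc m) (u + h)
    + (if c = Suc (j + m) then w \<cdot> (- 1) ^ m else 0)"
proof (induction m rule: less_induct)
  case (less m)
  let ?v = "u + h"
  let ?y = "u - of_nat m * h"
  have sv: "scal ?v" using assms(4) by (intro scal_intros)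
  have yv: "?v - of_nat m * h = ?y + h" by simp
  have first: "w \<cdot> ((- 1) ^ (m + 0) * NN j c 0 ?v * lf c (j + m) (?y + h))
    = (if c = Suc (j + m) then w \<cdot> (- 1) ^ m else 0) - x \<cdot> MM j m u \<cdot> h"
  proof -
    have "lf c (j + m) (?y + h) = E c (j + m)" using less.prems assms(5) by (simp add: lf_def)
    moreover have "w \<cdot> E c (j + m) = (if c = Suc (j + m) then w else 0) - x \<cdot> ((- 1) ^ m * MM j m u) \<cdot> h"
      using less.prems assms(5,6) by (subst act_E) (simp_all add: rel)
    ultimately show ?thesis
      by (cases "even m") (simp_all add: NN_0 act_minus_right act_minus_left act_diff_left)
  qed
  have other: "w \<cdot> ((- 1) ^ (m + b) * NN j c b ?v * lf (j + b) (j + m) (?y + h)) =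
    x \<cdot> ((- 1) ^ (m + b) * MM j b u * lf (j + b) (j + m) (?y + h))
    - x \<cdot> ((- 1) ^ (m + b) * MM j b ?v * lf (j + b) (j + m) (?y + h))" if b: "0 < b" "b \<le> m" for b
  proof -
    obtain b' where b': "b = Suc b'" using b by (cases b) auto
    have "w \<cdot> NN j c b ?v = x \<cdot> MM j b u - x \<cdot> MM j b ?v"
      using less.IH[of b'] b b' less.prems assms(5) by simp
    then show ?thesis
      by (cases "even (m + b)") (simp_all add: act_minus_right act_mult act_diff_left)
  qed
  have split: "(\<Sum>b\<le>m. f b) = f 0 + (\<Sum>b\<in>{0<..m}. f b)" for f :: "nat \<Rightarrow> 'y"
  proof -
    have "{..m} = insert 0 {0<..m}" by auto
    then show ?thesis by simp
  qed
  let ?X = "\<lambda>b u. x \<cdot> ((- 1) ^ (m + b) * MM j b u * lf (j + b) (j + m) (?y + h))"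
  have "w \<cdot> NN j c (Suc m) ?v = (\<Sum>b\<le>m. w \<cdot> ((- 1) ^ (m + b) * NN j c b ?v *
    lf (if b = 0 then c else j + b) (j + m) (?y + h)))"
    using NN_Suc[OF assms(1,3) sv _ less.prems(1), of c] assms(5,6) yv by simp
  also have "\<dots> = (if c = Suc (j + m) then w \<cdot> (- 1) ^ m else 0) - x \<cdot> MM j m u \<cdot> h
      + (\<Sum>b\<in>{0<..m}. ?X b u - ?X b ?v)"
    unfolding split using first other by simp
  also have "(\<Sum>b\<in>{0<..m}. ?X b u - ?X b ?v) = (\<Sum>b\<le>m. ?X b u) - (\<Sum>b\<le>m. ?X b ?v)"
    unfolding split sum_subtractf by (simp add: MM_0)
  also have "(\<Sum>b\<le>m. ?X b ?v) = x \<cdot> MM j (Suc m) ?v"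
    using MM_Suc[OF assms(2,3) sv less.prems(1)] yv by simp
  also have "(\<Sum>b\<le>m. ?X b u) = (\<Sum>b\<le>m. x \<cdot> ((- 1) ^ (m + b) * MM j b u * lf (j + b) (j + m) ?y)
      + (if b = m then x \<cdot> ((- 1) ^ (m + b) * MM j b u * h) else 0))"
    by (rule sum.cong) (auto simp: lf_shift distrib_left act_add_right)
  also have "\<dots> = x \<cdot> MM j (Suc m) u + x \<cdot> MM j m u \<cdot> h"
    unfolding MM_Suc[OF assms(2,3,4) less.prems(1)] sum.distrib
    by (simp add: act_mult flip: mult_2)
  finally show ?case by simp
qed

lemma ad_MM_row:
  assumes "scal v" "j + n \<le> N" "j + n \<le> c" "c < N" "b < n"
  shows "ad c (j + b) (MM j n v) = qm ([j..<j + n][b := c]) [j..<j + n] v"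
  using ad_qm_row[of "[j..<j + n]" "[j..<j + n]" c v b] assms by (simp add: MM_def subset_iff)

lemma ad_MM_NN:
  assumes "scal v" "j + Suc n \<le> N" "j + Suc n \<le> c" "c < N"
  shows "ad c j (MM j (Suc n) v) = NN j c (Suc n) v"
  using ad_MM_row[OF assms, of 0] by (simp add: NN_pos upt_conv_Cons del: upt_Suc)

lemma ad_MM_central:
  assumes "scal v" "j + n \<le> N" "j \<le> p" "p < j + n" "j \<le> q" "q < j + n"
  shows "ad p q (MM j n v) = 0"
  unfolding MM_def using assms by (intro ad_qm_central) auto

lemma ad_MM_outside:
  assumes "scal v" "j + n \<le> N" "j + n \<le> p" "p < N" "j + n \<le> q" "q < N"
  shows "ad p q (MM j n v) = 0"
  unfolding MM_def using assms by (intro ad_qm_none) auto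

text \<open>Row \<open>c\<close> acts on the minor through \<open>NN\<close>, and
  \<open>wh_NN\<close> evaluates this as the change of the minor from the parameter
  \<open>u + h\<close> to \<open>u\<close>.\<close>

lemma D_MM:
  assumes "wh j n w" "wh j n (D c j w)" "j + n \<le> N" "scal u" "j + n \<le> c" "c < N" "m < n"
    and rel: "\<And>b. b < n \<Longrightarrow> D c (j + b) w = D c j w \<cdot> ((- 1) ^ b * MM j b u)"
  shows "D c j (w \<cdot> MM j (Suc m) (u + h)) = D c j w \<cdot> MM j (Suc m) u
    + (if c = Suc (j + m) then w \<cdot> (- 1) ^ m else 0)"
proof -
  have sv: "scal (u + h)" using assms(4) by (intro scal_intros)
  have "D c j (w \<cdot> MM j (Suc m) (u + h)) = D c j w \<cdot> MM j (Suc m) (u + h) + w \<cdot> NN j c (Suc m) (u + h)"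
    using assms by (subst D_act) (simp_all add: ad_MM_NN[OF sv])
  also have "w \<cdot> NN j c (Suc m) (u + h) = D c j w \<cdot> MM j (Suc m) u - D c j w \<cdot> MM j (Suc m) (u + h)
    + (if c = Suc (j + m) then w \<cdot> (- 1) ^ m else 0)"
    using assms by (intro wh_NN[of j n]) auto
  finally show ?thesis by simp
qed

text \<open>The class of vectors met while the factors \<open>P\<^sup>\<psi>\<^sub>i\<^sub>j\<close>
  with one fixed \<open>j\<close> are applied. A row \<open>c\<close> below the block acts in every
  column of the block through its action in column \<open>j\<close>, so once \<open>D c j\<close>
  kills the vector, the whole row does.\<close>

definition cls :: "nat \<Rightarrow> nat \<Rightarrow> 'u \<Rightarrow> 'y \<Rightarrow> bool"
  where "cls j n u w \<longleftrightarrow> wh j n w \<and>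
    (\<forall>c b. j + n \<le> c \<longrightarrow> c < N \<longrightarrow> b < n \<longrightarrow> D c (j + b) w = D c j w \<cdot> ((- 1) ^ b * MM j b u))"

lemma clsD:
  assumes "cls j n u w"
  shows "wh j n w"
    and "j + n \<le> c \<Longrightarrow> c < N \<Longrightarrow> b < n \<Longrightarrow> D c (j + b) w = D c j w \<cdot> ((- 1) ^ b * MM j b u)"
  using assms unfolding cls_def by auto

lemma wh_D:
  assumes "wh j n w" "j + n \<le> c" "c < N" "j < c"
  shows "wh j n (D c j w)"
  unfolding wh_def
proof (intro allI impI)
  fix p q assume pq: "j \<le> q" "q < p" "p < j + n"
  then have "D p q (D c j w) = D c j (D p q w)" using assms by (subst D_D) auto
  then show "D p q (D c j w) = 0" using assms(1) pq by (simp add: wh_def)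
qed

lemma wh_mono: "wh j n w \<Longrightarrow> m \<le> n \<Longrightarrow> wh j m w"
  by (auto simp: wh_def)

lemma D_commute_cls:
  assumes "j + n \<le> c" "c < N" "j + n \<le> b" "b < N" "k < n"
  shows "D c (j + k) (D b j w) = D b j (D c (j + k) w)"
  using assms by (subst D_D) auto

text \<open>\<open>D b j\<close> commutes with the other rows below the block, and by
  \<open>D_MM\<close> it lowers the parameter of each minor that it passes by
  \<open>h\<close>.\<close>

lemma cls_D:
  assumes "cls j n u w" "j + n \<le> N" "scal u" "j + n \<le> b" "b < N" "0 < n"
  shows "cls j n (u - h) (D b j w)"
proof -
  have su: "scal (u - h)" using assms(3) by (intro scal_intros)
  \<comment> \<open>The claim is for all \<open>b\<close> and \<open>c\<close> at once:
    \<open>D_MM\<close> is applied to \<open>D c j w\<close> and the row \<open>b\<close>, and takes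
    the induction hypothesis with the two exchanged.\<close>
  have main: "k < n \<Longrightarrow> (\<And>b c. j + n \<le> b \<Longrightarrow> b < N \<Longrightarrow> j + n \<le> c \<Longrightarrow> c < N \<Longrightarrow>
      D c (j + k) (D b j w) = D c j (D b j w) \<cdot> ((- 1) ^ k * MM j k (u - h)))" for k
  proof (induction k rule: less_induct)
    case (less k)
    show ?case
    proof (cases k)
      case 0
      then show ?thesis by (simp add: MM_0)
    next
      case (Suc m)
      let ?w = "D c j w"
      have wh: "wh j n ?w" using less.prems assms by (intro wh_D) (auto dest: clsD(1))
      have whb: "wh j n (D b j ?w)" by (rule wh_D[OF wh]) (use less.prems assms in auto)
      have "D b (j + l) ?w = D b j ?w \<cdot> ((- 1) ^ l * MM j l (u - h))" if "l < k" for l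
        using that less by (intro less.IH) auto
      then have "D b j (?w \<cdot> MM j (Suc m) (u - h + h)) = D b j ?w \<cdot> MM j (Suc m) (u - h)
          + (if b = Suc (j + m) then ?w \<cdot> (- 1) ^ m else 0)"
        using less.prems Suc assms(2) wh_mono[OF wh] wh_mono[OF whb] su by (intro D_MM[of j k]) auto
      then have e: "D b j (?w \<cdot> MM j k u) = D b j ?w \<cdot> MM j k (u - h)"
        using less.prems Suc by simp
      have "D c (j + k) (D b j w) = D b j (?w \<cdot> ((- 1) ^ k * MM j k u))"
        using less.prems assms by (subst D_commute_cls) (auto simp: clsD(2)[OF assms(1)])
      also have "\<dots> = D b j ?w \<cdot> ((- 1) ^ k * MM j k (u - h))"
        using e by (simp add: act_sign D_minus)
      also have "D b j ?w = D c j (D b j w)"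
        using less.prems assms(6) D_commute_cls[of j n c b 0 w] by simp
      finally show ?thesis .
    qed
  qed
  show ?thesis
    unfolding cls_def
  proof (intro conjI allI impI)
    show "wh j n (D b j w)" using assms by (intro wh_D) (auto dest: clsD(1))
  qed (use main assms in auto)
qed

end

section \<open>Row vectors and multiplication by principal minors\<close>

context whittaker begin

text \<open>Families transforming under the lower triangular matrices like a row of the matrix \<open>E\<close>.\<close>

definition vrow :: "nat \<Rightarrow> nat \<Rightarrow> (nat \<Rightarrow> 'y) \<Rightarrow> bool"
  where "vrow j n s \<longleftrightarrow> (\<forall>b p q. b < n \<longrightarrow> q < p \<longrightarrow> p < n \<longrightarrow> D (j + p) (j + q) (s b) = (if b = p then - s q else 0))"

text \<open>By \<open>act_E\<close> an entry below the diagonal, in row \<open>b > d\<close>, acts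
  as its value under \<open>\<psi>\<close> plus a correction \<open>s d \<cdot> h\<close>. The
  \<open>n - Suc d\<close> corrections raise the parameter of the diagonal entry. This is the source
  of the constants \<open>(N - k) \<hbar>\<close>.\<close>

lemma vrow_lf:
  assumes "vrow j n s" "j + n \<le> N" "d < n"
  shows "(\<Sum>b<n. s b \<cdot> lf (j + b) (j + d) y) =
    (\<Sum>b\<le>d. s b \<cdot> lf (j + b) (j + d) (y + of_nat (n - Suc d) * h)) + (if Suc d < n then s (Suc d) else 0)"
proof -
  have up: "s b \<cdot> lf (j + b) (j + d) y = (if b = Suc d then s (Suc d) else 0) + s d \<cdot> h" if "d < b" "b < n" for b
  proof -
    have "D (j + b) (j + d) (s b) = - s d" using assms(1) that unfolding vrow_def by auto
    then show ?thesis using that assms(2) by (auto simp: lf_def act_E act_minus_left)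
  qed
  have "{..<n} = {..d} \<union> {Suc d..<n}" "{..d} \<inter> {Suc d..<n} = {}" using assms(3) by auto
  then have "(\<Sum>b<n. s b \<cdot> lf (j + b) (j + d) y) =
      (\<Sum>b\<le>d. s b \<cdot> lf (j + b) (j + d) y) + (\<Sum>b\<in>{Suc d..<n}. s b \<cdot> lf (j + b) (j + d) y)"
    by (simp add: sum.union_disjoint)
  also have "(\<Sum>b\<in>{Suc d..<n}. s b \<cdot> lf (j + b) (j + d) y) =
      (\<Sum>b\<in>{Suc d..<n}. (if b = Suc d then s (Suc d) else 0) + s d \<cdot> h)"
    by (rule sum.cong) (auto simp: up)
  also have "\<dots> = (if Suc d < n then s (Suc d) else 0) + (\<Sum>b\<in>{Suc d..<n}. s d \<cdot> h)"
    by (simp add: sum.distrib)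
  also have "(\<Sum>b\<in>{Suc d..<n}. s d \<cdot> h) = s d \<cdot> (of_nat (n - Suc d) * h)"
    unfolding act_sum_right[symmetric] by simp
  also have "(\<Sum>b\<le>d. s b \<cdot> lf (j + b) (j + d) y) + ((if Suc d < n then s (Suc d) else 0) + s d \<cdot> (of_nat (n - Suc d) * h))
    = (\<Sum>b\<le>d. s b \<cdot> lf (j + b) (j + d) y + (if b = d then s d \<cdot> (of_nat (n - Suc d) * h) else 0)) + (if Suc d < n then s (Suc d) else 0)"
    by (simp add: sum.distrib)
  also have "(\<Sum>b\<le>d. s b \<cdot> lf (j + b) (j + d) y + (if b = d then s d \<cdot> (of_nat (n - Suc d) * h) else 0)) =
    (\<Sum>b\<le>d. s b \<cdot> lf (j + b) (j + d) (y + of_nat (n - Suc d) * h))"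
    by (rule sum.cong) (auto simp: lf_shift act_add_right)
  finally show ?thesis .
qed

text \<open>By \<open>vrow_lf\<close>, column \<open>d\<close> expresses \<open>s (Suc d)\<close>
  through the entries before it, so the first entry determines all others.\<close>

lemma vrow_zero:
  assumes "vrow j n s" "j + n \<le> N" "s 0 = 0"
    and "\<And>d. d < n \<Longrightarrow> (\<Sum>b<n. s b \<cdot> lf (j + b) (j + d) y) = 0"
  shows "b < n \<Longrightarrow> s b = 0"
proof (induction b rule: less_induct)
  case (less b)
  show ?case
  proof (cases b)
    case (Suc d)
    then have "(\<Sum>b\<le>d. s b \<cdot> lf (j + b) (j + d) (y + of_nat (n - Suc d) * h)) = 0"
      using less by (intro sum.neutral) auto
    then show ?thesis using vrow_lf[OF assms(1,2), of d y] assms(4)[of d] less.prems Suc by simp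
  qed (use assms in simp)
qed

lemma vrow_diff:
  assumes "vrow j n s" "vrow j n t"
  shows "vrow j n (\<lambda>b. s b - t b)"
  using assms unfolding vrow_def by (simp add: D_diff)

lemma sign_shift: "q < b \<Longrightarrow> (- 1) ^ b * (- 1) ^ (b - Suc q) = - ((- 1) ^ q :: 'u)"
  by (auto simp: minus_one_power_iff)

text \<open>The cases are the positions of \<open>p\<close> and \<open>q\<close> relative to the
  first \<open>b\<close> indices of the block. With both inside, the minor is central for them; with
  both outside, no index is touched. With \<open>q\<close> inside and \<open>p > b\<close>, a row
  too far down arises and \<open>wh_qm_zero\<close> applies. For \<open>p = b\<close> the row
  \<open>q\<close> is traded for the row \<open>b\<close>, and \<open>wh_del_row\<close> reduces the
  result to the minor of size \<open>q\<close>.\<close>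

lemma vrow_MM:
  assumes "wh j n x" "j + n \<le> N" "scal u"
  shows "vrow j n (\<lambda>b. x \<cdot> ((- 1) ^ b * MM j b u))"
  unfolding vrow_def
proof (intro allI impI)
  fix b p q assume bpq: "b < n" "q < p" "p < n"
  have "D (j + p) (j + q) x = 0" using assms(1) bpq by (simp add: wh_def)
  then have D: "D (j + p) (j + q) (x \<cdot> ((- 1) ^ b * MM j b u)) = x \<cdot> ((- 1) ^ b * ad (j + p) (j + q) (MM j b u))"
    using bpq assms(2) by (cases "even b") (simp_all add: D_act ad_minus)
  consider "p < b" | "b \<le> q" | "q < b" "b < p" | "b = p" using bpq by linarith
  then show "D (j + p) (j + q) (x \<cdot> ((- 1) ^ b * MM j b u)) = (if b = p then - (x \<cdot> ((- 1) ^ q * MM j q u)) else 0)"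
  proof cases
    case 1
    then show ?thesis using bpq assms ad_MM_central[of u j b "j + p" "j + q"] by (simp add: D)
  next
    case 2
    then show ?thesis using bpq assms ad_MM_outside[of u j b "j + p" "j + q"] by (simp add: D)
  next
    case 3
    let ?r = "[j..<j + b][q := j + p]"
    have "ad (j + p) (j + q) (MM j b u) = qm ?r [j..<j + b] u"
      using 3 bpq assms by (intro ad_MM_row) auto
    moreover have "x \<cdot> qm ?r [j..<j + b] u = 0"
    proof (rule wh_qm_zero[OF assms, where k = "j + p"])
      show "set ?r \<subseteq> {..<N}"
        using set_update_subset_insert[of "[j..<j + b]" q "j + p"] bpq assms(2) by auto
      show "j + p \<in> set ?r" using 3 by (simp add: set_update_memI)
    qed (use 3 bpq in auto)
    ultimately show ?thesis unfolding D using 3 by (simp add: act_sign)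
  next
    case 4
    let ?r = "[j..<j + b][q := j + b]"
    have "?r = [j..<j + q] @ (j + b) # [Suc (j + q)..<j + b]"
      using 4 bpq by (simp add: upd_conv_take_nth_drop)
    moreover have "qm ([j..<j + q] @ (j + b) # [Suc (j + q)..<j + b]) [j..<j + b] u =
        (- 1) ^ (b - Suc q) * qm ([j..<j + q] @ [Suc (j + q)..<j + b] @ [j + b]) [j..<j + b] u"
      using 4 bpq by (subst qm_row_move) auto
    moreover have "[j..<j + q] @ [Suc (j + q)..<j + b] @ [j + b] = del_row j j q b"
      using 4 bpq by (auto simp: del_row_def upt_conv_Cons)
    ultimately have "ad (j + p) (j + q) (MM j b u) = (- 1) ^ (b - Suc q) * qm (del_row j j q b) [j..<j + b] u"
      using 4 bpq assms ad_MM_row[of u j b "j + p" q] by simp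
    moreover have "x \<cdot> qm (del_row j j q b) [j..<j + b] u = x \<cdot> MM j q u"
      using wh_del_row[OF assms, of j q b] 4 bpq by (simp add: NN_self)
    ultimately have "D (j + p) (j + q) (x \<cdot> ((- 1) ^ b * MM j b u)) = x \<cdot> (((- 1) ^ b * (- 1) ^ (b - Suc q)) * qm (del_row j j q b) [j..<j + b] u)"
      by (simp add: D mult.assoc)
    also have "\<dots> = - (x \<cdot> ((- 1) ^ q * MM j q u))"
      unfolding sign_shift[of q b, OF bpq(2)[folded 4]]
      using \<open>x \<cdot> qm (del_row j j q b) [j..<j + b] u = x \<cdot> MM j q u\<close>
      by (cases "even q") (simp_all add: act_minus_right)
    finally show ?thesis using 4 by simp
  qed
qed

text \<open>The parameter is chosen so that \<open>vrow_lf\<close> turns it into the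
  \<open>u - of_nat d * h\<close> of the recursion \<open>MM_Suc\<close>. The sum up to
  \<open>d\<close> is then a signed minor of size \<open>Suc d\<close>, which the next entry of the
  row cancels except in the last column. Up to sign the row is the last row of an adjugate.\<close>

lemma MM_row_lf:
  assumes "wh j n x" "j + n \<le> N" "scal u" "d < n"
  shows "(\<Sum>b<n. x \<cdot> ((- 1) ^ b * MM j b u) \<cdot> lf (j + b) (j + d) (u + h - of_nat n * h)) =
    (if Suc d = n then x \<cdot> ((- 1) ^ d * MM j n u) else 0)"
proof -
  have y: "u + h - of_nat n * h + of_nat (n - Suc d) * h = u - of_nat d * h"
    using assms(4) by (simp add: of_nat_diff algebra_simps)
  have "(\<Sum>b\<le>d. x \<cdot> ((- 1) ^ b * MM j b u) \<cdot> lf (j + b) (j + d) (u - of_nat d * h)) =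
    (\<Sum>b\<le>d. x \<cdot> ((- 1) ^ (d + b) * MM j b u * lf (j + b) (j + d) (u - of_nat d * h))) \<cdot> (- 1) ^ d"
    unfolding act_sum_left
    by (rule sum.cong) (auto simp: act_mult act_minus_right act_minus_left minus_one_power_iff)
  also have "\<dots> = x \<cdot> ((- 1) ^ d * MM j (Suc d) u)"
    using MM_Suc[OF assms] by (cases "even d") (simp_all add: act_minus_right)
  finally have s: "(\<Sum>b\<le>d. x \<cdot> ((- 1) ^ b * MM j b u) \<cdot> lf (j + b) (j + d) (u - of_nat d * h)) = x \<cdot> ((- 1) ^ d * MM j (Suc d) u)" .
  show ?thesis
    unfolding vrow_lf[OF vrow_MM[OF assms(1-3)] assms(2,4)] y s
    using assms(4) by (auto simp: act_minus_right)
qed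

lemma MM_commutes_E:
  assumes "scal v" "j + n \<le> N" "j \<le> p" "p < j + n" "j \<le> q" "q < j + n"
  shows "MM j n v * E p q = E p q * MM j n v"
  using E_commutes[OF _ _ ad_MM_central[OF assms]] assms by simp

lemma MM_commutes_lf:
  assumes "scal v" "scal y" "j + n \<le> N" "j \<le> p" "p < j + n" "j \<le> q" "q < j + n"
  shows "MM j n v * lf p q y = lf p q y * MM j n v"
  using assms by (intro lf_commutes MM_commutes_E) auto

lemma MM_commutes:
  assumes "scal v" "scal y" "j + n \<le> N" "b \<le> n"
  shows "MM j n v * MM j b y = MM j b y * MM j n v"
  unfolding MM_def[of j b] using assms by (intro qm_commutes MM_commutes_E) auto

text \<open>A minor with the column \<open>j + d\<close> repeated is zero. Its expansion along the
  last column relates \<open>E c (j + d)\<close> to the minors in which a row of the block is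
  replaced by \<open>c\<close>, and these are the derivatives \<open>ad c (j + b)\<close>.\<close>

lemma MM_E_outside:
  assumes "scal v" "j + n \<le> N" "j + n \<le> c" "c < N" "d < n"
  shows "MM j n v * E c (j + d) = (\<Sum>b<n. ad c (j + b) (MM j n v) * lf (j + b) (j + d) (v - of_nat n * h))"
proof -
  let ?B = "[j..<j + n]"
  have "0 = qm (?B @ [c]) (?B @ [j + d]) v"
    using assms by (intro qm_col_dup[symmetric]) auto
  also have "\<dots> = (\<Sum>b\<le>n. (if b = n then 1 else - 1) *
    qm (?B[b := c]) ?B v * lf ((?B @ [c]) ! b) (j + d) (v - of_nat n * h))"
    using qm_snoc_update[of ?B ?B c "j + d" v] by simp
  also have "{..n} = insert n {..<n}" by auto
  also have "(\<Sum>b\<in>insert n {..<n}. (if b = n then 1 else - 1) *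
    qm (?B[b := c]) ?B v * lf ((?B @ [c]) ! b) (j + d) (v - of_nat n * h)) =
    MM j n v * lf c (j + d) (v - of_nat n * h) + (\<Sum>b<n. - (ad c (j + b) (MM j n v) * lf (j + b) (j + d) (v - of_nat n * h)))"
    using assms by (auto simp: MM_def[of j n v, symmetric] nth_append list_update_beyond ad_MM_row intro!: sum.cong)
  finally show ?thesis using assms(3,5) by (simp add: sum_negf lf_def)
qed

text \<open>Prepares \<open>cls_MM\<close>: the value is the one that \<open>MM_row_lf\<close> gives
  for the expected row. It results from computing
  \<open>w \<cdot> MM j n v \<cdot> E c (j + d)\<close> once by \<open>act_E\<close> and once by
  \<open>MM_E_outside\<close>.\<close>

lemma D_act_MM_commute:
  assumes "cls j n u w" "j + n \<le> N" "scal u" "j + n \<le> c" "c < N" "d < n"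
  defines "v \<equiv> u + h"
  shows "(\<Sum>b<n. D c (j + b) (w \<cdot> MM j n v) \<cdot> lf (j + b) (j + d) (v + h - of_nat n * h)) =
    (if Suc d = n then D c j (w \<cdot> MM j n v) \<cdot> ((- 1) ^ d * MM j n v) else 0)"
proof -
  have sv: "scal v" unfolding v_def using assms(3) by (intro scal_intros)
  have whw: "wh j n w" using assms(1) by (rule clsD)
  have whx: "wh j n (D c j w)" using whw assms by (intro wh_D) auto
  let ?y = "v - of_nat n * h"
  have sy: "scal ?y" using sv by (rule scal_sub)
  let ?\<delta> = "\<lambda>b. D c (j + b) (w \<cdot> MM j n v)"
  have \<delta>: "?\<delta> b = D c j w \<cdot> ((- 1) ^ b * MM j b u) \<cdot> MM j n v + w \<cdot> ad c (j + b) (MM j n v)" if "b < n" for b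
    using that assms by (subst D_act) (simp_all add: clsD(2)[OF assms(1)])
  have "?\<delta> d \<cdot> h = (if c = Suc (j + d) then w \<cdot> MM j n v else 0) - w \<cdot> MM j n v \<cdot> E c (j + d)"
    using assms by (subst act_E) auto
  also have "w \<cdot> MM j n v \<cdot> E c (j + d) = (\<Sum>b<n. w \<cdot> ad c (j + b) (MM j n v) \<cdot> lf (j + b) (j + d) ?y)"
    unfolding act_mult[symmetric] MM_E_outside[OF sv assms(2,4,5,6)] act_sum_right ..
  also have "\<dots> = (\<Sum>b<n. ?\<delta> b \<cdot> lf (j + b) (j + d) ?y - D c j w \<cdot> ((- 1) ^ b * MM j b u) \<cdot> lf (j + b) (j + d) ?y \<cdot> MM j n v)"
  proof (rule sum.cong[OF refl])
    fix b assume "b \<in> {..<n}"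
    then have b: "b < n" by simp
    have "MM j n v * lf (j + b) (j + d) ?y = lf (j + b) (j + d) ?y * MM j n v"
      using b assms sv sy by (intro MM_commutes_lf) auto
    then show "w \<cdot> ad c (j + b) (MM j n v) \<cdot> lf (j + b) (j + d) ?y =
      ?\<delta> b \<cdot> lf (j + b) (j + d) ?y - D c j w \<cdot> ((- 1) ^ b * MM j b u) \<cdot> lf (j + b) (j + d) ?y \<cdot> MM j n v"
      unfolding \<delta>[OF b] by (simp add: act_add_left) (metis act_mult)
  qed
  also have "\<dots> = (\<Sum>b<n. ?\<delta> b \<cdot> lf (j + b) (j + d) ?y) -
      (\<Sum>b<n. D c j w \<cdot> ((- 1) ^ b * MM j b u) \<cdot> lf (j + b) (j + d) (u + h - of_nat n * h)) \<cdot> MM j n v"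
    by (simp add: sum_subtractf act_sum_left v_def)
  also have "(\<Sum>b<n. D c j w \<cdot> ((- 1) ^ b * MM j b u) \<cdot> lf (j + b) (j + d) (u + h - of_nat n * h)) =
      (if Suc d = n then D c j w \<cdot> ((- 1) ^ d * MM j n u) else 0)"
    by (rule MM_row_lf[OF whx assms(2,3,6)])
  finally have A: "(\<Sum>b<n. ?\<delta> b \<cdot> lf (j + b) (j + d) ?y) + ?\<delta> d \<cdot> h =
      (if Suc d = n then D c j w \<cdot> ((- 1) ^ d * MM j n u) else 0) \<cdot> MM j n v + (if c = Suc (j + d) then w \<cdot> MM j n v else 0)"
    by simp
  have B: "(\<Sum>b<n. ?\<delta> b \<cdot> lf (j + b) (j + d) ?y) + ?\<delta> d \<cdot> h = (\<Sum>b<n. ?\<delta> b \<cdot> lf (j + b) (j + d) (?y + h))"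
  proof -
    have "(\<Sum>b<n. ?\<delta> b \<cdot> lf (j + b) (j + d) (?y + h)) =
        (\<Sum>b<n. ?\<delta> b \<cdot> lf (j + b) (j + d) ?y + (if b = d then ?\<delta> d \<cdot> h else 0))"
      by (rule sum.cong) (auto simp: lf_shift act_add_right)
    then show ?thesis using assms(6) by (simp add: sum.distrib)
  qed
  have C: "D c j (w \<cdot> MM j n v) = D c j w \<cdot> MM j n u + (if c = Suc (j + d) then w \<cdot> (- 1) ^ d else 0)" if "Suc d = n"
    using D_MM[OF whw whx assms(2,3,4,5,6) clsD(2)[OF assms(1,4,5)]] that by (simp add: v_def)
  have y: "v + h - of_nat n * h = ?y + h" by simp
  show ?thesis
    unfolding y B[symmetric] A
  proof (cases "Suc d = n")
    case True
    then show "(if Suc d = n then D c j w \<cdot> ((- 1) ^ d * MM j n u) else 0) \<cdot> MM j n v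
        + (if c = Suc (j + d) then w \<cdot> MM j n v else 0) =
      (if Suc d = n then D c j (w \<cdot> MM j n v) \<cdot> ((- 1) ^ d * MM j n v) else 0)"
      unfolding C[OF True] by (cases "even d") (simp_all add: act_minus_right act_minus_left act_add_left)
  next
    case False
    then show "(if Suc d = n then D c j w \<cdot> ((- 1) ^ d * MM j n u) else 0) \<cdot> MM j n v
        + (if c = Suc (j + d) then w \<cdot> MM j n v else 0) =
      (if Suc d = n then D c j (w \<cdot> MM j n v) \<cdot> ((- 1) ^ d * MM j n v) else 0)"
      using assms(4,6) by simp
  qed
qed

text \<open>The actual row and the expected row are both of the kind \<open>vrow\<close>, agree in
  entry 0 and have the same product with \<open>L\<close>, so \<open>vrow_zero\<close> applies to
  their difference.\<close>

lemma cls_MM: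
  assumes "cls j n u w" "j + n \<le> N" "scal u" "0 < n"
  shows "cls j n (u + h) (w \<cdot> MM j n (u + h))"
proof -
  define v where "v = u + h"
  have sv: "scal v" unfolding v_def using assms(3) by (intro scal_intros)
  have whw: "wh j n w" using assms(1) by (rule clsD)
  have whM: "wh j n (w \<cdot> MM j n v)"
    using whw assms(2) unfolding wh_def by (auto simp: D_act ad_MM_central[OF sv assms(2)])
  have "D c (j + b) (w \<cdot> MM j n v) = D c j (w \<cdot> MM j n v) \<cdot> ((- 1) ^ b * MM j b v)"
    if c: "j + n \<le> c" "c < N" and b: "b < n" for c b
  proof -
    let ?s = "\<lambda>b. D c (j + b) (w \<cdot> MM j n v)"
    let ?t = "\<lambda>b. ?s 0 \<cdot> ((- 1) ^ b * MM j b v)"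
    have s0: "?s 0 = D c j (w \<cdot> MM j n v)" by simp
    have wh0: "wh j n (?s 0)" unfolding s0 using whM c assms by (intro wh_D) auto
    have "vrow j n ?s"
      unfolding vrow_def
    proof (intro allI impI)
      fix b p q assume bpq: "b < n" "q < p" "p < n"
      have "D (j + p) (j + q) (w \<cdot> MM j n v) = 0" using whM bpq by (simp add: wh_def)
      then show "D (j + p) (j + q) (?s b) = (if b = p then - ?s q else 0)"
        using bpq c assms(2) by (subst D_D) auto
    qed
    moreover have "vrow j n ?t" by (rule vrow_MM[OF wh0 assms(2) sv])
    ultimately have row: "vrow j n (\<lambda>b. ?s b - ?t b)" by (rule vrow_diff)
    have "?s b - ?t b = 0"
    proof (rule vrow_zero[OF row assms(2) _ _ b])
      fix d assume d: "d < n"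
      have "(\<Sum>b<n. (?s b - ?t b) \<cdot> lf (j + b) (j + d) (v + h - of_nat n * h)) =
          (\<Sum>b<n. ?s b \<cdot> lf (j + b) (j + d) (v + h - of_nat n * h)) -
          (\<Sum>b<n. ?t b \<cdot> lf (j + b) (j + d) (v + h - of_nat n * h))"
        by (simp only: act_diff_left sum_subtractf)
      also have "\<dots> = 0"
        unfolding MM_row_lf[OF wh0 assms(2) sv d]
        using D_act_MM_commute[OF assms(1,2,3) c d] by (simp add: v_def)
      finally show "(\<Sum>b<n. (?s b - ?t b) \<cdot> lf (j + b) (j + d) (v + h - of_nat n * h)) = 0" .
    qed (simp add: MM_0)
    then show ?thesis by simp
  qed
  with whM show ?thesis unfolding cls_def v_def by blast
qed

lemma cls_D_MM:
  assumes "cls j n u w" "j + n \<le> N" "scal u" "j + n \<le> c" "c < N" "0 < n"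
  shows "D c j (w \<cdot> MM j n (u + h)) = D c j w \<cdot> MM j n u + (if c = j + n then w \<cdot> (- 1) ^ (n - 1) else 0)"
proof -
  have whw: "wh j n w" using assms(1) by (rule clsD)
  have whx: "wh j n (D c j w)" using whw assms by (intro wh_D) auto
  obtain m where m: "n = Suc m" using assms(6) by (cases n) auto
  show ?thesis
    using D_MM[OF whw whx assms(2,3,4,5) _ clsD(2)[OF assms(1,4,5)], of m] m by simp
qed

end


section \<open>The operators \<open>P\<^sup>\<psi>\<^sub>i\<^sub>j\<close>\<close>

locale whittaker_exp = whittaker N E h ad act D for N and E :: "nat \<Rightarrow> nat \<Rightarrow> 'u::ring_1" and h ad
    and act :: "'y::ab_group_add \<Rightarrow> 'u \<Rightarrow> 'y" (infixl "\<cdot>" 75) and D +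
  fixes q :: "nat \<Rightarrow> 'u"
  assumes D_nilpotent: "j < i \<Longrightarrow> i < N \<Longrightarrow> \<exists>K. (D i j ^^ K) x = 0"
    and q_0: "q 0 = 1"
    and q_Suc: "of_nat (Suc k) * q (Suc k) = q k"
    and scal_q: "scal (q k)"
begin

text \<open>The common form of \<open>P\<^sup>\<psi>\<^sub>i\<^sub>j\<close> and of the operators
  \<open>Gop\<close> below: an exponential series in \<open>D i j\<close>, with \<open>q k\<close>
  in the role of \<open>1 / k!\<close>, whose terms are multiplied on the right by
  \<open>g k\<close>.\<close>

definition Dexp :: "nat \<Rightarrow> nat \<Rightarrow> (nat \<Rightarrow> 'u) \<Rightarrow> 'y \<Rightarrow> 'y"
  where "Dexp i j g x = Sum_any (\<lambda>k. (D i j ^^ k) x \<cdot> (q k * g k))"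

lemma Dpow_0 [simp]: "(D i j ^^ k) 0 = 0"
  by (induction k) auto

lemma Dpow_add: "(D i j ^^ k) (x + y) = (D i j ^^ k) x + (D i j ^^ k) y"
  by (induction k) (auto simp: D_add)

lemma Dpow_zero_mono: "(D i j ^^ K) x = 0 \<Longrightarrow> K \<le> k \<Longrightarrow> (D i j ^^ k) x = 0"
  by (metis Dpow_0 add.commute funpow_add le_Suc_ex o_apply)

lemma Dexp_sum:
  assumes "(D i j ^^ K) x = 0"
  shows "Dexp i j g x = (\<Sum>k<K. (D i j ^^ k) x \<cdot> (q k * g k))"
  unfolding Dexp_def
proof (rule Sum_any.expand_superset)
  show "{a. (D i j ^^ a) x \<cdot> (q a * g a) \<noteq> 0} \<subseteq> {..<K}"
  proof
    fix a assume "a \<in> {a. (D i j ^^ a) x \<cdot> (q a * g a) \<noteq> 0}"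
    then have "(D i j ^^ a) x \<noteq> 0" by auto
    then show "a \<in> {..<K}" using Dpow_zero_mono[OF assms, of a] by (cases "K \<le> a") auto
  qed
qed simp

lemma Dexp_add:
  assumes "j < i" "i < N"
  shows "Dexp i j g (x + y) = Dexp i j g x + Dexp i j g y"
proof -
  obtain K L where K: "(D i j ^^ K) x = 0" and L: "(D i j ^^ L) y = 0" using D_nilpotent[OF assms] by blast
  have x: "(D i j ^^ max K L) x = 0" and y: "(D i j ^^ max K L) y = 0"
    using Dpow_zero_mono[OF K, of "max K L"] Dpow_zero_mono[OF L, of "max K L"] by auto
  then have xy: "(D i j ^^ max K L) (x + y) = 0" by (simp add: Dpow_add)
  show ?thesis
    unfolding Dexp_sum[OF x] Dexp_sum[OF y] Dexp_sum[OF xy] Dpow_add act_add_left sum.distrib ..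
qed

lemma Dexp_0: "Dexp i j g 0 = 0"
  by (simp add: Dexp_def)

lemma Dexp_id:
  assumes "D i j x = 0" "g 0 = 1"
  shows "Dexp i j g x = x"
  using Dexp_sum[where K = 1 and i = i and j = j and x = x and g = g] assms by (simp add: q_0)

lemma Dpow_act:
  assumes "j < i" "i < N" "ad i j a = b" "ad i j b = 0"
  shows "(D i j ^^ k) (x \<cdot> a) = (D i j ^^ k) x \<cdot> a + (D i j ^^ (k - 1)) x \<cdot> (of_nat k * b)"
proof (induction k)
  case (Suc k)
  have "D i j ((D i j ^^ (k - 1)) x \<cdot> (of_nat k * b)) = (D i j ^^ k) x \<cdot> (of_nat k * b)"
    using assms by (cases k) (simp_all add: D_act ad_mult ad_add ad_1 ad_of_nat)
  then show ?case
    using assms by (simp add: Suc D_add D_act distrib_right act_add_right add_ac)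
qed simp

lemma Dexp_act:
  assumes "j < i" "i < N" "ad i j a = 0" "\<And>k. a * g k = g' k * a"
  shows "Dexp i j g (x \<cdot> a) = Dexp i j g' x \<cdot> a"
proof -
  obtain K where K: "(D i j ^^ K) x = 0" using D_nilpotent[OF assms(1,2)] by blast
  have pow: "(D i j ^^ k) (x \<cdot> a) = (D i j ^^ k) x \<cdot> a" for k
    using Dpow_act[OF assms(1,2,3), of k x] by (simp add: ad_0)
  then have K': "(D i j ^^ K) (x \<cdot> a) = 0" using K by simp
  have "a * (q k * g k) = q k * g' k * a" for k
    using scalD(1)[OF scal_q, of k a] assms(4)[of k] by (metis mult.assoc)
  then show ?thesis
    unfolding Dexp_sum[OF K'] Dexp_sum[OF K] pow act_sum_left act_mult[symmetric] by (simp only:)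
qed

lemma D_Dpow_commute:
  assumes "\<And>x. D c d (D i j x) = D i j (D c d x)"
  shows "D c d ((D i j ^^ k) x) = (D i j ^^ k) (D c d x)"
  by (induction k) (simp_all add: assms)

lemma D_Dexp_commute:
  assumes "j < i" "i < N" "d < c" "c < N" "\<And>x. D c d (D i j x) = D i j (D c d x)" "\<And>k. ad c d (g k) = 0"
  shows "D c d (Dexp i j g x) = Dexp i j g (D c d x)"
proof -
  obtain K where K: "(D i j ^^ K) x = 0" using D_nilpotent[OF assms(1,2)] by blast
  have "(D i j ^^ K) (D c d x) = 0" using D_Dpow_commute[OF assms(5), of K x] K by simp
  then show ?thesis
    using K assms by (simp add: Dexp_sum D_sum D_act ad_mult scalD(2)[OF scal_q] D_Dpow_commute[OF assms(5)])
qed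

lemma sum_telescope: "(\<Sum>k<Suc K. f k - (if k = 0 then 0 else f (k - 1))) = (f K :: 'y)"
  by (induction K) simp_all

lemma sum_shift: "(\<Sum>k<Suc K. if k = 0 then 0 else f (k - 1)) = (\<Sum>k<K. f k :: 'y)"
  by (simp only: sum.lessThan_Suc_shift) simp

section \<open>Falling factorials of principal minors\<close>

definition ff :: "nat \<Rightarrow> nat \<Rightarrow> 'u \<Rightarrow> nat \<Rightarrow> 'u"
  where "ff j n u k = prod_list (map (\<lambda>r. MM j n (u - of_nat r * h)) [0..<k])"

lemma ff_0 [simp]: "ff j n u 0 = 1"
  by (simp add: ff_def)

lemma ff_Suc: "ff j n u (Suc k) = ff j n u k * MM j n (u - of_nat k * h)"
  by (simp add: ff_def)

lemma ff_Suc': "ff j n u (Suc k) = MM j n u * ff j n (u - h) k"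
proof (induction k)
  case (Suc k)
  have "u - of_nat (Suc k) * h = u - h - of_nat k * h" by (simp add: algebra_simps)
  then show ?case using Suc by (simp only: ff_Suc[of j n u "Suc k"] ff_Suc[of j n "u - h" k] mult.assoc)
qed (simp add: ff_Suc)

lemma ff_commutes:
  assumes "scal u" "scal v" "j + n \<le> N"
  shows "MM j n v * ff j n u k = ff j n u k * MM j n v"
  unfolding ff_def using assms by (intro prod_list_commutes) (auto intro!: MM_commutes scal_sub)

lemma ff_Suc_right:
  assumes "scal u" "j + n \<le> N"
  shows "ff j n u (Suc k) = ff j n (u - h) k * MM j n u"
  using ff_commutes[of "u - h" u j n k] assms by (simp add: ff_Suc' scal_diff scal_h)

lemma ad_ff:
  assumes "\<And>v. scal v \<Longrightarrow> ad c d (MM j n v) = 0" "scal u"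
  shows "ad c d (ff j n u k) = 0"
  by (induction k) (simp_all add: ff_Suc ad_1 ad_mult assms scal_sub)

lemma cls_ff:
  assumes "j + n \<le> N" "0 < n"
  shows "scal u \<Longrightarrow> cls j n (u - of_nat k * h) w \<Longrightarrow> cls j n u (w \<cdot> ff j n u k)"
proof (induction k arbitrary: u)
  case (Suc k)
  have su: "scal (u - h)" using Suc.prems(1) by (intro scal_intros)
  have e: "u - of_nat (Suc k) * h = u - h - of_nat k * h" by (simp add: algebra_simps)
  have "cls j n (u - h + h) (w \<cdot> ff j n (u - h) k \<cdot> MM j n (u - h + h))"
    using Suc.prems(2) unfolding e by (intro cls_MM Suc.IH su assms)
  then show ?case by (simp add: ff_Suc_right[OF Suc.prems(1) assms(1)] act_mult)
qed simp

text \<open>Iterates \<open>cls_D_MM\<close>: passing through lowers each parameter by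
  \<open>h\<close>, and for \<open>c = j + n\<close> the operator also acts like a derivative,
  removing one of the \<open>k\<close> factors with the sign \<open>(- 1) ^ (n - 1)\<close>.\<close>

lemma D_ff:
  assumes "j + n \<le> N" "0 < n" "j + n \<le> c" "c < N"
  shows "scal u \<Longrightarrow> cls j n (u - of_nat k * h) w \<Longrightarrow> D c j (w \<cdot> ff j n u k) = D c j w \<cdot> ff j n (u - h) k
    + (if c = j + n then w \<cdot> ((- 1) ^ (n - 1) * (of_nat k * ff j n (u - h) (k - 1))) else 0)"
proof (induction k arbitrary: u)
  case (Suc k)
  have su: "scal (u - h)" using Suc.prems(1) by (intro scal_intros)
  have e: "u - of_nat (Suc k) * h = u - h - of_nat k * h" by (simp add: algebra_simps)
  have c: "cls j n (u - h) (w \<cdot> ff j n (u - h) k)"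
    using Suc.prems(2) unfolding e by (intro cls_ff su assms)
  have "D c j (w \<cdot> ff j n u (Suc k)) = D c j (w \<cdot> ff j n (u - h) k \<cdot> MM j n (u - h + h))"
    by (simp add: ff_Suc_right[OF Suc.prems(1) assms(1)] act_mult)
  also have "\<dots> = D c j (w \<cdot> ff j n (u - h) k) \<cdot> MM j n (u - h) + (if c = j + n then w \<cdot> ff j n (u - h) k \<cdot> (- 1) ^ (n - 1) else 0)"
    using assms by (intro cls_D_MM c su)
  also have "D c j (w \<cdot> ff j n (u - h) k) = D c j w \<cdot> ff j n (u - h - h) k
    + (if c = j + n then w \<cdot> ((- 1) ^ (n - 1) * (of_nat k * ff j n (u - h - h) (k - 1))) else 0)"
    using Suc.prems(2) unfolding e by (intro Suc.IH su)
  also have "(D c j w \<cdot> ff j n (u - h - h) k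
    + (if c = j + n then w \<cdot> ((- 1) ^ (n - 1) * (of_nat k * ff j n (u - h - h) (k - 1))) else 0)) \<cdot> MM j n (u - h)
    + (if c = j + n then w \<cdot> ff j n (u - h) k \<cdot> (- 1) ^ (n - 1) else 0)
    = D c j w \<cdot> ff j n (u - h) (Suc k)
    + (if c = j + n then w \<cdot> ((- 1) ^ (n - 1) * (of_nat (Suc k) * ff j n (u - h) k)) else 0)"
  proof -
    have "of_nat k * ff j n (u - h - h) (k - 1) * MM j n (u - h) = of_nat k * ff j n (u - h) k"
      using ff_Suc_right[OF su assms(1), of "k - 1"] by (cases k) (simp_all add: mult.assoc)
    then have "w \<cdot> (of_nat k * ff j n (u - h - h) (k - 1)) \<cdot> MM j n (u - h) = w \<cdot> (of_nat k * ff j n (u - h) k)"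
      by (metis act_mult)
    then have "w \<cdot> ((- 1) ^ (n - 1) * (of_nat k * ff j n (u - h - h) (k - 1))) \<cdot> MM j n (u - h)
        + w \<cdot> ff j n (u - h) k \<cdot> (- 1) ^ (n - 1) = w \<cdot> ((- 1) ^ (n - 1) * (of_nat (Suc k) * ff j n (u - h) k))"
      by (cases "even (n - 1)") (simp_all add: act_minus_right act_minus_left distrib_right act_add_right act_diff_right)
    moreover have "D c j w \<cdot> ff j n (u - h - h) k \<cdot> MM j n (u - h) = D c j w \<cdot> ff j n (u - h) (Suc k)"
      by (simp add: ff_Suc_right[OF su assms(1)] act_mult)
    ultimately show ?thesis by (simp add: act_add_left add.assoc del: of_nat_Suc)
  qed
  finally show ?case by simp
qed simp

lemma cls_add: "cls j n u x \<Longrightarrow> cls j n u y \<Longrightarrow> cls j n u (x + y)"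
  by (simp add: cls_def wh_def D_add act_add_left)

lemma cls_0: "cls j n u 0"
  by (simp add: cls_def wh_def)

lemma cls_sum: "(\<And>k. k \<in> A \<Longrightarrow> cls j n u (f k)) \<Longrightarrow> cls j n u (sum f A)"
  by (induction A rule: infinite_finite_induct) (simp_all add: cls_0 cls_add)

lemma cls_act_scal:
  assumes "cls j n u x" "scal v" "j + n \<le> N" "0 < n"
  shows "cls j n u (x \<cdot> v)"
  using assms by (auto simp: cls_def wh_def D_act_scal act_scal[OF assms(2)])

text \<open>This is \<open>P\<^sup>\<psi>\<^sub>i\<^sub>j(u)\<close>: on the quotient
  \<open>\<hbar>\<^sup>-\<^sup>k (- E\<^sup>\<psi>\<^sub>i\<^sub>j)\<^sup>k\<close> acts as the
  power of \<open>D i j\<close>, and \<open>i - j\<close> has the parity of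
  \<open>i + j\<close>.\<close>

definition Pop :: "nat \<Rightarrow> nat \<Rightarrow> 'u \<Rightarrow> 'y \<Rightarrow> 'y"
  where "Pop i j u = Dexp i j (\<lambda>k. (- 1) ^ ((i - j) * k) * ff j (i - j) u k)"

definition dz :: "nat \<Rightarrow> 'y \<Rightarrow> bool"
  where "dz m y \<longleftrightarrow> (\<forall>p q. m \<le> q \<longrightarrow> q < p \<longrightarrow> p < N \<longrightarrow> D p q y = 0)"

section \<open>One factor of \<open>P\<close> enlarges the block by one index\<close>

context
  fixes j n u y
  assumes jn: "j + n < N" and n: "0 < n" and u: "scal u" and y: "cls j n u y"
begin

text \<open>Each \<open>D\<close> lowers the parameter by \<open>h\<close> and each factor of
  \<open>ff\<close> raises it again, so all terms of the series end in the class with parameter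
  \<open>u\<close>. This is the purpose of the falling factorial in
  \<open>P\<^sup>\<psi>\<^sub>i\<^sub>j\<close>.\<close>

lemma cls_Dpow: "cls j n (u - of_nat k * h) ((D (j + n) j ^^ k) y)"
proof (induction k)
  case (Suc k)
  have "cls j n (u - of_nat k * h - h) (D (j + n) j ((D (j + n) j ^^ k) y))"
    using jn n u by (intro cls_D Suc scal_sub) auto
  moreover have "u - of_nat k * h - h = u - of_nat (Suc k) * h" by (simp add: algebra_simps)
  ultimately show ?case by simp
qed (simp add: y)

definition sg :: "nat \<Rightarrow> 'u"
  where "sg k = q k * (- 1) ^ (n * k)"

lemma scal_sg: "scal (sg k)"
  unfolding sg_def by (intro scal_mult scal_q scal_power scal_minus scal_1)

lemma sg_Suc: "of_nat (Suc k) * sg (Suc k) = (- 1) ^ n * sg k"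
proof -
  have "of_nat (Suc k) * sg (Suc k) = q k * (- 1) ^ (n * Suc k)"
    unfolding sg_def mult.assoc[symmetric] q_Suc ..
  also have "\<dots> = (- 1) ^ n * sg k" by (auto simp: sg_def minus_one_power_iff)
  finally show ?thesis .
qed

lemma Pop_sum:
  assumes "(D (j + n) j ^^ K) y = 0"
  shows "Pop (j + n) j u y = (\<Sum>k<K. (D (j + n) j ^^ k) y \<cdot> ff j n u k \<cdot> sg k)"
proof -
  have "q k * ((- 1) ^ (n * k) * ff j n u k) = ff j n u k * sg k" for k
    using scalD(1)[OF scal_sg, of k "ff j n u k"] by (simp add: sg_def mult.assoc)
  then show ?thesis unfolding Pop_def by (subst Dexp_sum[OF assms]) (simp add: act_mult)
qed

lemma cls_Pop: "cls j n u (Pop (j + n) j u y)"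
proof -
  obtain K where K: "(D (j + n) j ^^ K) y = 0" using D_nilpotent[of j "j + n" y] jn n by auto
  show ?thesis
    unfolding Pop_sum[OF K] using jn n u cls_Dpow by (intro cls_sum cls_act_scal scal_sg cls_ff) auto
qed

text \<open>For \<open>c = j + n\<close> the series behaves like an exponential: raising the power
  of \<open>D\<close> in term \<open>k\<close> cancels against removing a factor of
  \<open>ff\<close> in term \<open>k + 1\<close>, because the \<open>(- 1) ^ n\<close> gained by
  \<open>sg\<close> is opposite to the sign in \<open>D_ff\<close>. For larger \<open>c\<close> only
  the parameter drops.\<close>

lemma D_Pop:
  assumes "j + n \<le> c" "c < N"
  shows "\<exists>K. (D (j + n) j ^^ K) y = 0 \<and> D c j (Pop (j + n) j u y) =
    (if c = j + n then 0 else (\<Sum>k<K. (D (j + n) j ^^ k) (D c j y) \<cdot> ff j n (u - h) k \<cdot> sg k))"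
proof -
  obtain K' where K': "(D (j + n) j ^^ K') y = 0" using D_nilpotent[of j "j + n" y] jn n by auto
  define K where "K = Suc K'"
  have K: "(D (j + n) j ^^ K) y = 0" unfolding K_def using Dpow_zero_mono[OF K'] by simp
  have Dk: "D c j ((D (j + n) j ^^ k) y \<cdot> ff j n u k \<cdot> sg k) =
      D c j ((D (j + n) j ^^ k) y) \<cdot> ff j n (u - h) k \<cdot> sg k
      + (if c = j + n then (D (j + n) j ^^ k) y \<cdot> ((- 1) ^ (n - 1) * (of_nat k * ff j n (u - h) (k - 1))) \<cdot> sg k else 0)" for k
    using jn n assms D_ff[OF _ n assms u cls_Dpow] by (simp add: D_act_scal scal_sg act_add_left)
  show ?thesis
  proof (cases "c = j + n")
    case True
    define f where "f = (\<lambda>k. (D (j + n) j ^^ Suc k) y \<cdot> ff j n (u - h) k \<cdot> sg k)"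
    have "(D (j + n) j ^^ k) y \<cdot> ((- 1) ^ (n - 1) * (of_nat k * ff j n (u - h) (k - 1))) \<cdot> sg k
        = - (if k = 0 then 0 else f (k - 1))" for k
    proof (cases k)
      case (Suc m)
      have "of_nat (Suc m) * ff j n (u - h) m = ff j n (u - h) m * of_nat (Suc m)"
        by (rule mult_of_nat_commute)
      then have "(- 1) ^ (n - 1) * (of_nat k * ff j n (u - h) (k - 1)) * sg k =
          (- 1) ^ (n - 1) * (ff j n (u - h) m * ((- 1) ^ n * sg m))"
        using sg_Suc[of m] unfolding Suc by (simp add: mult.assoc)
      also have "\<dots> = - (ff j n (u - h) m * sg m)"
        using n by (auto simp: minus_one_power_iff)
      finally show ?thesis unfolding f_def Suc by (simp add: act_minus_right flip: act_mult)
    qed simp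
    then have "D c j (Pop (j + n) j u y) = (\<Sum>k<Suc K'. f k - (if k = 0 then 0 else f (k - 1)))"
      unfolding Pop_sum[OF K] D_sum Dk K_def using True by (intro sum.cong) (auto simp: f_def)
    also have "\<dots> = f K'" by (rule sum_telescope)
    also have "f K' = 0" unfolding f_def using Dpow_zero_mono[OF K', of "Suc K'"] by simp
    finally show ?thesis using K True by auto
  next
    case False
    have "D c j (D (j + n) j x) = D (j + n) j (D c j x)" for x
      using jn n assms by (subst D_D) auto
    then have "D c j ((D (j + n) j ^^ k) y) = (D (j + n) j ^^ k) (D c j y)" for k
      by (rule D_Dpow_commute)
    then show ?thesis using K False unfolding Pop_sum[OF K] D_sum Dk by auto
  qed
qed

text \<open>Row \<open>j + n\<close> joins the block because \<open>D_Pop\<close> makes its action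
  in column \<open>j\<close>, and with it the whole row, vanish. For a lower row \<open>c\<close>
  the new column \<open>j + n\<close> is reached through the bracket of the matrix units
  \<open>(c, j + n)\<close> and \<open>(j + n, j)\<close>, which is the unit
  \<open>(c, j)\<close>.\<close>

lemma cls_Suc_Pop:
  assumes "dz (j + n) y"
  shows "cls j (Suc n) u (Pop (j + n) j u y) \<and> dz (j + Suc n) (Pop (j + n) j u y)"
proof
  let ?a = "j + n"
  let ?y = "Pop ?a j u y"
  have c: "cls j n u ?y" by (rule cls_Pop)
  have 0: "D ?a j ?y = 0" using D_Pop[of ?a] jn by auto
  have wh: "wh j (Suc n) ?y"
    unfolding wh_def
  proof (intro allI impI)
    fix p q assume pq: "j \<le> q" "q < p" "p < j + Suc n"
    show "D p q ?y = 0"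
    proof (cases "p = ?a")
      case True
      then have "D ?a (j + (q - j)) ?y = D ?a j ?y \<cdot> ((- 1) ^ (q - j) * MM j (q - j) u)"
        using pq jn by (intro clsD(2)[OF c]) auto
      then show ?thesis using True pq 0 by simp
    next
      case False
      then show ?thesis using clsD(1)[OF c] pq by (auto simp: wh_def)
    qed
  qed
  show "cls j (Suc n) u ?y"
    unfolding cls_def
  proof (intro conjI wh allI impI)
    fix c b assume cb: "j + Suc n \<le> c" "c < N" "b < Suc n"
    show "D c (j + b) ?y = D c j ?y \<cdot> ((- 1) ^ b * MM j b u)"
    proof (cases "b = n")
      case False
      then show ?thesis using cb by (intro clsD(2)[OF cls_Pop]) auto
    next
      case True
      \<comment> \<open>By \<open>dz\<close> the operator kills \<open>y\<close>, so only the
        \<open>k\<close> brackets with the factors \<open>D ?a j\<close> contribute, and all of them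
        give the same term.\<close>
      have Dc: "D c ?a ((D ?a j ^^ k) y) = (D ?a j ^^ (k - 1)) (D c j y) \<cdot> of_nat k" for k
      proof (induction k)
        case 0
        then show ?case using assms cb by (simp add: dz_def)
      next
        case (Suc k)
        have comm: "D c j (D ?a j x) = D ?a j (D c j x)" for x
          using jn n cb by (subst D_D) auto
        have "D c ?a ((D ?a j ^^ Suc k) y) = D ?a j (D c ?a ((D ?a j ^^ k) y)) + D c j ((D ?a j ^^ k) y)"
          using jn n cb by (simp add: D_D[of ?a c j ?a])
        also have "D ?a j (D c ?a ((D ?a j ^^ k) y)) = (D ?a j ^^ k) (D c j y) \<cdot> of_nat k"
          unfolding Suc using jn n by (cases k) (simp_all only: D_act_scal scal_of_nat, simp_all)
        finally show ?case by (simp add: D_Dpow_commute[OF comm] act_add_right)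
      qed
      obtain K where K: "(D ?a j ^^ K) y = 0"
        and DK: "D c j ?y = (\<Sum>k<K. (D ?a j ^^ k) (D c j y) \<cdot> ff j n (u - h) k \<cdot> sg k)"
        using D_Pop[of c] cb by auto
      have K1: "(D ?a j ^^ Suc K) y = 0" using Dpow_zero_mono[OF K] by simp
      have adff: "ad c ?a (ff j n u k) = 0" for k
        using jn cb u by (intro ad_ff ad_MM_outside) auto
      have "D c ?a ?y = (\<Sum>k<Suc K. (D ?a j ^^ (k - 1)) (D c j y) \<cdot> of_nat k \<cdot> ff j n u k \<cdot> sg k)"
        unfolding Pop_sum[OF K1] D_sum
        using cb by (intro sum.cong refl) (simp add: D_act adff Dc scalD(2)[OF scal_sg])
      \<comment> \<open>The factor \<open>k\<close> merges with \<open>1 / k!\<close> and one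
        principal minor is split off, so the series for column \<open>j + n\<close> is the one for
        column \<open>j\<close>, shifted by one place.\<close>
      also have "\<dots> = (\<Sum>k<Suc K. if k = 0 then 0 else (\<lambda>m. (D ?a j ^^ m) (D c j y) \<cdot> ff j n (u - h) m \<cdot> sg m \<cdot> ((- 1) ^ n * MM j n u)) (k - 1))"
      proof (rule sum.cong[OF refl])
        fix k assume "k \<in> {..<Suc K}"
        show "(D ?a j ^^ (k - 1)) (D c j y) \<cdot> of_nat k \<cdot> ff j n u k \<cdot> sg k =
          (if k = 0 then 0 else (\<lambda>m. (D ?a j ^^ m) (D c j y) \<cdot> ff j n (u - h) m \<cdot> sg m \<cdot> ((- 1) ^ n * MM j n u)) (k - 1))"
        proof (cases k)
          case (Suc m)
          have "of_nat k * ff j n u k * sg k = ff j n u (Suc m) * (of_nat (Suc m) * sg (Suc m))"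
            using mult_of_nat_commute[of k "ff j n u k"] by (simp only: Suc mult.assoc)
          also have "\<dots> = ff j n (u - h) m * MM j n u * ((- 1) ^ n * sg m)"
            using jn by (simp only: sg_Suc ff_Suc_right[OF u] less_imp_le)
          also have "\<dots> = ff j n (u - h) m * sg m * ((- 1) ^ n * MM j n u)"
            using scalD(1)[OF scal_sg, of m "MM j n u"] by (auto simp: minus_one_power_iff mult.assoc)
          finally show ?thesis using Suc by (simp del: of_nat_Suc flip: act_mult)
        qed simp
      qed
      also have "\<dots> = D c j ?y \<cdot> ((- 1) ^ n * MM j n u)"
        unfolding DK act_sum_left
        by (rule sum_shift[of "\<lambda>m. (D ?a j ^^ m) (D c j y) \<cdot> ff j n (u - h) m \<cdot> sg m \<cdot> ((- 1) ^ n * MM j n u)"])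
      finally show ?thesis using True by simp
    qed
  qed
  show "dz (j + Suc n) ?y"
    unfolding dz_def
  proof (intro allI impI)
    fix p q assume pq: "j + Suc n \<le> q" "q < p" "p < N"
    have comm: "D p q (D ?a j x) = D ?a j (D p q x)" for x
      using jn n pq by (subst D_D) auto
    have "D p q ?y = Dexp ?a j (\<lambda>k. (- 1) ^ ((?a - j) * k) * ff j (?a - j) u k) (D p q y)"
      unfolding Pop_def
    proof (rule D_Dexp_commute[OF _ _ _ _ comm])
      fix k
      have "ad p q (ff j n u k) = 0" using jn pq u by (intro ad_ff ad_MM_outside) auto
      then show "ad p q ((- 1) ^ ((?a - j) * k) * ff j (?a - j) u k) = 0"
        by (cases "even (n * k)") (simp_all add: ad_minus)
    qed (use jn n pq in auto)
    also have "D p q y = 0" using assms pq by (simp add: dz_def)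
    finally show "D p q ?y = 0" by (simp add: Dexp_0)
  qed
qed

end

lemma cls_1: "cls j (Suc 0) u y"
  by (simp add: cls_def wh_def MM_0)

lemma fold_Pop:
  assumes "dz (Suc j) y" "scal u"
  shows "j + m < N \<Longrightarrow> cls j (Suc m) u (fold (\<lambda>a. Pop a j u) [Suc j..<Suc (j + m)] y)
    \<and> dz (j + Suc m) (fold (\<lambda>a. Pop a j u) [Suc j..<Suc (j + m)] y)"
proof (induction m)
  case 0
  show ?case using assms by (simp add: cls_1)
next
  case (Suc m)
  then show ?case using cls_Suc_Pop[of j "Suc m" u] assms by simp
qed

text \<open>The arguments of \<open>P\<close> in the definition of
  \<open>\<phi>\<^sup>\<psi>\<^sub>k\<close>; as indices start at 0 here, \<open>uu j\<close> is the
  entry with number \<open>j + 1\<close>.\<close>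

definition uu :: "nat \<Rightarrow> 'u"
  where "uu j = of_nat (N - Suc j) * h"

lemma scal_uu: "scal (uu j)"
  unfolding uu_def by (intro scal_intros)

definition PM :: "nat \<Rightarrow> 'y \<Rightarrow> 'y"
  where "PM m = fold (\<lambda>j. fold (\<lambda>a. Pop a j (uu j)) [Suc j..<N]) (rev [m..<N])"

text \<open>Downward induction on the column: the factors of column \<open>m\<close> enlarge the
  block that starts at \<open>m\<close> from one index to all the remaining ones.\<close>

lemma dz_PM: "m \<le> N \<Longrightarrow> dz m (PM m y)"
proof (induction m rule: inc_induct)
  case base
  show ?case by (simp add: dz_def)
next
  case (step m)
  let ?y = "PM (Suc m) y"
  have "PM m y = fold (\<lambda>a. Pop a m (uu m)) [Suc m..<Suc (m + (N - Suc m))] ?y"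
    using step by (simp add: PM_def upt_conv_Cons)
  moreover have "cls m (Suc (N - Suc m)) (uu m) (fold (\<lambda>a. Pop a m (uu m)) [Suc m..<Suc (m + (N - Suc m))] ?y)"
    using fold_Pop[OF step.IH scal_uu[of m], of "N - Suc m"] step by simp
  ultimately have "wh m (N - m) (PM m y)" using step by (simp add: cls_def Suc_diff_Suc)
  then show ?case using step by (auto simp: wh_def dz_def)
qed

end


section \<open>Invariants and the Borel subalgebra\<close>

context whittaker_exp begin

text \<open>The bound \<open>p\<close> counts the columns still present. The operator
  \<open>P\<close> changes vectors within \<open>p = N - 1\<close>, and for invariants the columns
  are removed one by one down to \<open>p = 0\<close>, where only zero is left.\<close>

inductive_set bu :: "nat \<Rightarrow> 'y set" for p :: nat
  where
    zero: "0 \<in> bu p"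
  | add: "x \<in> bu p \<Longrightarrow> y \<in> bu p \<Longrightarrow> x + y \<in> bu p"
  | gen: "i \<le> j \<Longrightarrow> j < p \<Longrightarrow> x \<cdot> lf i j (uu j) \<in> bu p"

lemma bu_minus: "x \<in> bu p \<Longrightarrow> - x \<in> bu p"
proof (induction rule: bu.induct)
  case (gen i j x)
  then show ?case using bu.gen[of i j p "- x"] by (simp add: act_minus_left)
next
  case (add x y)
  then show ?case unfolding minus_add_distrib by (intro bu.add)
qed (simp add: bu.zero)

lemma bu_diff: "x \<in> bu p \<Longrightarrow> y \<in> bu p \<Longrightarrow> x - y \<in> bu p"
  using bu.add[of x p "- y"] bu_minus by simp

lemma bu_sum: "(\<And>a. a \<in> A \<Longrightarrow> f a \<in> bu p) \<Longrightarrow> sum f A \<in> bu p"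
  by (induction A rule: infinite_finite_induct) (auto intro: bu.intros)

text \<open>The expansion along the last column puts an entry of column \<open>j + m\<close> at the
  right end. Its parameter is \<open>uu j - of_nat m * h = uu (j + m)\<close>: the arguments of
  \<open>P\<close> fit together across the columns.\<close>

lemma MM_uu_bu:
  assumes "j + Suc m < N"
  shows "x \<cdot> MM j (Suc m) (uu j) \<in> bu (N - 1)"
proof -
  have u: "uu j - of_nat m * h = uu (j + m)"
  proof -
    have "N - Suc j = N - Suc (j + m) + m" using assms by simp
    then have "uu j = of_nat (N - Suc (j + m) + m) * h" by (simp add: uu_def)
    then show ?thesis by (simp add: uu_def distrib_right)
  qed
  have "MM j (Suc m) (uu j) = (\<Sum>b\<le>m. (- 1) ^ (m + b) *
      qm (take b [j..<Suc (j + m)] @ drop (Suc b) [j..<Suc (j + m)]) [j..<j + m] (uu j) *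
      lf ([j..<Suc (j + m)] ! b) (j + m) (uu (j + m)))"
    using qm_snoc[of "[j..<Suc (j + m)]" "[j..<j + m]" "j + m" "uu j"] by (simp add: MM_def u)
  then have "x \<cdot> MM j (Suc m) (uu j) = (\<Sum>b\<le>m. x \<cdot> ((- 1) ^ (m + b) *
      qm (take b [j..<Suc (j + m)] @ drop (Suc b) [j..<Suc (j + m)]) [j..<j + m] (uu j)) \<cdot>
      lf ([j..<Suc (j + m)] ! b) (j + m) (uu (j + m)))"
    by (simp only: act_sum_right act_mult)
  also have "\<dots> \<in> bu (N - 1)"
  proof (intro bu_sum bu.gen)
    fix b assume "b \<in> {..m}"
    then show "[j..<Suc (j + m)] ! b \<le> j + m" by (simp del: upt_Suc)
  qed (use assms in simp)
  finally show ?thesis .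
qed

text \<open>The term \<open>k = 0\<close> is \<open>y\<close>, and every other term ends in a
  principal minor at \<open>uu j\<close>.\<close>

lemma Pop_bu:
  assumes "j < a" "a < N"
  shows "Pop a j (uu j) y - y \<in> bu (N - 1)"
proof -
  obtain K' where K': "(D a j ^^ K') y = 0" using D_nilpotent[OF assms] by blast
  then have K: "(D a j ^^ Suc K') y = 0" by simp
  define n where "n = a - j - 1"
  have an: "a - j = Suc n" "a = j + Suc n" using assms by (simp_all add: n_def)
  let ?g = "\<lambda>k. (- 1) ^ (Suc n * k) * ff j (Suc n) (uu j) k"
  have "Pop a j (uu j) y - y = (\<Sum>k<K'. (D a j ^^ Suc k) y \<cdot> (q (Suc k) * ?g (Suc k)))"
    unfolding Pop_def an(1) Dexp_sum[OF K] sum.lessThan_Suc_shift by (simp add: q_0)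
  also have "\<dots> = (\<Sum>k<K'. (D a j ^^ Suc k) y \<cdot> (q (Suc k) * ((- 1) ^ (Suc n * Suc k) * ff j (Suc n) (uu j - h) k)) \<cdot> MM j (Suc n) (uu j))"
    using assms an by (intro sum.cong refl) (simp only: ff_Suc_right[OF scal_uu] less_imp_le mult.assoc act_mult)
  also have "\<dots> \<in> bu (N - 1)" using assms an by (intro bu_sum MM_uu_bu) auto
  finally show ?thesis .
qed

lemma fold_bu:
  assumes "\<And>a y. a \<in> set xs \<Longrightarrow> f a y - y \<in> bu p"
  shows "fold f xs y - y \<in> bu p"
  using assms
proof (induction xs arbitrary: y)
  case (Cons a xs)
  then have "fold f xs (f a y) - f a y \<in> bu p" "f a y - y \<in> bu p" by auto
  then have "(fold f xs (f a y) - f a y) + (f a y - y) \<in> bu p" by (rule bu.add)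
  then show ?case by simp
qed (simp add: bu.zero)

lemma PM_bu: "PM 0 y - y \<in> bu (N - 1)"
  unfolding PM_def by (intro fold_bu Pop_bu) auto

definition inv_from :: "nat \<Rightarrow> nat \<Rightarrow> 'y \<Rightarrow> bool"
  where "inv_from m l z \<longleftrightarrow> (\<forall>r. l \<le> r \<longrightarrow> r \<le> m \<longrightarrow> D (Suc m) r z = 0)"

text \<open>The stages between \<open>bu (Suc m)\<close> and \<open>bu m\<close>: of column
  \<open>m\<close> only the entries above row \<open>l\<close> are left. The coefficients are
  invariant for part of row \<open>Suc m\<close>, because then \<open>E (Suc m) m\<close> acts on
  them as the identity and the next \<open>Gop\<close> can remove an entry.\<close>

inductive_set bs :: "nat \<Rightarrow> nat \<Rightarrow> 'y set" for m l :: nat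
  where
    zero: "0 \<in> bs m l"
  | add: "x \<in> bs m l \<Longrightarrow> y \<in> bs m l \<Longrightarrow> x + y \<in> bs m l"
  | gen: "i \<le> j \<Longrightarrow> j < m \<Longrightarrow> inv_from m l z \<Longrightarrow> z \<cdot> lf i j (uu j) \<in> bs m l"
  | col: "i < l \<Longrightarrow> inv_from m l z \<Longrightarrow> z \<cdot> E i m \<in> bs m l"

lemma bs_0: "x \<in> bs m 0 \<Longrightarrow> x \<in> bu m"
  by (induction rule: bs.induct) (auto intro: bu.intros)

lemma bs_minus: "x \<in> bs m l \<Longrightarrow> - x \<in> bs m l"
proof (induction rule: bs.induct)
  case (gen i j z)
  then show ?case using bs.gen[of i j m l "- z"] by (simp add: act_minus_left inv_from_def D_minus)
next
  case (col i z)
  then show ?case using bs.col[of i l m "- z"] by (simp add: act_minus_left inv_from_def D_minus)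
next
  case (add x y)
  then show ?case unfolding minus_add_distrib by (intro bs.add)
qed (simp add: bs.zero)

lemma MM_1: "MM j (Suc 0) v = lf j j v"
  by (simp add: MM_def qm_def cdet_Suc) (simp add: cdet_def)

text \<open>The operators \<open>Pop p m\<close> and, for \<open>l < m\<close>, \<open>Gop m l\<close> fix the invariants. Applied in
  succession they kill the last column of the Borel subalgebra with columns below \<open>p\<close>, and they pass
  through the other columns.\<close>

definition Gop :: "nat \<Rightarrow> nat \<Rightarrow> 'y \<Rightarrow> 'y"
  where "Gop m l = Dexp (Suc m) l (\<lambda>k. (- 1) ^ k * E l m ^ k)"

lemma power_commutes': "a * b = b * (a::'u) \<Longrightarrow> a * ((- 1) ^ k * b ^ k) = (- 1) ^ k * b ^ k * a"
proof -
  assume "a * b = b * a"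
  then have "a * b ^ k = b ^ k * a" by (rule power_commuting_commutes[symmetric, OF sym])
  then show ?thesis by (cases "even k") simp_all
qed

lemma E_E_commute: "i < N \<Longrightarrow> j < N \<Longrightarrow> k < N \<Longrightarrow> l < N \<Longrightarrow> j \<noteq> k \<Longrightarrow> l \<noteq> i \<Longrightarrow> E i j * E k l = E k l * E i j"
  using E_comm[of i j k l] by simp

lemma q_left: "a * (q k * b) = q k * (a * b)"
  using scalD(1)[OF scal_q, of k a] by (simp flip: mult.assoc)

lemma sign_left: "a * ((- 1) ^ k * b) = (- 1) ^ k * (a * (b :: 'u))"
  by (cases "even k") simp_all

section \<open>Removal of the last column of the span\<close>

context
  fixes m assumes p: "Suc m < N"
begin

lemma Pop_zero: "Pop (Suc m) m u 0 = 0"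
  by (simp add: Pop_def Dexp_0)

lemma Pop_p: "Pop (Suc m) m u = Dexp (Suc m) m (\<lambda>k. (- 1) ^ k * ff m (Suc 0) u k)"
  using p by (simp add: Pop_def)

lemma D_Pop_p: "scal u \<Longrightarrow> D (Suc m) m (Pop (Suc m) m u z) = 0"
  using D_Pop[of m "Suc 0" u z "Suc m"] p cls_1 by auto

lemma Pop_p_add: "Pop (Suc m) m u (x + y) = Pop (Suc m) m u x + Pop (Suc m) m u y"
  unfolding Pop_def using p by (intro Dexp_add) auto

lemma ff_1_commutes:
  assumes "\<And>r. a * lf m m (u - of_nat r * h) = lf m m (u + v - of_nat r * h) * a"
  shows "a * ((- 1) ^ k * ff m (Suc 0) u k) = (- 1) ^ k * ff m (Suc 0) (u + v) k * a"
proof -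
  have "a * ff m (Suc 0) u k = ff m (Suc 0) (u + v) k * a"
  proof (induction k)
    case (Suc k)
    then have "a * ff m (Suc 0) u (Suc k) = ff m (Suc 0) (u + v) k * (a * lf m m (u - of_nat k * h))"
      by (simp add: ff_Suc MM_1 flip: mult.assoc)
    then show ?case by (simp only: assms ff_Suc MM_1 mult.assoc)
  qed simp
  then show ?thesis by (cases "even k") simp_all
qed

lemma Pop_p_lf:
  assumes "i \<le> j" "j < m" "scal u" "scal v"
  shows "Pop (Suc m) m u (z \<cdot> lf i j v) = Pop (Suc m) m u z \<cdot> lf i j v"
  unfolding Pop_p
proof (rule Dexp_act)
  show "ad (Suc m) m (lf i j v) = 0" using assms p by (subst ad_lf) auto
  fix k
  have "E i j * E m m = E m m * E i j"
    using assms p by (intro E_E_commute) auto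
  then have "lf i j v * lf m m w = lf m m w * lf i j v" if "scal w" for w
    using that assms(4) by (intro lf_commutes) (auto intro!: lf_commutes[symmetric, OF _ sym])
  then show "lf i j v * ((- 1) ^ k * ff m (Suc 0) u k) = (- 1) ^ k * ff m (Suc 0) u k * lf i j v"
    using ff_1_commutes[of "lf i j v" u 0 k] assms(3) scal_sub by simp
qed (use p in auto)

text \<open>\<open>E i m\<close> does not commute with \<open>E m m\<close> but shifts it by
  \<open>h\<close>; the coefficient is therefore the series at \<open>u + h\<close>, which is
  invariant as well.\<close>

lemma Pop_p_col:
  assumes "i < m" "scal u"
  shows "Pop (Suc m) m u (z \<cdot> E i m) = Pop (Suc m) m (u + h) z \<cdot> E i m"
  unfolding Pop_p
proof (rule Dexp_act)
  show "ad (Suc m) m (E i m) = 0" using assms p by (subst ad_E) auto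
  fix k
  have "E i m * E m m = E m m * E i m + h * E i m"
    using assms p by (subst E_comm) auto
  then have "E i m * lf m m (u - of_nat r * h) = lf m m (u + h - of_nat r * h) * E i m" for r
    using scalD(1)[OF scal_sub[OF assms(2)], of r "E i m"]
    by (simp add: lf_def distrib_left distrib_right) (simp add: algebra_simps)
  then show "E i m * ((- 1) ^ k * ff m (Suc 0) u k) = (- 1) ^ k * ff m (Suc 0) (u + h) k * E i m"
    by (rule ff_1_commutes)
qed (use p in auto)

text \<open>Under \<open>D (Suc m) m\<close> the variable \<open>lf m m u\<close> has the derivative
  \<open>E (Suc m) m\<close>, which acts as the identity up to a change of the parameter by
  \<open>h\<close>. The series is the difference analogue of evaluating a Taylor expansion at zero,
  with falling factorials as powers, and it annihilates a multiple of the variable by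
  telescoping.\<close>

lemma Pop_p_kill:
  assumes "scal u"
  shows "Pop (Suc m) m u (z \<cdot> lf m m u) = 0"
proof -
  let ?e = "D (Suc m) m" and ?L = "lf m m"
  obtain K' where K': "(?e ^^ K') z = 0" using D_nilpotent[of m "Suc m" z] p by auto
  have a1: "ad (Suc m) m (?L u) = E (Suc m) m"
    using p assms by (subst ad_lf) (auto simp: lf_def)
  have a2: "ad (Suc m) m (E (Suc m) m) = 0" using p by (subst ad_E) auto
  have Epp: "x \<cdot> E (Suc m) m = x - ?e x \<cdot> h" for x using p by (subst act_E) auto
  have pow: "(?e ^^ k) (z \<cdot> ?L u) = (?e ^^ k) z \<cdot> ?L (u - of_nat k * h) + (?e ^^ (k - 1)) z \<cdot> of_nat k" for k
  proof -
    have "(?e ^^ k) (z \<cdot> ?L u) = (?e ^^ k) z \<cdot> ?L u + (?e ^^ (k - 1)) z \<cdot> (of_nat k * E (Suc m) m)"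
      using p by (intro Dpow_act a1 a2) auto
    also have "(?e ^^ (k - 1)) z \<cdot> (of_nat k * E (Suc m) m) = (?e ^^ (k - 1)) z \<cdot> E (Suc m) m \<cdot> of_nat k"
      by (simp only: act_mult act_scal[OF scal_of_nat])
    also have "\<dots> = (?e ^^ (k - 1)) z \<cdot> of_nat k - (?e ^^ k) z \<cdot> (of_nat k * h)"
      unfolding Epp by (cases k) (simp_all add: act_diff_left act_mult[symmetric] h_central[of "of_nat _"] del: of_nat_Suc)
    finally show ?thesis
      using lf_shift[of m m "u - of_nat k * h" "of_nat k * h"] by (simp add: act_add_right)
  qed
  have K: "(?e ^^ Suc K') (z \<cdot> ?L u) = 0"
    unfolding pow using K' Dpow_zero_mono[OF K', of "Suc K'"] by simp
  define f where "f = (\<lambda>k. (?e ^^ k) z \<cdot> (q k * ((- 1) ^ k * ff m (Suc 0) u (Suc k))))"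
  have comm: "?L (u - of_nat k * h) * (q k * ((- 1) ^ k * ff m (Suc 0) u k)) =
      q k * ((- 1) ^ k * ff m (Suc 0) u (Suc k))" for k
  proof -
    have "?L (u - of_nat k * h) * ff m (Suc 0) u k = ff m (Suc 0) u (Suc k)"
      using ff_commutes[of u "u - of_nat k * h" m "Suc 0" k] assms p scal_sub by (simp add: ff_Suc MM_1)
    then show ?thesis by (simp only: q_left[of "?L (u - of_nat k * h)"] sign_left[of "?L (u - of_nat k * h)"])
  qed
  have "Pop (Suc m) m u (z \<cdot> ?L u) = (\<Sum>k<Suc K'. f k - (if k = 0 then 0 else f (k - 1)))"
    unfolding Pop_p Dexp_sum[OF K]
  proof (rule sum.cong[OF refl])
    fix k
    have "(?e ^^ (k - 1)) z \<cdot> of_nat k \<cdot> (q k * ((- 1) ^ k * ff m (Suc 0) u k)) = - (if k = 0 then 0 else f (k - 1))"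
    proof (cases k)
      case (Suc n)
      have "of_nat k * (q k * ((- 1) ^ k * ff m (Suc 0) u k)) = q n * ((- 1) ^ Suc n * ff m (Suc 0) u (Suc n))"
        unfolding mult.assoc[symmetric] by (simp only: Suc q_Suc)
      then show ?thesis using Suc by (simp add: f_def act_minus_right del: of_nat_Suc flip: act_mult)
    qed simp
    then show "(?e ^^ k) (z \<cdot> ?L u) \<cdot> (q k * ((- 1) ^ k * ff m (Suc 0) u k)) = f k - (if k = 0 then 0 else f (k - 1))"
      unfolding pow act_add_left by (simp add: f_def comm flip: act_mult)
  qed
  also have "\<dots> = f K'" by (rule sum_telescope)
  finally show ?thesis using K' by (simp add: f_def)
qed

lemma Pop_bs: "y \<in> bu (Suc m) \<Longrightarrow> Pop (Suc m) m (uu m) y \<in> bs m m"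
proof (induction rule: bu.induct)
  case zero
  show ?case by (simp add: Pop_zero bs.zero)
next
  case (add x y)
  then show ?case by (simp add: Pop_p_add bs.add)
next
  case (gen i j x)
  have inv: "inv_from m m (Pop (Suc m) m u z)" if "scal u" for u z
    unfolding inv_from_def
  proof (intro allI impI)
    fix r assume "m \<le> r" "r \<le> m"
    then have "r = m" by simp
    then show "D (Suc m) r (Pop (Suc m) m u z) = 0" using D_Pop_p[OF that] by simp
  qed
  consider "j < m" | "j = m" "i < m" | "j = m" "i = m" using gen by linarith
  then show ?case
  proof cases
    case 1
    then show ?thesis using gen bs.gen[OF _ _ inv[OF scal_uu]] by (simp add: Pop_p_lf scal_uu)
  next
    case 2
    then have "lf i j (uu j) = E i m" by (simp add: lf_def)
    then show ?thesis using 2 bs.col[OF _ inv] scal_uu scal_h by (simp add: Pop_p_col scal_add)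
  next
    case 3
    then show ?thesis using Pop_p_kill[OF scal_uu] by (simp add: bs.zero)
  qed
qed

context
  fixes l assumes l: "l < m"
begin

lemma Gop_zero: "Gop m l 0 = 0"
  by (simp add: Gop_def Dexp_0)

lemma Gop_add: "Gop m l (x + y) = Gop m l x + Gop m l y"
  unfolding Gop_def using p l by (intro Dexp_add) auto

lemma Gop_act:
  assumes "ad (Suc m) l a = 0" "a * E l m = E l m * a"
  shows "Gop m l (z \<cdot> a) = Gop m l z \<cdot> a"
  unfolding Gop_def using p l assms by (intro Dexp_act power_commutes') auto

lemma D_Gop:
  assumes "r \<noteq> l" "r \<le> m"
  shows "D (Suc m) r (Gop m l z) = Gop m l (D (Suc m) r z)"
  unfolding Gop_def
proof (rule D_Dexp_commute)
  show "D (Suc m) r (D (Suc m) l x) = D (Suc m) l (D (Suc m) r x)" for x using p l assms by (subst D_D) auto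
  have "ad (Suc m) r (E l m) = 0" using p l assms by (subst ad_E) auto
  then have "ad (Suc m) r (E l m ^ k) = 0" for k by (induction k) (simp_all add: ad_1 ad_mult)
  then show "ad (Suc m) r ((- 1) ^ k * E l m ^ k) = 0" for k by (cases "even k") (simp_all add: ad_minus)
qed (use p l assms in auto)

lemma ad_pl: "ad (Suc m) l (E l m) = E (Suc m) m"
  using p l by (subst ad_E) auto

lemma act_ad_power:
  assumes "x \<cdot> E (Suc m) m = x"
  shows "x \<cdot> ad (Suc m) l (E l m ^ k) = x \<cdot> (of_nat k * E l m ^ (k - 1))"
  using assms
proof (induction k arbitrary: x)
  case (Suc k)
  have comm: "E (Suc m) m * E l m = E l m * E (Suc m) m"
    using p l by (intro E_E_commute) auto
  have "x \<cdot> E l m \<cdot> E (Suc m) m = x \<cdot> E l m"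
    using Suc.prems comm by (metis act_mult)
  then have "x \<cdot> E l m \<cdot> ad (Suc m) l (E l m ^ k) = x \<cdot> E l m \<cdot> (of_nat k * E l m ^ (k - 1))"
    by (rule Suc.IH)
  also have "\<dots> = x \<cdot> (of_nat k * E l m ^ k)"
    unfolding act_mult[symmetric] using mult_of_nat_commute[of k "E l m"]
    by (cases k) (simp_all flip: mult.assoc)
  finally show ?case
    using Suc.prems by (simp add: ad_mult ad_pl act_add_right act_mult distrib_right)
qed (simp add: ad_1)

lemma q_sign: "of_nat (Suc k) * (q (Suc k) * ((- 1) ^ Suc k * a)) = - (q k * ((- 1) ^ k * a))"
  unfolding mult.assoc[symmetric] q_Suc by simp

lemma inv_from_pow:
  assumes "D (Suc m) r x = 0" "r \<le> m"
  shows "D (Suc m) r ((D (Suc m) l ^^ k) x) = 0"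
proof (cases "r = l")
  case True
  then show ?thesis using assms by (metis Dpow_0 comp_apply funpow_swap1 funpow.simps(2))
next
  case False
  then have "D (Suc m) r (D (Suc m) l x) = D (Suc m) l (D (Suc m) r x)" for x using p l assms by (subst D_D) auto
  then show ?thesis using assms by (simp add: D_Dpow_commute)
qed

text \<open>By the hypothesis, \<open>E (Suc m) m = ad (Suc m) l (E l m)\<close> acts on
  \<open>z\<close> and its derivatives as the identity. So \<open>E l m\<close> is a variable with
  derivative 1 under \<open>D (Suc m) l\<close>, and \<open>Gop\<close> evaluates the Taylor
  expansion at zero. The derivative of the result telescopes to zero.\<close>

lemma D_Gop_l:
  assumes "D (Suc m) m z = 0"
  shows "D (Suc m) l (Gop m l z) = 0"
proof -
  let ?e = "D (Suc m) l" and ?E = "E l m"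
  obtain K' where K': "(?e ^^ K') z = 0" using D_nilpotent[of l "Suc m" z] p l by auto
  then have K: "(?e ^^ Suc K') z = 0" by simp
  have fx: "(?e ^^ k) z \<cdot> E (Suc m) m = (?e ^^ k) z" for k
    using p inv_from_pow[OF assms, of k] by (subst act_E) auto
  define f where "f = (\<lambda>k. (?e ^^ Suc k) z \<cdot> (q k * ((- 1) ^ k * ?E ^ k)))"
  have "?e (Gop m l z) = (\<Sum>k<Suc K'. f k - (if k = 0 then 0 else f (k - 1)))"
    unfolding Gop_def Dexp_sum[OF K] D_sum
  proof (rule sum.cong[OF refl])
    fix k
    have "ad (Suc m) l (q k * ((- 1) ^ k * ?E ^ k)) = ad (Suc m) l (?E ^ k) * (q k * (- 1) ^ k)"
      using scalD(1)[OF scal_q, of k "ad (Suc m) l (?E ^ k)"] by (cases "even k") (simp_all add: ad_mult ad_minus scalD(2)[OF scal_q])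
    then have "?e ((?e ^^ k) z \<cdot> (q k * ((- 1) ^ k * ?E ^ k))) = f k + (?e ^^ k) z \<cdot> ad (Suc m) l (?E ^ k) \<cdot> (q k * (- 1) ^ k)"
      using p l by (subst D_act) (auto simp: f_def act_mult)
    also have "(?e ^^ k) z \<cdot> ad (Suc m) l (?E ^ k) \<cdot> (q k * (- 1) ^ k) = (?e ^^ k) z \<cdot> (of_nat k * ?E ^ (k - 1)) \<cdot> (q k * (- 1) ^ k)"
      by (simp add: act_ad_power[OF fx])
    also have "\<dots> = - (if k = 0 then 0 else f (k - 1))"
    proof (cases k)
      case (Suc n)
      have "?E ^ n * (q k * (- 1) ^ k) = q k * ((- 1) ^ k * ?E ^ n)"
        using scalD(1)[OF scal_q, of k "?E ^ n"] by (cases "even k") simp_all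
      then have "of_nat k * ?E ^ n * (q k * (- 1) ^ k) = - (q n * ((- 1) ^ n * ?E ^ n))"
        using q_sign[of n "?E ^ n"] unfolding Suc by (simp only: mult.assoc)
      then show ?thesis using Suc by (simp add: f_def act_minus_right flip: act_mult)
    qed simp
    finally show "?e ((?e ^^ k) z \<cdot> (q k * ((- 1) ^ k * ?E ^ k))) = f k - (if k = 0 then 0 else f (k - 1))" by simp
  qed
  also have "\<dots> = f K'" by (rule sum_telescope)
  finally show ?thesis using K by (simp add: f_def)
qed

lemma inv_from_Gop:
  assumes "inv_from m (Suc l) z"
  shows "inv_from m l (Gop m l z)"
  unfolding inv_from_def
proof (intro allI impI)
  fix r assume "l \<le> r" "r \<le> m"
  then show "D (Suc m) r (Gop m l z) = 0"
    using assms l D_Gop_l[of z] D_Gop[of r z] Gop_zero by (cases "r = l") (auto simp: inv_from_def)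
qed

text \<open>The Taylor evaluation of \<open>D_Gop_l\<close>, applied to a multiple of the
  variable.\<close>

lemma Gop_kill:
  assumes "D (Suc m) m z = 0"
  shows "Gop m l (z \<cdot> E l m) = 0"
proof -
  let ?e = "D (Suc m) l" and ?E = "E l m"
  obtain K' where K': "(?e ^^ K') z = 0" using D_nilpotent[of l "Suc m" z] p l by auto
  have fx: "(?e ^^ k) z \<cdot> E (Suc m) m = (?e ^^ k) z" for k
    using p inv_from_pow[OF assms, of k] by (subst act_E) auto
  have a2: "ad (Suc m) l (E (Suc m) m) = 0" using p l by (subst ad_E) auto
  have pow: "(?e ^^ k) (z \<cdot> ?E) = (?e ^^ k) z \<cdot> ?E + (?e ^^ (k - 1)) z \<cdot> of_nat k" for k
    using Dpow_act[OF _ _ ad_pl a2, of k z] p l fx[of "k - 1"] act_scal[OF scal_of_nat, of "(?e ^^ (k - 1)) z" k "E (Suc m) m"]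
    by (simp add: act_mult)
  have K: "(?e ^^ Suc K') (z \<cdot> ?E) = 0"
    unfolding pow using K' Dpow_zero_mono[OF K', of "Suc K'"] by simp
  define f where "f = (\<lambda>k. (?e ^^ k) z \<cdot> (q k * ((- 1) ^ k * ?E ^ Suc k)))"
  have "Gop m l (z \<cdot> ?E) = (\<Sum>k<Suc K'. f k - (if k = 0 then 0 else f (k - 1)))"
    unfolding Gop_def Dexp_sum[OF K]
  proof (rule sum.cong[OF refl])
    fix k
    have "?E * (q k * ((- 1) ^ k * ?E ^ k)) = q k * ((- 1) ^ k * ?E ^ Suc k)"
      by (simp only: q_left[of ?E] sign_left[of ?E] power_Suc)
    then have 1: "(?e ^^ k) z \<cdot> ?E \<cdot> (q k * ((- 1) ^ k * ?E ^ k)) = f k"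
      by (simp add: f_def flip: act_mult)
    have 2: "(?e ^^ (k - 1)) z \<cdot> of_nat k \<cdot> (q k * ((- 1) ^ k * ?E ^ k)) = - (if k = 0 then 0 else f (k - 1))"
    proof (cases k)
      case (Suc n)
      then show ?thesis using q_sign[of n "?E ^ Suc n"] by (simp add: f_def act_minus_right del: power_Suc of_nat_Suc flip: act_mult)
    qed simp
    show "(?e ^^ k) (z \<cdot> ?E) \<cdot> (q k * ((- 1) ^ k * ?E ^ k)) = f k - (if k = 0 then 0 else f (k - 1))"
      unfolding pow act_add_left 1 2 by simp
  qed
  also have "\<dots> = f K'" by (rule sum_telescope)
  finally show ?thesis using K' by (simp add: f_def)
qed

lemma E_power_shift:
  assumes "a * E l m = E l m * a + h * b" "b * E l m = E l m * b"
  shows "a * E l m ^ k = E l m ^ k * a + of_nat k * E l m ^ (k - 1) * b * h"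
proof (induction k)
  case (Suc k)
  let ?E = "E l m"
  have bE: "b * ?E ^ k = ?E ^ k * b" by (rule power_commuting_commutes[symmetric, OF assms(2)[symmetric]])
  have "a * ?E ^ Suc k = ?E * (a * ?E ^ k) + h * (b * ?E ^ k)"
    by (simp add: assms(1) distrib_right flip: mult.assoc)
  also have "h * (b * ?E ^ k) = ?E ^ k * b * h" unfolding bE by (rule h_central)
  also have "?E * (a * ?E ^ k) = ?E ^ Suc k * a + of_nat k * (?E * ?E ^ (k - 1)) * b * h"
    unfolding Suc using mult_of_nat_commute[of k ?E] by (simp add: distrib_left flip: mult.assoc)
  also have "of_nat k * (?E * ?E ^ (k - 1)) = of_nat k * ?E ^ k" by (cases k) simp_all
  finally show ?case by (simp add: distrib_right add_ac)
qed simp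

text \<open>The \<open>k\<close>-th derivative turns \<open>lf l l u\<close> into
  \<open>lf l l u - of_nat k * h\<close>, and this shift is undone when the element is moved past
  the \<open>k\<close>-th power of \<open>E l m\<close>.\<close>

lemma Gop_lf_diag: "Gop m l (z \<cdot> lf l l u) = Gop m l z \<cdot> lf l l u" if u: "scal u"
proof -
  let ?e = "D (Suc m) l" and ?E = "E l m"
  obtain K where K: "(?e ^^ K) z = 0" using D_nilpotent[of l "Suc m" z] p l by auto
  have a1: "ad (Suc m) l (lf l l u) = E (Suc m) l" using p l u by (subst ad_lf) (auto simp: lf_def)
  have a2: "ad (Suc m) l (E (Suc m) l) = 0" using p l by (subst ad_E) auto
  have Epl: "x \<cdot> E (Suc m) l = - (?e x \<cdot> h)" for x using p l by (subst act_E) auto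
  have pow: "(?e ^^ k) (z \<cdot> lf l l u) = (?e ^^ k) z \<cdot> (lf l l u - of_nat k * h)" for k
  proof -
    have "(?e ^^ k) (z \<cdot> lf l l u) = (?e ^^ k) z \<cdot> lf l l u + (?e ^^ (k - 1)) z \<cdot> (of_nat k * E (Suc m) l)"
      using p l by (intro Dpow_act a1 a2) auto
    also have "(?e ^^ (k - 1)) z \<cdot> (of_nat k * E (Suc m) l) = (?e ^^ (k - 1)) z \<cdot> E (Suc m) l \<cdot> of_nat k"
      by (simp only: act_mult act_scal[OF scal_of_nat])
    also have "\<dots> = - ((?e ^^ k) z \<cdot> (of_nat k * h))"
      unfolding Epl by (cases k) (simp_all add: act_minus_left act_mult[symmetric] h_central[of "of_nat _"] del: of_nat_Suc)
    finally show ?thesis by (simp add: act_diff_right)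
  qed
  have K2: "(?e ^^ K) (z \<cdot> lf l l u) = 0" unfolding pow using K by simp
  have "(lf l l u - of_nat k * h) * (q k * ((- 1) ^ k * ?E ^ k)) = q k * ((- 1) ^ k * ?E ^ k) * lf l l u" for k
  proof -
    have "E l l * ?E = ?E * E l l + h * ?E"
      using p l by (subst E_comm) auto
    then have "lf l l u * ?E = ?E * lf l l u + h * ?E"
      using scalD(1)[OF u, of ?E] by (simp add: lf_def distrib_left distrib_right)
    then have "lf l l u * ?E ^ k = ?E ^ k * lf l l u + of_nat k * ?E ^ (k - 1) * ?E * h"
      by (rule E_power_shift) simp
    also have "of_nat k * ?E ^ (k - 1) * ?E * h = of_nat k * h * ?E ^ k"
      using h_central[of "?E ^ k"] by (cases k) (simp_all add: mult.assoc power_commutes)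
    finally have "(lf l l u - of_nat k * h) * ?E ^ k = ?E ^ k * lf l l u"
      by (simp add: left_diff_distrib)
    then show ?thesis
      by (simp only: q_left[of "lf l l u - of_nat k * h"] sign_left[of "lf l l u - of_nat k * h"] mult.assoc)
  qed
  then show ?thesis
    unfolding Gop_def Dexp_sum[OF K2] Dexp_sum[OF K] pow act_sum_left act_mult[symmetric] by (simp only:)
qed

text \<open>The derivative of \<open>E l j\<close> is \<open>E (Suc m) j\<close>, which acts as zero
  because \<open>j < m\<close> and \<open>D (Suc m) j z = 0\<close>. This is a use of the invariance
  demanded in \<open>bs\<close>.\<close>

lemma Gop_row:
  assumes "l < j" "j < m" "D (Suc m) j z = 0"
  shows "Gop m l (z \<cdot> E l j) = Gop m l z \<cdot> E l j"
proof -
  let ?e = "D (Suc m) l" and ?E = "E l m"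
  obtain K where K: "(?e ^^ K) z = 0" using D_nilpotent[of l "Suc m" z] p l by auto
  have a1: "ad (Suc m) l (E l j) = E (Suc m) j" using p l assms by (subst ad_E) auto
  have a2: "ad (Suc m) l (E (Suc m) j) = 0" using p l assms by (subst ad_E) auto
  have pow: "(?e ^^ k) (z \<cdot> E l j) = (?e ^^ k) z \<cdot> E l j" for k
  proof -
    have "(?e ^^ (k - 1)) z \<cdot> E (Suc m) j = 0"
      using p assms inv_from_pow[OF assms(3), of "k - 1"] by (subst act_E) auto
    then have "(?e ^^ (k - 1)) z \<cdot> (of_nat k * E (Suc m) j) = 0"
      by (simp only: act_mult act_scal[OF scal_of_nat] act_0_left)
    then show ?thesis using Dpow_act[OF _ _ a1 a2, of k z] p l by simp
  qed
  have K2: "(?e ^^ K) (z \<cdot> E l j) = 0" unfolding pow using K by simp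
  have "E l j * ?E = ?E * E l j" using p l assms by (intro E_E_commute) auto
  then have "E l j * (q k * ((- 1) ^ k * ?E ^ k)) = q k * ((- 1) ^ k * ?E ^ k) * E l j" for k
    using power_commutes'[of "E l j" ?E k] by (simp only: q_left[of "E l j"] mult.assoc)
  then show ?thesis
    unfolding Gop_def Dexp_sum[OF K2] Dexp_sum[OF K] pow act_sum_left act_mult[symmetric] by (simp only:)
qed

text \<open>\<open>E i l\<close> does not commute with \<open>E l m\<close>, and their bracket
  leaves a correction in column \<open>m\<close> above row \<open>l\<close>. For this reason the
  stages \<open>bs\<close> contain generators in that column.\<close>

lemma Gop_col:
  assumes "i < l"
  shows "Gop m l (z \<cdot> E i l) = Gop m l z \<cdot> E i l - Gop m l (D (Suc m) l z) \<cdot> h \<cdot> E i m"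
proof -
  let ?e = "D (Suc m) l" and ?E = "E l m" and ?b = "E i m"
  obtain K where K: "(?e ^^ K) z = 0" using D_nilpotent[of l "Suc m" z] p l by auto
  have K1: "(?e ^^ Suc K) z = 0" using K by simp
  have swap: "(?e ^^ Suc k) z = (?e ^^ k) (?e z)" for k by (simp only: funpow_Suc_right o_apply)
  have Ke: "(?e ^^ K) (?e z) = 0" using K1 unfolding swap .
  have a1: "ad (Suc m) l (E i l) = 0" using p l assms by (subst ad_E) auto
  have pow: "(?e ^^ k) (z \<cdot> E i l) = (?e ^^ k) z \<cdot> E i l" for k
    using Dpow_act[OF _ _ a1, of k z] p l by (simp add: ad_0)
  have K2: "(?e ^^ Suc K) (z \<cdot> E i l) = 0" unfolding pow K1 by simp
  have step: "E i l * (q k * ((- 1) ^ k * ?E ^ k)) = q k * ((- 1) ^ k * ?E ^ k) * E i l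
      - (if k = 0 then 0 else q (k - 1) * ((- 1) ^ (k - 1) * ?E ^ (k - 1)) * (h * ?b))" for k
  proof -
    have 1: "E i l * ?E = ?E * E i l + h * ?b" using p l assms by (subst E_comm) auto
    have 2: "?b * ?E = ?E * ?b" using p l assms by (intro E_E_commute) auto
    have "E i l * (q k * ((- 1) ^ k * ?E ^ k)) = q k * ((- 1) ^ k * (E i l * ?E ^ k))"
      by (simp only: q_left[of "E i l"] sign_left[of "E i l"])
    also have "E i l * ?E ^ k = ?E ^ k * E i l + of_nat k * ?E ^ (k - 1) * ?b * h"
      by (rule E_power_shift[OF 1 2])
    also have "of_nat k * ?E ^ (k - 1) * ?b * h = of_nat k * (?E ^ (k - 1) * (h * ?b))"
      using h_central[of ?b] by (simp add: mult.assoc)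
    also have "q k * ((- 1) ^ k * (?E ^ k * E i l + of_nat k * (?E ^ (k - 1) * (h * ?b)))) =
        q k * ((- 1) ^ k * ?E ^ k) * E i l + of_nat k * (q k * ((- 1) ^ k * (?E ^ (k - 1) * (h * ?b))))"
      using mult_of_nat_commute[of k "q k * (- 1) ^ k"] by (simp add: distrib_left mult.assoc[symmetric])
    also have "of_nat k * (q k * ((- 1) ^ k * (?E ^ (k - 1) * (h * ?b)))) =
        - (if k = 0 then 0 else q (k - 1) * ((- 1) ^ (k - 1) * ?E ^ (k - 1)) * (h * ?b))"
      using q_sign[of "k - 1" "?E ^ (k - 1) * (h * ?b)"] by (cases k) (simp_all only:, simp_all add: mult.assoc)
    finally show ?thesis by simp
  qed
  define f where "f = (\<lambda>k. (?e ^^ Suc k) z \<cdot> (q k * ((- 1) ^ k * ?E ^ k)) \<cdot> (h * ?b))"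
  have "Gop m l (z \<cdot> E i l) = (\<Sum>k<Suc K. (?e ^^ k) z \<cdot> (q k * ((- 1) ^ k * ?E ^ k)) \<cdot> E i l - (if k = 0 then 0 else f (k - 1)))"
    unfolding Gop_def Dexp_sum[OF K2] pow
  proof (rule sum.cong[OF refl])
    fix k
    show "(?e ^^ k) z \<cdot> E i l \<cdot> (q k * ((- 1) ^ k * ?E ^ k)) =
        (?e ^^ k) z \<cdot> (q k * ((- 1) ^ k * ?E ^ k)) \<cdot> E i l - (if k = 0 then 0 else f (k - 1))"
      unfolding act_mult[symmetric, of _ "E i l"] step
    proof (cases k)
      case (Suc n)
      show "(?e ^^ k) z \<cdot> (q k * ((- 1) ^ k * ?E ^ k) * E i l -
          (if k = 0 then 0 else q (k - 1) * ((- 1) ^ (k - 1) * ?E ^ (k - 1)) * (h * ?b))) =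
        (?e ^^ k) z \<cdot> (q k * ((- 1) ^ k * ?E ^ k)) \<cdot> E i l - (if k = 0 then 0 else f (k - 1))"
        unfolding act_diff_right act_mult[of _ _ "E i l"] using Suc by (simp add: f_def act_mult[of _ _ "h * ?b"] del: power_Suc)
    qed (simp add: act_mult)
  qed
  also have "\<dots> = Gop m l z \<cdot> E i l - (\<Sum>k<K. f k)"
    unfolding sum_subtractf Gop_def Dexp_sum[OF K1] act_sum_left using sum_shift[of f K] by (simp only:)
  also have "(\<Sum>k<K. f k) = Gop m l (?e z) \<cdot> h \<cdot> ?b"
    unfolding Gop_def Dexp_sum[OF Ke] act_sum_left f_def swap act_mult[of _ h] ..
  finally show ?thesis .
qed

lemma Gop_bs: "y \<in> bs m (Suc l) \<Longrightarrow> Gop m l y \<in> bs m l"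
proof (induction rule: bs.induct)
  case zero
  show ?case by (simp add: Gop_zero bs.zero)
next
  case (add x y)
  then show ?case by (simp add: Gop_add bs.add)
next
  case (gen i j z)
  have inv: "inv_from m l (Gop m l z)" using gen by (intro inv_from_Gop) auto
  have ij: "i < N" "j < N" using gen p by auto
  consider "i = l" "j = l" | "i = l" "l < j" | "i < l" "j = l" | "i \<noteq> l" "j \<noteq> l" using gen(1) by linarith
  then show ?case
  proof cases
    case 1
    then show ?thesis using gen inv by (simp add: Gop_lf_diag scal_uu bs.gen)
  next
    case 2
    then have "D (Suc m) j z = 0" using gen by (simp add: inv_from_def)
    then have "Gop m l (z \<cdot> lf i j (uu j)) = Gop m l z \<cdot> lf i j (uu j)"
      using 2 gen Gop_row[of j z] by (simp add: lf_def)
    then show ?thesis using gen inv by (simp add: bs.gen)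
  next
    case 3
    have "inv_from m (Suc l) (D (Suc m) l z)"
      using gen(3) inv_from_pow[of _ z 1] by (simp add: inv_from_def)
    then have "inv_from m l (Gop m l (D (Suc m) l z))" by (rule inv_from_Gop)
    then have "inv_from m l (Gop m l (D (Suc m) l z) \<cdot> h)"
      using p by (auto simp: inv_from_def D_act_scal scal_h)
    then have "Gop m l (D (Suc m) l z) \<cdot> h \<cdot> E i m \<in> bs m l" using 3 by (intro bs.col)
    moreover have "Gop m l z \<cdot> lf i j (uu j) \<in> bs m l" using gen inv by (intro bs.gen)
    ultimately have "Gop m l z \<cdot> lf i j (uu j) + - (Gop m l (D (Suc m) l z) \<cdot> h \<cdot> E i m) \<in> bs m l"
      by (intro bs.add bs_minus)
    then show ?thesis using 3 Gop_col[of i z] by (simp add: lf_def)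
  next
    case 4
    have "ad (Suc m) l (lf i j (uu j)) = 0" using 4 gen p l ij by (subst ad_lf) (auto simp: scal_uu)
    moreover have "E i j * E l m = E l m * E i j"
      using 4 gen p l by (intro E_E_commute) auto
    then have "lf i j (uu j) * E l m = E l m * lf i j (uu j)"
      using lf_commutes[OF scal_uu, of "E l m" i j j] by simp
    ultimately show ?thesis using gen inv by (simp add: Gop_act bs.gen)
  qed
next
  case (col i z)
  have inv: "inv_from m l (Gop m l z)" using col by (intro inv_from_Gop) auto
  show ?case
  proof (cases "i = l")
    case True
    then show ?thesis using Gop_kill[of z] col l by (simp add: inv_from_def bs.zero)
  next
    case False
    then have i: "i < l" using col by simp
    have "ad (Suc m) l (E i m) = 0" using i p l by (subst ad_E) auto
    moreover have "E i m * E l m = E l m * E i m"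
      using i p l by (intro E_E_commute) auto
    ultimately show ?thesis using i inv by (simp add: Gop_act bs.col)
  qed
qed

end

text \<open>On an invariant all the series reduce to the term \<open>k = 0\<close>. So
  \<open>y\<close> is its own image under \<open>Pop\<close> and under each \<open>Gop\<close>,
  while these images run through the stages down to \<open>bs m 0\<close>.\<close>

lemma bu_step:
  assumes "y \<in> bu (Suc m)" "dz 0 y"
  shows "y \<in> bu m"
proof -
  have D: "D (Suc m) l y = 0" if "l < (Suc m)" for l using assms(2) p that by (simp add: dz_def)
  have "y \<in> bs m l" if "l \<le> m" for l
    using that
  proof (induction l rule: inc_induct)
    case base
    have "Pop (Suc m) m (uu m) y = y"
      unfolding Pop_p using D p by (intro Dexp_id) auto
    then show ?case using Pop_bs[OF assms(1)] by simp
  next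
    case (step l)
    have "Gop m l y = y" unfolding Gop_def using D step by (intro Dexp_id) auto
    then show ?case using Gop_bs[of l y] step by simp
  qed
  then show ?thesis by (intro bs_0) simp
qed

end

theorem bu_invariant_zero:
  assumes "dz 0 y" "y \<in> bu (N - 1)"
  shows "y = 0"
proof -
  have "y \<in> bu p \<Longrightarrow> p \<le> N - 1 \<Longrightarrow> y = 0" for p
  proof (induction p)
    case 0
    from 0(1) show ?case by (induction rule: bu.induct) auto
  next
    case (Suc p)
    then have "y \<in> bu p" using assms(1) bu_step[of p y] by simp
    then show ?case using Suc by simp
  qed
  then show ?thesis using assms by blast
qed

theorem PM_eq:
  assumes "dz 0 y" "y - x \<in> bu (N - 1)"
  shows "PM 0 x = y"
proof -
  have "(PM 0 x - x) - (y - x) \<in> bu (N - 1)" by (rule bu_diff[OF PM_bu assms(2)])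
  moreover have "dz 0 (PM 0 x - y)" using dz_PM[of 0 x] assms(1) by (simp add: dz_def D_diff)
  ultimately have "PM 0 x - y = 0" by (intro bu_invariant_zero) simp_all
  then show ?thesis by simp
qed

end


section \<open>The Kostant--Whittaker quotient\<close>

text \<open>Inverse to \<open>idx\<close> up to the shift by one between the two numberings. Values
  outside \<open>{..<CARD('n)}\<close> are unspecified, hence the bounds in what follows.\<close>

definition en :: "nat \<Rightarrow> 'n::{finite,linorder}"
  where "en p = sorted_list_of_set UNIV ! p"

lemma en_less: "p < q \<Longrightarrow> q < CARD('n) \<Longrightarrow> en p < (en q :: 'n::{finite,linorder})"
  unfolding en_def
  by (rule sorted_wrt_nth_less[OF strict_sorted_list_of_set]) simp_all

lemma en_less_iff: "p < CARD('n) \<Longrightarrow> q < CARD('n) \<Longrightarrow> en p < (en q :: 'n::{finite,linorder}) \<longleftrightarrow> p < q"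
  by (metis en_less linorder_neqE_nat order.asym)

lemma en_eq_iff: "p < CARD('n) \<Longrightarrow> q < CARD('n) \<Longrightarrow> en p = (en q :: 'n::{finite,linorder}) \<longleftrightarrow> p = q"
  by (metis en_less linorder_neqE_nat order.irrefl)

lemma en_surj: "\<exists>p<CARD('n). i = (en p :: 'n::{finite,linorder})"
proof -
  have "i \<in> set (sorted_list_of_set UNIV)" by simp
  then show ?thesis unfolding en_def in_set_conv_nth by auto
qed

lemma bij_en: "bij_betw (en :: nat \<Rightarrow> 'n::{finite,linorder}) {..<CARD('n)} UNIV"
proof -
  have "x \<in> en ` {..<CARD('n)}" for x :: 'n using en_surj[of x] by auto
  then show ?thesis unfolding bij_betw_def inj_on_def using en_eq_iff[where 'n = 'n] by auto
qed

lemma idx_en: "p < CARD('n) \<Longrightarrow> idx (en p :: 'n::{finite,linorder}) = Suc p"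
proof -
  assume p: "p < CARD('n)"
  have "{..en p :: 'n} = en ` {..p}"
  proof (intro equalityI subsetI)
    fix i assume "i \<in> {..en p :: 'n}"
    moreover obtain r where "r < CARD('n)" "i = en r" using en_surj[of i] by auto
    ultimately show "i \<in> en ` {..p}" using en_less_iff[of p r, where 'n = 'n] p by auto
  next
    fix i :: 'n assume "i \<in> en ` {..p}"
    then obtain r where "r \<le> p" "i = en r" by auto
    then show "i \<in> {..en p :: 'n}" using p en_less_iff[of p r, where 'n = 'n] by (auto simp: not_less[symmetric])
  qed
  moreover have "inj_on (en :: nat \<Rightarrow> 'n) {..p}" using p en_eq_iff[where 'n = 'n] by (auto simp: inj_on_def)
  ultimately show ?thesis by (simp add: idx_def card_image)
qed

lemma sorted_list_en:
  assumes "finite B" "B \<subseteq> {..<CARD('n)}"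
  shows "sorted_list_of_set (en ` B :: 'n::{finite,linorder} set) = map en (sorted_list_of_set B)"
proof (rule sorted_list_of_set_unique[THEN iffD1])
  have B: "set (sorted_list_of_set B) = B" using assms by simp
  have "sorted_wrt (<) (map (en :: nat \<Rightarrow> 'n) (sorted_list_of_set B))"
    unfolding sorted_wrt_map
    by (rule sorted_wrt_mono_rel[OF _ strict_sorted_list_of_set]) (use B assms in \<open>auto intro!: en_less\<close>)
  moreover have "card (en ` B :: 'n set) = card B"
    using assms en_eq_iff[where 'n = 'n] by (intro card_image) (auto simp: inj_on_def subset_iff)
  ultimately show "sorted_wrt (<) (map (en :: nat \<Rightarrow> 'n) (sorted_list_of_set B)) \<and> set (map en (sorted_list_of_set B)) = (en ` B :: 'n set)
      \<and> length (map (en :: nat \<Rightarrow> 'n) (sorted_list_of_set B)) = card (en ` B :: 'n set)"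
    using B by simp
qed simp

lemma en_image:
  shows "j < CARD('n) \<Longrightarrow> i < CARD('n) \<Longrightarrow> {en j..<en i :: 'n::{finite,linorder}} = en ` {j..<i}"
    and "j < CARD('n) \<Longrightarrow> {en j :: 'n<..} = en ` {Suc j..<CARD('n)}"
    and "(UNIV :: 'n set) = en ` {0..<CARD('n)}"
proof -
  have mem: "x \<in> en ` B \<longleftrightarrow> (\<exists>r\<in>B. x = en r)" for x :: 'n and B by auto
  show "{en j..<en i :: 'n} = en ` {j..<i}" if j: "j < CARD('n)" and i: "i < CARD('n)"
  proof (intro equalityI subsetI)
    fix x assume x: "x \<in> {en j..<en i :: 'n}"
    obtain r where r: "r < CARD('n)" "x = en r" using en_surj[of x] by auto
    then show "x \<in> en ` {j..<i}"
      using x i j en_less_iff[of r j, where 'n = 'n] en_less_iff[of r i, where 'n = 'n] by auto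
  next
    fix x :: 'n assume "x \<in> en ` {j..<i}"
    then obtain r where "j \<le> r" "r < i" "x = en r" by auto
    then show "x \<in> {en j..<en i :: 'n}"
      using i j en_less_iff[of r j, where 'n = 'n] en_less_iff[of r i, where 'n = 'n] by auto
  qed
  show "{en j :: 'n<..} = en ` {Suc j..<CARD('n)}" if j: "j < CARD('n)"
  proof (intro equalityI subsetI)
    fix x assume x: "x \<in> {en j :: 'n<..}"
    obtain r where r: "r < CARD('n)" "x = en r" using en_surj[of x] by auto
    then show "x \<in> en ` {Suc j..<CARD('n)}" using x j en_less_iff[of j r, where 'n = 'n] by auto
  next
    fix x :: 'n assume "x \<in> en ` {Suc j..<CARD('n)}"
    then show "x \<in> {en j :: 'n<..}" using j by (auto intro!: en_less)
  qed
  show "(UNIV :: 'n set) = en ` {0..<CARD('n)}"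
    using bij_en[where 'n = 'n] by (simp add: bij_betw_def atLeast0LessThan)
qed

lemma sum_en: "(\<Sum>i\<in>UNIV. f (i :: 'n::{finite,linorder})) = (\<Sum>p<CARD('n). f (en p))"
  using sum.reindex_bij_betw[OF bij_en, of f] by simp

lemma psi_en: "p < CARD('n) \<Longrightarrow> q < CARD('n) \<Longrightarrow> psi (en p) (en q :: 'n::{finite,linorder}) = (if p = Suc q then 1 else 0)"
  by (simp add: psi_def idx_en)

section \<open>The adjoint derivation of \<open>U\<^sub>\<hbar>(gl\<^sub>N)\<close>\<close>

lemma adU_add: "adU i j (x + y) = adU i j x + adU i j y"
  by (induction x rule: U.abs_induct, induction y rule: U.abs_induct)
    (simp add: adU.abs_eq flip: abs_U_simps(3))

lemma adU_mult: "adU i j (x * y) = adU i j x * y + x * adU i j y"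
  by (induction x rule: U.abs_induct, induction y rule: U.abs_induct)
    (simp add: adU.abs_eq flip: abs_U_simps(4))

lemma adU_E: "adU i j (E k l) = lieU i j k l"
  by (simp add: adU.abs_eq flip: abs_U_simps(2))

lemma adU_scal: "adU i j (scalU c) = 0"
  by (simp add: adU.abs_eq flip: abs_U_simps(1))

lemma adU_0: "adU i j 0 = 0"
  using adU_scal[of i j 0] by simp

lemma adU_minus: "adU i j (- x) = - adU i j x"
  using adU_add[of i j "- x" x] by (simp add: adU_0 eq_neg_iff_add_eq_0)

lemma hb_U_central: "hb_U * x = x * hb_U"
  unfolding hb_U_def by (rule scalU_central)

lemma E_adU: "E i j * x = x * E i j + hb_U * adU i j x"
proof (induction x rule: U_induct)
  case (scal c)
  show ?case by (simp add: adU_scal scalU_central)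
next
  case (E k l)
  show ?case unfolding adU_E hb_U_def by (rule E_E)
next
  case (plus z w)
  then show ?case by (simp add: adU_add distrib_left distrib_right)
next
  case (times z w)
  have "E i j * (z * w) = z * (E i j * w) + hb_U * adU i j z * w"
    using times(1) by (simp add: distrib_right mult.assoc flip: mult.assoc[of "E i j"])
  also have "\<dots> = z * w * E i j + (z * hb_U) * adU i j w + hb_U * adU i j z * w"
    using times(2) by (simp add: distrib_left mult.assoc)
  also have "z * hb_U = hb_U * z" by (rule hb_U_central[symmetric])
  finally show ?case by (simp add: adU_mult distrib_left mult.assoc)
qed

lemma scalU_half: "x + x = 0 \<Longrightarrow> x = (0 :: ('a::field_char_0, 'n) U)"
proof -
  assume x: "x + x = 0"
  have "[:1/2:] + [:1/2:] = (1 :: 'a poly)" by (simp flip: one_pCons)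
  then have "(scalU ([:1/2:] + [:1/2:]) :: ('a, 'n) U) = 1" by (simp only: scalU_1)
  then have "scalU [:1/2:] * (x + x) = x"
    by (simp only: scalU_add distrib_left flip: distrib_right) simp
  then show ?thesis using x by simp
qed

lemma funpow_zero_mono:
  fixes f :: "'b::zero \<Rightarrow> 'b"
  assumes "(f ^^ K) x = 0" "f 0 = 0" "K \<le> k"
  shows "(f ^^ k) x = 0"
proof -
  have z: "(f ^^ n) 0 = 0" for n by (induction n) (simp_all add: assms(2))
  obtain m where "k = m + K" using assms(3) by (metis add.commute le_Suc_ex)
  then show ?thesis using assms(1) z by (simp add: funpow_add)
qed

lemma adU_pow_add: "(adU i j ^^ k) (x + y) = (adU i j ^^ k) x + (adU i j ^^ k) y"
  by (induction k) (simp_all add: adU_add)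

lemma adU_pow_0: "(adU i j ^^ k) 0 = 0"
  by (induction k) (simp_all add: adU_0)

lemma adU_pow_mult:
  "k + l \<le> n \<Longrightarrow> (adU i j ^^ k) x = 0 \<Longrightarrow> (adU i j ^^ l) y = 0 \<Longrightarrow> (adU i j ^^ n) (x * y) = 0"
proof (induction n arbitrary: k l x y)
  case (Suc n)
  consider "k = 0" | "l = 0" | k' l' where "k = Suc k'" "l = Suc l'" by (cases k; cases l) auto
  then show ?case
  proof cases
    case 3
    have "(adU i j ^^ n) (adU i j x * y) = 0"
      using Suc.prems 3 by (intro Suc.IH[of k' l]) (simp_all add: funpow_swap1)
    moreover have "(adU i j ^^ n) (x * adU i j y) = 0"
      using Suc.prems 3 by (intro Suc.IH[of k l']) (simp_all add: funpow_swap1)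
    ultimately show ?thesis
      by (simp only: funpow_Suc_right o_apply adU_mult adU_pow_add) simp
  qed (use Suc.prems in \<open>simp_all add: adU_pow_0 adU_0\<close>)
qed simp

lemma adU_nilpotent: "i \<noteq> j \<Longrightarrow> \<exists>K. (adU i j ^^ K) x = (0 :: ('a::field, 'n) U)"
proof (induction x rule: U_induct)
  case (scal c)
  then show ?case by (intro exI[of _ 1]) (simp add: adU_scal)
next
  case (E k l)
  have "adU i j (adU i j (lieU i j k l)) = (0 :: ('a, 'n) U)"
    using E by (auto simp: lieU_def adU_E adU_0 adU_minus adU_add diff_conv_add_uminus simp del: add_uminus_conv_diff)
  then show ?case by (intro exI[of _ "Suc (Suc (Suc 0))"]) (simp add: adU_E)
next
  case (plus z w)
  then obtain K L where "(adU i j ^^ K) z = 0" "(adU i j ^^ L) w = 0" by auto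
  then have "(adU i j ^^ (K + L)) z = 0" "(adU i j ^^ (K + L)) w = 0"
    using funpow_zero_mono[of K "adU i j" z "K + L"] funpow_zero_mono[of L "adU i j" w "K + L"] by (simp_all add: adU_0)
  then show ?case by (intro exI[of _ "K + L"]) (simp add: adU_pow_add)
next
  case (times z w)
  then show ?case using adU_pow_mult by (metis le_refl)
qed

text \<open>Up to normalization, \<open>TA\<close> is half the difference of the left and right actions of the quadratic
  Casimir element; this is why it commutes with \<open>leftA\<close>.\<close>

definition leftA :: "('n \<Rightarrow> 'n \<Rightarrow> 'r::ring_1) \<Rightarrow> 'r \<Rightarrow> 'n \<Rightarrow> 'n \<Rightarrow> 'r ^ 'n \<Rightarrow> 'r ^ 'n::finite"
  where "leftA F h i j x = axis j (- (h * x $ i)) + (\<chi> k. F i j * x $ k)"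

definition TA :: "('n \<Rightarrow> 'n \<Rightarrow> 'r::ring_1) \<Rightarrow> 'r ^ 'n \<Rightarrow> 'r ^ 'n::finite"
  where "TA F x = (\<chi> b. \<Sum>k\<in>UNIV. F b k * x $ k)"

lemma leftA_nth: "leftA F h i j x $ m = (if m = j then - (h * x $ i) else 0) + F i j * x $ m"
  by (simp add: leftA_def axis_def)

lemma TA_leftA:
  assumes rel: "\<And>i j k l. F i j * F k l = F k l * F i j + h * ((if j = k then F i l else 0) - (if l = i then F k j else 0))"
    and h: "\<And>x. h * x = x * h"
  shows "TA F (leftA F h i j x) = leftA F h i j (TA F x)"
proof (rule vec_eq_iff[THEN iffD2], rule allI)
  fix b
  have "TA F (leftA F h i j x) $ b = (\<Sum>k\<in>UNIV. (if k = j then F b k * - (h * x $ i) else 0) + F b k * (F i j * x $ k))"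
    unfolding TA_def vec_lambda_beta leftA_nth by (intro sum.cong) (simp_all add: distrib_left)
  also have "\<dots> = F b j * - (h * x $ i) + (\<Sum>k\<in>UNIV. F b k * (F i j * x $ k))"
    by (simp add: sum.distrib)
  also have "(\<Sum>k\<in>UNIV. F b k * (F i j * x $ k)) = (\<Sum>k\<in>UNIV. F i j * (F b k * x $ k) +
      ((if k = i then h * (F b j * x $ k) else 0) - (if j = b then h * (F i k * x $ k) else 0)))"
  proof (rule sum.cong[OF refl])
    fix k
    have "F b k * (F i j * x $ k) = (F i j * F b k + h * ((if k = i then F b j else 0) - (if j = b then F i k else 0))) * x $ k"
      using rel[of b k i j] by (simp flip: mult.assoc)
    then show "F b k * (F i j * x $ k) = F i j * (F b k * x $ k) +
      ((if k = i then h * (F b j * x $ k) else 0) - (if j = b then h * (F i k * x $ k) else 0))"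
      by (cases "k = i"; cases "j = b") (simp_all add: algebra_simps)
  qed
  also have "\<dots> = F i j * TA F x $ b + (h * (F b j * x $ i) - (if j = b then h * TA F x $ i else 0))"
    by (simp add: sum.distrib sum_subtractf TA_def sum_distrib_left)
  also have "F b j * - (h * x $ i) = - (h * (F b j * x $ i))"
  proof -
    have "F b j * (h * x $ i) = h * (F b j * x $ i)" using h[of "F b j"] by (simp flip: mult.assoc)
    then show ?thesis by simp
  qed
  finally show "TA F (leftA F h i j x) $ b = leftA F h i j (TA F x) $ b"
    by (simp add: leftA_nth)
qed

lemma TA_add: "TA F (x + y) = TA F x + TA F y"
  by (simp add: TA_def vec_eq_iff distrib_left sum.distrib)

lemma TA_right_mult: "TA F (right_mult x z) = right_mult (TA F x) z"
  by (simp add: TA_def right_mult_def vec_eq_iff sum_distrib_right mult.assoc)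

lemma TA_scale:
  assumes "\<And>i j. F i j * c = c * F i j"
  shows "TA F (\<chi> k. c * x $ k) = (\<chi> k. c * TA F x $ k)"
proof -
  have "F b k * (c * x $ k) = c * (F b k * x $ k)" for b k
    using assms[of b k] by (simp flip: mult.assoc)
  then show ?thesis by (simp add: TA_def vec_eq_iff sum_distrib_left)
qed

lemma right_mult_add: "right_mult (x + y) z = right_mult x z + right_mult y (z :: 'r::ring_1)"
  by (simp add: right_mult_def vec_eq_iff distrib_right)

lemma right_mult_add_right: "right_mult x (y + z) = right_mult x y + right_mult x (z :: 'r::ring_1)"
  by (simp add: right_mult_def vec_eq_iff distrib_left)

lemma right_mult_mult: "right_mult x (y * z) = right_mult (right_mult x y) (z :: 'r::ring_1)"
  by (simp add: right_mult_def vec_eq_iff mult.assoc)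

lemma right_mult_leftA: "right_mult (leftA F h i j x) z = leftA F h i j (right_mult x z)"
  by (simp add: right_mult_def leftA_nth vec_eq_iff distrib_right mult.assoc)

inductive_set ln_null :: "(('a::field_char_0, 'n::{finite,linorder}) V_U) set"
  where
    zero: "0 \<in> ln_null"
  | add: "x \<in> ln_null \<Longrightarrow> y \<in> ln_null \<Longrightarrow> x + y \<in> ln_null"
  | left: "j < i \<Longrightarrow> leftA E hb_U i j x - (\<chi> k. scalU [:psi i j:] * x $ k) \<in> ln_null"

lemma leftA_minus: "leftA F h i j (- x) = - leftA F h i j x"
  by (simp add: leftA_nth vec_eq_iff)

lemma ln_null_minus: "x \<in> ln_null \<Longrightarrow> - x \<in> ln_null"
proof (induction rule: ln_null.induct)
  case (add x y)
  then show ?case unfolding minus_add_distrib by (intro ln_null.add)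
next
  case (left j i x)
  have "- (leftA E hb_U i j x - (\<chi> k. scalU [:psi i j:] * x $ k)) =
      leftA E hb_U i j (- x) - (\<chi> k. scalU [:psi i j:] * (- x) $ k)"
    by (simp add: leftA_minus vec_eq_iff)
  then show ?case using ln_null.left[OF left, of "- x"] by simp
qed (simp add: ln_null.zero)

lemma ln_null_right:
  fixes x :: "('a::field_char_0, 'n::{finite,linorder}) V_U"
  shows "x \<in> ln_null \<Longrightarrow> right_mult x z \<in> ln_null"
proof (induction rule: ln_null.induct)
  case zero
  have "right_mult (0 :: ('a, 'n) V_U) z = 0" by (simp add: right_mult_def vec_eq_iff)
  then show ?case by (simp add: ln_null.zero)
next
  case (add x y)
  then show ?case unfolding right_mult_add by (intro ln_null.add)
next
  case (left j i x)
  have "right_mult (leftA E hb_U i j x - (\<chi> k. scalU [:psi i j:] * x $ k)) z =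
      leftA E hb_U i j (right_mult x z) - (\<chi> k. scalU [:psi i j:] * right_mult x z $ k)"
    unfolding right_mult_leftA[symmetric] by (simp add: right_mult_def vec_eq_iff left_diff_distrib mult.assoc)
  then show ?case using ln_null.left[OF left] by simp
qed

lemma ln_null_TA:
  fixes x :: "('a::field_char_0, 'n::{finite,linorder}) V_U"
  shows "x \<in> ln_null \<Longrightarrow> TA E x \<in> ln_null"
proof (induction rule: ln_null.induct)
  case zero
  have "TA E 0 = (0 :: ('a, 'n) V_U)" by (simp add: TA_def vec_eq_iff)
  then show ?case by (simp add: ln_null.zero)
next
  case (add x y)
  then show ?case unfolding TA_add by (intro ln_null.add)
next
  case (left j i x)
  have diff: "TA E (u - v) = TA E u - TA E v" for u v :: "('a, 'n) V_U"
    by (simp add: TA_def vec_eq_iff right_diff_distrib sum_subtractf)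
  have rel: "E i j * E k l = (E k l * E i j + hb_U * ((if j = k then E i l else 0) - (if l = i then E k j else 0)) :: ('a, 'n) U)"
    for i j k l :: 'n
    unfolding hb_U_def using E_E[of i j k l] by (simp only: lieU_def)
  have "TA E (leftA E hb_U i j x) = leftA E hb_U i j (TA E x)"
    by (rule TA_leftA[OF rel hb_U_central])
  moreover have "TA E (\<chi> k. scalU [:psi i j:] * x $ k) = (\<chi> k. scalU [:psi i j:] * TA E x $ k)"
    by (rule TA_scale) (rule scalU_central[symmetric])
  ultimately show ?case unfolding diff using ln_null.left[OF left, of "TA E x"] by simp
qed

lemma ad_diag_nth: "ad_diag i j x $ m = (if m = j then - x $ i else 0) + adU i j (x $ m)"
  by (simp add: ad_diag_def axis_def)

lemma ad_diag_add: "ad_diag i j (x + y) = ad_diag i j x + ad_diag i j y"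
  by (simp add: vec_eq_iff ad_diag_nth adU_add)

lemma ad_diag_minus: "ad_diag i j (- x) = - ad_diag i j x"
  by (simp add: vec_eq_iff ad_diag_nth adU_minus)

lemma ad_diag_diff: "ad_diag i j (x - y) = ad_diag i j x - ad_diag i j y"
  using ad_diag_add[of i j x "- y"] by (simp add: ad_diag_minus)

lemma ad_diag_0: "ad_diag i j 0 = 0"
  by (simp add: vec_eq_iff ad_diag_nth adU_0)

lemma ad_diag_leftA:
  fixes x :: "('a::field, 'n::finite) V_U"
  shows "ad_diag i j (leftA E hb_U k l x) = leftA E hb_U k l (ad_diag i j x)
    + ((if j = k then leftA E hb_U i l x else 0) - (if l = i then leftA E hb_U k j x else 0))"
proof (rule vec_eq_iff[THEN iffD2], rule allI)
  fix m
  have "adU i j (hb_U * y) = hb_U * adU i j y" for y :: "('a, 'n) U"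
    by (simp add: adU_mult hb_U_def adU_scal)
  then have "ad_diag i j (leftA E hb_U k l x) $ m = (if m = j then - ((if i = l then - (hb_U * x $ k) else 0) + E k l * x $ i) else 0)
      + ((if m = l then - (hb_U * adU i j (x $ k)) else 0) + (lieU i j k l * x $ m + E k l * adU i j (x $ m)))"
    by (simp add: ad_diag_nth leftA_nth adU_add adU_minus adU_mult[of i j "E k l"] adU_E adU_0)
  also have "\<dots> = (if m = l then - (hb_U * ((if k = j then - x $ i else 0) + adU i j (x $ k))) else 0)
      + E k l * ((if m = j then - x $ i else 0) + adU i j (x $ m))
      + ((if j = k then (if m = l then - (hb_U * x $ i) else 0) + E i l * x $ m else 0)
        - (if l = i then (if m = j then - (hb_U * x $ k) else 0) + E k j * x $ m else 0))"
    by (auto simp: lieU_def distrib_left left_diff_distrib)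
  finally show "ad_diag i j (leftA E hb_U k l x) $ m = (leftA E hb_U k l (ad_diag i j x)
    + ((if j = k then leftA E hb_U i l x else 0) - (if l = i then leftA E hb_U k j x else 0))) $ m"
    by (simp add: leftA_nth ad_diag_nth)
qed

text \<open>In other words, \<open>\<psi>\<close> vanishes on
  \<open>[n\<^sub>-, n\<^sub>-]\<close>.\<close>

lemma psi_far: "j < k \<Longrightarrow> k < i \<Longrightarrow> psi i (j :: 'n::{finite,linorder}) = 0"
proof -
  assume jk: "j < k" "k < i"
  obtain a b c where abc: "j = en a" "k = en b" "i = en c" "a < CARD('n)" "b < CARD('n)" "c < CARD('n)"
    using en_surj[of j] en_surj[of k] en_surj[of i] by auto
  then show ?thesis using jk en_less_iff[of a b, where 'n = 'n] en_less_iff[of b c, where 'n = 'n] by (simp add: psi_en)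
qed

text \<open>Moving the diagonal action through the left action produces bracket terms; there
  \<open>psi_far\<close> applies, so they are generators of \<open>ln_null\<close>
  themselves.\<close>

lemma ln_null_ad_diag:
  fixes x :: "('a::field_char_0, 'n::{finite,linorder}) V_U"
  assumes "j < i" "x \<in> ln_null"
  shows "ad_diag i j x \<in> ln_null"
  using assms(2)
proof (induction rule: ln_null.induct)
  case zero
  then show ?case by (simp add: ad_diag_0 ln_null.zero)
next
  case (add x y)
  then show ?case unfolding ad_diag_add by (intro ln_null.add)
next
  case (left l k x)
  have sc: "ad_diag i j (\<chi> m. scalU c * x $ m) = (\<chi> m. scalU c * ad_diag i j x $ m)" for c
    by (simp add: vec_eq_iff ad_diag_nth adU_mult adU_scal distrib_left)
  have 1: "(if j = k then leftA E hb_U i l x else 0) \<in> ln_null"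
  proof (cases "j = k")
    case True
    then have "l < i" "psi i l = (0 :: 'a)" using left assms(1) psi_far by auto
    then have "leftA E hb_U i l x - (\<chi> m. scalU [:psi i l:] * x $ m) \<in> ln_null" by (intro ln_null.left)
    then show ?thesis using \<open>psi i l = 0\<close> True by (simp add: zero_vec_def[symmetric])
  qed (simp add: ln_null.zero)
  have 2: "(if l = i then leftA E hb_U k j x else 0) \<in> ln_null"
  proof (cases "l = i")
    case True
    then have "j < k" "psi k j = (0 :: 'a)" using left assms(1) psi_far by auto
    then have "leftA E hb_U k j x - (\<chi> m. scalU [:psi k j:] * x $ m) \<in> ln_null" by (intro ln_null.left)
    then show ?thesis using \<open>psi k j = 0\<close> True by (simp add: zero_vec_def[symmetric])
  qed (simp add: ln_null.zero)
  have "ad_diag i j (leftA E hb_U k l x - (\<chi> m. scalU [:psi k l:] * x $ m)) =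
      (leftA E hb_U k l (ad_diag i j x) - (\<chi> m. scalU [:psi k l:] * ad_diag i j x $ m))
      + ((if j = k then leftA E hb_U i l x else 0) + - (if l = i then leftA E hb_U k j x else 0))"
    unfolding ad_diag_diff ad_diag_leftA sc by simp
  also have "\<dots> \<in> ln_null" by (intro ln_null.add ln_null.left left ln_null_minus 1 2)
  finally show ?case .
qed

section \<open>The quotient by \<open>n\<^sub>-\<^sup>\<psi>\<close> as a Whittaker module\<close>

definition kw_rel :: "('a::field_char_0, 'n::{finite,linorder}) V_U \<Rightarrow> ('a, 'n) V_U \<Rightarrow> bool"
  where "kw_rel x y \<longleftrightarrow> x - y \<in> ln_null"

lemma kw_rel_equivp: "equivp kw_rel"
proof (rule equivpI)
  show "reflp kw_rel" by (auto simp: reflp_def kw_rel_def ln_null.zero)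
  show "symp kw_rel"
    using ln_null_minus by (fastforce simp: symp_def kw_rel_def)
  show "transp kw_rel"
    using ln_null.add by (fastforce simp: transp_def kw_rel_def)
qed

quotient_type (overloaded) ('a, 'n) kw = "('a::field_char_0, 'n::{finite,linorder}) V_U" / kw_rel
  by (rule kw_rel_equivp)

instantiation kw :: (field_char_0, "{finite,linorder}") ab_group_add
begin

lift_definition zero_kw :: "('a, 'b) kw" is 0 .
lift_definition plus_kw :: "('a, 'b) kw \<Rightarrow> ('a, 'b) kw \<Rightarrow> ('a, 'b) kw" is "(+)"
  unfolding kw_rel_def using ln_null.add by (fastforce simp: algebra_simps)
lift_definition uminus_kw :: "('a, 'b) kw \<Rightarrow> ('a, 'b) kw" is uminus
  unfolding kw_rel_def using ln_null_minus by fastforce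
lift_definition minus_kw :: "('a, 'b) kw \<Rightarrow> ('a, 'b) kw \<Rightarrow> ('a, 'b) kw" is "(-)"
proof -
  fix x x' y y' :: "('a, 'b) V_U"
  assume "kw_rel x x'" "kw_rel y y'"
  then have "(x - x') + - (y - y') \<in> ln_null" unfolding kw_rel_def by (intro ln_null.add ln_null_minus)
  then show "kw_rel (x - y) (x' - y')" unfolding kw_rel_def by (simp add: algebra_simps)
qed

instance
proof
  fix a b c :: "('a, 'b) kw"
  show "a + b + c = a + (b + c)" by transfer (simp add: kw_rel_def ln_null.zero add.assoc)
  show "a + b = b + a" by transfer (simp add: kw_rel_def ln_null.zero add.commute)
  show "0 + a = a" by transfer (simp add: kw_rel_def ln_null.zero)
  show "- a + a = 0" by transfer (simp add: kw_rel_def ln_null.zero)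
  show "a - b = a + - b" by transfer (simp add: kw_rel_def ln_null.zero)
qed

end

lemma kw_eq_iff: "abs_kw x = abs_kw y \<longleftrightarrow> x - y \<in> ln_null"
  by (simp add: kw.abs_eq_iff kw_rel_def)

lemma kw_lift:
  assumes "\<And>x. x \<in> ln_null \<Longrightarrow> f x \<in> ln_null" "\<And>x y. f (x - y) = f x - f y"
  shows "abs_kw (f (rep_kw (abs_kw x))) = abs_kw (f x)"
proof -
  have "rep_kw (abs_kw x) - x \<in> ln_null"
    unfolding kw_eq_iff[symmetric] by (rule Quotient_abs_rep[OF Quotient_kw])
  then show ?thesis unfolding kw_eq_iff assms(2)[symmetric] by (rule assms(1))
qed

definition kw_act :: "('a::field_char_0, 'n::{finite,linorder}) kw \<Rightarrow> ('a, 'n) U \<Rightarrow> ('a, 'n) kw"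
  where "kw_act x z = abs_kw (right_mult (rep_kw x) z)"

text \<open>The diagonal action is known to descend to the quotient for \<open>j < i\<close>; the
  value zero elsewhere makes the operator total.\<close>

definition kw_D :: "'n \<Rightarrow> 'n \<Rightarrow> ('a::field_char_0, 'n::{finite,linorder}) kw \<Rightarrow> ('a, 'n) kw"
  where "kw_D i j x = (if j < i then abs_kw (ad_diag i j (rep_kw x)) else 0)"

definition kw_T :: "('a::field_char_0, 'n::{finite,linorder}) kw \<Rightarrow> ('a, 'n) kw"
  where "kw_T x = abs_kw (TA E (rep_kw x))"

lemma kw_act_abs: "kw_act (abs_kw x) z = abs_kw (right_mult x z)"
  unfolding kw_act_def
  by (rule kw_lift) (auto simp: ln_null_right right_mult_def vec_eq_iff left_diff_distrib intro: ln_null_right[unfolded right_mult_def])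

lemma kw_D_abs: "j < i \<Longrightarrow> kw_D i j (abs_kw x) = abs_kw (ad_diag i j x)"
  unfolding kw_D_def by (simp add: kw_lift ln_null_ad_diag ad_diag_diff)

lemma kw_T_abs: "kw_T (abs_kw x) = abs_kw (TA E x)"
  unfolding kw_T_def
  by (rule kw_lift) (simp_all add: ln_null_TA, simp add: TA_def vec_eq_iff right_diff_distrib sum_subtractf)

lemmas kw_abs_simps = kw_act_abs kw_D_abs kw_T_abs plus_kw.abs_eq minus_kw.abs_eq uminus_kw.abs_eq

lemma scalU_of_nat: "scalU (of_nat k) = (of_nat k :: ('a::field, 'n) U)"
  by (induction k) (simp_all add: scalU_add)

text \<open>On \<open>V\<close> the square of the operator is zero for \<open>i \<noteq> j\<close>,
  so the binomial formula keeps two terms. Nilpotency on the tensor product thus reduces to that on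
  the algebra.\<close>

lemma ad_diag_pow_nth:
  fixes x :: "('a::field, 'n::finite) V_U"
  assumes "i \<noteq> j"
  shows "(ad_diag i j ^^ k) x $ m = (adU i j ^^ k) (x $ m) - (if m = j then of_nat k * (adU i j ^^ (k - 1)) (x $ i) else 0)"
proof (induction k arbitrary: m)
  case (Suc k)
  have nat: "adU i j (of_nat k * y) = of_nat k * adU i j y" for y :: "('a, 'n) U"
    unfolding scalU_of_nat[symmetric] by (simp add: adU_mult adU_scal)
  have diff: "adU i j (x - y) = adU i j x - adU i j y" for x y :: "('a, 'n) U"
    using adU_add[of i j x "- y"] by (simp add: adU_minus)
  have "(ad_diag i j ^^ Suc k) x $ m = (if m = j then - (ad_diag i j ^^ k) x $ i else 0) + adU i j ((ad_diag i j ^^ k) x $ m)"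
    by (simp add: ad_diag_nth)
  also have "\<dots> = (if m = j then - (adU i j ^^ k) (x $ i) else 0) + ((adU i j ^^ Suc k) (x $ m) -
      (if m = j then of_nat k * adU i j ((adU i j ^^ (k - 1)) (x $ i)) else 0))"
    unfolding Suc using assms by (simp add: diff nat adU_0)
  also have "of_nat k * adU i j ((adU i j ^^ (k - 1)) (x $ i)) = of_nat k * (adU i j ^^ k) (x $ i)"
    by (cases k) simp_all
  finally show ?case by (simp add: distrib_right)
qed simp

lemma ad_diag_nilpotent:
  assumes "i \<noteq> j"
  shows "\<exists>K. (ad_diag i j ^^ K) x = (0 :: ('a::field_char_0, 'n::{finite,linorder}) V_U)"
proof -
  have "\<forall>m. \<exists>K. (adU i j ^^ K) (x $ m) = 0" using adU_nilpotent[OF assms] by blast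
  then obtain K where K: "\<And>m. (adU i j ^^ K m) (x $ m) = 0" by (auto dest!: choice)
  define L where "L = Suc (\<Sum>m\<in>UNIV. K m)"
  have le: "K m \<le> (\<Sum>m\<in>UNIV. K m)" for m by (rule member_le_sum) auto
  have "(adU i j ^^ L) (x $ m) = 0" "(adU i j ^^ (L - 1)) (x $ m) = 0" for m
    using le[of m] by (auto simp: L_def simp del: funpow.simps intro!: funpow_zero_mono[OF K] adU_0)
  then show ?thesis
    by (intro exI[of _ L]) (simp add: vec_eq_iff ad_diag_pow_nth[OF assms])
qed

lemma kw_D_abs_pow: "j < i \<Longrightarrow> (kw_D i j ^^ k) (abs_kw x) = abs_kw ((ad_diag i j ^^ k) x)"
  by (induction k) (simp_all add: kw_D_abs)

definition qfac :: "nat \<Rightarrow> ('a::field_char_0, 'n) U"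
  where "qfac k = scalU [:1 / fact k:]"

lemma derivation_bracket:
  fixes a b c :: "'r::ring \<Rightarrow> 'r"
  assumes "\<And>x y. a (x + y) = a x + a y" "\<And>x y. a (x * y) = a x * y + x * a y"
    and "\<And>x y. b (x + y) = b x + b y" "\<And>x y. b (x * y) = b x * y + x * b y"
    and "\<And>x y. c (x * y) = c x * y + x * c y"
    and "a (b x) = b (a x) + c x" "a (b y) = b (a y) + c y"
  shows "a (b (x * y)) = b (a (x * y)) + c (x * y)"
  unfolding assms by (simp add: distrib_left distrib_right ac_simps)

lemma adU_adU:
  fixes z :: "('a::field, 'n) U"
  shows "adU i j (adU k l z) = adU k l (adU i j z) +
    ((if j = k then adU i l z else 0) - (if l = i then adU k j z else 0))"
proof -
  define c where "c z = (if j = k then adU i l z else 0) - (if l = i then adU k j z else 0)" for z :: "('a, 'n) U"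
  have add: "c (x + y) = c x + c y" for x y by (simp add: c_def adU_add)
  have mult: "c (x * y) = c x * y + x * c y" for x y
    unfolding c_def by (cases "j = k"; cases "l = i") (simp_all only: if_True if_False adU_mult, simp_all add: left_diff_distrib right_diff_distrib)
  have lie: "adU i j (adU k l (E p q)) = adU k l (adU i j (E p q)) + c (E p q)" for p q
  proof -
    have e: "adU a b (if P then E r s else 0) = (if P then lieU a b r s else (0 :: ('a, 'n) U))" for P a b r s
      by (cases P) (simp_all only: if_True if_False adU_E adU_0)
    have diff: "adU a b (x - y) = adU a b x - adU a b (y :: ('a, 'n) U)" for a b x y
      using adU_add[of a b x "- y"] by (simp add: adU_minus)
    show ?thesis
      unfolding adU_E c_def lieU_def[of k l p q] lieU_def[of i j p q] diff e
      unfolding lieU_def by (auto simp del: One_nat_def)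
  qed
  have "adU i j (adU k l z) = adU k l (adU i j z) + c z"
  proof (induction z rule: U_induct)
    case (scal r)
    show ?case by (simp add: c_def adU_scal adU_0)
  next
    case (E p q)
    show ?case by (rule lie)
  next
    case (plus x y)
    show ?case unfolding adU_add add plus by (simp add: ac_simps)
  next
    case (times x y)
    show ?case by (rule derivation_bracket[OF adU_add adU_mult adU_add adU_mult mult times])
  qed
  then show ?thesis unfolding c_def .
qed

lemma ad_diag_ad_diag:
  fixes x :: "('a::field, 'n::finite) V_U"
  shows "ad_diag i j (ad_diag k l x) = ad_diag k l (ad_diag i j x) +
  ((if j = k then ad_diag i l x else 0) - (if l = i then ad_diag k j x else 0))"
proof (rule vec_eq_iff[THEN iffD2], rule allI)
  fix m
  have neg: "adU a b (if P then - y else 0) = (if P then - adU a b y else 0)" for a b P and y :: "('a, 'n) U"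
    by (cases P) (simp_all only: if_True if_False adU_minus adU_0)
  have nth: "(if P then y else 0) $ m = (if P then y $ m else 0)" for P and y :: "('a, 'n) V_U"
    by (cases P) simp_all
  show "ad_diag i j (ad_diag k l x) $ m = (ad_diag k l (ad_diag i j x) +
    ((if j = k then ad_diag i l x else 0) - (if l = i then ad_diag k j x else 0))) $ m"
    unfolding vector_add_component vector_minus_component nth ad_diag_nth adU_add neg adU_adU[of i j k l]
    apply (simp only: eq_commute[of l i] eq_commute[of k j])
    apply (cases "m = j"; cases "m = l"; cases "i = l"; cases "j = k")
    apply (simp_all only: if_True if_False refl simp_thms)
    apply (simp_all add: ac_simps)
    done
qed


interpretation gl: gl_alg "CARD('n)" "\<lambda>p q. E (en p :: 'n::{finite,linorder}) (en q) :: ('a::field_char_0, 'n) U"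
  hb_U "\<lambda>p q. adU (en p) (en q)"
proof
  fix i j k l :: nat and x y :: "('a, 'n) U"
  show "adU (en i) (en j) (x + y) = adU (en i) (en j) x + adU (en i) (en j) y" by (rule adU_add)
  show "adU (en i) (en j) (x * y) = adU (en i) (en j) x * y + x * adU (en i) (en j) y" by (rule adU_mult)
  show "adU (en i) (en j) hb_U = (0 :: ('a, 'n) U)" by (simp add: hb_U_def adU_scal)
  show "hb_U * x = x * hb_U" by (rule hb_U_central)
  show "x + x = 0 \<Longrightarrow> x = 0" by (rule scalU_half)
  show "E (en i) (en j) * x = x * E (en i) (en j) + hb_U * adU (en i) (en j) x" by (rule E_adU)
  assume "i < CARD('n)" "j < CARD('n)" "k < CARD('n)" "l < CARD('n)"
  then show "adU (en i) (en j) (E (en k) (en l)) =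
      (if j = k then E (en i) (en l) else 0) - (if l = i then E (en k) (en j) else (0 :: ('a, 'n) U))"
    by (simp add: adU_E lieU_def en_eq_iff)
qed

interpretation kw: whittaker_exp "CARD('n)" "\<lambda>p q. E (en p :: 'n::{finite,linorder}) (en q) :: ('a::field_char_0, 'n) U"
  hb_U "\<lambda>p q. adU (en p) (en q)" kw_act "\<lambda>p q. kw_D (en p) (en q)" qfac
proof
  fix i j k l :: nat and x y :: "('a, 'n) U" and a b :: "('a, 'n) kw"
  show "kw_act (a + b) x = kw_act a x + kw_act b x" by (induction a rule: kw.abs_induct, induction b rule: kw.abs_induct) (simp add: kw_abs_simps right_mult_add)
  show "kw_act a (x + y) = kw_act a x + kw_act a y" by (induction a rule: kw.abs_induct) (simp add: kw_abs_simps right_mult_add_right)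
  show "kw_act a (x * y) = kw_act (kw_act a x) y" by (induction a rule: kw.abs_induct) (simp add: kw_abs_simps right_mult_mult)
  show "kw_act a 1 = a" by (induction a rule: kw.abs_induct) (simp add: kw_abs_simps right_mult_def vec_lambda_eta)
  show "kw_D (en i) (en j) (a + b) = kw_D (en i) (en j) a + kw_D (en i) (en j) b"
    by (cases "en j < (en i :: 'n)"; induction a rule: kw.abs_induct, induction b rule: kw.abs_induct)
      (simp_all add: kw_abs_simps ad_diag_add, simp add: kw_D_def)
  show "qfac 0 = (1 :: ('a, 'n) U)" by (simp add: qfac_def flip: one_pCons)
  show "of_nat (Suc k) * qfac (Suc k) = (qfac k :: ('a, 'n) U)"
  proof -
    have "(of_nat (Suc k) :: ('a, 'n) U) = scalU (of_nat (Suc k))" by (rule scalU_of_nat[symmetric])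
    moreover have "of_nat (Suc k) * [:1 / fact (Suc k):] = [:1 / fact k :: 'a:]"
      by (simp add: of_nat_poly del: of_nat_Suc)
    ultimately show ?thesis unfolding qfac_def by (simp only: flip: scalU_mult)
  qed
  show "gl.scal (qfac k :: ('a, 'n) U)"
    unfolding gl.scal_def qfac_def by (intro conjI allI scalU_central adU_scal)
next
  fix i j :: nat and x :: "('a, 'n) U" and a :: "('a, 'n) kw"
  assume ij: "j < i" "i < CARD('n)"
  then have ij': "en j < (en i :: 'n)" by (rule en_less)
  show "kw_D (en i) (en j) (kw_act a x) = kw_act (kw_D (en i) (en j) a) x + kw_act a (adU (en i) (en j) x)"
  proof (induction a rule: kw.abs_induct)
    case (1 y)
    have "ad_diag (en i) (en j) (right_mult y x) = right_mult (ad_diag (en i) (en j) y) x + right_mult y (adU (en i) (en j) x)"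
      by (simp add: right_mult_def vec_eq_iff ad_diag_nth adU_mult distrib_right)
    then show ?case using ij' by (simp add: kw_abs_simps)
  qed
  show "\<exists>K. (kw_D (en i) (en j) ^^ K) a = 0"
  proof (induction a rule: kw.abs_induct)
    case (1 x)
    have "en i \<noteq> (en j :: 'n)" using ij' by simp
    then obtain K where "(ad_diag (en i) (en j) ^^ K) x = 0" using ad_diag_nilpotent by blast
    then show ?case using kw_D_abs_pow[OF ij', of K x] by (auto simp: zero_kw_def)
  qed
  have psi: "psi (en i) (en j :: 'n) = (if i = Suc j then 1 else (0 :: 'a))" using ij by (simp add: psi_en)
  show "kw_act a (E (en i) (en j)) = (if i = Suc j then a else 0) - kw_act (kw_D (en i) (en j) a) hb_U"
  proof (induction a rule: kw.abs_induct)
    case (1 x)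
    let ?i = "en i :: 'n" and ?j = "en j :: 'n"
    \<comment> \<open>The left action of \<open>E\<^sub>i\<^sub>j\<close> minus right multiplication
      by it is \<open>\<hbar>\<close> times the diagonal action; modulo the relation for
      \<open>\<psi>\<close> this is the axiom \<open>act_E\<close>.\<close>
    have "right_mult x (E ?i ?j) - ((\<chi> k. scalU [:psi ?i ?j:] * x $ k) - right_mult (ad_diag ?i ?j x) hb_U) =
        leftA E hb_U ?i ?j x - (\<chi> k. scalU [:psi ?i ?j:] * x $ k)"
    proof (rule vec_eq_iff[THEN iffD2], rule allI)
      fix m
      have "E ?i ?j * x $ m = x $ m * E ?i ?j + adU ?i ?j (x $ m) * hb_U"
        using E_adU[of ?i ?j "x $ m"] hb_U_central[of "adU ?i ?j (x $ m)"] by simp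
      then show "(right_mult x (E ?i ?j) - ((\<chi> k. scalU [:psi ?i ?j:] * x $ k) - right_mult (ad_diag ?i ?j x) hb_U)) $ m =
        (leftA E hb_U ?i ?j x - (\<chi> k. scalU [:psi ?i ?j:] * x $ k)) $ m"
        using hb_U_central[of "x $ ?i"] by (simp add: right_mult_def leftA_nth ad_diag_nth distrib_right)
    qed
    then have "right_mult x (E ?i ?j) - ((\<chi> k. scalU [:psi ?i ?j:] * x $ k) - right_mult (ad_diag ?i ?j x) hb_U) \<in> ln_null"
      using ln_null.left[OF ij'] by metis
    then have "kw_act (abs_kw x) (E ?i ?j) = abs_kw (\<chi> k. scalU [:psi ?i ?j:] * x $ k) - kw_act (kw_D ?i ?j (abs_kw x)) hb_U"
      using ij' by (simp add: kw_abs_simps kw_eq_iff)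
    moreover have "abs_kw (\<chi> k. scalU [:psi ?i ?j:] * x $ k) = (if i = Suc j then abs_kw x else 0)"
      unfolding psi by (auto simp: zero_kw_def zero_vec_def[symmetric] one_pCons[symmetric] vec_lambda_eta)
    ultimately show ?case by simp
  qed
next
  fix i j k l :: nat and a :: "('a, 'n) kw"
  assume *: "j < i" "i < CARD('n)" "l < k" "k < CARD('n)"
  then have "en j < (en i :: 'n)" "en l < (en k :: 'n)" by (auto intro: en_less)
  moreover have "en j = (en k :: 'n) \<longleftrightarrow> j = k" "en l = (en i :: 'n) \<longleftrightarrow> l = i" using * by (auto simp: en_eq_iff)
  moreover have "j = k \<Longrightarrow> en l < (en i :: 'n)" "l = i \<Longrightarrow> en j < (en k :: 'n)" using * by (auto intro: en_less)
  moreover have "j = k \<Longrightarrow> l \<noteq> i" using * by auto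
  ultimately show "kw_D (en i) (en j) (kw_D (en k) (en l) a) = kw_D (en k) (en l) (kw_D (en i) (en j) a) +
      ((if j = k then kw_D (en i) (en l) a else 0) - (if l = i then kw_D (en k) (en j) a else 0))"
    by (induction a rule: kw.abs_induct) (simp add: kw_abs_simps ad_diag_ad_diag[of "en i" "en j" "en k" "en l"] zero_kw_def)
qed

section \<open>Identification of the operators \<open>P\<close> on the quotient\<close>

lemma quantum_minor_en:
  fixes u :: "('a::field_char_0, 'n::{finite,linorder}) U"
  assumes "length rws = length cls" "set rws \<subseteq> {..<CARD('n)}" "set cls \<subseteq> {..<CARD('n)}"
  shows "quantum_minor (map en rws) (map en cls) u = gl.qm rws cls u"
  unfolding quantum_minor_def gl.qm_def cdet_def length_map
proof (intro sum.cong refl arg_cong2[where f = "(*)"] arg_cong[where f = prod_list] map_cong)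
  fix \<sigma> r assume "\<sigma> \<in> {\<sigma>. \<sigma> permutes {..<length cls}}" "r \<in> set [0..<length cls]"
  then have "r < length cls" "\<sigma> r < length cls" using permutes_in_image[of \<sigma> "{..<length cls}" r] by auto
  moreover from this have "rws ! \<sigma> r < CARD('n)" "cls ! r < CARD('n)" using assms by (auto simp: subset_iff)
  ultimately show "L (map en rws ! \<sigma> r) (map en cls ! r) (u - of_nat r * hb_U) = gl.lf (rws ! \<sigma> r) (cls ! r) (u - of_nat r * hb_U)"
    using assms(1) en_eq_iff[of "rws ! \<sigma> r" "cls ! r", where 'n = 'n] by (simp add: L_def gl.lf_def)
qed

lemma abs_kw_sum: "abs_kw (sum f A) = (\<Sum>a\<in>A. abs_kw (f a))"
  by (induction A rule: infinite_finite_induct) (simp_all add: zero_kw_def plus_kw.abs_eq[symmetric])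

lemma P_psi_en:
  fixes u :: "('a::field_char_0, 'n::{finite,linorder}) U"
  assumes j: "j < a" and a: "a < CARD('n)"
  shows "abs_kw (P_psi (en a) (en j) u x) = kw.Pop a j u (abs_kw x)"
proof -
  have ji: "en j < (en a :: 'n)" using assms by (rule en_less)
  then have ne: "en a \<noteq> (en j :: 'n)" by simp
  obtain K where K: "(ad_diag (en a) (en j) ^^ K) x = 0" using ad_diag_nilpotent[OF ne] by blast
  have K': "(kw_D (en a) (en j) ^^ K) (abs_kw x) = 0"
    unfolding kw_D_abs_pow[OF ji] K zero_kw_def ..
  have js: "sorted_list_of_set {en j..<en a :: 'n} = map en [j..<a]"
    using assms by (subst en_image(1)) (simp_all add: sorted_list_en subset_iff)
  let ?g = "\<lambda>k. (- 1) ^ ((a - j) * k) * kw.ff j (a - j) u k :: ('a, 'n) U"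
  have minor: "quantum_minor (map en [j..<a]) (map en [j..<a]) v = kw.MM j (a - j) v" for v :: "('a, 'n) U"
    unfolding kw.MM_def using assms by (subst quantum_minor_en) auto
  have prod: "prod_list (map (\<lambda>r. quantum_minor (map en [j..<a]) (map en [j..<a]) (u - of_nat r * hb_U)) [0..<k]) =
      kw.ff j (a - j) u k" for k
    unfolding kw.ff_def minor ..
  have sgn: "(scalU [:(- 1) ^ ((idx (en a :: 'n) + idx (en j :: 'n)) * k) / fact k:] :: ('a, 'n) U) = qfac k * (- 1) ^ ((a - j) * k)" for k
  proof -
    have "even ((idx (en a :: 'n) + idx (en j :: 'n)) * k) \<longleftrightarrow> even ((a - j) * k)"
      using assms by (auto simp: idx_en)
    then have "((- 1) ^ ((idx (en a :: 'n) + idx (en j :: 'n)) * k) :: 'a) = (- 1) ^ ((a - j) * k)"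
      by (simp only: minus_one_power_iff)
    then show ?thesis
    proof (cases "even ((a - j) * k)")
      case True
      then show ?thesis using \<open>_ = (- 1) ^ ((a - j) * k)\<close> by (simp add: qfac_def)
    next
      case False
      have "(scalU [:- 1 / fact k:] :: ('a, 'n) U) = scalU (- 1) * qfac k"
        unfolding qfac_def scalU_mult[symmetric] by simp
      then show ?thesis using \<open>_ = (- 1) ^ ((a - j) * k)\<close> False by (simp add: scalU_minus_1)
    qed
  qed
  have term_eq: "(\<chi> m. scalU [:(- 1) ^ ((idx (en a :: 'n) + idx (en j :: 'n)) * k) / fact k:] * (y $ m) * kw.ff j (a - j) u k) =
      right_mult y (qfac k * ?g k)" for k and y :: "('a, 'n) V_U"
  proof -
    have "qfac k * (- 1) ^ ((a - j) * k) * y $ m = y $ m * (qfac k * (- 1) ^ ((a - j) * k))" for m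
      unfolding sgn[symmetric] by (rule scalU_central)
    then show ?thesis unfolding right_mult_def sgn by (simp add: mult.assoc)
  qed
  have "P_psi (en a) (en j) u x = Sum_any (\<lambda>k. right_mult ((ad_diag (en a) (en j) ^^ k) x) (qfac k * ?g k))"
    unfolding P_psi_def Let_def js prod term_eq ..
  also have "\<dots> = (\<Sum>k<K. right_mult ((ad_diag (en a) (en j) ^^ k) x) (qfac k * ?g k))"
  proof (rule Sum_any.expand_superset)
    show "{k. right_mult ((ad_diag (en a) (en j) ^^ k) x) (qfac k * ?g k) \<noteq> 0} \<subseteq> {..<K}"
    proof
      fix k assume k: "k \<in> {k. right_mult ((ad_diag (en a) (en j) ^^ k) x) (qfac k * ?g k) \<noteq> 0}"
      show "k \<in> {..<K}"
      proof (rule ccontr)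
        assume "k \<notin> {..<K}"
        then have "(ad_diag (en a) (en j) ^^ k) x = 0"
          by (intro funpow_zero_mono[OF K ad_diag_0]) simp
        with k show False by (simp add: right_mult_def vec_eq_iff)
      qed
    qed
  qed simp
  finally have "abs_kw (P_psi (en a) (en j) u x) = (\<Sum>k<K. abs_kw (right_mult ((ad_diag (en a) (en j) ^^ k) x) (qfac k * ?g k)))"
    by (simp only: abs_kw_sum)
  also have "\<dots> = (\<Sum>k<K. kw_act ((kw_D (en a) (en j) ^^ k) (abs_kw x)) (qfac k * ?g k))"
    unfolding kw_D_abs_pow[OF ji] kw_act_abs ..
  also have "\<dots> = kw.Pop a j u (abs_kw x)"
    unfolding kw.Pop_def by (rule kw.Dexp_sum[OF K', symmetric])
  finally show ?thesis .
qed

lemma fold_transfer: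
  assumes "\<And>a x. a \<in> set xs \<Longrightarrow> r (f a x) = g a (r x)"
  shows "r (fold f xs x) = fold g xs (r x)"
  using assms by (induction xs arbitrary: x) simp_all

lemma P_m_en:
  fixes x :: "('a::field_char_0, 'n::{finite,linorder}) V_U"
  assumes "\<And>j. j < CARD('n) \<Longrightarrow> u (en j) = kw.uu j"
  shows "abs_kw (P_m u x) = kw.PM 0 (abs_kw x)"
proof -
  have U: "sorted_list_of_set (UNIV :: 'n set) = map en [0..<CARD('n)]"
    by (subst en_image(3)) (simp add: sorted_list_en subset_iff)
  show ?thesis
    unfolding P_m_def kw.PM_def U rev_map fold_map
  proof (rule fold_transfer)
    fix j and y :: "('a, 'n) V_U" assume "j \<in> set (rev [0..<CARD('n)])"
    then have j: "j < CARD('n)" by simp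
    have "sorted_list_of_set {en j :: 'n<..} = map en [Suc j..<CARD('n)]"
      using j by (subst en_image(2)) (simp_all add: sorted_list_en subset_iff)
    then show "abs_kw (((\<lambda>j. fold (\<lambda>i. P_psi i j (u j)) (sorted_list_of_set {j<..})) \<circ> en) j y) =
        fold (\<lambda>a. kw.Pop a j (kw.uu j)) [Suc j..<CARD('n)] (abs_kw y)"
      unfolding o_apply assms[OF j]
      by (simp only: fold_map) (rule fold_transfer, simp only: o_apply, rule P_psi_en, auto)
  qed
qed

section \<open>The endomorphism \<open>T\<close> on the quotient\<close>

lemma TA_ad_diag: "TA E (ad_diag i j x) = ad_diag i j (TA E x)"
proof (rule vec_eq_iff[THEN iffD2], rule allI)
  fix b
  have sum: "adU i j (sum f A) = (\<Sum>k\<in>A. adU i j (f k))" for f :: "'b \<Rightarrow> ('a, 'b) U" and A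
    by (induction A rule: infinite_finite_induct) (simp_all add: adU_0 adU_add)
  have "TA E (ad_diag i j x) $ b = (\<Sum>k\<in>UNIV. (if k = j then E b k * - (x $ i) else 0) + E b k * adU i j (x $ k))"
    unfolding TA_def vec_lambda_beta ad_diag_nth by (intro sum.cong) (simp_all add: distrib_left)
  also have "\<dots> = E b j * - (x $ i) + (\<Sum>k\<in>UNIV. E b k * adU i j (x $ k))"
    by (simp add: sum.distrib)
  finally have 1: "TA E (ad_diag i j x) $ b = \<dots>" .
  have "ad_diag i j (TA E x) $ b = (if b = j then - TA E x $ i else 0) + (\<Sum>k\<in>UNIV. lieU i j b k * x $ k + E b k * adU i j (x $ k))"
    by (simp add: ad_diag_nth TA_def sum adU_mult adU_E)
  also have "(\<Sum>k\<in>UNIV. lieU i j b k * x $ k + E b k * adU i j (x $ k)) =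
      (\<Sum>k\<in>UNIV. ((if j = b then E i k * x $ k else 0) - (if k = i then E b j * x $ k else 0)) + E b k * adU i j (x $ k))"
    by (intro sum.cong) (auto simp: lieU_def left_diff_distrib)
  also have "\<dots> = (if j = b then TA E x $ i else 0) - E b j * x $ i + (\<Sum>k\<in>UNIV. E b k * adU i j (x $ k))"
    by (simp add: sum.distrib sum_subtractf TA_def)
  finally show "TA E (ad_diag i j x) $ b = ad_diag i j (TA E x) $ b" unfolding 1 by auto
qed

definition kphi :: "nat \<Rightarrow> ('a::field_char_0, 'n::{finite,linorder}) kw"
  where "kphi k = abs_kw (axis (en k) 1)"

lemma kw_D_kphi:
  assumes "q < p" "p < CARD('n::{finite,linorder})" "b < CARD('n)"
  shows "kw_D (en p) (en q) (kphi b :: ('a::field_char_0, 'n) kw) = (if b = p then - kphi q else 0)"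
proof -
  have "en q < (en p :: 'n)" using assms by (intro en_less)
  moreover have "adU (en p :: 'n) (en q) (if P then 1 else 0) = (0 :: ('a, 'n) U)" for P
    using adU_scal[of "en p" "en q" 1] adU_0[of "en p" "en q"] by (cases P) simp_all
  then have "ad_diag (en p :: 'n) (en q) (axis (en b) 1 :: ('a, 'n) V_U) = (if b = p then - axis (en q) 1 else 0)"
    using assms en_eq_iff[of p b, where 'n = 'n] by (auto simp: vec_eq_iff ad_diag_nth axis_def)
  ultimately show ?thesis unfolding kphi_def by (simp add: kw_D_abs zero_kw_def uminus_kw.abs_eq)
qed

lemma kw_T_kphi:
  assumes "k < CARD('n::{finite,linorder})"
  shows "kw_T (kphi k :: ('a::field_char_0, 'n) kw) = (\<Sum>b<CARD('n). kw_act (kphi b) (E (en b) (en k)))"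
proof -
  have "TA E (axis (en k) 1 :: ('a, 'n) V_U) = (\<Sum>b\<in>UNIV. right_mult (axis b 1) (E b (en k)))"
  proof (rule vec_eq_iff[THEN iffD2], rule allI)
    fix m :: 'n
    have "TA E (axis (en k) 1 :: ('a, 'n) V_U) $ m = (\<Sum>b\<in>UNIV. if b = en k then E m b else 0)"
      unfolding TA_def vec_lambda_beta by (intro sum.cong) (simp_all add: axis_def)
    also have "\<dots> = (\<Sum>b\<in>UNIV. if b = m then E b (en k) else 0)" by simp
    also have "\<dots> = (\<Sum>b\<in>UNIV. right_mult (axis b 1) (E b (en k))) $ m"
      unfolding sum_component by (intro sum.cong) (auto simp: right_mult_def axis_def)
    finally show "TA E (axis (en k) 1 :: ('a, 'n) V_U) $ m = (\<Sum>b\<in>UNIV. right_mult (axis b 1) (E b (en k))) $ m" .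
  qed
  then show ?thesis unfolding kphi_def kw_T_abs kw_act_abs by (simp add: abs_kw_sum sum_en)
qed

lemma kw_T_add: "kw_T (x + y) = kw_T x + kw_T y"
  by (induction x rule: kw.abs_induct, induction y rule: kw.abs_induct) (simp add: kw_abs_simps TA_add)

lemma kw_T_act: "kw_T (kw_act x z) = kw_act (kw_T x) z"
  by (induction x rule: kw.abs_induct) (simp add: kw_abs_simps TA_right_mult)

lemma kw_T_0: "kw_T 0 = 0"
  using kw_T_add[of 0 0] by simp

lemma kw_T_D: "kw_T (kw_D i j x) = kw_D i j (kw_T x)"
proof (cases "j < i")
  case True
  then show ?thesis by (induction x rule: kw.abs_induct) (simp add: kw_abs_simps TA_ad_diag)
next
  case False
  then show ?thesis by (simp add: kw_D_def kw_T_0)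
qed

lemma bu_kw_T: "x \<in> kw.bu p \<Longrightarrow> kw_T x \<in> kw.bu p"
proof (induction rule: kw.bu.induct)
  case zero
  show ?case unfolding kw_T_0 by (rule kw.bu.zero)
next
  case (add x y)
  then show ?case unfolding kw_T_add by (intro kw.bu.add)
next
  case (gen i j x)
  then show ?case unfolding kw_T_act by (intro kw.bu.gen)
qed

text \<open>The vectors \<open>\<phi>\<^sub>k\<close> form a \<open>vrow\<close> for the block of
  all indices, so \<open>vrow_lf\<close> with parameter 0 computes \<open>T \<phi>\<^sub>k\<close>.
  The shift of the parameter that it produces is exactly \<open>uu k\<close>.\<close>

lemma kw_T_kphi_lf:
  assumes "k < CARD('n::{finite,linorder})"
  shows "kw_T (kphi k :: ('a::field_char_0, 'n) kw) =
    (\<Sum>b\<le>k. kw_act (kphi b) (gl.lf b k (kw.uu k))) + (if Suc k < CARD('n) then kphi (Suc k) else 0)"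
proof -
  have "kw.vrow 0 CARD('n) (kphi :: nat \<Rightarrow> ('a, 'n) kw)"
    unfolding kw.vrow_def by (simp add: kw_D_kphi)
  from kw.vrow_lf[OF this, of k 0] assms show ?thesis
    by (simp add: gl.lf_def kw.uu_def kw_T_kphi)
qed

lemma kw_T_pow_kphi:
  assumes "k < CARD('n::{finite,linorder})"
  shows "(kw_T ^^ k) (kphi 0) - (kphi k :: ('a::field_char_0, 'n) kw) \<in> kw.bu (CARD('n) - 1)"
  using assms
proof (induction k)
  case 0
  show ?case by (simp add: kw.bu.zero)
next
  case (Suc k)
  let ?N = "CARD('n)"
  have eq: "kw_T (kphi k) - (kphi (Suc k) :: ('a, 'n) kw) = (\<Sum>b\<le>k. kw_act (kphi b) (gl.lf b k (kw.uu k)))"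
    using Suc.prems by (simp add: kw_T_kphi_lf)
  have 1: "(\<Sum>b\<le>k. kw_act (kphi b :: ('a, 'n) kw) (gl.lf b k (kw.uu k))) \<in> kw.bu (?N - 1)"
    using Suc.prems by (intro kw.bu_sum kw.bu.gen) auto
  have 2: "kw_T ((kw_T ^^ k) (kphi 0) - (kphi k :: ('a, 'n) kw)) \<in> kw.bu (?N - 1)"
    using Suc by (intro bu_kw_T) simp
  have "kw_T (x - y) = kw_T x - kw_T y" for x y :: "('a, 'n) kw"
    using kw_T_add[of "x - y" y] by simp
  then have "(kw_T ^^ Suc k) (kphi 0) - (kphi (Suc k) :: ('a, 'n) kw) =
      kw_T ((kw_T ^^ k) (kphi 0) - kphi k) + (kw_T (kphi k) - kphi (Suc k))" by simp
  then show ?case by (simp only: kw.bu.add[OF 2 1[folded eq]])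
qed

text \<open>The formula \<open>kw_T_kphi_lf\<close> on representatives, in which form it can be
  carried over to the double quotient.\<close>

lemma TA_axis:
  assumes "k < CARD('n::{finite,linorder})"
  shows "TA E (axis (en k) 1) - ((\<Sum>b\<le>k. right_mult (axis (en b) 1) (gl.lf b k (kw.uu k))) +
    (if Suc k < CARD('n) then axis (en (Suc k)) 1 else 0)) \<in> (ln_null :: ('a::field_char_0, 'n) V_U set)"
proof -
  have "(if P then abs_kw x else 0) = abs_kw (if P then x else (0 :: ('a, 'n) V_U))" for P x
    by (simp add: zero_kw_def)
  then show ?thesis
    using kw_T_kphi_lf[OF assms, where 'a = 'a]
    unfolding kphi_def kw_T_abs kw_act_abs abs_kw_sum[symmetric] by (simp only: plus_kw.abs_eq kw_eq_iff)
qed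

lemma phi_psi_power:
  assumes k: "k < CARD('n::{finite,linorder})"
  shows "phi_psi (en k) - (TA E ^^ k) (axis (en 0) 1) \<in> (ln_null :: ('a::field_char_0, 'n) V_U set)"
proof -
  have pow: "abs_kw ((TA E ^^ n) y) = (kw_T ^^ n) (abs_kw y)" for n and y :: "('a, 'n) V_U"
    by (induction n) (simp_all add: kw_T_abs[symmetric])
  have "kw.dz 0 ((kw_T ^^ n) (kphi 0) :: ('a, 'n) kw)" for n
  proof (induction n)
    case 0
    show ?case unfolding kw.dz_def by (simp add: kw_D_kphi)
  next
    case (Suc n)
    then show ?case unfolding kw.dz_def by (simp add: kw_T_D[symmetric] kw_T_0)
  qed
  from kw.PM_eq[OF this kw_T_pow_kphi[OF k]]
  have "abs_kw (phi_psi (en k) :: ('a, 'n) V_U) = (kw_T ^^ k) (kphi 0)"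
    unfolding phi_psi_def by (subst P_m_en) (simp_all add: kphi_def kw.uu_def idx_en)
  then show ?thesis unfolding kphi_def pow[symmetric] kw_eq_iff .
qed


section \<open>The vertex-IRF identity\<close>

lemma on_fst_mult: "on_fst A ** on_fst B = on_fst (\<lambda>m. A m ** B m)"
proof (rule vec_eq_iff[THEN iffD2], rule allI, rule vec_eq_iff[THEN iffD2], rule allI)
  fix p q
  have "(on_fst A ** on_fst B) $ p $ q = (\<Sum>r\<in>UNIV. \<Sum>s\<in>UNIV. on_fst A $ p $ (r, s) * on_fst B $ (r, s) $ q)"
    unfolding matrix_matrix_mult_def vec_lambda_beta UNIV_Times_UNIV[symmetric] sum.cartesian_product
    by (simp add: case_prod_beta)
  also have "\<dots> = (\<Sum>r\<in>UNIV. \<Sum>s\<in>UNIV. if s = snd q then (if snd p = snd q then A (snd q) $ fst p $ r * B (snd q) $ r $ fst q else 0) else 0)"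
    by (intro sum.cong) (auto simp: on_fst_def)
  also have "\<dots> = on_fst (\<lambda>m. A m ** B m) $ p $ q"
    by (simp add: on_fst_def matrix_matrix_mult_def)
  finally show "(on_fst A ** on_fst B) $ p $ q = on_fst (\<lambda>m. A m ** B m) $ p $ q" .
qed

lemma on_snd_mult: "on_snd A ** on_snd B = on_snd (\<lambda>m. A m ** B m)"
proof (rule vec_eq_iff[THEN iffD2], rule allI, rule vec_eq_iff[THEN iffD2], rule allI)
  fix p q
  have "(on_snd A ** on_snd B) $ p $ q = (\<Sum>s\<in>UNIV. \<Sum>r\<in>UNIV. on_snd A $ p $ (r, s) * on_snd B $ (r, s) $ q)"
    unfolding matrix_matrix_mult_def vec_lambda_beta UNIV_Times_UNIV[symmetric]
    by (subst sum.swap) (simp add: sum.cartesian_product case_prod_beta)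
  also have "\<dots> = (\<Sum>s\<in>UNIV. \<Sum>r\<in>UNIV. if r = fst q then (if fst p = fst q then A (fst q) $ snd p $ s * B (fst q) $ s $ snd q else 0) else 0)"
    by (intro sum.cong) (auto simp: on_snd_def)
  also have "\<dots> = on_snd (\<lambda>m. A m ** B m) $ p $ q"
    by (simp add: on_snd_def matrix_matrix_mult_def)
  finally show "(on_snd A ** on_snd B) $ p $ q = on_snd (\<lambda>m. A m ** B m) $ p $ q" .
qed

lemma on_fst_1: "on_fst (\<lambda>_. mat 1) = mat 1" and on_snd_1: "on_snd (\<lambda>_. mat 1) = mat 1"
  by (auto simp: on_fst_def on_snd_def mat_def vec_eq_iff prod_eq_iff)

lemma on_fst_on_snd_nth: "(on_fst A ** on_snd B) $ (i, j) $ (k, m) = A j $ i $ k * B k $ j $ m"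
proof -
  have "(on_fst A ** on_snd B) $ (i, j) $ (k, m) = (\<Sum>r\<in>UNIV. \<Sum>s\<in>UNIV. on_fst A $ (i, j) $ (r, s) * on_snd B $ (r, s) $ (k, m))"
    unfolding matrix_matrix_mult_def vec_lambda_beta UNIV_Times_UNIV[symmetric] sum.cartesian_product
    by (simp add: case_prod_beta)
  also have "\<dots> = (\<Sum>r\<in>UNIV. \<Sum>s\<in>UNIV. if s = j then (if r = k then A j $ i $ k * B k $ j $ m else 0) else 0)"
    by (intro sum.cong) (auto simp: on_fst_def on_snd_def)
  finally show ?thesis by simp
qed

lemma on_snd_on_fst_nth: "(on_snd B ** on_fst A) $ (i, j) $ (k, m) = B i $ j $ m * A m $ i $ k"
proof -
  have "(on_snd B ** on_fst A) $ (i, j) $ (k, m) = (\<Sum>r\<in>UNIV. \<Sum>s\<in>UNIV. on_snd B $ (i, j) $ (r, s) * on_fst A $ (r, s) $ (k, m))"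
    unfolding matrix_matrix_mult_def vec_lambda_beta UNIV_Times_UNIV[symmetric] sum.cartesian_product
    by (simp add: case_prod_beta)
  also have "\<dots> = (\<Sum>r\<in>UNIV. \<Sum>s\<in>UNIV. if s = m then (if r = i then B i $ j $ m * A m $ i $ k else 0) else 0)"
    by (intro sum.cong) (auto simp: on_fst_def on_snd_def)
  finally show ?thesis by simp
qed

lemma flip_mat_left: "(flip_mat ** M) $ (i, j) = M $ (j, i)"
proof (rule vec_eq_iff[THEN iffD2], rule allI)
  fix q
  have "(flip_mat ** M) $ (i, j) $ q = (\<Sum>r\<in>UNIV. if r = (j, i) then M $ r $ q else 0)"
    unfolding matrix_matrix_mult_def flip_mat_def vec_lambda_beta by (intro sum.cong) auto
  then show "(flip_mat ** M) $ (i, j) $ q = M $ (j, i) $ q" by simp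
qed

lemma flip_mat_right: "(M ** flip_mat) $ p $ (k, m) = M $ p $ (m, k)"
proof -
  have "(M ** flip_mat) $ p $ (k, m) = (\<Sum>r\<in>UNIV. if r = (m, k) then M $ p $ r else 0)"
    unfolding matrix_matrix_mult_def flip_mat_def vec_lambda_beta by (intro sum.cong) auto
  then show ?thesis by simp
qed

lemma mat_prod_eqI: "(\<And>i j k m. A $ (i, j) $ (k, m) = B $ (i, j) $ (k, m)) \<Longrightarrow> A = B"
  by (auto simp: vec_eq_iff)

lemma J_mat_nth: "J_mat hb l $ p $ (a, b) =
    (if p = (a, b) then 1 else 0) + (if b < a \<and> p = (b, a) then hb * inverse (l b - l a) else 0)"
  by (simp add: J_mat_def)

lemma J_mat_left:
  fixes l :: "'n::{finite,linorder} \<Rightarrow> 'k::field"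
  shows "(J_mat hb l ** M) $ (i, j) $ q =
  M $ (i, j) $ q + (if i < j then hb * inverse (l i - l j) * M $ (j, i) $ q else 0)"
proof -
  have "(J_mat hb l ** M) $ (i, j) $ q = (\<Sum>r\<in>UNIV. (if r = (i, j) then M $ r $ q else 0)
      + (if r = (j, i) then (if i < j then hb * inverse (l i - l j) * M $ r $ q else 0) else 0))"
    unfolding matrix_matrix_mult_def vec_lambda_beta
  proof (intro sum.cong refl)
    fix r :: "'n \<times> 'n"
    obtain a b where r: "r = (a, b)" by (cases r)
    show "J_mat hb l $ (i, j) $ r * M $ r $ q = (if r = (i, j) then M $ r $ q else 0)
      + (if r = (j, i) then (if i < j then hb * inverse (l i - l j) * M $ r $ q else 0) else 0)"
      unfolding r J_mat_nth by (cases "a = i"; cases "b = j"; cases "a = j"; cases "b = i") simp_all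
  qed
  then show ?thesis by (simp add: sum.distrib)
qed

text \<open>The off-diagonal part of \<open>J\<close> has square zero and is linear in
  \<open>hb\<close>, so changing the sign of \<open>hb\<close> gives the inverse.\<close>

lemma invertible_J_mat: "invertible (J_mat hb l)"
proof -
  have "J_mat (- hb) l ** J_mat hb l = mat 1"
  proof (rule mat_prod_eqI)
    fix i j k m
    show "(J_mat (- hb) l ** J_mat hb l) $ (i, j) $ (k, m) = mat 1 $ (i, j) $ (k, m)"
      unfolding J_mat_left J_mat_nth mat_def vec_lambda_beta prod.inject
      by (cases i j rule: linorder_cases; cases "k = i"; cases "m = j"; cases "k = j"; cases "m = i") (simp_all, auto)
  qed
  then show ?thesis by (metis invertible_def matrix_left_right_inverse)
qed

lemma sum_idx: "(\<Sum>k\<in>UNIV. f (idx (k :: 'n::{finite,linorder}) - 1)) = (\<Sum>p<CARD('n). f p)"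
  unfolding sum_en by (intro sum.cong) (auto simp: idx_en)

lemma idx_less: "idx (k :: 'n::{finite,linorder}) - 1 < CARD('n)"
  using en_surj[of k] by (auto simp: idx_en)

text \<open>Up to nonzero row factors this is a Vandermonde matrix: a vector in the kernel lists the
  coefficients of a polynomial of degree below \<open>CARD('n)\<close> that vanishes at
  \<open>CARD('n)\<close> distinct points.\<close>

lemma invertible_S_mat:
  fixes l :: "'n::{finite,linorder} \<Rightarrow> 'k::field"
  assumes "inj l"
  shows "invertible (S_mat l)"
proof -
  have "x = 0" if x: "S_mat l *v x = 0" for x
  proof -
    define p where "p = (\<Sum>k<CARD('n). monom (x $ (en k :: 'n)) k)"
    have c: "coeff p k = (if k < CARD('n) then x $ (en k :: 'n) else 0)" for k
      unfolding p_def coeff_sum by simp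
    have root: "poly p (l i) = 0" for i
    proof -
      have "(S_mat l *v x) $ i = (\<Prod>j\<in>{..<i}. inverse (l i - l j)) * poly p (l i)"
        unfolding matrix_vector_mult_def vec_lambda_beta S_mat_nth p_def poly_sum poly_monom sum_en
        by (simp add: idx_en sum_distrib_left ac_simps)
      moreover have "(\<Prod>j\<in>{..<i}. inverse (l i - l j)) \<noteq> 0"
        using assms by (auto simp: inj_eq)
      ultimately show ?thesis using x by simp
    qed
    have "p = 0"
    proof (rule ccontr)
      assume "p \<noteq> 0"
      have "CARD('n) = card (range l)" using assms by (simp add: card_image)
      also have "\<dots> \<le> card {r. poly p r = 0}"
        using root \<open>p \<noteq> 0\<close> by (intro card_mono poly_roots_finite) auto
      also have "\<dots> \<le> degree p" using \<open>p \<noteq> 0\<close> by (rule card_poly_roots_bound)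
      finally have "coeff p (degree p) = 0" unfolding c by simp
      with \<open>p \<noteq> 0\<close> show False by simp
    qed
    have "x $ i = 0" for i
    proof -
      obtain k where "k < CARD('n)" "i = en k" using en_surj[of i] by blast
      then show ?thesis using c[of k] \<open>p = 0\<close> by simp
    qed
    then show "x = 0" by (simp add: vec_eq_iff)
  qed
  then show ?thesis
    by (metis matrix_left_invertible_ker invertible_def matrix_left_right_inverse)
qed

section \<open>Values of polynomials in two variables and \<open>R\<^sup>C\<^sup>G\<close>\<close>

definition eval2 :: "'k::field poly poly \<Rightarrow> 'k \<Rightarrow> 'k \<Rightarrow> 'k"
  where "eval2 f u v = poly (poly f [:v:]) u"

lemma eval2_simps:
  "eval2 (f + g) u v = eval2 f u v + eval2 g u v" "eval2 (f - g) u v = eval2 f u v - eval2 g u v"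
  "eval2 (f * g) u v = eval2 f u v * eval2 g u v" "eval2 (f ^ n) u v = eval2 f u v ^ n"
  "eval2 X1 u v = u" "eval2 X2 u v = v" "eval2 [:[:c:]:] u v = c"
  by (simp_all add: eval2_def X1_def X2_def)

definition deg_below :: "nat \<Rightarrow> 'k::field poly poly \<Rightarrow> bool"
  where "deg_below n f \<longleftrightarrow> (\<forall>a b. n \<le> a \<or> n \<le> b \<longrightarrow> coeff (coeff f b) a = 0)"

lemma X_monom: "X1 ^ k * X2 ^ m = (monom (monom 1 k) m :: 'k::field poly poly)"
proof -
  have "X1 ^ k = (monom (monom 1 k) 0 :: 'k poly poly)"
  proof -
    have "[:p:] ^ k = [:p ^ k :: 'k poly:]" for p by (induction k) (simp_all add: ac_simps one_pCons)
    then show ?thesis unfolding X1_def by (simp add: monom_altdef)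
  qed
  moreover have "X2 ^ m = (monom 1 m :: 'k poly poly)"
    unfolding X2_def by (simp add: monom_altdef)
  ultimately show ?thesis by (simp add: mult_monom)
qed

lemma deg_below_X: "k < n \<Longrightarrow> m < n \<Longrightarrow> deg_below n (X1 ^ k * X2 ^ m)"
  unfolding X_monom deg_below_def by auto

lemma deg_below_simps:
  "deg_below n f \<Longrightarrow> deg_below n g \<Longrightarrow> deg_below n (f - g)"
  "deg_below n f \<Longrightarrow> deg_below n (- f)"
  "(\<And>a. a \<in> A \<Longrightarrow> deg_below n (F a)) \<Longrightarrow> deg_below n (sum F A)"
  "deg_below n f \<Longrightarrow> deg_below n ([:[:c:]:] * f)"
  by (auto simp: deg_below_def coeff_sum)

lemma poly_below:
  fixes f :: "'b::comm_ring_1 poly"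
  assumes "\<And>b. n \<le> b \<Longrightarrow> coeff f b = 0"
  shows "poly f x = (\<Sum>b<n. coeff f b * x ^ b)"
proof -
  have "poly f x = (\<Sum>b\<in>{..degree f} \<union> {..<n}. coeff f b * x ^ b)"
    unfolding poly_altdef by (rule sum.mono_neutral_left) (auto simp: coeff_eq_0)
  also have "\<dots> = (\<Sum>b<n. coeff f b * x ^ b)"
    by (rule sum.mono_neutral_right) (use assms in auto)
  finally show ?thesis .
qed

lemma eval2_below:
  assumes "deg_below n f"
  shows "eval2 f u v = (\<Sum>b<n. \<Sum>a<n. coeff (coeff f b) a * u ^ a * v ^ b)"
proof -
  have "poly f [:v:] = (\<Sum>b<n. coeff f b * [:v:] ^ b)"
    using assms by (intro poly_below) (auto simp: deg_below_def poly_eq_iff)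
  then have "eval2 f u v = (\<Sum>b<n. poly (coeff f b) u * v ^ b)"
    unfolding eval2_def by (simp add: poly_sum)
  also have "\<dots> = (\<Sum>b<n. \<Sum>a<n. coeff (coeff f b) a * u ^ a * v ^ b)"
  proof (rule sum.cong[OF refl])
    fix b
    have "poly (coeff f b) u = (\<Sum>a<n. coeff (coeff f b) a * u ^ a)"
      using assms by (intro poly_below) (auto simp: deg_below_def)
    then show "poly (coeff f b) u * v ^ b = (\<Sum>a<n. coeff (coeff f b) a * u ^ a * v ^ b)"
      by (simp add: sum_distrib_right)
  qed
  finally show ?thesis .
qed

text \<open>After a common monomial is taken out, the quotient is a geometric sum. Written out, it
  keeps the degree in each variable below \<open>n\<close>, so that the coefficients read off in
  \<open>R_CG\<close> describe the whole polynomial.\<close>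

lemma X_diff_dvd:
  assumes "k < n" "m < n"
  shows "\<exists>g. deg_below n g \<and> X1 ^ k * X2 ^ m - X2 ^ k * X1 ^ m = (X1 - X2) * (g :: 'k::field poly poly)"
proof -
  have *: "\<exists>g. deg_below n g \<and> X1 ^ (r + d) * X2 ^ r - X2 ^ (r + d) * X1 ^ r = (X1 - X2) * (g :: 'k poly poly)" if "r + d < n" for r d
  proof (intro exI conjI)
    let ?g = "\<Sum>i<d. X1 ^ (r + i) * X2 ^ (r + (d - Suc i)) :: 'k poly poly"
    show "deg_below n ?g" using that by (intro deg_below_simps deg_below_X) auto
    have "X1 ^ (r + d) * X2 ^ r - X2 ^ (r + d) * X1 ^ r = X1 ^ r * X2 ^ r * (X1 ^ d - X2 ^ d :: 'k poly poly)"
      by (simp add: power_add algebra_simps)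
    also have "X1 ^ d - X2 ^ d = (X1 - X2) * (\<Sum>i<d. X2 ^ (d - Suc i) * (X1 :: 'k poly poly) ^ i)"
      by (rule power_diff_sumr2)
    also have "X1 ^ r * X2 ^ r * ((X1 - X2) * (\<Sum>i<d. X2 ^ (d - Suc i) * (X1 :: 'k poly poly) ^ i)) = (X1 - X2) * ?g"
      by (simp only: sum_distrib_left power_add mult.assoc mult.commute mult.left_commute)
    finally show "X1 ^ (r + d) * X2 ^ r - X2 ^ (r + d) * X1 ^ r = (X1 - X2) * ?g" .
  qed
  show ?thesis
  proof (cases "m \<le> k")
    case True
    then show ?thesis using *[of m "k - m"] assms by simp
  next
    case False
    then obtain g :: "'k poly poly" where "deg_below n g" "X1 ^ m * X2 ^ k - X2 ^ m * X1 ^ k = (X1 - X2) * g"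
      using *[of k "m - k"] assms by auto
    then show ?thesis
      by (intro exI[of _ "- g"]) (simp add: deg_below_simps(2) algebra_simps)
  qed
qed

lemma CG_op_X:
  fixes hb :: "'k::field"
  assumes "k < n" "m < n"
  defines "g \<equiv> CG_op hb (X1 ^ k * X2 ^ m)"
  shows "deg_below n g"
    and "u \<noteq> v \<Longrightarrow> eval2 g u v = u ^ k * v ^ m - hb * ((u ^ k * v ^ m - v ^ k * u ^ m) / (u - v))"
proof -
  have s: "subst2 (X1 ^ k * X2 ^ m) X2 X1 = X2 ^ k * (X1 :: 'k poly poly) ^ m"
    unfolding X_monom subst2_def by (simp add: map_poly_monom poly_monom flip: one_pCons)
  obtain q :: "'k poly poly" where q: "deg_below n q" "X1 ^ k * X2 ^ m - X2 ^ k * X1 ^ m = (X1 - X2) * q"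
    using X_diff_dvd[OF assms(1,2)] by blast
  have "X1 \<noteq> (X2 :: 'k poly poly)" by (simp add: X1_def X2_def)
  then have g: "g = X1 ^ k * X2 ^ m - [:[:hb:]:] * q"
    unfolding g_def CG_op_def s q(2) by (simp only: nonzero_mult_div_cancel_left right_minus_eq not_False_eq_True)
  show "deg_below n g" unfolding g using assms(1,2) q(1) by (intro deg_below_simps deg_below_X)
  assume "u \<noteq> v"
  have "eval2 ((X1 - X2) * q) u v = u ^ k * v ^ m - v ^ k * u ^ m"
    unfolding q(2)[symmetric] eval2_simps ..
  then have "eval2 q u v = (u ^ k * v ^ m - v ^ k * u ^ m) / (u - v)"
    unfolding eval2_simps using \<open>u \<noteq> v\<close> by (simp add: eq_divide_eq mult.commute)
  then show "eval2 g u v = u ^ k * v ^ m - hb * ((u ^ k * v ^ m - v ^ k * u ^ m) / (u - v))"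
    unfolding g eval2_simps by simp
qed

lemma R_CG_nth: "R_CG hb $ (i, j) $ (k, m) =
  coeff (coeff (CG_op hb (X1 ^ (idx k - 1) * X2 ^ (idx m - 1))) (idx j - 1)) (idx i - 1)"
  by (simp add: R_CG_def)

lemma matrix_inv_mult: "invertible A \<Longrightarrow> matrix_inv A ** A = mat 1"
  unfolding invertible_def matrix_inv_def by (rule someI2_ex) auto

text \<open>\<open>P\<close> and \<open>Q\<close> are the values of one monomial at
  \<open>(x, y)\<close> and \<open>(y, x)\<close>, \<open>d\<close> is the difference of the two
  coordinates up to sign, and \<open>D\<close> is the common normalization of the two rows. The
  identities are the rows \<open>(i, j)\<close> with \<open>i < j\<close> and with
  \<open>i > j\<close> of the comparison in \<open>vertex_irf\<close>; the off-diagonal term of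
  \<open>J\<close> sits on the right in the first and on the left in the second.\<close>

lemma vertex_irf_field_identities:
  fixes P Q D d hb :: "'k::field"
  assumes "d \<noteq> 0" "d + hb \<noteq> 0"
  shows "D * (d / (d + hb)) * Q = D * (Q - hb * ((Q - P) / d)) + hb * inverse (- d) * (D * (d / (d + hb)) * (P - hb * ((P - Q) / - d)))"
    and "D * P + hb * inverse (- d) * (D * (d / (d + hb)) * Q) = D * (d / (d + hb)) * (P - hb * ((P - Q) / - d))"
proof -
  define s where "s = d + hb"
  have hb: "hb = s - d" and s: "s \<noteq> 0" using assms(2) by (simp_all add: s_def)
  have 1: "P - hb * ((P - Q) / - d) = (s * P - hb * Q) / d"
    using assms(1) by (simp add: hb field_simps)
  have 2: "D * (d / s) * ((s * P - hb * Q) / d) = D * P - D * hb * Q / s"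
    using assms(1) s by (simp add: field_simps)
  have 3: "hb * inverse (- d) * (D * (d / s) * Q) = - (D * hb * Q / s)"
    using assms(1) by (simp add: field_simps)
  have 4: "hb * inverse (- d) * (D * P - D * hb * Q / s) = - (D * hb * P / d) + D * Q * (hb * hb / (d * s))"
    using assms(1) s by (simp add: field_simps)
  have 5: "D * (Q - hb * ((Q - P) / d)) = D * Q * (1 - hb / d) + D * hb * P / d"
    using assms(1) by (simp add: field_simps)
  have 6: "d / s = 1 - hb / d + hb * hb / (d * s)"
    using assms(1) s by (simp add: hb field_simps)
  show "D * P + hb * inverse (- d) * (D * (d / (d + hb)) * Q) = D * (d / (d + hb)) * (P - hb * ((P - Q) / - d))"
    unfolding s_def[symmetric] 1 2 3 by simp
  show "D * (d / (d + hb)) * Q = D * (Q - hb * ((Q - P) / d)) + hb * inverse (- d) * (D * (d / (d + hb)) * (P - hb * ((P - Q) / - d)))"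
    unfolding s_def[symmetric] 1 2 4 5 by (simp add: 6 distrib_left mult.commute mult.left_commute)
qed

text \<open>Clearing the inverses turns the identity into
  \<open>flip_mat ** (J ** F) = J ** F ** flip_mat ** R_CG hb\<close>, where \<open>F\<close> is the
  dynamical tensor square of \<open>S\<close> and \<open>G\<close>, its conjugate by the flip, is
  inverted by the left factor. The rows of \<open>F\<close> are multiples of evaluations of
  polynomials, so both sides are compared row by row.\<close>

lemma vertex_irf:
  fixes l :: "'n::{finite,linorder} \<Rightarrow> 'k::field"
  assumes hb: "hb \<noteq> 0" and l: "\<And>i j. i \<noteq> j \<Longrightarrow> l i \<noteq> l j" "\<And>i j. i \<noteq> j \<Longrightarrow> l i - l j \<noteq> hb"
  shows "R_CG hb = (on_fst (\<lambda>_. matrix_inv (S_mat l)) ** on_snd (\<lambda>i. matrix_inv (S_mat (dyn_shift hb l i)))) **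
    R_dyn hb l ** (on_fst (\<lambda>m. S_mat (dyn_shift hb l m)) ** on_snd (\<lambda>_. S_mat l))"
proof -
  define F where "F = on_fst (\<lambda>m. S_mat (dyn_shift hb l m)) ** on_snd (\<lambda>_. S_mat l)"
  define G where "G = on_snd (\<lambda>i. S_mat (dyn_shift hb l i)) ** on_fst (\<lambda>_. S_mat l)"
  define c where "c i j = (\<Prod>a\<in>{..<i}. inverse (dyn_shift hb l j i - dyn_shift hb l j a)) * (\<Prod>a\<in>{..<j}. inverse (l j - l a))" for i j
  have F_nth: "F $ (i, j) $ (k, m) = c i j * (dyn_shift hb l j i ^ (idx k - 1) * l j ^ (idx m - 1))" for i j k m
    unfolding F_def on_fst_on_snd_nth S_mat_nth c_def by simp
  have F_entry: "F $ (i, j) $ (k, m) = S_mat (dyn_shift hb l j) $ i $ k * S_mat l $ j $ m" for i j k m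
    by (simp add: F_def on_fst_on_snd_nth)
  have G: "G = flip_mat ** F ** flip_mat"
    by (rule mat_prod_eqI) (simp add: G_def flip_mat_left flip_mat_right F_entry on_snd_on_fst_nth flip: matrix_mul_assoc)
  have inj: "inj l" using l(1) by (auto simp: inj_def)
  have "inj (dyn_shift hb l i)" for i
  proof (rule injI, rule ccontr)
    fix j k assume *: "dyn_shift hb l i j = dyn_shift hb l i k" "j \<noteq> k"
    then show False
      using l(1)[of j k] l(2)[of j k] l(2)[of k j] by (auto simp: dyn_shift_def algebra_simps split: if_splits)
  qed
  then have "(on_fst (\<lambda>_. matrix_inv (S_mat l)) ** on_snd (\<lambda>i. matrix_inv (S_mat (dyn_shift hb l i)))) ** G
      = on_fst (\<lambda>_. matrix_inv (S_mat l)) ** ((on_snd (\<lambda>i. matrix_inv (S_mat (dyn_shift hb l i))) **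
        on_snd (\<lambda>i. S_mat (dyn_shift hb l i))) ** on_fst (\<lambda>_. S_mat l))"
    by (simp add: G_def matrix_mul_assoc)
  also have "\<dots> = mat 1"
    using \<open>\<And>i. inj (dyn_shift hb l i)\<close> inj
    by (simp add: on_snd_mult on_fst_mult matrix_inv_mult invertible_S_mat on_snd_1 on_fst_1)
  finally have G_inv: "(on_fst (\<lambda>_. matrix_inv (S_mat l)) ** on_snd (\<lambda>i. matrix_inv (S_mat (dyn_shift hb l i)))) ** G = mat 1" .
  define D where "D i j = (\<Prod>a\<in>{..<i}. inverse (l i - l a)) * (\<Prod>a\<in>{..<j}. inverse (l j - l a))" for i j
  have c1: "c i j = D i j" if "i < j" for i j
    unfolding c_def D_def using that by (intro arg_cong2[where f = "(*)"] prod.cong) (auto simp: dyn_shift_def)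
  \<comment> \<open>Only the factor with \<open>a = i\<close> sees the shift of \<open>l i\<close>
    by \<open>hb\<close>.\<close>
  have c2: "c j i = D i j * ((l j - l i) / (l j - l i + hb))" if ij: "i < j" for i j
  proof -
    have "(\<Prod>a\<in>{..<j}. inverse (dyn_shift hb l i j - dyn_shift hb l i a)) =
        inverse (l j - l i + hb) * (\<Prod>a\<in>{..<j} - {i}. inverse (l j - l a))"
      using ij by (subst prod.remove[of _ i]) (auto simp: dyn_shift_def algebra_simps intro!: arg_cong2[where f = "(*)"] prod.cong)
    moreover have "(\<Prod>a\<in>{..<j}. inverse (l j - l a)) = inverse (l j - l i) * (\<Prod>a\<in>{..<j} - {i}. inverse (l j - l a))"
      using ij by (subst prod.remove[of _ i]) auto
    moreover have "l j - l i \<noteq> 0" using l(1)[OF less_imp_neq[OF ij]] by auto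
    ultimately show ?thesis unfolding c_def D_def by (simp add: field_simps)
  qed
  define M where "M = F ** flip_mat ** R_CG hb"
  define val where "val k m u v = u ^ (idx k - 1) * v ^ (idx m - 1) - hb * ((u ^ (idx k - 1) * v ^ (idx m - 1) - v ^ (idx k - 1) * u ^ (idx m - 1)) / (u - v))"
    for k m :: 'n and u v
  have M_nth: "M $ (i, j) $ (k, m) = c i j * val k m (l j) (dyn_shift hb l j i)" for i j k m
  proof -
    let ?g = "CG_op hb (X1 ^ (idx k - 1) * X2 ^ (idx m - 1))" and ?x = "dyn_shift hb l j i"
    have ne: "l j \<noteq> ?x" using hb l(1)[of j i] by (auto simp: dyn_shift_def)
    have "M $ (i, j) $ (k, m) = (\<Sum>r\<in>UNIV. (F ** flip_mat) $ (i, j) $ r * R_CG hb $ r $ (k, m))"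
      unfolding M_def by (simp add: matrix_matrix_mult_def)
    also have "\<dots> = (\<Sum>r\<in>UNIV. \<Sum>s\<in>UNIV. (F ** flip_mat) $ (i, j) $ (r, s) * R_CG hb $ (r, s) $ (k, m))"
      unfolding UNIV_Times_UNIV[symmetric] sum.cartesian_product by (simp add: case_prod_beta)
    also have "\<dots> = (\<Sum>s\<in>(UNIV :: 'n set). \<Sum>r\<in>(UNIV :: 'n set). c i j * (coeff (coeff ?g (idx s - 1)) (idx r - 1) * l j ^ (idx r - 1) * ?x ^ (idx s - 1)))"
    proof (rule trans[OF sum.swap], rule sum.cong[OF refl], rule sum.cong[OF refl])
      fix s r
      show "(F ** flip_mat) $ (i, j) $ (r, s) * R_CG hb $ (r, s) $ (k, m) =
          c i j * (coeff (coeff ?g (idx s - 1)) (idx r - 1) * l j ^ (idx r - 1) * ?x ^ (idx s - 1))"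
        unfolding flip_mat_right F_nth R_CG_nth by (simp only: mult.assoc mult.commute mult.left_commute)
    qed
    also have "\<dots> = c i j * (\<Sum>b<CARD('n). \<Sum>a<CARD('n). coeff (coeff ?g b) a * l j ^ a * ?x ^ b)"
      unfolding sum_distrib_left[symmetric] sum_idx[where f = "\<lambda>a. coeff (coeff ?g (idx s - 1)) a * l j ^ a * ?x ^ (idx s - 1)" for s]
        sum_idx[where f = "\<lambda>b. \<Sum>a<CARD('n). coeff (coeff ?g b) a * l j ^ a * ?x ^ b"] ..
    also have "(\<Sum>b<CARD('n). \<Sum>a<CARD('n). coeff (coeff ?g b) a * l j ^ a * ?x ^ b) = eval2 ?g (l j) ?x"
      by (rule eval2_below[OF CG_op_X(1)[OF idx_less idx_less], symmetric])
    also have "\<dots> = val k m (l j) ?x"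
      unfolding val_def by (rule CG_op_X(2)[OF idx_less idx_less ne])
    finally show ?thesis .
  qed
  have "flip_mat ** (J_mat hb l ** F) = J_mat hb l ** M"
  proof (rule mat_prod_eqI)
    fix i j k m
    have sh: "dyn_shift hb l a b = l b" if "a \<noteq> b" for a b using that by (simp add: dyn_shift_def)
    show "(flip_mat ** (J_mat hb l ** F)) $ (i, j) $ (k, m) = (J_mat hb l ** M) $ (i, j) $ (k, m)"
    proof (cases i j rule: linorder_cases)
      \<comment> \<open>Here the two points differ by \<open>hb\<close>, so the divided difference
        makes \<open>R\<^sup>C\<^sup>G\<close> a mere exchange of the two values.\<close>
      case equal
      then show ?thesis
        using hb by (simp add: flip_mat_left J_mat_left F_nth M_nth val_def dyn_shift_def)
    next
      case less
      define d where "d = l j - l i"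
      have d: "d \<noteq> 0" "d + hb \<noteq> 0" "l i - l j = - d" "l j - l i = d"
        using l(1)[OF less_imp_neq[OF less]] l(2)[OF less_imp_neq[OF less]] by (auto simp: d_def algebra_simps)
      have "(j < i) = False" "dyn_shift hb l j i = l i" "dyn_shift hb l i j = l j" using less by (auto simp: sh)
      then show ?thesis
        using less vertex_irf_field_identities(1)[OF d(1,2), of "D i j" "l j ^ (idx k - 1) * l i ^ (idx m - 1)" "l i ^ (idx k - 1) * l j ^ (idx m - 1)"]
        by (simp only: flip_mat_left J_mat_left F_nth M_nth val_def c1 c2 d if_True if_False add_0_right)
    next
      case greater
      define d where "d = l i - l j"
      have d: "d \<noteq> 0" "d + hb \<noteq> 0" "l j - l i = - d" "l i - l j = d"
        using l(1)[OF less_imp_neq[OF greater]] l(2)[OF less_imp_neq[OF greater]] by (auto simp: d_def algebra_simps)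
      have "(i < j) = False" "dyn_shift hb l j i = l i" "dyn_shift hb l i j = l j" using greater by (auto simp: sh)
      then show ?thesis
        using greater vertex_irf_field_identities(2)[OF d(1,2), of "D j i" "l j ^ (idx k - 1) * l i ^ (idx m - 1)" "l i ^ (idx k - 1) * l j ^ (idx m - 1)"]
        by (simp only: flip_mat_left J_mat_left F_nth M_nth val_def c1 c2 d if_True if_False add_0_right)
    qed
  qed
  then have "matrix_inv (J_mat hb l) ** (flip_mat ** (J_mat hb l ** F)) = matrix_inv (J_mat hb l) ** J_mat hb l ** M"
    by (simp add: matrix_mul_assoc)
  then have "flip_mat ** (matrix_inv (J_mat hb l) ** (flip_mat ** (J_mat hb l ** F))) = flip_mat ** M"
    by (simp add: matrix_inv_mult invertible_J_mat)
  then have "R_dyn hb l ** F = G ** R_CG hb"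
    by (simp add: R_dyn_def M_def G matrix_mul_assoc)
  then have "on_fst (\<lambda>_. matrix_inv (S_mat l)) ** on_snd (\<lambda>i. matrix_inv (S_mat (dyn_shift hb l i))) ** R_dyn hb l ** F = R_CG hb"
    using G_inv by (metis matrix_mul_assoc matrix_mul_lid)
  then show ?thesis unfolding F_def by simp
qed

lemma lam_generic:
  fixes i j :: "'n::{finite,linorder}"
  assumes "i \<noteq> j"
  shows "lam i - lam j - of_int m * hb_frac \<noteq> (0 :: ('a::field, 'n) Uh fract)"
proof -
  let ?n = "int (CARD('n) - idx i) - int (CARD('n) - idx j)"
  let ?s = "\<lambda>m. Uh_var i - Uh_var j + Uh_scal (of_int (?n - m) * hb_poly) :: ('a, 'n) Uh"
  have h: "of_int m * hb_frac = (Fract (Uh_scal (of_int m * hb_poly)) 1 :: ('a, 'n) Uh fract)"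
  proof (induction m rule: int_induct[where k = 0])
    case base
    show ?case by (simp add: Zero_fract_def)
  next
    case (step1 m)
    then show ?case by (simp add: distrib_right Uh_scal_add hb_frac_def)
  next
    case (step2 m)
    then show ?case by (simp add: left_diff_distrib Uh_scal_diff hb_frac_def)
  qed
  have "lam i - lam j - of_int m * hb_frac = Fract (?s m) 1"
    unfolding h lam_Fract by (simp add: left_diff_distrib Uh_scal_diff Uh_scal_add algebra_simps)
  moreover have "?s m \<noteq> 0" by (rule Uh_den_factor_nonzero[OF assms])
  ultimately show ?thesis by (simp add: Zero_fract_def eq_fract)
qed

lemma hb_frac_nonzero: "hb_frac \<noteq> (0 :: ('a::field, 'n::{finite,linorder}) Uh fract)"
proof -
  have "Poly_Mapping.lookup (Uh_scal hb_poly :: ('a, 'n) Uh) 0 \<noteq> 0"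
    by (simp add: Uh_scal_def hb_poly_def)
  then have "Uh_scal hb_poly \<noteq> (0 :: ('a, 'n) Uh)" by auto
  then show ?thesis by (simp add: hb_frac_def Zero_fract_def eq_fract)
qed

lemma lam_distinct: "i \<noteq> j \<Longrightarrow> lam i \<noteq> lam j"
  using lam_generic[of i j 0] by simp

lemma vertex_irf_lam:
  "R_CG hb_frac = (on_fst (\<lambda>_. matrix_inv (S_mat lam)) ** on_snd (\<lambda>i. matrix_inv (S_mat (dyn_shift hb_frac lam i)))) **
    R_dyn hb_frac lam ** (on_fst (\<lambda>m. S_mat (dyn_shift hb_frac lam m)) ** on_snd (\<lambda>_. S_mat lam))"
proof (rule vertex_irf[OF hb_frac_nonzero lam_distinct])
  show "lam i - lam j \<noteq> hb_frac" if "i \<noteq> j" for i j using lam_generic[OF that, of 1] by simp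
qed


section \<open>The double quotient\<close>

lemma U_Ugen_add: "U_Ugen (x + y) = U_Ugen x + U_Ugen y"
  by (simp add: U_Ugen_def tens_add_right)

lemma U_Ugen_0: "U_Ugen 0 = 0"
  by (simp add: U_Ugen_def tens_0_right)

lemma U_Ugen_1: "U_Ugen 1 = 1"
  by (simp add: U_Ugen_def one_Ugen_def)

lemma U_Ugen_mult: "U_Ugen (x * y) = U_Ugen x * U_Ugen y"
  by (simp add: U_Ugen_def tens_1_times)

lemma U_Ugen_minus: "U_Ugen (- x) = - U_Ugen x"
  by (simp add: U_Ugen_def tens_minus_right)

lemma U_Ugen_diff: "U_Ugen (x - y) = U_Ugen x - U_Ugen y"
  using U_Ugen_add[of x "- y"] by (simp add: U_Ugen_minus)

lemma U_Ugen_scal_central: "U_Ugen (scalU c) * x = x * U_Ugen (scalU c)"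
proof (induction x rule: Ugen_induct)
  case (tens f z)
  have "U_Ugen (scalU c) * tens f z = tens (Uhgen_scal c * f) z"
    unfolding U_Ugen_def by (simp only: Ugen_mult_simps hmult_1 U_mult_Ugen_simps hmult_simps mult_1_left)
  also have "\<dots> = tens f (z * scalU c)" by (simp only: hmult_scal_tens scalU_central)
  also have "\<dots> = tens f z * U_Ugen (scalU c)" unfolding U_Ugen_def by (rule tens_times_right[symmetric])
  finally show ?case .
qed (simp_all add: distrib_left distrib_right)

lemma U_Ugen_E_E:
  fixes i j k l :: "'n::{finite,linorder}"
  shows "(U_Ugen (E i j) * U_Ugen (E k l) :: ('a::field, 'n) Ugen) = U_Ugen (E k l) * U_Ugen (E i j) +
    U_Ugen hb_U * ((if j = k then U_Ugen (E i l) else 0) - (if l = i then U_Ugen (E k j) else 0))"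
proof -
  have "(if P then U_Ugen x else 0) = (U_Ugen (if P then x else 0) :: ('a, 'n) Ugen)" for P x
    by (simp add: U_Ugen_0)
  then show ?thesis
    by (simp only: hb_U_def E_E[of i j k l] lieU_def flip: U_Ugen_mult U_Ugen_add U_Ugen_diff)
qed

lemma left_E_leftA: "left_E i j x = leftA (\<lambda>i j. U_Ugen (E i j)) (U_Ugen hb_U) i j x"
  by (simp add: left_E_def leftA_def)

lemma right_mult_minus: "right_mult (- x) z = - right_mult x (z :: 'r::ring_1)"
  by (simp add: right_mult_def vec_eq_iff)

lemma right_mult_diff: "right_mult (x - y) z = right_mult x z - right_mult y (z :: 'r::ring_1)"
  by (simp add: right_mult_def vec_eq_iff left_diff_distrib)

lemma right_mult_sum: "right_mult (sum f A) z = (\<Sum>a\<in>A. right_mult (f a) (z :: 'r::ring_1))"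
  by (induction A rule: infinite_finite_induct) (simp_all add: right_mult_add, simp_all add: right_mult_def vec_eq_iff)

lemma right_mult_0:
  fixes x :: "'r::ring_1 ^ 'n"
  shows "right_mult 0 (z :: 'r) = (0 :: 'r ^ 'n)" "right_mult x 0 = 0" "right_mult x 1 = x"
  by (simp_all add: right_mult_def vec_eq_iff)

lemma dq_null_minus: "x \<in> dq_null \<Longrightarrow> - x \<in> dq_null"
proof (induction rule: dq_null.induct)
  case (add x y)
  then show ?case unfolding minus_add_distrib by (intro dq_null.add)
next
  case (left j i x)
  have "- (left_E i j x - (\<chi> k. U_Ugen (scalU [:psi i j:]) * x $ k)) =
      left_E i j (- x) - (\<chi> k. U_Ugen (scalU [:psi i j:]) * (- x) $ k)"
    by (simp add: left_E_leftA leftA_minus vec_eq_iff)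
  then show ?case using dq_null.left[OF left, of "- x"] by simp
next
  case (right i j x)
  then show ?case using dq_null.right[of i j "- x"] by (simp add: right_mult_minus)
qed (simp add: dq_null.zero)

definition dq_eq :: "('a::field, 'n::{finite,linorder}) V_Ugen \<Rightarrow> ('a, 'n) V_Ugen \<Rightarrow> bool"  (infix "\<doteq>" 50)
  where "x \<doteq> y \<longleftrightarrow> x - y \<in> dq_null"

lemma dq_refl: "x \<doteq> x"
  by (simp add: dq_eq_def dq_null.zero)

lemma dq_sym: "x \<doteq> y \<Longrightarrow> y \<doteq> x"
  using dq_null_minus[of "x - y"] by (simp add: dq_eq_def)

lemma dq_trans [trans]: "x \<doteq> y \<Longrightarrow> y \<doteq> z \<Longrightarrow> x \<doteq> z"
  using dq_null.add[of "x - y" "y - z"] by (simp add: dq_eq_def)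

lemma dq_add: "x \<doteq> y \<Longrightarrow> x' \<doteq> y' \<Longrightarrow> x + x' \<doteq> y + y'"
  using dq_null.add[of "x - y" "x' - y'"] by (simp add: dq_eq_def add_diff_add)

lemma dq_sum: "(\<And>a. a \<in> A \<Longrightarrow> f a \<doteq> g a) \<Longrightarrow> sum f A \<doteq> sum g A"
  by (induction A rule: infinite_finite_induct) (simp_all add: dq_refl dq_add)

lemma dq_class_eqI:
  assumes "x \<doteq> y"
  shows "dq_class x = dq_class y"
  unfolding dq_class_def dq_eq_def[symmetric] using dq_trans[OF _ assms] dq_trans[OF _ dq_sym[OF assms]] by blast

lemma dq_left:
  fixes x :: "('a::field, 'n::{finite,linorder}) V_Ugen"
  assumes "j < i"
  shows "left_E i j x \<doteq> (if idx i = Suc (idx j) then x else 0)"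
proof -
  have "left_E i j x \<doteq> (\<chi> k. U_Ugen (scalU [:psi i j:]) * x $ k)"
    unfolding dq_eq_def using assms by (rule dq_null.left)
  moreover have "U_Ugen (scalU [:psi i j:]) = (if idx i = Suc (idx j) then 1 else (0 :: ('a, 'n) Ugen))"
    using U_Ugen_0 U_Ugen_1 by (auto simp: psi_def simp flip: one_pCons)
  ultimately show ?thesis by (cases "idx i = Suc (idx j)") (simp_all add: vec_lambda_eta flip: zero_vec_def)
qed

text \<open>Right multiplication commutes with the left action. It respects right multiples of
  \<open>n\<close> because \<open>E\<^sub>i\<^sub>j g = \<tau>(g) E\<^sub>i\<^sub>j\<close> with
  \<open>\<tau>\<close> a shift automorphism.\<close>

lemma dq_right_mult: "x \<doteq> y \<Longrightarrow> right_mult x (Uhgen_Ugen g) \<doteq> right_mult y (Uhgen_Ugen g)"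
  for x y :: "('a::field, 'n::{finite,linorder}) V_Ugen"
proof -
  have null: "z \<in> dq_null \<Longrightarrow> right_mult z (Uhgen_Ugen g) \<in> dq_null" for z :: "('a, 'n) V_Ugen"
  proof (induction rule: dq_null.induct)
    case zero
    show ?case by (simp add: right_mult_0 dq_null.zero)
  next
    case (add x y)
    then show ?case unfolding right_mult_add by (intro dq_null.add)
  next
    case (left j i x)
    have "right_mult (left_E i j x - (\<chi> k. U_Ugen (scalU [:psi i j:]) * x $ k)) (Uhgen_Ugen g) =
        left_E i j (right_mult x (Uhgen_Ugen g)) - (\<chi> k. U_Ugen (scalU [:psi i j:]) * right_mult x (Uhgen_Ugen g) $ k)"
      unfolding right_mult_diff left_E_leftA right_mult_leftA by (simp add: right_mult_def vec_eq_iff mult.assoc)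
    then show ?case using dq_null.left[OF left] by simp
  next
    case (right i j x)
    have "U_Ugen (E i j) * Uhgen_Ugen g = (tens (shift (wt i j) g) (E i j) :: ('a, 'n) Ugen)"
      unfolding U_Ugen_def Uhgen_Ugen_def by (simp add: Ugen_mult_simps hmult_1 U_mult_Ugen_simps Emult_simps)
    also have "\<dots> = Uhgen_Ugen (shift (wt i j) g) * U_Ugen (E i j)"
      unfolding U_Ugen_def Uhgen_Ugen_def by (simp add: tens_times_right)
    finally have "right_mult (right_mult x (U_Ugen (E i j))) (Uhgen_Ugen g) =
        right_mult (right_mult x (Uhgen_Ugen (shift (wt i j) g))) (U_Ugen (E i j))"
      by (simp only: right_mult_mult[symmetric])
    then show ?case using dq_null.right[OF right] by simp
  qed
  assume "x \<doteq> y"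
  then show ?thesis unfolding dq_eq_def right_mult_diff[symmetric] by (rule null)
qed

abbreviation TU :: "('a::field, 'n::{finite,linorder}) V_Ugen \<Rightarrow> ('a, 'n) V_Ugen"
  where "TU \<equiv> TA (\<lambda>i j. U_Ugen (E i j))"

lemma TA_diff: "TA F (x - y) = TA F x - TA F y"
  using TA_add[of F "x - y" y] by simp

lemma TA_sum: "TA F (sum f A) = (\<Sum>a\<in>A. TA F (f a))"
proof -
  have "TA F 0 = 0" using TA_add[of F 0 0] by simp
  then show ?thesis by (induction A rule: infinite_finite_induct) (simp_all add: TA_add)
qed

lemma dq_TU:
  fixes x y :: "('a::field, 'n::{finite,linorder}) V_Ugen"
  assumes "x \<doteq> y"
  shows "TU x \<doteq> TU y"
proof -
  have null: "z \<in> dq_null \<Longrightarrow> TU z \<in> dq_null" for z :: "('a, 'n) V_Ugen"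
  proof (induction rule: dq_null.induct)
    case zero
    have "TU (0 :: ('a, 'n) V_Ugen) = 0" using TA_add[of _ 0 0] by simp
    then show ?case by (simp add: dq_null.zero)
  next
    case (add x y)
    then show ?case unfolding TA_add by (intro dq_null.add)
  next
    case (left j i x)
    have 1: "TU (left_E i j x) = left_E i j (TU x)"
      unfolding left_E_leftA by (rule TA_leftA[OF U_Ugen_E_E]) (simp only: hb_U_def U_Ugen_scal_central)
    have 2: "TU (\<chi> k. U_Ugen (scalU [:psi i j:]) * x $ k) = (\<chi> k. U_Ugen (scalU [:psi i j:]) * TU x $ k)"
      by (rule TA_scale) (rule U_Ugen_scal_central[symmetric])
    show ?case unfolding TA_diff 1 2 by (rule dq_null.left[OF left])
  next
    case (right i j x)
    then show ?case unfolding TA_right_mult by (intro dq_null.right)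
  qed
  show ?thesis using assms unfolding dq_eq_def TA_diff[symmetric] by (rule null)
qed

lemma ln_null_dq_null:
  fixes x :: "('a::field_char_0, 'n::{finite,linorder}) V_U"
  shows "x \<in> ln_null \<Longrightarrow> (\<chi> m. U_Ugen (x $ m)) \<in> dq_null"
proof (induction rule: ln_null.induct)
  case zero
  have "(\<chi> m. U_Ugen ((0 :: ('a, 'n) V_U) $ m)) = 0" by (simp add: vec_eq_iff U_Ugen_0)
  then show ?case by (simp only: dq_null.zero)
next
  case (add x y)
  have "(\<chi> m. U_Ugen ((x + y) $ m)) = (\<chi> m. U_Ugen (x $ m)) + (\<chi> m. U_Ugen (y $ m))"
    by (simp add: vec_eq_iff U_Ugen_add)
  then show ?case using dq_null.add[OF add.IH] by simp
next
  case (left j i x)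
  have "(\<chi> m. U_Ugen ((leftA E hb_U i j x - (\<chi> k. scalU [:psi i j:] * x $ k)) $ m)) =
      left_E i j (\<chi> m. U_Ugen (x $ m)) - (\<chi> k. U_Ugen (scalU [:psi i j:]) * (\<chi> m. U_Ugen (x $ m)) $ k)"
    unfolding left_E_leftA
    by (simp add: vec_eq_iff leftA_nth U_Ugen_diff U_Ugen_add U_Ugen_minus U_Ugen_mult U_Ugen_0)
  then show ?case using dq_null.left[OF left, of "\<chi> m. U_Ugen (x $ m)"] by simp
qed

section \<open>Coordinates in the double quotient\<close>

definition Ugen_frac :: "('a::field, 'n::{finite,linorder}) Uh fract \<Rightarrow> ('a, 'n) Ugen"
  where "Ugen_frac c = Uhgen_Ugen (to_Uhgen c)"

lemma Ugen_frac_of: "Ugen_frac (of_Uhgen g) = Uhgen_Ugen g"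
  by (simp add: Ugen_frac_def of_Uhgen_inverse)

lemma Ugen_frac_simps:
  fixes c d :: "('a::field, 'n::{finite,linorder}) Uh fract"
  assumes "c \<in> range of_Uhgen" "d \<in> range of_Uhgen"
  shows "Ugen_frac (c + d) = Ugen_frac c + Ugen_frac d" "c + d \<in> range of_Uhgen"
    and "Ugen_frac (c * d) = Ugen_frac c * Ugen_frac d"
proof -
  obtain f g where *: "c = of_Uhgen f" "d = of_Uhgen g" using assms by blast
  show "Ugen_frac (c + d) = Ugen_frac c + Ugen_frac d"
    unfolding * plus_Uhgen.rep_eq[symmetric] Ugen_frac_of by (simp add: Uhgen_Ugen_def tens_add_left)
  show "c + d \<in> range of_Uhgen" unfolding * plus_Uhgen.rep_eq[symmetric] by simp
  show "Ugen_frac (c * d) = Ugen_frac c * Ugen_frac d"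
    unfolding * times_Uhgen.rep_eq[symmetric] Ugen_frac_of by (simp add: Uhgen_Ugen_def tens_times_left)
qed

lemma range_of_Uhgen_0: "0 \<in> range of_Uhgen"
  by (auto simp flip: zero_Uhgen.rep_eq)

lemma Ugen_frac_0: "Ugen_frac 0 = 0" and Ugen_frac_1: "Ugen_frac 1 = 1"
  unfolding zero_Uhgen.rep_eq[symmetric] one_Uhgen.rep_eq[symmetric] Ugen_frac_of
  by (simp_all add: Uhgen_Ugen_def tens_0_left one_Ugen_def)

lemma Ugen_frac_sum:
  assumes "\<And>a. a \<in> A \<Longrightarrow> f a \<in> range of_Uhgen"
  shows "Ugen_frac (sum f A) = (\<Sum>a\<in>A. Ugen_frac (f a)) \<and> sum f A \<in> range of_Uhgen"
  using assms
  by (induction A rule: infinite_finite_induct)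
    (simp_all add: Ugen_frac_0 range_of_Uhgen_0 Ugen_frac_simps)

lemma dq_right_frac: "x \<doteq> y \<Longrightarrow> right_mult x (Ugen_frac g) \<doteq> right_mult y (Ugen_frac g)"
  unfolding Ugen_frac_def by (rule dq_right_mult)

definition nu :: "nat \<Rightarrow> ('a::field, 'n::{finite,linorder}) Uh fract"
  where "nu p = lam (en p)"

definition comb :: "(nat \<Rightarrow> ('a::field, 'n::{finite,linorder}) Uh fract) \<Rightarrow> ('a, 'n) V_Ugen"
  where "comb c = (\<Sum>m<CARD('n). right_mult (axis (en m) 1) (Ugen_frac (c m)))"

lemma nu_mem: "nu p \<in> range of_Uhgen"
  unfolding nu_def by (rule lam_mem)

text \<open>The argument of \<open>P\<close> in column \<open>k\<close> and the shift in the
  definition of \<open>\<lambda>\<close> are the same multiple of \<open>\<hbar>\<close>.\<close>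

lemma U_Ugen_lf_diag:
  assumes "k < CARD('n::{finite,linorder})"
  shows "U_Ugen (gl.lf k k (kw.uu k)) = (Ugen_frac (nu k) :: ('a::field_char_0, 'n) Ugen)"
proof -
  let ?c = "of_nat (CARD('n) - Suc k) * hb_poly :: 'a poly"
  have "nu k = of_Uhgen (Uhgen_E (en k) + Uhgen_scal ?c :: ('a, 'n) Uhgen)"
    using assms by (simp add: nu_def lam_Fract idx_en plus_Uhgen.rep_eq Uhgen_E.rep_eq Uhgen_scal.rep_eq)
  moreover have "(gl.lf k k (kw.uu k) :: ('a, 'n) U) = E (en k) (en k) + scalU ?c"
    unfolding gl.lf_def kw.uu_def unfolding hb_U_def by (simp add: scalU_mult scalU_of_nat add.commute)
  moreover have "U_Ugen (E i i) = (Uhgen_Ugen (Uhgen_E i) :: ('a, 'n) Ugen)"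
    "U_Ugen (scalU c) = (Uhgen_Ugen (Uhgen_scal c) :: ('a, 'n) Ugen)"
    for i :: 'n and c :: "'a poly"
    unfolding U_Ugen_def Uhgen_Ugen_def
    using tens_balanced_E[of "1 :: ('a, 'n) Uhgen" i 1] tens_balanced_scal[of "1 :: ('a, 'n) Uhgen" c 1] by simp_all
  ultimately show ?thesis
    by (simp add: Ugen_frac_of U_Ugen_add) (simp add: Uhgen_Ugen_def tens_add_left)
qed

text \<open>In \<open>TA_axis\<close> the terms with \<open>b < k\<close> are right multiples of
  elements of \<open>n\<close> and drop out, so \<open>T\<close> becomes bidiagonal.\<close>

lemma TU_axis:
  assumes k: "k < CARD('n::{finite,linorder})"
  shows "TU (axis (en k) 1) \<doteq> (if Suc k < CARD('n) then axis (en (Suc k)) 1 else 0)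
    + right_mult (axis (en k) 1) (Ugen_frac (nu k) :: ('a::field_char_0, 'n) Ugen)"
proof -
  let ?\<iota> = "\<lambda>x :: ('a, 'n) V_U. \<chi> m. U_Ugen (x $ m)"
  have add: "?\<iota> (x + y) = ?\<iota> x + ?\<iota> y" and diff: "?\<iota> (x - y) = ?\<iota> x - ?\<iota> y" for x y
    by (simp_all add: vec_eq_iff U_Ugen_add U_Ugen_diff)
  have zero: "?\<iota> 0 = 0" by (simp add: vec_eq_iff U_Ugen_0)
  have sum: "?\<iota> (sum f A) = (\<Sum>a\<in>A. ?\<iota> (f a))" for f :: "nat \<Rightarrow> ('a, 'n) V_U" and A
    by (induction A rule: infinite_finite_induct) (simp_all only: sum.infinite sum.empty sum.insert add zero not_False_eq_True)
  have ax: "?\<iota> (axis i 1) = axis i 1" for i by (simp add: vec_eq_iff axis_def U_Ugen_0 U_Ugen_1)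
  have rm: "?\<iota> (right_mult x z) = right_mult (?\<iota> x) (U_Ugen z)" for x z
    by (simp add: vec_eq_iff right_mult_def U_Ugen_mult)
  have sumU: "U_Ugen (sum f A) = (\<Sum>a\<in>A. U_Ugen (f a))" for f :: "'n \<Rightarrow> ('a, 'n) U" and A
    by (induction A rule: infinite_finite_induct) (simp_all add: U_Ugen_0 U_Ugen_add)
  have ta: "?\<iota> (TA E x) = TU (?\<iota> x)" for x
    by (simp add: vec_eq_iff TA_def sumU U_Ugen_mult)
  have ifx: "?\<iota> (if P then x else 0) = (if P then ?\<iota> x else 0)" for P x using zero by simp
  have "TU (axis (en k) 1) \<doteq> (\<Sum>b\<le>k. right_mult (axis (en b) 1) (U_Ugen (gl.lf b k (kw.uu k)))) +
      (if Suc k < CARD('n) then axis (en (Suc k)) 1 else (0 :: ('a, 'n) V_Ugen))"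
    using ln_null_dq_null[OF TA_axis[OF k, where 'a = 'a]]
    unfolding diff add sum rm ta ax ifx dq_eq_def .
  also have "(\<Sum>b\<le>k. right_mult (axis (en b) 1) (U_Ugen (gl.lf b k (kw.uu k)))) =
      (\<Sum>b<k. right_mult (axis (en b) 1) (U_Ugen (E (en b) (en k)))) + right_mult (axis (en k) 1) (Ugen_frac (nu k) :: ('a, 'n) Ugen)"
    unfolding U_Ugen_lf_diag[OF k, symmetric] lessThan_Suc_atMost[symmetric] by (simp add: gl.lf_def)
  also have "(\<Sum>b<k. right_mult (axis (en b) 1) (U_Ugen (E (en b) (en k)))) + right_mult (axis (en k) 1) (Ugen_frac (nu k) :: ('a, 'n) Ugen)
      + (if Suc k < CARD('n) then axis (en (Suc k)) 1 else 0) \<doteq>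
      (\<Sum>b<k. 0) + right_mult (axis (en k) 1) (Ugen_frac (nu k) :: ('a, 'n) Ugen) + (if Suc k < CARD('n) then axis (en (Suc k)) 1 else 0)"
  proof (intro dq_add dq_refl dq_sum)
    fix b assume "b \<in> {..<k}"
    then have "en b < (en k :: 'n)" using k by (auto intro: en_less)
    then show "right_mult (axis (en b) 1) (U_Ugen (E (en b) (en k))) \<doteq> (0 :: ('a, 'n) V_Ugen)"
      unfolding dq_eq_def diff_zero by (rule dq_null.right)
  qed
  finally show ?thesis by (simp add: add.commute)
qed

lemma TU_comb:
  fixes c :: "nat \<Rightarrow> ('a::field_char_0, 'n::{finite,linorder}) Uh fract"
  assumes c: "\<And>m. c m \<in> range of_Uhgen"
  shows "TU (comb c) \<doteq> comb (\<lambda>m. (if m = 0 then 0 else c (m - 1)) + nu m * c m)"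
proof -
  let ?N = "CARD('n)" and ?a = "\<lambda>m. axis (en m) 1 :: ('a, 'n) V_Ugen"
  let ?c = "\<lambda>m. if m = 0 then 0 else c (m - 1)"
  have N: "?N = Suc (?N - 1)" by simp
  have "TU (comb c) = (\<Sum>m<?N. right_mult (TU (?a m)) (Ugen_frac (c m)))"
    by (simp add: comb_def TA_sum TA_right_mult)
  also have "\<dots> \<doteq> (\<Sum>m<?N. right_mult ((if Suc m < ?N then ?a (Suc m) else 0) + right_mult (?a m) (Ugen_frac (nu m))) (Ugen_frac (c m)))"
    by (intro dq_sum dq_right_frac TU_axis) simp
  also have "\<dots> = (\<Sum>m<?N. right_mult (if Suc m < ?N then ?a (Suc m) else 0) (Ugen_frac (c m)))
      + (\<Sum>m<?N. right_mult (?a m) (Ugen_frac (nu m * c m)))"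
    by (simp add: right_mult_add sum.distrib right_mult_mult Ugen_frac_simps(3)[OF nu_mem c])
  also have "(\<Sum>m<?N. right_mult (if Suc m < ?N then ?a (Suc m) else 0) (Ugen_frac (c m))) =
      (\<Sum>m<?N - 1. right_mult (?a (Suc m)) (Ugen_frac (c m)))"
    by (subst N, subst sum.lessThan_Suc) (auto simp: right_mult_0 intro!: sum.cong)
  also have "\<dots> = (\<Sum>m<?N. right_mult (?a m) (Ugen_frac (?c m)))"
    by (subst (2) N, subst sum.lessThan_Suc_shift) (simp add: right_mult_0 Ugen_frac_0)
  also have "\<dots> + (\<Sum>m<?N. right_mult (?a m) (Ugen_frac (nu m * c m))) = comb (\<lambda>m. ?c m + nu m * c m)"
    unfolding comb_def sum.distrib[symmetric] right_mult_add_right[symmetric]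
    using c by (intro sum.cong refl arg_cong2[where f = right_mult] Ugen_frac_simps(1)[symmetric])
      (auto intro: range_of_Uhgen_mult nu_mem range_of_Uhgen_0)
  finally show ?thesis .
qed

text \<open>Each \<open>E\<close> in the chain acts from the left by its value under
  \<open>\<psi>\<close>, which is zero unless the index rises by exactly one.\<close>

lemma chain_vec_eq:
  assumes "sorted_wrt (<) (p # qs)" "set (p # qs) \<subseteq> {..<CARD('n::{finite,linorder})}"
  shows "chain_vec (en p) (map en qs) \<doteq>
    (if qs = [Suc p..<Suc p + length qs] then axis (en (p + length qs)) 1 else (0 :: ('a::field, 'n) V_Ugen))"
  using assms
proof (induction qs arbitrary: p)
  case Nil
  show ?case by (simp add: dq_refl)
next
  case (Cons q qs)
  then have q: "p < q" "q < CARD('n)" by auto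
  have "chain_vec (en p) (map en (q # qs)) \<doteq> (if q = Suc p then chain_vec (en q) (map en qs) else (0 :: ('a, 'n) V_Ugen))"
    using dq_left[OF en_less[OF q], of "chain_vec (en q) (map en qs) :: ('a, 'n) V_Ugen"] q by (simp add: idx_en)
  also have "\<dots> \<doteq> (if q = Suc p then if qs = [Suc q..<Suc q + length qs] then axis (en (q + length qs)) 1 else 0 else 0)"
    by (cases "q = Suc p") (use Cons.IH[of q] Cons.prems in \<open>simp_all add: dq_refl del: upt_Suc\<close>)
  also have "\<dots> = (if q # qs = [Suc p..<Suc p + length (q # qs)] then axis (en (p + length (q # qs))) 1 else 0)"
  proof -
    have "[Suc p..<Suc p + length (q # qs)] = Suc p # [Suc (Suc p)..<Suc (Suc p) + length qs]"
      by (subst upt_conv_Cons) simp_all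
    then show ?thesis by (cases "q = Suc p") (simp_all del: upt_Suc)
  qed
  finally show ?case .
qed

definition bar_coeff :: "nat \<Rightarrow> nat \<Rightarrow> ('a::field, 'n::{finite,linorder}) Uh fract"
  where "bar_coeff p m = (if p \<le> m then \<Prod>a\<in>{Suc p..<Suc m}. inverse (nu p - nu a) else 0)"

lemma inverse_nu_mem: "inverse (nu p - nu a) \<in> range (of_Uhgen :: ('a::field, 'n::{finite,linorder}) Uhgen \<Rightarrow> _)"
proof (cases "en p = (en a :: 'n)")
  case True
  then show ?thesis by (simp add: nu_def range_of_Uhgen_0)
next
  case False
  then show ?thesis unfolding nu_def by (rule inverse_lam_diff_mem)
qed

lemma bar_coeff_mem: "bar_coeff p m \<in> range of_Uhgen"
proof (cases "p \<le> m")
  case True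
  then show ?thesis unfolding bar_coeff_def if_P[OF True] by (intro range_of_Uhgen_prod inverse_nu_mem)
next
  case False
  then show ?thesis by (simp add: bar_coeff_def range_of_Uhgen_0)
qed

lemma nu_distinct: "p < CARD('n) \<Longrightarrow> q < CARD('n) \<Longrightarrow> p \<noteq> q \<Longrightarrow> nu p \<noteq> (nu q :: ('a::field, 'n::{finite,linorder}) Uh fract)"
  unfolding nu_def by (rule lam_distinct) (simp add: en_eq_iff)

text \<open>By \<open>chain_vec_eq\<close> only the subsets that are intervals starting at
  \<open>Suc p\<close> contribute; the interval ending at \<open>m\<close> gives the coefficient at
  \<open>\<phi>\<^sub>m\<close>, the empty one that at \<open>m = p\<close>.\<close>

lemma phi_bar_comb:
  assumes p: "p < CARD('n::{finite,linorder})"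
  shows "phi_bar (en p) \<doteq> (comb (bar_coeff p) :: ('a::field, 'n) V_Ugen)"
proof -
  let ?N = "CARD('n)"
  let ?pr = "\<lambda>B. Ugen_frac (\<Prod>a\<in>B. inverse (nu p - nu a)) :: ('a, 'n) Ugen"
  let ?S = "\<lambda>d. {Suc p..<Suc p + d}"
  have inj: "inj_on (en :: nat \<Rightarrow> 'n) {..<?N}" using bij_en by (rule bij_betw_imp_inj_on)
  have inj': "inj_on (en :: nat \<Rightarrow> 'n) B" if "B \<subseteq> {Suc p..<?N}" for B
    using that by (intro inj_on_subset[OF inj]) auto
  have "phi_bar (en p) = (\<Sum>B\<in>Pow {Suc p..<?N}. right_mult (chain_vec (en p) (sorted_list_of_set (en ` B :: 'n set)))
      (Ugen_frac (\<Prod>a\<in>en ` B. inverse (lam (en p) - lam a)) :: ('a, 'n) Ugen))"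
    unfolding phi_bar_def Ugen_frac_def en_image(2)[OF p] image_Pow_surj[OF refl, symmetric]
    by (rule sum.reindex[unfolded o_def]) (intro inj_on_image_Pow inj' order_refl)
  also have "\<dots> = (\<Sum>B\<in>Pow {Suc p..<?N}. right_mult (chain_vec (en p) (map en (sorted_list_of_set B))) (?pr B))"
  proof (rule sum.cong[OF refl])
    fix B assume "B \<in> Pow {Suc p..<?N}"
    then have B: "B \<subseteq> {Suc p..<?N}" "finite B" using finite_subset by auto
    have "(\<Prod>a\<in>en ` B. inverse (lam (en p) - lam a)) = (\<Prod>a\<in>B. inverse (nu p - (nu a :: ('a, 'n) Uh fract)))"
      unfolding nu_def by (subst prod.reindex[OF inj'[OF B(1)]]) simp
    moreover have "sorted_list_of_set (en ` B :: 'n set) = map en (sorted_list_of_set B)"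
      using B by (intro sorted_list_en) auto
    ultimately show "right_mult (chain_vec (en p) (sorted_list_of_set (en ` B :: 'n set)))
      (Ugen_frac (\<Prod>a\<in>en ` B. inverse (lam (en p) - lam a)) :: ('a, 'n) Ugen) =
      right_mult (chain_vec (en p) (map en (sorted_list_of_set B))) (?pr B)" by simp
  qed
  also have "\<dots> \<doteq> (\<Sum>B\<in>Pow {Suc p..<?N}. right_mult (if B = ?S (card B) then axis (en (p + card B)) 1 else 0) (?pr B))"
  proof (intro dq_sum dq_right_frac)
    fix B assume "B \<in> Pow {Suc p..<?N}"
    then have B: "B \<subseteq> {Suc p..<?N}" "finite B" using finite_subset by auto
    have iff: "sorted_list_of_set B = [Suc p..<Suc p + card B] \<longleftrightarrow> B = ?S (card B)"
      by (metis B(2) set_sorted_list_of_set sorted_list_of_set_range set_upt)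
    have "sorted_wrt (<) (p # sorted_list_of_set B)" "set (p # sorted_list_of_set B) \<subseteq> {..<?N}"
      using B p by auto
    from chain_vec_eq[OF this] show "chain_vec (en p) (map en (sorted_list_of_set B)) \<doteq>
        (if B = ?S (card B) then axis (en (p + card B)) 1 else (0 :: ('a, 'n) V_Ugen))"
      unfolding length_sorted_list_of_set iff .
  qed
  also have "(\<Sum>B\<in>Pow {Suc p..<?N}. right_mult (if B = ?S (card B) then axis (en (p + card B)) 1 else 0) (?pr B)) =
      (\<Sum>B\<in>?S ` {..<?N - p}. right_mult (if B = ?S (card B) then axis (en (p + card B)) 1 else 0) (?pr B))"
  proof (rule sum.mono_neutral_right)
    show "\<forall>B\<in>Pow {Suc p..<?N} - ?S ` {..<?N - p}. right_mult (if B = ?S (card B) then axis (en (p + card B)) 1 else 0) (?pr B) = 0"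
    proof
      fix B assume B: "B \<in> Pow {Suc p..<?N} - ?S ` {..<?N - p}"
      have "card B \<le> card {Suc p..<?N}" using B by (intro card_mono) auto
      then have "card B < ?N - p" using p by simp
      then have "B \<noteq> ?S (card B)" using B by blast
      then show "right_mult (if B = ?S (card B) then axis (en (p + card B)) 1 else 0) (?pr B) = 0" by (simp add: right_mult_0)
    qed
  qed (use p in auto)
  also have "\<dots> = (\<Sum>d<?N - p. right_mult (axis (en (p + d)) 1) (?pr (?S d)))"
  proof (subst sum.reindex)
    show "inj_on ?S {..<?N - p}"
      by (rule inj_onI) (metis card_atLeastLessThan add_diff_cancel_left')
  qed (simp add: o_def)
  also have "\<dots> = (\<Sum>m\<in>{p..<?N}. right_mult (axis (en m) 1) (?pr {Suc p..<Suc m}))"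
    by (rule sum.reindex_bij_witness[of _ "\<lambda>m. m - p" "\<lambda>d. p + d"]) auto
  also have "\<dots> = (\<Sum>m<?N. right_mult (axis (en m) 1) (Ugen_frac (bar_coeff p m)))"
    by (rule sum.mono_neutral_cong_left) (auto simp: bar_coeff_def Ugen_frac_0 right_mult_0)
  finally show ?thesis unfolding comb_def .
qed

lemma comb_cong: "(\<And>m. m < CARD('n) \<Longrightarrow> c m = d m) \<Longrightarrow> comb c = (comb d :: ('a::field, 'n::{finite,linorder}) V_Ugen)"
  unfolding comb_def by (intro sum.cong) auto

lemma comb_right_mult:
  assumes "\<And>m. c m \<in> range of_Uhgen" "s \<in> range of_Uhgen"
  shows "right_mult (comb c) (Ugen_frac s) = comb (\<lambda>m. c m * s)"
  by (simp add: comb_def right_mult_sum right_mult_mult Ugen_frac_simps(3) assms)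

text \<open>For a bidiagonal operator the eigenvector equation is a recursion along the
  coefficients, here \<open>bar_coeff p (m - 1) = (nu p - nu m) * bar_coeff p m\<close>, and the
  products of inverses solve it.\<close>

lemma TU_bar_coeff:
  assumes p: "p < CARD('n::{finite,linorder})"
  shows "TU (comb (bar_coeff p)) \<doteq> right_mult (comb (bar_coeff p) :: ('a::field_char_0, 'n) V_Ugen) (Ugen_frac (nu p))"
proof -
  let ?b = "bar_coeff p :: nat \<Rightarrow> ('a, 'n) Uh fract"
  have "(if m = 0 then 0 else ?b (m - 1)) + nu m * ?b m = ?b m * nu p" if m: "m < CARD('n)" for m
  proof (cases m p rule: linorder_cases)
    case greater
    then have "{Suc p..<Suc m} = insert m {Suc p..<m}" by auto
    moreover have "p \<le> m - 1" "Suc (m - 1) = m" using greater by auto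
    ultimately have "?b m = inverse (nu p - nu m) * ?b (m - 1)"
      using greater by (simp add: bar_coeff_def)
    moreover have "nu p - nu m \<noteq> (0 :: ('a, 'n) Uh fract)" using nu_distinct[OF p m] greater by simp
    ultimately have "?b (m - 1) = (nu p - nu m) * ?b m" by simp
    then show ?thesis using greater by (simp add: algebra_simps)
  qed (auto simp: bar_coeff_def)
  then have "comb (\<lambda>m. (if m = 0 then 0 else ?b (m - 1)) + nu m * ?b m) = comb (\<lambda>m. ?b m * nu p)"
    by (rule comb_cong)
  then show ?thesis
    using TU_comb[of ?b, OF bar_coeff_mem] by (simp only: comb_right_mult[OF bar_coeff_mem nu_mem])
qed

lemma nu_power_mem: "nu p ^ k \<in> range of_Uhgen"
  using range_of_Uhgen_prod[of "{..<k}" "\<lambda>_. nu p"] by (simp add: nu_mem)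

lemma TU_pow_bar_coeff:
  assumes p: "p < CARD('n::{finite,linorder})"
  shows "(TU ^^ k) (comb (bar_coeff p)) \<doteq> right_mult (comb (bar_coeff p) :: ('a::field_char_0, 'n) V_Ugen) (Ugen_frac (nu p ^ k))"
proof (induction k)
  case 0
  show ?case by (simp add: Ugen_frac_1 right_mult_0 dq_refl)
next
  case (Suc k)
  let ?v = "comb (bar_coeff p) :: ('a, 'n) V_Ugen"
  have "(TU ^^ Suc k) ?v \<doteq> TU (right_mult ?v (Ugen_frac (nu p ^ k)))"
    using dq_TU[OF Suc.IH] by simp
  also have "\<dots> = right_mult (TU ?v) (Ugen_frac (nu p ^ k))" by (rule TA_right_mult)
  also have "\<dots> \<doteq> right_mult (right_mult ?v (Ugen_frac (nu p))) (Ugen_frac (nu p ^ k))"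
    by (rule dq_right_frac[OF TU_bar_coeff[OF p]])
  also have "\<dots> = right_mult ?v (Ugen_frac (nu p ^ Suc k))"
    by (simp add: Ugen_frac_simps(3)[OF nu_mem nu_power_mem] right_mult_mult)
  finally show ?case .
qed

text \<open>The sum is the divided difference of the constant function 1 at the points
  \<open>f p\<close>. The fact \<open>step\<close> is the recursion of divided differences; it
  reduces the claim to one point fewer, and for two points the right-hand side is
  \<open>1 - 1\<close>.\<close>

lemma partial_fractions_sum_zero:
  fixes f :: "'i \<Rightarrow> 'k::field"
  assumes "finite B" "inj_on f (insert x (insert y B))" "x \<noteq> y" "x \<notin> B" "y \<notin> B"
  shows "(\<Sum>p\<in>insert x (insert y B). \<Prod>a\<in>insert x (insert y B) - {p}. inverse (f p - f a)) = 0"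
proof -
  define S where "S A = (\<Sum>p\<in>A. \<Prod>a\<in>A - {p}. inverse (f p - f a))" for A
  have step: "(f x - f y) * S (insert x (insert y B)) = S (insert x B) - S (insert y B)"
    if B: "finite B" "inj_on f (insert x (insert y B))" "x \<noteq> y" "x \<notin> B" "y \<notin> B" for x y B
  proof -
    have ne: "f a \<noteq> f b" if "a \<in> insert x (insert y B)" "b \<in> insert x (insert y B)" "a \<noteq> b" for a b
      using B(2) that by (auto simp: inj_on_def)
    have 1: "S (insert z B) = (\<Prod>a\<in>B. inverse (f z - f a)) + (\<Sum>p\<in>B. inverse (f p - f z) * (\<Prod>a\<in>B - {p}. inverse (f p - f a)))"
      if "z \<notin> B" for z
    proof -
      have "(\<Prod>a\<in>insert z B - {p}. inverse (f p - f a)) = inverse (f p - f z) * (\<Prod>a\<in>B - {p}. inverse (f p - f a))" if "p \<in> B" for p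
      proof -
        have "insert z B - {p} = insert z (B - {p})" using that \<open>z \<notin> B\<close> by auto
        then show ?thesis using B(1) \<open>z \<notin> B\<close> by simp
      qed
      then show ?thesis unfolding S_def using B(1) that by simp
    qed
    have 2: "S (insert x (insert y B)) = inverse (f x - f y) * (\<Prod>a\<in>B. inverse (f x - f a)) +
        inverse (f y - f x) * (\<Prod>a\<in>B. inverse (f y - f a)) +
        (\<Sum>p\<in>B. inverse (f p - f x) * (inverse (f p - f y) * (\<Prod>a\<in>B - {p}. inverse (f p - f a))))"
    proof -
      have "(\<Prod>a\<in>insert x (insert y B) - {p}. inverse (f p - f a)) = inverse (f p - f x) * (inverse (f p - f y) * (\<Prod>a\<in>B - {p}. inverse (f p - f a)))"
        if "p \<in> B" for p
      proof -
        have "insert x (insert y B) - {p} = insert x (insert y (B - {p}))" using that B by auto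
        then show ?thesis using B by simp
      qed
      moreover have "insert x (insert y B) - {x} = insert y B" "insert x (insert y B) - {y} = insert x B" using B by auto
      ultimately show ?thesis unfolding S_def using B by simp
    qed
    have e: "(f x - f y) * (inverse (f p - f x) * (inverse (f p - f y) * c)) = inverse (f p - f x) * c - inverse (f p - f y) * c" if "p \<in> B" for p c
    proof -
      have "f p - f x \<noteq> 0" "f p - f y \<noteq> 0" using ne[of p x] ne[of p y] that B by auto
      then show ?thesis by (simp add: field_simps)
    qed
    have xy: "(f x - f y) * (inverse (f x - f y) * c) = c" "(f x - f y) * (inverse (f y - f x) * c) = - c" for c
      using ne[of x y] B(3) by (simp_all add: field_simps)
    show ?thesis
      unfolding 1[OF B(4)] 1[OF B(5)] 2 distrib_left xy sum_distrib_left
      by (simp add: e sum_subtractf)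
  qed
  have "S (insert x (insert y B)) = 0"
    using assms
  proof (induction B arbitrary: x y rule: finite_induct)
    case empty
    then have "f x - f y \<noteq> 0" by (auto simp: inj_on_def)
    moreover have "(f x - f y) * S {x, y} = 0" using step[of "{}" x y] empty by (simp add: S_def)
    ultimately show ?case by simp
  next
    case (insert z B)
    have "f x - f y \<noteq> 0" using insert.prems by (auto simp: inj_on_def)
    moreover have "S (insert x (insert z B)) = 0" "S (insert y (insert z B)) = 0"
      using insert.prems insert.hyps
      by (intro insert.IH; auto simp: inj_on_def)+
    ultimately show ?case using step[of "insert z B" x y] insert.prems insert.hyps by simp
  qed
  then show ?thesis unfolding S_def .
qed

text \<open>The diagonal entry of \<open>D(\<lambda>)\<close>, which by \<open>axis_comb\<close> is
  also the coefficient of the first basis vector of \<open>V\<close> along an eigenvector of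
  \<open>T\<close>.\<close>

definition bar_scale :: "nat \<Rightarrow> ('a::field, 'n::{finite,linorder}) Uh fract"
  where "bar_scale p = (\<Prod>a<p. inverse (nu p - nu a))"

lemma bar_scale_mem: "bar_scale p \<in> range of_Uhgen"
  unfolding bar_scale_def by (intro range_of_Uhgen_prod inverse_nu_mem)

text \<open>The two products combine into one over all indices up to \<open>m\<close> other than
  \<open>p\<close>, so the sum over \<open>p\<close> is a partial fraction sum, which vanishes for
  \<open>m > 0\<close>.\<close>

lemma sum_bar_coeff:
  assumes m: "m < CARD('n::{finite,linorder})"
  shows "(\<Sum>p<CARD('n). bar_coeff p m * bar_scale p) = (if m = 0 then 1 else (0 :: ('a::field, 'n) Uh fract))"
proof -
  let ?n = "nu :: nat \<Rightarrow> ('a, 'n) Uh fract"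
  have "(\<Sum>p<CARD('n). bar_coeff p m * bar_scale p) = (\<Sum>p\<in>{..m}. \<Prod>a\<in>{..m} - {p}. inverse (?n p - ?n a))"
  proof (rule sum.mono_neutral_cong_right)
    show "bar_coeff p m * bar_scale p = (\<Prod>a\<in>{..m} - {p}. inverse (?n p - ?n a))" if "p \<in> {..m}" for p
    proof -
      have "{..m} - {p} = {Suc p..<Suc m} \<union> {..<p}" using that by auto
      then show ?thesis
        using that by (simp add: bar_coeff_def bar_scale_def prod.union_disjoint disjoint_iff)
    qed
  qed (use m in \<open>auto simp: bar_coeff_def\<close>)
  also have "\<dots> = (if m = 0 then 1 else 0)"
  proof (cases "m = 0")
    case False
    have "inj_on ?n {..m}"
    proof (rule inj_onI, rule ccontr)
      fix p q assume "p \<in> {..m}" "q \<in> {..m}" "?n p = ?n q" "p \<noteq> q"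
      then show False using nu_distinct[of p q, where 'a = 'a and 'n = 'n] m by simp
    qed
    moreover have "{..m} = insert m (insert 0 {0<..<m})" using False by auto
    ultimately show ?thesis
      using partial_fractions_sum_zero[of "{0<..<m}" ?n m 0] False by simp
  qed simp
  finally show ?thesis .
qed

lemma axis_comb: "axis (en 0) 1 = (\<Sum>p<CARD('n). right_mult (comb (bar_coeff p)) (Ugen_frac (bar_scale p)) :: ('a::field, 'n::{finite,linorder}) V_Ugen)"
proof -
  have mem: "bar_coeff p m * bar_scale p \<in> range (of_Uhgen :: ('a, 'n) Uhgen \<Rightarrow> _)" for p m
    by (intro range_of_Uhgen_mult bar_coeff_mem bar_scale_mem)
  have "(\<Sum>p<CARD('n). right_mult (comb (bar_coeff p)) (Ugen_frac (bar_scale p))) =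
      (\<Sum>p<CARD('n). comb (\<lambda>m. bar_coeff p m * bar_scale p) :: ('a, 'n) V_Ugen)"
    by (simp only: comb_right_mult[OF bar_coeff_mem bar_scale_mem])
  also have "\<dots> = (\<Sum>m<CARD('n). right_mult (axis (en m) 1) (\<Sum>p<CARD('n). Ugen_frac (bar_coeff p m * bar_scale p)))"
    unfolding comb_def by (subst sum.swap) (simp add: right_mult_def vec_eq_iff sum_distrib_left)
  also have "\<dots> = (\<Sum>m<CARD('n). right_mult (axis (en m) 1) (Ugen_frac (\<Sum>p<CARD('n). bar_coeff p m * bar_scale p)))"
  proof (rule sum.cong[OF refl])
    fix m
    show "right_mult (axis (en m) 1) (\<Sum>p<CARD('n). Ugen_frac (bar_coeff p m * bar_scale p)) =
        (right_mult (axis (en m) 1) (Ugen_frac (\<Sum>p<CARD('n). bar_coeff p m * bar_scale p)) :: ('a, 'n) V_Ugen)"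
      using Ugen_frac_sum[of "{..<CARD('n)}" "\<lambda>p. bar_coeff p m * bar_scale p :: ('a, 'n) Uh fract"] mem by simp
  qed
  also have "\<dots> = (\<Sum>m<CARD('n). if m = 0 then axis (en m) 1 else 0)"
    by (intro sum.cong refl) (simp add: sum_bar_coeff Ugen_frac_0 Ugen_frac_1 right_mult_0)
  finally show ?thesis by simp
qed

lemma U_Ugen_TA:
  fixes x :: "('a::field, 'n::{finite,linorder}) V_U"
  shows "(\<chi> m. U_Ugen (TA E x $ m)) = TU (\<chi> m. U_Ugen (x $ m))"
proof -
  have "U_Ugen (sum f A) = (\<Sum>a\<in>A. U_Ugen (f a))" for f :: "'n \<Rightarrow> ('a, 'n) U" and A
    by (induction A rule: infinite_finite_induct) (simp_all add: U_Ugen_0 U_Ugen_add)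
  then show ?thesis by (simp add: vec_eq_iff TA_def U_Ugen_mult)
qed

lemma U_Ugen_TA_pow: "(\<chi> m. U_Ugen ((TA E ^^ k) x $ m)) = (TU ^^ k) (\<chi> m. U_Ugen (x $ m))"
  by (induction k) (simp_all add: U_Ugen_TA)

lemma S_mat_en:
  assumes "p < CARD('n::{finite,linorder})" "k < CARD('n)"
  shows "S_mat lam $ en p $ en k = (nu p ^ k * bar_scale p :: ('a::field, 'n) Uh fract)"
proof -
  have "{..<en p :: 'n} = en ` {..<p}"
  proof -
    have "en 0 \<le> (x :: 'n)" for x using en_surj[of x] en_less[of 0 _, where 'n = 'n] by (metis gr0I order.strict_implies_order order_refl)
    then have "{..<en p :: 'n} = {en 0..<en p}" by auto
    then show ?thesis using en_image(1)[of 0 p, where 'n = 'n] assms(1) by (simp add: atLeast0LessThan)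
  qed
  moreover have "inj_on (en :: nat \<Rightarrow> 'n) {..<p}"
    using assms(1) en_eq_iff[where 'n = 'n] by (auto simp: inj_on_def)
  ultimately show ?thesis
    using assms by (simp add: S_mat_nth nu_def bar_scale_def idx_en prod.reindex o_def)
qed

text \<open>This is where the two factors of \<open>S\<close> arise: \<open>bar_scale\<close> from
  the expansion of the first basis vector of \<open>V\<close>, and the Vandermonde matrix from the
  powers of the eigenvalues when \<open>T\<close> is applied \<open>k\<close> times.\<close>

lemma phi_psi_phi_bar:
  assumes k: "k < CARD('n::{finite,linorder})"
  shows "(\<chi> m. U_Ugen ((phi_psi (en k) :: ('a::field_char_0, 'n) V_U) $ m)) \<doteq>
    (\<Sum>p<CARD('n). right_mult (phi_bar (en p)) (Ugen_frac (S_mat lam $ en p $ en k)))"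
proof -
  let ?N = "CARD('n)" and ?v = "\<lambda>p. comb (bar_coeff p) :: ('a, 'n) V_Ugen"
  have ax: "(\<chi> m. U_Ugen ((axis (en 0) 1 :: ('a, 'n) V_U) $ m)) = axis (en 0) 1"
    by (simp add: vec_eq_iff axis_def U_Ugen_0 U_Ugen_1)
  have pow: "(TU ^^ k) (\<Sum>p<?N. right_mult (x p) (z p)) = (\<Sum>p<?N. right_mult ((TU ^^ k) (x p)) (z p))"
    for x :: "nat \<Rightarrow> ('a, 'n) V_Ugen" and z
    by (induction k) (simp_all add: TA_sum TA_right_mult)
  have "(\<chi> m. U_Ugen ((phi_psi (en k) :: ('a, 'n) V_U) $ m)) \<doteq> (\<chi> m. U_Ugen ((TA E ^^ k) (axis (en 0) 1) $ m))"
  proof -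
    have "(\<chi> m. U_Ugen ((x - y) $ m)) = (\<chi> m. U_Ugen (x $ m)) - (\<chi> m. U_Ugen (y $ m))" for x y :: "('a, 'n) V_U"
      by (simp add: vec_eq_iff U_Ugen_diff)
    then show ?thesis unfolding dq_eq_def using ln_null_dq_null[OF phi_psi_power[OF k, where 'a = 'a]] by (simp only:)
  qed
  also have "\<dots> = (\<Sum>p<?N. right_mult ((TU ^^ k) (?v p)) (Ugen_frac (bar_scale p)))"
    unfolding U_Ugen_TA_pow ax pow[symmetric] axis_comb ..
  also have "\<dots> \<doteq> (\<Sum>p<?N. right_mult (right_mult (?v p) (Ugen_frac (nu p ^ k))) (Ugen_frac (bar_scale p)))"
    by (intro dq_sum dq_right_frac TU_pow_bar_coeff) simp
  also have "\<dots> \<doteq> (\<Sum>p<?N. right_mult (right_mult (phi_bar (en p)) (Ugen_frac (nu p ^ k))) (Ugen_frac (bar_scale p)))"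
    by (intro dq_sum dq_right_frac dq_sym[OF phi_bar_comb]) simp
  also have "\<dots> = (\<Sum>p<?N. right_mult (phi_bar (en p)) (Ugen_frac (S_mat lam $ en p $ en k)))"
    by (intro sum.cong refl)
      (simp add: S_mat_en k Ugen_frac_simps(3)[OF nu_power_mem bar_scale_mem] right_mult_mult)
  finally show ?thesis .
qed

theorem theorem7p13:
  assumes "CARD('n::{finite,linorder}) \<ge> 2"
  shows "(\<forall>k :: 'n.
            dq_class (\<chi> m. U_Ugen ((phi_psi k :: ('a::{alg_closed_field,field_char_0}, 'n) V_U) $ m))
            = dq_class (\<Sum>i\<in>UNIV. right_mult (phi_bar i) (Uhgen_Ugen (to_Uhgen (S_mat lam $ i $ k)))))
       \<and> invertible (S_mat lam :: ((('a, 'n) Uh fract, 'n) vec, 'n) vec)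
       \<and> (R_CG hb_frac :: ('a, 'n) Uh fract ^ ('n \<times> 'n) ^ ('n \<times> 'n)) =
           (on_fst (\<lambda>_. matrix_inv (S_mat lam)) **
              on_snd (\<lambda>i. matrix_inv (S_mat (dyn_shift hb_frac lam i)))) **
           R_dyn hb_frac lam **
           (on_fst (\<lambda>m. S_mat (dyn_shift hb_frac lam m)) ** on_snd (\<lambda>_. S_mat lam))"
proof (intro conjI allI)
  fix k :: 'n
  obtain r where r: "r < CARD('n)" "k = en r" using en_surj[of k] by blast
  show "dq_class (\<chi> m. U_Ugen ((phi_psi k :: ('a, 'n) V_U) $ m))
      = dq_class (\<Sum>i\<in>UNIV. right_mult (phi_bar i) (Uhgen_Ugen (to_Uhgen (S_mat lam $ i $ k))))"
    unfolding r(2) sum_en Ugen_frac_def[symmetric] by (rule dq_class_eqI[OF phi_psi_phi_bar[OF r(1)]])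
  have "inj (lam :: 'n \<Rightarrow> ('a, 'n) Uh fract)" using lam_distinct by (auto simp: inj_def)
  then show "invertible (S_mat lam :: ((('a, 'n) Uh fract, 'n) vec, 'n) vec)" by (rule invertible_S_mat)
qed (rule vertex_irf_lam)

end
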